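(* Let $\mathcal{H}$ be a finite-dimensional complex Hilbert space and let $f,g\in\mathrm{Pick}(\mathbb{C}_+,B(\mathbb{C}))_{\mathbb{R}}$ and $F\in\mathrm{Pick}(\mathbb{C}_+,B(\mathcal{H}))_{\mathbb{R}}$ be regular Pick functions. Then $$\deg(f\circ F\circ g)=\deg(f)\cdot\deg(F)\cdot\deg(g).$$
   Context: $\mathbb{C}_+=\{z\in\mathbb{C}:\operatorname{Im} z>0\}$. For a finite-dimensional complex Hilbert space $\mathcal{H}$, $\mathrm{Pick}(\mathbb{C}_+,B(\mathcal{H}))_{\mathbb{R}}$ is the set of holomorphic $F:\mathbb{C}_+\to B(\mathcal{H})$ with $\frac1{2i}(F(z)-F(z)^* )\ge0$ for all $z\in\mathbb{C}_+$ and such that the limit $F_*(x)=\lim_{\epsilon\downarrow0}F(x+i\epsilon)$ exists and is self-adjoint for almost every $x\in\mathbb{R}$. For $\mathcal{H}=\mathbb{C}$ these are complex-valued functions. $H^2(\mathbb{C}_+,\mathcal{H})$ is the Hardy space of holomorphic $f:\mathbb{C}_+\to\mathcal{H}$ with $\sup_{y>0}\int_{\mathbb{R}}\|f(x+iy)\|^2dx<\infty$, identified via boundary values with a closed subspace of $L^2(\mathbb{R},\mathcal{H})$. $F$ is called regular if $\bigcap_{t\in\mathbb{R}}e^{itF_*}H^2(\mathbb{C}_+,\mathcal{H})=\{0\}$ and $\overline{\bigcup_{t\in\mathbb{R}}e^{itF_*}H^2(\mathbb{C}_+,\mathcal{H})}=L^2(\mathbb{R},\mathcal{H})$. It is known that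 $F$ is regular if and only if $\operatorname{Spec}(F(z))\subseteq\mathbb{C}_+$ for all $z\in\mathbb{C}_+$; hence for regular $f,g,F$ the composition $(f\circ F\circ g)(z)=f(F(g(z)))$ is defined ($f$ applied by holomorphic functional calculus), and it is again a regular element of $\mathrm{Pick}(\mathbb{C}_+,B(\mathcal{H}))_{\mathbb{R}}$. $F$ is called rational if there are a self-adjoint $C\in B(\mathcal{H})$, positive semidefinite $D,A_1,\dots,A_m\in B(\mathcal{H})$ and pairwise distinct $\lambda_1,\dots,\lambda_m\in\mathbb{R}$ with $F(z)=C+zD+\sum_{j=1}^m\frac1{\lambda_j-z}A_j$; then $\deg F:=\operatorname{rk}(D)+\sum_{j=1}^m\operatorname{rk}(A_j)$. If $F$ is not rational, $\deg F:=\infty$. Products are taken in $\mathbb{N}_0\cup\{\infty\}$ with $n\cdot\infty=\infty$ for $n\ge1$ and $0\cdot\infty=0$. *)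

theory Defs
  imports
    "HOL-Complex_Analysis.Complex_Analysis"
    "HOL-Library.Extended_Nat"
    "Jordan_Normal_Form.Schur_Decomposition"
    "Jordan_Normal_Form.Gauss_Jordan_Elimination"
    "Jordan_Normal_Form.Spectral_Radius"
    "Jordan_Normal_Form.DL_Rank"
begin

(* Both HOL-Analysis and Jordan_Normal_Form declare vectors and matrices; only the latter are used. *)
hide_type (open) Finite_Cartesian_Product.vec
hide_const (open)
  Finite_Cartesian_Product.vec Finite_Cartesian_Product.mat Finite_Cartesian_Product.vec_nth
no_notation Finite_Cartesian_Product.vec_nth (infixl \<open>$\<close> 90)

text \<open>A finite-dimensional complex Hilbert space is coordinatised by an orthonormal basis: it is
  the space of complex vectors of dimension \<open>n\<close> (\<open>n = 0\<close> allowed) with its standard inner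
  product, and its operators are the \<open>n \<times> n\<close> complex matrices.  Functions on the upper half plane
  are total functions of which only the values on the upper half plane matter.\<close>

definition upper_half_plane :: "complex set" where
  "upper_half_plane = {z. Im z > 0}"

definition self_adjoint :: "nat \<Rightarrow> complex mat \<Rightarrow> bool" where
  "self_adjoint n A \<longleftrightarrow> A \<in> carrier_mat n n \<and> mat_adjoint A = A"

text \<open>The order on complex numbers is the one of \<^theory>\<open>HOL-Library.Complex_Order\<close>, so \<open>0 \<le> c\<close>
  says that \<open>c\<close> is real and nonnegative.\<close>

definition psd :: "nat \<Rightarrow> complex mat \<Rightarrow> bool" where
  "psd n A \<longleftrightarrow> A \<in> carrier_mat n n \<and> (\<forall>v\<in>carrier_vec n. 0 \<le> (A *\<^sub>v v) \<bullet>c v)"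

definition holomorphic_mat :: "nat \<Rightarrow> (complex \<Rightarrow> complex mat) \<Rightarrow> bool" where
  "holomorphic_mat n F \<longleftrightarrow>
     (\<forall>z\<in>upper_half_plane. F z \<in> carrier_mat n n) \<and>
     (\<forall>i<n. \<forall>j<n. (\<lambda>z. F z $$ (i, j)) holomorphic_on upper_half_plane)"

definition holomorphic_vec :: "nat \<Rightarrow> (complex \<Rightarrow> complex vec) \<Rightarrow> bool" where
  "holomorphic_vec n h \<longleftrightarrow>
     (\<forall>z\<in>upper_half_plane. h z \<in> carrier_vec n) \<and>
     (\<forall>i<n. (\<lambda>z. h z $ i) holomorphic_on upper_half_plane)"

definition boundary_mat :: "nat \<Rightarrow> (complex \<Rightarrow> complex mat) \<Rightarrow> real \<Rightarrow> complex mat" where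
  "boundary_mat n F x = mat n n (\<lambda>(i, j). Lim (at_right 0) (\<lambda>\<epsilon>. F (Complex x \<epsilon>) $$ (i, j)))"

definition has_boundary_mat ::
    "nat \<Rightarrow> (complex \<Rightarrow> complex mat) \<Rightarrow> real \<Rightarrow> complex mat \<Rightarrow> bool" where
  "has_boundary_mat n F x B \<longleftrightarrow> B \<in> carrier_mat n n \<and>
     (\<forall>i<n. \<forall>j<n. ((\<lambda>\<epsilon>. F (Complex x \<epsilon>) $$ (i, j)) \<longlongrightarrow> B $$ (i, j)) (at_right 0))"

definition has_boundary_vec ::
    "nat \<Rightarrow> (complex \<Rightarrow> complex vec) \<Rightarrow> real \<Rightarrow> complex vec \<Rightarrow> bool" where
  "has_boundary_vec n h x v \<longleftrightarrow> v \<in> carrier_vec n \<and>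
     (\<forall>i<n. ((\<lambda>\<epsilon>. h (Complex x \<epsilon>) $ i) \<longlongrightarrow> v $ i) (at_right 0))"

definition Pick_R :: "nat \<Rightarrow> (complex \<Rightarrow> complex mat) set" where
  "Pick_R n = {F. holomorphic_mat n F \<and>
     (\<forall>z\<in>upper_half_plane. psd n ((1 / (2 * \<i>)) \<cdot>\<^sub>m (F z - mat_adjoint (F z)))) \<and>
     (AE x in lborel. \<exists>B. has_boundary_mat n F x B \<and> self_adjoint n B)}"

definition scalar_op :: "(complex \<Rightarrow> complex) \<Rightarrow> complex \<Rightarrow> complex mat" where
  "scalar_op f z = mat 1 1 (\<lambda>_. f z)"


definition norm_sq :: "complex vec \<Rightarrow> real" where
  "norm_sq v = (\<Sum>i<dim_vec v. (cmod (v $ i))\<^sup>2)"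

definition L2_sq :: "(real \<Rightarrow> complex vec) \<Rightarrow> ennreal" where
  "L2_sq u = (\<integral>\<^sup>+x. ennreal (norm_sq (u x)) \<partial>lborel)"

text \<open>Elements of \<open>L\<^sup>2\<close> are represented by square-integrable Borel functions; every set of such
  functions below is closed under almost everywhere equality, so that equality of sets of
  representatives is equality of the sets of classes.\<close>

definition L2 :: "nat \<Rightarrow> (real \<Rightarrow> complex vec) set" where
  "L2 n = {u. (\<forall>x. u x \<in> carrier_vec n) \<and> (\<forall>i<n. (\<lambda>x. u x $ i) \<in> borel_measurable lborel) \<and>
     L2_sq u < \<infinity>}"

definition L2_zero :: "nat \<Rightarrow> (real \<Rightarrow> complex vec) set" where
  "L2_zero n = {u \<in> L2 n. AE x in lborel. u x = 0\<^sub>v n}"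

definition L2_closure ::
    "nat \<Rightarrow> (real \<Rightarrow> complex vec) set \<Rightarrow> (real \<Rightarrow> complex vec) set" where
  "L2_closure n U = {u \<in> L2 n. \<forall>\<epsilon>>0. \<exists>v\<in>U. L2_sq (\<lambda>x. u x - v x) < ennreal (\<epsilon>\<^sup>2)}"

definition Hardy2 :: "nat \<Rightarrow> (complex \<Rightarrow> complex vec) set" where
  "Hardy2 n = {h. holomorphic_vec n h \<and> (SUP y\<in>{0<..}. L2_sq (\<lambda>x. h (Complex x y))) < \<infinity>}"

definition Hardy2_boundary :: "nat \<Rightarrow> (real \<Rightarrow> complex vec) set" where
  "Hardy2_boundary n = {u \<in> L2 n. \<exists>h\<in>Hardy2 n. AE x in lborel. has_boundary_vec n h x (u x)}"

definition mat_exp :: "nat \<Rightarrow> complex mat \<Rightarrow> complex mat" where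
  "mat_exp n A = mat n n (\<lambda>(i, j). \<Sum>k. (A ^\<^sub>m k) $$ (i, j) / fact k)"

text \<open>\<open>e\<^bsup>itF\<^esup> H\<^sup>2\<close>, with the boundary function of \<open>F\<close> in the exponent.\<close>

definition exp_Hardy2 ::
    "nat \<Rightarrow> (complex \<Rightarrow> complex mat) \<Rightarrow> real \<Rightarrow> (real \<Rightarrow> complex vec) set" where
  "exp_Hardy2 n F t = {u \<in> L2 n. \<exists>w\<in>Hardy2_boundary n.
     AE x in lborel. u x = mat_exp n ((\<i> * of_real t) \<cdot>\<^sub>m boundary_mat n F x) *\<^sub>v w x}"

definition regular_Pick :: "nat \<Rightarrow> (complex \<Rightarrow> complex mat) \<Rightarrow> bool" where
  "regular_Pick n F \<longleftrightarrow>
     (\<Inter>t. exp_Hardy2 n F t) = L2_zero n \<and> L2_closure n (\<Union>t. exp_Hardy2 n F t) = L2 n"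


text \<open>Holomorphic functional calculus (Riesz--Dunford) for functions holomorphic on the upper half
  plane and matrices with spectrum in it.  As the upper half plane is simply connected, winding
  number 1 about every eigenvalue is the only requirement on the closed path, and the value does
  not depend on the chosen path.\<close>

definition calc_contour :: "complex mat \<Rightarrow> (real \<Rightarrow> complex) \<Rightarrow> bool" where
  "calc_contour A \<gamma> \<longleftrightarrow> valid_path \<gamma> \<and> pathfinish \<gamma> = pathstart \<gamma> \<and>
     path_image \<gamma> \<subseteq> upper_half_plane - spectrum A \<and>
     (\<forall>\<mu>\<in>spectrum A. winding_number \<gamma> \<mu> = 1)"

definition resolvent :: "nat \<Rightarrow> complex mat \<Rightarrow> complex \<Rightarrow> complex mat" where
  "resolvent n A \<zeta> = the (mat_inverse (\<zeta> \<cdot>\<^sub>m 1\<^sub>m n - A))"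

definition hol_calc :: "nat \<Rightarrow> (complex \<Rightarrow> complex) \<Rightarrow> complex mat \<Rightarrow> complex mat" where
  "hol_calc n f A = (let \<gamma> = (SOME \<gamma>. calc_contour A \<gamma>) in
     mat n n (\<lambda>(i, j). 1 / (2 * pi * \<i>) *
       contour_integral \<gamma> (\<lambda>\<zeta>. f \<zeta> * resolvent n A \<zeta> $$ (i, j))))"

definition Pick_comp :: "nat \<Rightarrow> (complex \<Rightarrow> complex) \<Rightarrow> (complex \<Rightarrow> complex mat) \<Rightarrow>
    (complex \<Rightarrow> complex) \<Rightarrow> complex \<Rightarrow> complex mat" where
  "Pick_comp n f F g z = hol_calc n f (F (g z))"


definition rational_rep :: "nat \<Rightarrow> (complex \<Rightarrow> complex mat) \<Rightarrow> complex mat \<Rightarrow> complex mat \<Rightarrow>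
    nat \<Rightarrow> (nat \<Rightarrow> real) \<Rightarrow> (nat \<Rightarrow> complex mat) \<Rightarrow> bool" where
  "rational_rep n F C D m l A \<longleftrightarrow>
     self_adjoint n C \<and> psd n D \<and> (\<forall>k\<in>{1..m}. psd n (A k)) \<and> inj_on l {1..m} \<and>
     (\<forall>z\<in>upper_half_plane. \<forall>i<n. \<forall>j<n.
        F z $$ (i, j) = C $$ (i, j) + z * D $$ (i, j)
          + (\<Sum>k=1..m. 1 / (of_real (l k) - z) * A k $$ (i, j)))"

definition rational_Pick :: "nat \<Rightarrow> (complex \<Rightarrow> complex mat) \<Rightarrow> bool" where
  "rational_Pick n F \<longleftrightarrow> (\<exists>C D m l A. rational_rep n F C D m l A)"

text \<open>The representation is unique up to the order of the summands and summands \<open>A k = 0\<close>, which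
  have rank 0, so the description below determines the degree.\<close>

definition Pick_deg :: "nat \<Rightarrow> (complex \<Rightarrow> complex mat) \<Rightarrow> enat" where
  "Pick_deg n F =
     (if rational_Pick n F
      then enat (THE d. \<exists>C D m l A. rational_rep n F C D m l A \<and>
             d = vec_space.rank n D + (\<Sum>k=1..m. vec_space.rank n (A k)))
      else \<infinity>)"

end

theory Submission
  imports Defs
begin

text \<open>For a rational Pick function \<open>F\<close> and every \<open>w\<close> in the upper half plane, \<open>det (F z - w)\<close> has
  exactly \<open>deg F\<close> zeros there: write \<open>F\<close> as \<open>C + W (L - s)\<^sup>-\<^sup>1 W\<^sup>*\<close> with \<open>L\<close> real diagonal and
  \<open>s = 1 / (t - z)\<close>, and apply Sylvester's determinant identity.  Counting the zeros of
  \<open>det (f (F (g z)) - w)\<close> through the eigenvalues then gives the product of the degrees.  If the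
  composition is rational, it is proper, i.e. \<open>\<bar>det (F z - w)\<bar> / \<bar>det (F z - cnj w)\<bar>\<close> is bounded below
  off a compact set, and by the Schwarz--Pick inequality so are the three factors.  A proper Pick
  function is rational: its resolvent at \<open>cnj w\<close> is bounded, and reflection in the real line
  continues it meromorphically with finitely many poles.\<close>


subsection \<open>Bounded holomorphic functions with real boundary values\<close>

text \<open>Regularity enters through the inclusion of every spectrum in the upper half plane: a
  real eigenvalue of some \<open>F z\<close> yields an eigenvector common to all values and boundary
  values of \<open>F\<close>, on which the boundary exponentials act as scalars, and hence a nonzero
  element of the intersection. The same inclusion makes all degrees positive when
  \<open>n > 0\<close>, because a constant self-adjoint function has real spectrum; this keeps
  \<open>0 * \<infinity>\<close> out of the product. The determinant is the right scalar invariant: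
  it depends on a matrix only through the eigenvalues with multiplicity, and these are transported
  by the functional calculus even when the matrix is not diagonalizable. The obstacle in the
  converse direction is that boundary values are known only almost everywhere along vertical lines,
  so the classical reflection principle is out of reach. A bounded resolvent takes the place of
  \<open>F\<close>, and Poisson's formula with dominated convergence takes the place of continuity
  up to the real line.\<close>

lemma mem_upper_half_plane [simp]: "z \<in> upper_half_plane \<longleftrightarrow> 0 < Im z"
  by (simp add: upper_half_plane_def)

lemma open_upper_half_plane: "open upper_half_plane"
  by (simp add: upper_half_plane_def open_halfspace_Im_gt)

lemma convex_upper_half_plane: "convex upper_half_plane"
  by (simp add: upper_half_plane_def convex_halfspace_Im_gt)

text \<open>Cauchy's formula at \<open>z = Complex a b\<close> for
  \<open>H w * (z - cnj z) / (w - cnj z)\<close>, a function with value \<open>H z\<close> at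
  \<open>z\<close>. On the real line its quotient by \<open>w - z\<close> is \<open>2 * \<i>\<close>
  times \<open>H\<close> times the Poisson kernel. On the other three sides, of total length
  \<open>4 * R\<close>, the integrand is of order \<open>1 / R^2\<close>, which gives the
  error.\<close>

lemma poisson_rectangle:
  fixes H :: "complex \<Rightarrow> complex" and a b M \<epsilon> R :: real
  assumes hol: "H holomorphic_on {w. Im w > -\<epsilon>}" and \<epsilon>: "0 < \<epsilon>"
    and bd: "\<And>w. 0 \<le> Im w \<Longrightarrow> cmod (H w) \<le> M" and b: "0 < b" and R: "cmod (Complex a b) < R"
  shows "cmod (pi * H (Complex a b) - integral {-R..R} (\<lambda>x. H (of_real x) * of_real (b / ((x - a)\<^sup>2 + b\<^sup>2))))
    \<le> 4 * R * M * b / (R - cmod (Complex a b))\<^sup>2"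
proof -
  define z where "z = Complex a b"
  \<comment> \<open>The strip has to stay inside the domain of \<open>H\<close> and above the pole
    \<open>cnj z\<close> of \<open>K\<close>.\<close>
  define \<delta> where "\<delta> = min \<epsilon> b"
  define K where "K = (\<lambda>w. H w * (z - cnj z) / (w - cnj z))"
  define k where "k = (\<lambda>w. K w / (w - z))"
  define S where "S = {w. Im w > -\<delta>}"
  have R0: "0 < R" using R norm_ge_zero[of "Complex a b"] by linarith
  have M0: "0 \<le> M" using bd[of 0] norm_ge_zero[of "H 0"] by (simp del: norm_ge_zero)
  have Imz: "Im z = b" "Re z = a" by (simp_all add: z_def)
  have zR: "\<bar>a\<bar> < R" "b < R"
    using R abs_Re_le_cmod[of z] abs_Im_le_cmod[of z] b by (simp_all add: z_def)
  let ?c = "\<lambda>x y. Complex x y"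
  define p where "p = rectpath (?c (-R) 0) (?c R R)"
  have convS: "convex S" "open S" unfolding S_def
    by (simp_all add: convex_halfspace_Im_gt open_halfspace_Im_gt)
  have zcz: "w - cnj z \<noteq> 0" if "w \<in> S" for w
    using that b by (auto simp: S_def \<delta>_def complex_eq_iff Imz)
  have holK: "K holomorphic_on S"
    unfolding K_def using zcz
    by (intro holomorphic_intros holomorphic_on_subset[OF hol]) (auto simp: S_def \<delta>_def)
  have zbox: "z \<in> box (?c (-R) 0) (?c R R)"
    using zR b by (auto simp: in_box_complex_iff Imz)
  have pim: "path_image p \<subseteq> S - {z}"
  proof -
    have "path_image p \<subseteq> cbox (?c (-R) 0) (?c R R) - box (?c (-R) 0) (?c R R)"
      unfolding p_def using R0 by (subst path_image_rectpath_cbox_minus_box) auto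
    moreover have "cbox (?c (-R) 0) (?c R R) \<subseteq> S"
      using \<epsilon> b by (auto simp: in_cbox_complex_iff S_def \<delta>_def)
    ultimately show ?thesis using zbox by blast
  qed
  have zS: "z \<in> interior S" using convS b \<epsilon> by (simp add: interior_open S_def \<delta>_def Imz)
  have Kz: "K z = H z"
    using b by (simp add: K_def complex_eq_iff Imz)
  have wn: "winding_number p z = 1"
    unfolding p_def using zbox by (rule winding_number_rectpath)
  have "((\<lambda>w. K w / (w - z)) has_contour_integral (2 * pi * \<i> * winding_number p z * K z)) p"
    by (rule Cauchy_integral_formula_convex_simple[OF convS(1) holK zS _ pim]) (simp_all add: p_def)
  then have tot: "contour_integral p k = 2 * pi * \<i> * H z"
    by (simp add: Kz k_def contour_integral_unique wn)
  have segs: "closed_segment (?c (-R) 0) (?c R 0) \<subseteq> S - {z}" "closed_segment (?c R 0) (?c R R) \<subseteq> S - {z}"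
    "closed_segment (?c R R) (?c (-R) R) \<subseteq> S - {z}" "closed_segment (?c (-R) R) (?c (-R) 0) \<subseteq> S - {z}"
    using pim by (auto simp: p_def rectpath_def Let_def path_image_join)
  have contk: "continuous_on (S - {z}) k"
    unfolding k_def by (intro continuous_intros holomorphic_on_imp_continuous_on holomorphic_on_subset[OF holK]) auto
  have ci: "k contour_integrable_on linepath u v" if "closed_segment u v \<subseteq> S - {z}" for u v
    using contour_integrable_continuous_linepath continuous_on_subset[OF contk that] by blast
  have split: "contour_integral p k = contour_integral (linepath (?c (-R) 0) (?c R 0)) k
     + (contour_integral (linepath (?c R 0) (?c R R)) k
     + (contour_integral (linepath (?c R R) (?c (-R) R)) k
     + contour_integral (linepath (?c (-R) R) (?c (-R) 0)) k))"
    unfolding p_def rectpath_def Let_def using segs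
    by (simp add: ci contour_integrable_joinI)
  define B where "B = M * (2 * b) / (R - cmod z)\<^sup>2"
  have B0: "0 \<le> B" using M0 b by (simp add: B_def)
  have kB: "cmod (k w) \<le> B" if "R \<le> cmod w" "0 \<le> Im w" for w
  proof -
    have 1: "R - cmod z \<le> cmod (w - z)" "R - cmod z \<le> cmod (w - cnj z)"
      using that norm_triangle_ineq2[of w z] norm_triangle_ineq2[of w "cnj z"] by auto
    have 2: "0 < R - cmod z" using R by (simp add: z_def)
    have "cmod (z - cnj z) = 2 * b" using b by (simp add: complex_diff_cnj norm_mult Imz)
    then have "cmod (k w) = cmod (H w) * (2 * b) / (cmod (w - cnj z) * cmod (w - z))"
      by (simp add: k_def K_def norm_divide norm_mult)
    also have "\<dots> \<le> M * (2 * b) / ((R - cmod z) * (R - cmod z))"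
      using 1 2 bd[OF that(2)] b M0 by (intro frac_le mult_mono mult_pos_pos) auto
    finally show ?thesis by (simp add: B_def power2_eq_square)
  qed
  have s2: "cmod (contour_integral (linepath (?c R 0) (?c R R)) k) \<le> B * cmod (?c R R - ?c R 0)"
  proof (rule contour_integral_bound_linepath[OF ci[OF segs(2)] B0])
    fix w assume "w \<in> closed_segment (?c R 0) (?c R R)"
    then have "Re w = R" "0 \<le> Im w" using R0 by (auto simp: closed_segment_def left_diff_distrib)
    then show "cmod (k w) \<le> B" using abs_Re_le_cmod[of w] R0 by (intro kB) auto
  qed
  have s3: "cmod (contour_integral (linepath (?c R R) (?c (-R) R)) k) \<le> B * cmod (?c (-R) R - ?c R R)"
  proof (rule contour_integral_bound_linepath[OF ci[OF segs(3)] B0])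
    fix w assume "w \<in> closed_segment (?c R R) (?c (-R) R)"
    then have "Im w = R" by (auto simp: closed_segment_def left_diff_distrib)
    then show "cmod (k w) \<le> B" using abs_Im_le_cmod[of w] R0 by (intro kB) auto
  qed
  have s4: "cmod (contour_integral (linepath (?c (-R) R) (?c (-R) 0)) k) \<le> B * cmod (?c (-R) 0 - ?c (-R) R)"
  proof (rule contour_integral_bound_linepath[OF ci[OF segs(4)] B0])
    fix w assume "w \<in> closed_segment (?c (-R) R) (?c (-R) 0)"
    then obtain u where u: "0 \<le> u" "u \<le> 1" "w = (1 - u) *\<^sub>R ?c (-R) R + u *\<^sub>R ?c (-R) 0"
      by (auto simp: closed_segment_def)
    then have "Re w = -R" "Im w = (1 - u) * R" by (simp_all add: left_diff_distrib)
    moreover from this have "0 \<le> Im w" using u R0 by simp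
    ultimately have "Re w = -R" "0 \<le> Im w" by simp_all
    then show "cmod (k w) \<le> B" using abs_Re_le_cmod[of w] R0 by (intro kB) auto
  qed
  have lens: "cmod (?c R R - ?c R 0) = R" "cmod (?c (-R) R - ?c R R) = 2 * R" "cmod (?c (-R) 0 - ?c (-R) R) = R"
    using R0 by (simp_all add: complex_diff cmod_def real_sqrt_mult)
  have bottom: "contour_integral (linepath (?c (-R) 0) (?c R 0)) k = integral {-R..R} (\<lambda>x. k (of_real x))"
    using R0 by (subst contour_integral_linepath_Reals_eq) (auto simp: complex_is_Real_iff)
  have kreal: "k (of_real x) = 2 * \<i> * (H (of_real x) * of_real (b / ((x - a)\<^sup>2 + b\<^sup>2)))" for x
  proof -
    have d: "(of_real x - cnj z) * (of_real x - z) = of_real ((x - a)\<^sup>2 + b\<^sup>2)"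
      by (simp add: complex_eq_iff z_def power2_eq_square)
    have "k (of_real x) = H (of_real x) * (z - cnj z) / ((of_real x - cnj z) * (of_real x - z))"
      by (simp add: k_def K_def)
    also have "\<dots> = H (of_real x) * (2 * \<i> * of_real b) / of_real ((x - a)\<^sup>2 + b\<^sup>2)"
      unfolding d by (simp add: complex_diff_cnj Imz mult_ac)
    finally show ?thesis by simp
  qed
  let ?I = "integral {-R..R} (\<lambda>x. H (of_real x) * of_real (b / ((x - a)\<^sup>2 + b\<^sup>2)))"
  have bot2: "contour_integral (linepath (?c (-R) 0) (?c R 0)) k = 2 * \<i> * ?I"
    unfolding bottom kreal by (rule integral_mult_right)
  have "2 * \<i> * (pi * H z - ?I) = contour_integral (linepath (?c R 0) (?c R R)) k
     + (contour_integral (linepath (?c R R) (?c (-R) R)) k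
     + contour_integral (linepath (?c (-R) R) (?c (-R) 0)) k)"
    using tot split bot2 by (simp add: algebra_simps)
  then have "cmod (2 * \<i> * (pi * H z - ?I)) \<le> B * R + (B * (2 * R) + B * R)"
    using s2 s3 s4 unfolding lens by (smt (verit) norm_triangle_ineq)
  then have "2 * cmod (pi * H z - ?I) \<le> 4 * B * R"
    by (simp add: norm_mult)
  then have "cmod (pi * H z - ?I) \<le> 2 * B * R" by linarith
  also have "2 * B * R = 4 * R * M * b / (R - cmod z)\<^sup>2" by (simp add: B_def)
  finally show ?thesis by (simp add: z_def)
qed

lemma integrable_inverse_one_plus_square: "integrable lborel (\<lambda>x::real. inverse (1 + x\<^sup>2))"
proof -
  let ?f = "\<lambda>x::real. inverse (1 + x\<^sup>2)"
  have m: "?f \<in> borel_measurable borel" by measurable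
  have half: "(\<integral>\<^sup>+x. ennreal (?f x) * indicator {0..} x \<partial>lborel) = ennreal (pi / 2 - arctan 0)"
  proof (rule nn_integral_FTC_atLeast[OF m])
    show "DERIV arctan x :> ?f x" for x by (rule DERIV_arctan)
    show "(arctan \<longlongrightarrow> pi / 2) at_top" by (rule tendsto_arctan_at_top)
  qed simp
  have "(\<integral>\<^sup>+x. ennreal (?f x) * indicator {..0} x \<partial>lborel)
      = (\<integral>\<^sup>+x. ennreal (?f x) * indicator {0..} x \<partial>lborel)"
    using m by (subst nn_integral_real_affine[where c = "-1" and t = 0])
      (auto intro!: nn_integral_cong split: split_indicator)
  then have "(\<integral>\<^sup>+x. ennreal (?f x) * indicator {0..} x + ennreal (?f x) * indicator {..0} x \<partial>lborel) < \<infinity>"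
    using m by (subst nn_integral_add) (auto simp: half)
  moreover have "(\<integral>\<^sup>+x. ennreal (?f x) \<partial>lborel)
      \<le> (\<integral>\<^sup>+x. ennreal (?f x) * indicator {0..} x + ennreal (?f x) * indicator {..0} x \<partial>lborel)"
    by (intro nn_integral_mono) (auto split: split_indicator)
  ultimately have "(\<integral>\<^sup>+x. ennreal (?f x) \<partial>lborel) < \<infinity>" by (rule le_less_trans[rotated])
  then show ?thesis using m by (intro integrableI_nonneg) auto
qed

text \<open>Shifting \<open>h\<close> upwards by \<open>1 / Suc k\<close> makes it holomorphic
  across the real line, so Poisson's formula applies on the window from \<open>-k\<close> to
  \<open>k\<close>. As \<open>k\<close> grows the window error vanishes, and by dominated
  convergence the integral of the imaginary part tends to the integral of the boundary imaginary
  part, which is 0.\<close>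

lemma Im_eq_0_of_real_boundary:
  assumes hol: "h holomorphic_on upper_half_plane"
    and bd: "\<And>z. z \<in> upper_half_plane \<Longrightarrow> cmod (h z) \<le> M"
    and real: "AE x in lborel. \<exists>r::real. ((\<lambda>\<epsilon>. h (Complex x \<epsilon>)) \<longlongrightarrow> of_real r) (at_right 0)"
    and z: "z \<in> upper_half_plane"
  shows "Im (h z) = 0"
proof -
  define a b where "a = Re z" and "b = Im z"
  have b: "0 < b" using z by (simp add: b_def)
  have zab: "z = Complex a b" by (simp add: a_def b_def)
  have M0: "0 \<le> M" using bd[OF z] norm_ge_zero[of "h z"] by linarith
  define P where "P x = b / ((x - a)\<^sup>2 + b\<^sup>2)" for x
  have P0: "0 \<le> P x" for x using b by (simp add: P_def)
  have den: "(x - a)\<^sup>2 + b\<^sup>2 \<noteq> 0" for x using b by (simp add: add_nonneg_eq_0_iff)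
  \<comment> \<open>Comparison constant between the Poisson kernel and \<open>1 / (1 + x^2)\<close>;
    it comes from \<open>x^2 \<le> 2 * (x - a)^2 + 2 * a^2\<close> together with
    \<open>b > 0\<close>.\<close>
  define C where "C = b * (2 + (1 + 2 * a\<^sup>2) / b\<^sup>2)"
  have PC: "P x \<le> C * inverse (1 + x\<^sup>2)" for x
  proof -
    have p: "0 < (x - a)\<^sup>2 + b\<^sup>2" using b by (intro add_nonneg_pos) auto
    have "x\<^sup>2 + (x - 2 * a)\<^sup>2 = 2 * (x - a)\<^sup>2 + 2 * a\<^sup>2" by (simp add: power2_eq_square algebra_simps)
    then have "x\<^sup>2 \<le> 2 * (x - a)\<^sup>2 + 2 * a\<^sup>2" using zero_le_power2[of "x - 2 * a"] by linarith
    then have "1 + x\<^sup>2 \<le> 2 * (x - a)\<^sup>2 + (1 + 2 * a\<^sup>2)" by simp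
    also have "\<dots> \<le> (2 + (1 + 2 * a\<^sup>2) / b\<^sup>2) * ((x - a)\<^sup>2 + b\<^sup>2)"
    proof -
      have "(2 + (1 + 2 * a\<^sup>2) / b\<^sup>2) * ((x - a)\<^sup>2 + b\<^sup>2)
         = 2 * (x - a)\<^sup>2 + (1 + 2 * a\<^sup>2) + (2 * b\<^sup>2 + (1 + 2 * a\<^sup>2) / b\<^sup>2 * (x - a)\<^sup>2)"
        using b by (simp add: field_simps)
      moreover have "0 \<le> 2 * b\<^sup>2 + (1 + 2 * a\<^sup>2) / b\<^sup>2 * (x - a)\<^sup>2" by simp
      ultimately show ?thesis by linarith
    qed
    finally have "b * (1 + x\<^sup>2) \<le> C * ((x - a)\<^sup>2 + b\<^sup>2)"
      using b by (simp add: C_def mult.assoc)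
    then show ?thesis using p
      by (simp add: P_def field_simps add_pos_nonneg)
  qed
  define H where "H k w = h (w + \<i> * of_real (1 / real (Suc k)))" for k w
  define s where "s k x = indicator {-real k..real k} x * (Im (H k (of_real x)) * P x)" for k x
  have H_line: "H k (of_real x) = h (Complex x (1 / real (Suc k)))" for k x
    unfolding H_def by (rule arg_cong[where f = h]) (simp add: complex_eq_iff)
  have holH: "H k holomorphic_on {w. Im w > -(1 / real (Suc k))}" for k
    unfolding H_def
    by (rule holomorphic_on_compose_gen[OF _ hol, unfolded o_def]) (auto intro!: holomorphic_intros)
  have bdH: "cmod (H k w) \<le> M" if "0 \<le> Im w" for k w
    unfolding H_def by (rule bd) (use that in \<open>simp add: add_nonneg_pos\<close>)
  have contH: "continuous_on UNIV (\<lambda>x::real. H k (of_real x))" for k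
    by (rule continuous_on_compose2[OF holomorphic_on_imp_continuous_on[OF holH[of k]]])
       (auto intro!: continuous_intros)
  have contP: "continuous_on UNIV P"
    unfolding P_def using den by (intro continuous_intros) auto
  have contHP: "continuous_on UNIV (\<lambda>x. H k (of_real x) * of_real (P x))" for k
    by (intro continuous_intros contH contP)
  have meas: "s k \<in> borel_measurable lborel" for k
    unfolding s_def
    using borel_measurable_continuous_onI[OF continuous_on_Im[OF contH]]
      borel_measurable_continuous_onI[OF contP]
    by (intro borel_measurable_times borel_measurable_indicator) simp_all
  have lim0: "(\<lambda>k. LINT x|lborel. s k x) \<longlonglongrightarrow> (LINT x::real|lborel. 0)"
  proof (rule integral_dominated_convergence[where w = "\<lambda>x. M * C * inverse (1 + x\<^sup>2)"])
    show "integrable lborel (\<lambda>x. M * C * inverse (1 + x\<^sup>2))"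
      by (intro integrable_mult_right integrable_inverse_one_plus_square)
    have seq: "filterlim (\<lambda>k. 1 / real (Suc k)) (at_right 0) sequentially"
      using LIMSEQ_inverse_real_of_nat by (auto simp: filterlim_at inverse_eq_divide)
    show "AE x in lborel. (\<lambda>k. s k x) \<longlonglongrightarrow> 0"
      using real
    proof eventually_elim
      case (elim x)
      then obtain r :: real where "((\<lambda>\<epsilon>. h (Complex x \<epsilon>)) \<longlongrightarrow> of_real r) (at_right 0)" by blast
      from filterlim_compose[OF this seq] have "(\<lambda>k. H k (of_real x)) \<longlonglongrightarrow> of_real r"
        by (simp add: H_line)
      then have "(\<lambda>k. Im (H k (of_real x))) \<longlonglongrightarrow> 0" by (auto dest: tendsto_Im)
      then have 1: "(\<lambda>k. Im (H k (of_real x)) * P x) \<longlonglongrightarrow> 0" by (rule tendsto_mult_left_zero)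
      show ?case
        by (rule Lim_null_comparison[OF _ tendsto_norm_zero[OF 1]])
           (auto simp: s_def indicator_def intro!: always_eventually)
    qed
    show "AE x in lborel. norm (s k x) \<le> M * C * inverse (1 + x\<^sup>2)" for k
    proof (rule AE_I2)
      fix x
      have "norm (s k x) \<le> \<bar>Im (H k (of_real x))\<bar> * P x"
        using P0[of x] by (simp add: s_def indicator_def abs_mult)
      also have "\<dots> \<le> M * (C * inverse (1 + x\<^sup>2))"
        using abs_Im_le_cmod[of "H k (of_real x)"] bdH[of "of_real x" k] M0 P0[of x]
        by (intro mult_mono PC) auto
      finally show "norm (s k x) \<le> M * C * inverse (1 + x\<^sup>2)" by (simp add: mult.assoc)
    qed
  qed (use meas in auto)
  have eqI: "Im (integral {-real k..real k} (\<lambda>x. H k (of_real x) * of_real (P x))) = (LINT x|lborel. s k x)" for k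
  proof -
    have c: "continuous_on {-real k..real k} (\<lambda>x. H k (of_real x) * of_real (P x))"
      using contHP continuous_on_subset by blast
    have 1: "set_integrable lborel {-real k..real k} (\<lambda>x. H k (of_real x) * of_real (P x))"
      by (rule borel_integrable_atLeastAtMost'[OF c])
    have "integral {-real k..real k} (\<lambda>x. H k (of_real x) * of_real (P x))
       = (LINT x|lborel. indicator {-real k..real k} x *\<^sub>R (H k (of_real x) * of_real (P x)))"
      using set_borel_integral_eq_integral(2)[OF 1] by (simp add: set_lebesgue_integral_def)
    also have "Im \<dots> = (LINT x|lborel. Im (indicator {-real k..real k} x *\<^sub>R (H k (of_real x) * of_real (P x))))"
      using 1 by (intro integral_Im[symmetric]) (simp add: set_integrable_def)
    also have "(\<lambda>x. Im (indicator {-real k..real k} x *\<^sub>R (H k (of_real x) * of_real (P x)))) = s k"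
      by (auto simp: s_def)
    finally show ?thesis .
  qed
  have "eventually (\<lambda>k. norm (pi * Im (H k z) - (LINT x|lborel. s k x))
       \<le> 4 * real k * M * b / (real k - cmod z)\<^sup>2) sequentially"
  proof (rule eventually_mono[OF eventually_gt_at_top[of "nat \<lceil>cmod z\<rceil>"]])
    fix k assume "nat \<lceil>cmod z\<rceil> < k"
    then have k: "cmod z < real k" by linarith
    have "cmod (pi * H k z - integral {-real k..real k} (\<lambda>x. H k (of_real x) * of_real (P x)))
       \<le> 4 * real k * M * b / (real k - cmod z)\<^sup>2"
      using poisson_rectangle[OF holH _ bdH b, of k a "real k"] k by (simp add: zab P_def)
    then have "\<bar>Im (pi * H k z - integral {-real k..real k} (\<lambda>x. H k (of_real x) * of_real (P x)))\<bar>
       \<le> 4 * real k * M * b / (real k - cmod z)\<^sup>2"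
      using abs_Im_le_cmod order_trans by blast
    then show "norm (pi * Im (H k z) - (LINT x|lborel. s k x)) \<le> 4 * real k * M * b / (real k - cmod z)\<^sup>2"
      by (simp add: eqI)
  qed
  moreover have "(\<lambda>k. 4 * real k * M * b / (real k - cmod z)\<^sup>2) \<longlonglongrightarrow> 0"
    by real_asymp
  ultimately have "(\<lambda>k. pi * Im (H k z) - (LINT x|lborel. s k x)) \<longlonglongrightarrow> 0"
    by (rule Lim_null_comparison)
  from tendsto_add[OF this lim0] have l1: "(\<lambda>k. pi * Im (H k z)) \<longlonglongrightarrow> 0" by simp
  have "isCont h z"
    using hol z open_upper_half_plane continuous_on_eq_continuous_at holomorphic_on_imp_continuous_on by blast
  moreover have "(\<lambda>k. z + \<i> * of_real (1 / real (Suc k))) \<longlonglongrightarrow> z"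
    using tendsto_add[OF tendsto_const tendsto_mult[OF tendsto_const tendsto_of_real[OF LIMSEQ_inverse_real_of_nat]], of z \<i>]
    by (simp add: inverse_eq_divide)
  ultimately have "(\<lambda>k. H k z) \<longlonglongrightarrow> h z"
    unfolding H_def by (rule isCont_tendsto_compose)
  then have "(\<lambda>k. pi * Im (H k z)) \<longlonglongrightarrow> pi * Im (h z)" by (intro tendsto_intros)
  with l1 have "pi * Im (h z) = 0" by (rule LIMSEQ_unique[rotated])
  then show ?thesis by simp
qed

text \<open>A nonconstant holomorphic function has an open image, and no nonempty open set lies in
  the real line.\<close>

lemma holomorphic_Im_0_constant:
  assumes hol: "h holomorphic_on upper_half_plane" and im: "\<And>z. z \<in> upper_half_plane \<Longrightarrow> Im (h z) = 0"
  obtains c where "\<And>z. z \<in> upper_half_plane \<Longrightarrow> h z = c"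
proof -
  have "h constant_on upper_half_plane"
  proof (rule ccontr)
    assume nc: "\<not> h constant_on upper_half_plane"
    have "open (h ` upper_half_plane)"
      by (rule open_mapping_thm[OF hol open_upper_half_plane convex_connected[OF convex_upper_half_plane]
          open_upper_half_plane order_refl nc])
    moreover have "h \<i> \<in> h ` upper_half_plane" by simp
    ultimately obtain e where e: "0 < e" "ball (h \<i>) e \<subseteq> h ` upper_half_plane"
      by (meson openE)
    have "h \<i> + \<i> * of_real (e / 2) \<in> ball (h \<i>) e" using e by (simp add: dist_norm norm_mult)
    then obtain z where "z \<in> upper_half_plane" "h z = h \<i> + \<i> * of_real (e / 2)"
      using e(2) by (metis imageE subsetD)
    then show False using im[of z] im[of \<i>] e(1) by simp
  qed
  then show ?thesis using that unfolding constant_on_def by blast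
qed

subsection \<open>Rationality from boundary values\<close>

lemma holomorphic_divide_zero:
  assumes "open S" "e holomorphic_on S" "a \<in> S" "e a = 0"
  obtains k where "k holomorphic_on S" "\<And>z. z \<in> S \<Longrightarrow> e z = (z - a) * k z"
proof -
  have "(\<lambda>z. if z = a then deriv e a else e z / (z - a) - e a / (z - a)) holomorphic_on S"
    by (rule pole_theorem[OF assms(2)]) (use assms in \<open>auto simp: interior_open\<close>)
  then show ?thesis by (rule that) (use assms(4) in auto)
qed

section \<open>Functions with real boundary values and polynomial growth\<close>

definition real_boundary :: "(complex \<Rightarrow> complex) \<Rightarrow> bool" where
  "real_boundary h \<longleftrightarrow>
     (AE x in lborel. \<exists>r::real. ((\<lambda>\<epsilon>. h (Complex x \<epsilon>)) \<longlongrightarrow> of_real r) (at_right 0))"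

text \<open>The bound is uniform up to the real line, so it excludes real poles as well; only the
  growth at infinity is left free.\<close>

definition poly_growth :: "(complex \<Rightarrow> complex) \<Rightarrow> bool" where
  "poly_growth h \<longleftrightarrow> (\<exists>C N. \<forall>z\<in>upper_half_plane. cmod (h z) \<le> C * (1 + cmod z) ^ N)"

lemma poly_growthE:
  assumes "poly_growth h"
  obtains C N where "0 \<le> C" "\<And>z. z \<in> upper_half_plane \<Longrightarrow> cmod (h z) \<le> C * (1 + cmod z) ^ N"
proof -
  obtain C N where h: "\<And>z. z \<in> upper_half_plane \<Longrightarrow> cmod (h z) \<le> C * (1 + cmod z) ^ N"
    using assms unfolding poly_growth_def by blast
  have "cmod (h z) \<le> \<bar>C\<bar> * (1 + cmod z) ^ N" if "z \<in> upper_half_plane" for z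
    using h[OF that] by (rule order_trans) (intro mult_right_mono, auto)
  then show ?thesis by (intro that[of "\<bar>C\<bar>" N]) auto
qed

lemma poly_growth_bounded:
  assumes "\<And>z. z \<in> upper_half_plane \<Longrightarrow> cmod (h z) \<le> M"
  shows "poly_growth h"
  unfolding poly_growth_def by (rule exI[of _ M], rule exI[of _ 0]) (use assms in auto)

lemma poly_growth_mult:
  assumes "poly_growth h" "poly_growth k"
  shows "poly_growth (\<lambda>z. h z * k z)"
proof -
  obtain C N where h: "0 \<le> C" "\<And>z. z \<in> upper_half_plane \<Longrightarrow> cmod (h z) \<le> C * (1 + cmod z) ^ N"
    using poly_growthE[OF assms(1)] by blast
  obtain D L where k: "0 \<le> D" "\<And>z. z \<in> upper_half_plane \<Longrightarrow> cmod (k z) \<le> D * (1 + cmod z) ^ L"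
    using poly_growthE[OF assms(2)] by blast
  have "cmod (h z * k z) \<le> (C * D) * (1 + cmod z) ^ (N + L)" if "z \<in> upper_half_plane" for z
  proof -
    have "cmod (h z * k z) \<le> (C * (1 + cmod z) ^ N) * (D * (1 + cmod z) ^ L)"
      unfolding norm_mult using h k that by (intro mult_mono) auto
    then show ?thesis by (simp add: power_add mult_ac)
  qed
  then show ?thesis unfolding poly_growth_def by blast
qed

lemma poly_growth_add:
  assumes "poly_growth h" "poly_growth k"
  shows "poly_growth (\<lambda>z. h z + k z)"
proof -
  obtain C N where h: "0 \<le> C" "\<And>z. z \<in> upper_half_plane \<Longrightarrow> cmod (h z) \<le> C * (1 + cmod z) ^ N"
    using poly_growthE[OF assms(1)] by blast
  obtain D L where k: "0 \<le> D" "\<And>z. z \<in> upper_half_plane \<Longrightarrow> cmod (k z) \<le> D * (1 + cmod z) ^ L"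
    using poly_growthE[OF assms(2)] by blast
  have "cmod (h z + k z) \<le> (C + D) * (1 + cmod z) ^ (N + L)" if "z \<in> upper_half_plane" for z
  proof -
    have "cmod (h z + k z) \<le> C * (1 + cmod z) ^ N + D * (1 + cmod z) ^ L"
      using norm_triangle_ineq[of "h z" "k z"] h(2)[OF that] k(2)[OF that] by linarith
    also have "\<dots> \<le> C * (1 + cmod z) ^ (N + L) + D * (1 + cmod z) ^ (N + L)"
      using h k by (intro add_mono mult_left_mono power_increasing) auto
    finally show ?thesis by (simp add: algebra_simps)
  qed
  then show ?thesis unfolding poly_growth_def by blast
qed

lemma poly_growth_poly: "poly_growth (poly p)"
proof (induction p)
  case 0
  show ?case by (rule poly_growth_bounded[of _ 0]) simp
next
  case (pCons a p)
  have "poly_growth (\<lambda>z. z)"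
    unfolding poly_growth_def by (rule exI[of _ 1], rule exI[of _ 1]) auto
  moreover have "poly_growth (\<lambda>z. a)" by (rule poly_growth_bounded[of _ "cmod a"]) simp
  ultimately have "poly_growth (\<lambda>z. a + z * poly p z)"
    using pCons.IH by (intro poly_growth_add poly_growth_mult)
  then show ?case by (simp add: fun_eq_iff[symmetric] poly_pCons)
qed

text \<open>Interpolating \<open>h\<close> at \<open>\<i>\<close> by a real affine function and dividing by \<open>z\<^sup>2 + 1\<close> lowers the
  growth by 2 and keeps the boundary values real; bounded functions are handled by Poisson's
  formula.\<close>

lemma polynomial_of_real_boundary_even:
  assumes "h holomorphic_on upper_half_plane" "real_boundary h"
    and "\<And>z. z \<in> upper_half_plane \<Longrightarrow> cmod (h z) \<le> M * (1 + cmod z) ^ (2 * N)"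
  shows "\<exists>P. \<forall>z\<in>upper_half_plane. h z = poly P z"
  using assms
proof (induction N arbitrary: h M)
  case 0
  have "Im (h z) = 0" if "z \<in> upper_half_plane" for z
    by (rule Im_eq_0_of_real_boundary[OF 0(1) _ _ that, of M])
       (use 0 in \<open>auto simp: real_boundary_def\<close>)
  then obtain c where "\<And>z. z \<in> upper_half_plane \<Longrightarrow> h z = c"
    using holomorphic_Im_0_constant[OF 0(1)] by blast
  then show ?case by (intro exI[of _ "[:c:]"]) auto
next
  case (Suc N)
  define a b where "a = Re (h \<i>)" and "b = Im (h \<i>)"
  define q where "q = (\<lambda>z. complex_of_real a + of_real b * z)"
  have qi: "q \<i> = h \<i>" by (simp add: q_def a_def b_def complex_eq_iff)
  obtain k where k: "k holomorphic_on upper_half_plane"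
    "\<And>z. z \<in> upper_half_plane \<Longrightarrow> h z - q z = (z - \<i>) * k z"
    by (rule holomorphic_divide_zero[OF open_upper_half_plane, of "\<lambda>z. h z - q z" \<i>])
       (use Suc.prems(1) qi in \<open>auto simp: q_def intro!: holomorphic_intros\<close>)
  define g where "g z = k z / (z + \<i>)" for z
  have zi: "z + \<i> \<noteq> 0" if "z \<in> upper_half_plane" for z
    using that by (auto simp: complex_eq_iff)
  have hg: "h z = q z + (z\<^sup>2 + 1) * g z" if "z \<in> upper_half_plane" for z
  proof -
    have "(z\<^sup>2 + 1) * g z = (z - \<i>) * (z + \<i>) * g z" by (simp add: algebra_simps power2_eq_square)
    also have "\<dots> = (z - \<i>) * k z" using zi[OF that] by (simp add: g_def)
    finally show ?thesis using k(2)[OF that] by (metis diff_add_cancel add.commute)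
  qed
  have gh: "g z = (h z - q z) / (z\<^sup>2 + 1)" if "z \<in> upper_half_plane" "z \<noteq> \<i>" for z
  proof -
    have "z\<^sup>2 + 1 = (z - \<i>) * (z + \<i>)" by (simp add: algebra_simps power2_eq_square)
    then have "z\<^sup>2 + 1 \<noteq> 0" using that zi by auto
    then show ?thesis using hg[OF that(1)] by simp
  qed
  have holg: "g holomorphic_on upper_half_plane"
    unfolding g_def using zi by (intro holomorphic_intros k) auto
  have rbg: "real_boundary g"
    using Suc.prems(2) unfolding real_boundary_def
  proof eventually_elim
    case (elim x)
    then obtain r :: real where r: "((\<lambda>\<epsilon>. h (Complex x \<epsilon>)) \<longlongrightarrow> of_real r) (at_right 0)" by blast
    have c: "((\<lambda>\<epsilon>. Complex x \<epsilon>) \<longlongrightarrow> of_real x) (at_right 0)"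
      by (auto intro!: tendsto_eq_intros simp: tendsto_complex_iff)
    have "complex_of_real x ^ 2 + 1 = of_real (x\<^sup>2 + 1)" by simp
    moreover have "x\<^sup>2 + 1 \<noteq> 0" by (simp add: add_nonneg_eq_0_iff)
    ultimately have nz: "complex_of_real x ^ 2 + 1 \<noteq> 0" by (metis of_real_eq_0_iff)
    have "((\<lambda>\<epsilon>. (h (Complex x \<epsilon>) - q (Complex x \<epsilon>)) / ((Complex x \<epsilon>)\<^sup>2 + 1)) \<longlongrightarrow>
        (of_real r - (of_real a + of_real b * of_real x)) / (of_real x ^ 2 + 1)) (at_right 0)"
      unfolding q_def by (intro tendsto_intros r c nz)
    moreover have "eventually (\<lambda>\<epsilon>. (h (Complex x \<epsilon>) - q (Complex x \<epsilon>)) / ((Complex x \<epsilon>)\<^sup>2 + 1)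
        = g (Complex x \<epsilon>)) (at_right 0)"
    proof -
      have "eventually (\<lambda>\<epsilon>. \<epsilon> \<in> {0<..<1::real}) (at_right 0)" by (rule eventually_at_right_real) simp
      then show ?thesis by eventually_elim (auto simp: gh complex_eq_iff)
    qed
    ultimately have "((\<lambda>\<epsilon>. g (Complex x \<epsilon>)) \<longlongrightarrow>
        (of_real r - (of_real a + of_real b * of_real x)) / (of_real x ^ 2 + 1)) (at_right 0)"
      by (rule Lim_transform_eventually)
    moreover have "(of_real r - (of_real a + of_real b * of_real x)) / (of_real x ^ 2 + 1)
        = complex_of_real ((r - (a + b * x)) / (x\<^sup>2 + 1))" by simp
    ultimately show ?case by metis
  qed
  have "0 \<le> M * (1 + cmod \<i>) ^ (2 * Suc N)"
    by (rule order_trans[OF norm_ge_zero Suc.prems(3)]) simp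
  moreover have "0 < (1 + cmod \<i>) ^ (2 * Suc N)" by simp
  ultimately have M0: "0 \<le> M" by (metis zero_le_mult_iff not_le)
  have cballU: "cball \<i> (1/2) \<subseteq> upper_half_plane"
  proof
    fix x assume "x \<in> cball \<i> (1/2)"
    then have "\<bar>Im (\<i> - x)\<bar> \<le> 1/2" using abs_Im_le_cmod[of "\<i> - x"] by (simp add: dist_norm)
    then have "\<bar>1 - Im x\<bar> \<le> 1/2" by simp
    then have "0 < Im x" by linarith
    then show "x \<in> upper_half_plane" by simp
  qed
  have "compact (k ` cball \<i> (1/2))"
    by (intro compact_continuous_image continuous_on_subset[OF holomorphic_on_imp_continuous_on[OF k(1)] cballU])
       simp
  then obtain B where B: "\<And>z. z \<in> cball \<i> (1/2) \<Longrightarrow> cmod (k z) \<le> B"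
    by (meson bounded_iff compact_imp_bounded image_eqI)
  \<comment> \<open>Away from \<i> the two factors of \<open>z^2 + 1\<close> are bounded below by
    \<open>(1 + cmod z) / 6\<close> and \<open>(1 + cmod z) / 2\<close>, which gives the 12. Near
    \<i> the first bound fails, and the maximum \<open>B\<close> of \<open>k\<close> on a small disk
    is used instead.\<close>
  define M' where "M' = 12 * (M + \<bar>a\<bar> + \<bar>b\<bar>) + \<bar>B\<bar>"
  have zi1: "1 \<le> cmod (z + \<i>)" "1 + cmod z \<le> 2 * cmod (z + \<i>)" if "z \<in> upper_half_plane" for z
  proof -
    have z: "0 < Im z" using that by simp
    show 1: "1 \<le> cmod (z + \<i>)" using abs_Im_le_cmod[of "z + \<i>"] z by simp
    have "cmod z \<le> cmod (z + \<i>)"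
      unfolding cmod_def using z by (intro real_sqrt_le_mono) (simp add: power2_eq_square algebra_simps)
    with 1 show "1 + cmod z \<le> 2 * cmod (z + \<i>)" by simp
  qed
  have gB: "cmod (g z) \<le> M' * (1 + cmod z) ^ (2 * N)" if z: "z \<in> upper_half_plane" for z
  proof (cases "z \<in> cball \<i> (1/2)")
    case True
    have "cmod (g z) \<le> cmod (k z) / 1"
      unfolding g_def norm_divide using zi1[OF z] by (intro divide_left_mono) auto
    also have "\<dots> \<le> M' * 1" using B[OF True] M0 by (simp add: M'_def)
    also have "\<dots> \<le> M' * (1 + cmod z) ^ (2 * N)" using M0 by (intro mult_left_mono) (auto simp: M'_def)
    finally show ?thesis .
  next
    case False
    let ?t = "1 + cmod z"
    have t1: "1 \<le> ?t" by simp
    have "1 / 2 < cmod (z - \<i>)" using False by (simp add: dist_norm norm_minus_commute)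
    moreover have "cmod z - 1 \<le> cmod (z - \<i>)" using norm_triangle_ineq2[of z \<i>] by simp
    ultimately have d: "?t \<le> 6 * cmod (z - \<i>)" by argo
    have "?t * ?t \<le> (6 * cmod (z - \<i>)) * (2 * cmod (z + \<i>))"
      using d zi1[OF z] by (intro mult_mono) auto
    also have "\<dots> = 12 * cmod (z\<^sup>2 + 1)"
      by (simp add: norm_mult[symmetric] algebra_simps power2_eq_square)
    finally have den: "?t\<^sup>2 \<le> 12 * cmod (z\<^sup>2 + 1)" by (simp add: power2_eq_square)
    have "cmod (h z - q z) \<le> cmod (h z) + cmod (q z)" by (rule norm_triangle_ineq4)
    also have "cmod (q z) \<le> \<bar>a\<bar> + \<bar>b\<bar> * cmod z"
      unfolding q_def by (rule order_trans[OF norm_triangle_ineq]) (simp add: norm_mult)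
    also have "\<dots> \<le> (\<bar>a\<bar> + \<bar>b\<bar>) * ?t ^ 1" by (simp add: algebra_simps)
    also have "\<dots> \<le> (\<bar>a\<bar> + \<bar>b\<bar>) * ?t ^ (2 * Suc N)" using t1 by (intro mult_left_mono power_increasing) auto
    also have "cmod (h z) \<le> M * ?t ^ (2 * Suc N)" by (rule Suc.prems(3)[OF z])
    finally have num: "cmod (h z - q z) \<le> (M + \<bar>a\<bar> + \<bar>b\<bar>) * ?t ^ (2 * N) * ?t\<^sup>2"
      by (simp add: algebra_simps power2_eq_square)
    have "?t \<noteq> 0" using t1 by linarith
    then have t2: "0 < ?t\<^sup>2" by simp
    have "cmod (g z) = cmod (h z - q z) / cmod (z\<^sup>2 + 1)"
    proof -
      have "z \<noteq> \<i>" using False by auto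
      then show ?thesis using gh[OF z] by (simp add: norm_divide)
    qed
    also have "\<dots> \<le> ((M + \<bar>a\<bar> + \<bar>b\<bar>) * ?t ^ (2 * N) * ?t\<^sup>2) / (?t\<^sup>2 / 12)"
      using num den t2 M0 by (intro frac_le) auto
    also have "\<dots> = 12 * (M + \<bar>a\<bar> + \<bar>b\<bar>) * ?t ^ (2 * N)" using t2 by simp
    also have "\<dots> \<le> M' * ?t ^ (2 * N)" by (intro mult_right_mono) (auto simp: M'_def)
    finally show ?thesis .
  qed
  obtain P where P: "\<forall>z\<in>upper_half_plane. g z = poly P z"
    using Suc.IH[OF holg rbg gB] by blast
  show ?case
    by (rule exI[of _ "[:of_real a, of_real b:] + [:1, 0, 1:] * P"])
       (use P hg in \<open>auto simp: q_def power2_eq_square algebra_simps\<close>)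
qed

lemma polynomial_of_real_boundary:
  assumes "h holomorphic_on upper_half_plane" "real_boundary h" "poly_growth h"
  shows "\<exists>P. \<forall>z\<in>upper_half_plane. h z = poly P z"
proof -
  obtain C N where h: "0 \<le> C" "\<And>z. z \<in> upper_half_plane \<Longrightarrow> cmod (h z) \<le> C * (1 + cmod z) ^ N"
    using poly_growthE[OF assms(3)] by blast
  have "cmod (h z) \<le> C * (1 + cmod z) ^ (2 * N)" if "z \<in> upper_half_plane" for z
    using h(2)[OF that] by (rule order_trans) (use h(1) in \<open>intro mult_left_mono power_increasing, auto\<close>)
  then show ?thesis using polynomial_of_real_boundary_even assms by blast
qed

text \<open>Each zero is divided out with its full multiplicity, so the number of distinct zeros
  drops by exactly one and the induction can run on it.\<close>

lemma holomorphic_factor_finite_zeros: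
  assumes S: "open S" "connected S" "S \<noteq> {}" and hol: "f holomorphic_on S"
    and fin: "finite {z \<in> S. f z = 0}"
  shows "\<exists>p g. p \<noteq> 0 \<and> g holomorphic_on S \<and> (\<forall>z\<in>S. g z \<noteq> 0 \<and> f z = poly p z * g z)"
  using hol fin
proof (induction "card {z \<in> S. f z = 0}" arbitrary: f)
  case 0
  then have "\<forall>z\<in>S. f z \<noteq> 0" by auto
  then show ?case using 0 by (intro exI[of _ 1] exI[of _ f]) auto
next
  case (Suc m)
  then obtain \<zeta> where \<zeta>: "\<zeta> \<in> S" "f \<zeta> = 0"
    by (metis (mono_tags, lifting) card.empty empty_Collect_eq nat.distinct(1))
  have "infinite S"
    using S by (meson finite_imp_not_open)
  then have "{z \<in> S. f z = 0} \<noteq> S" using Suc.prems(2) by metis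
  then have nc: "\<not> f constant_on S" using \<zeta> by (auto simp: constant_on_def)
  obtain g r n where n: "0 < n" "0 < r" "ball \<zeta> r \<subseteq> S" "g holomorphic_on ball \<zeta> r"
     "\<And>w. w \<in> ball \<zeta> r \<Longrightarrow> f w = (w - \<zeta>) ^ n * g w" "\<And>w. w \<in> ball \<zeta> r \<Longrightarrow> g w \<noteq> 0"
    using holomorphic_factor_zero_nonconstant[OF Suc.prems(1) S(1,2) \<zeta> nc] by metis
  define k where "k z = (if z = \<zeta> then g \<zeta> else f z / (z - \<zeta>) ^ n)" for z
  have kg: "k z = g z" if "z \<in> ball \<zeta> r" for z
    using n(5)[OF that] by (simp add: k_def)
  have k1: "k holomorphic_on ball \<zeta> r" using n(4) by (rule holomorphic_transform) (simp add: kg)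
  have "(\<lambda>z. f z / (z - \<zeta>) ^ n) holomorphic_on (S - {\<zeta>})"
    by (intro holomorphic_intros holomorphic_on_subset[OF Suc.prems(1)]) auto
  then have k2: "k holomorphic_on (S - {\<zeta>})" by (rule holomorphic_transform) (simp add: k_def)
  have "k holomorphic_on (S - {\<zeta>}) \<union> ball \<zeta> r"
    using k1 k2 S by (intro holomorphic_on_Un) auto
  moreover have "(S - {\<zeta>}) \<union> ball \<zeta> r = S" using n \<zeta> by (auto dest: subsetD[OF n(3)])
  ultimately have k: "k holomorphic_on S" by simp
  have k\<zeta>: "k \<zeta> \<noteq> 0" using n by (simp add: k_def)
  have fk: "f z = (z - \<zeta>) ^ n * k z" if "z \<in> S" for z
    using \<zeta> n(1) by (simp add: k_def)
  have "{z \<in> S. k z = 0} = {z \<in> S. f z = 0} - {\<zeta>}" using fk k\<zeta> n(1) by auto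
  moreover from this have "card {z \<in> S. k z = 0} = m"
    using Suc.hyps(2) Suc.prems(2) \<zeta> by simp
  ultimately obtain p h where p: "p \<noteq> 0" "h holomorphic_on S" "\<forall>z\<in>S. h z \<noteq> 0 \<and> k z = poly p z * h z"
    using Suc.hyps(1)[of k] k Suc.prems(2) by auto
  show ?case
    by (rule exI[of _ "[:-\<zeta>, 1:] ^ n * p"], rule exI[of _ h]) (use p fk in auto)
qed

text \<open>The equation is multiplied out, so \<open>Q\<close> may vanish in the half plane and
  says nothing about \<open>h\<close> at such points. This makes closure under sums and products
  immediate; an honest quotient is recovered for continuous \<open>h\<close> in
  \<open>rational_on_uhp_reduced\<close>.\<close>

definition rational_on_uhp :: "(complex \<Rightarrow> complex) \<Rightarrow> bool" where
  "rational_on_uhp h \<longleftrightarrow> (\<exists>P Q. Q \<noteq> 0 \<and> (\<forall>z\<in>upper_half_plane. poly Q z * h z = poly P z))"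

lemma tendsto_Complex_at_right: "((\<lambda>\<epsilon>. Complex x \<epsilon>) \<longlongrightarrow> of_real x) (at_right 0)"
  by (auto intro!: tendsto_eq_intros simp: tendsto_complex_iff)

lemma eventually_Complex_notin_compact:
  assumes "compact K" "K \<subseteq> upper_half_plane"
  shows "eventually (\<lambda>\<epsilon>. Complex x \<epsilon> \<in> upper_half_plane - K) (at_right 0)"
proof -
  have "open (-K)" "of_real x \<in> -K" using assms by (auto simp: compact_imp_closed open_Compl)
  then have "eventually (\<lambda>\<epsilon>. Complex x \<epsilon> \<in> -K) (at_right 0)"
    using tendsto_Complex_at_right topological_tendstoD by blast
  then show ?thesis using eventually_at_right_less[of 0]
    by eventually_elim auto
qed

text \<open>If \<open>cnj r = \<psi> / b\<close> on the boundary, then \<open>c r + cnj c \<psi> / b\<close> is real there for every constant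
  \<open>c\<close>; after clearing the finitely many poles it is a polynomial, and \<open>c = 1, \<i>\<close> recover \<open>r\<close>.\<close>

lemma rational_of_boundary_reflection:
  assumes hol: "r holomorphic_on upper_half_plane" "\<psi> holomorphic_on upper_half_plane"
      "b holomorphic_on upper_half_plane"
    and bd: "\<And>z. z \<in> upper_half_plane \<Longrightarrow> cmod (r z) \<le> M" "\<And>z. z \<in> upper_half_plane \<Longrightarrow> cmod (\<psi> z) \<le> M"
    and K: "compact K" "K \<subseteq> upper_half_plane" and \<delta>: "0 < \<delta>"
    and b: "\<And>z. z \<in> upper_half_plane - K \<Longrightarrow> \<delta> \<le> cmod (b z)"
    and bdry: "AE x in lborel. \<exists>r0 \<psi>0 b0. ((\<lambda>\<epsilon>. r (Complex x \<epsilon>)) \<longlongrightarrow> r0) (at_right 0) \<and>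
        ((\<lambda>\<epsilon>. \<psi> (Complex x \<epsilon>)) \<longlongrightarrow> \<psi>0) (at_right 0) \<and>
        ((\<lambda>\<epsilon>. b (Complex x \<epsilon>)) \<longlongrightarrow> b0) (at_right 0) \<and> cnj r0 * b0 = \<psi>0"
  shows "rational_on_uhp r"
proof -
  let ?U = upper_half_plane
  have conn: "connected ?U" by (simp add: convex_upper_half_plane convex_connected)
  have zK: "{z \<in> ?U. b z = 0} = {z \<in> K. b z = 0}"
    using K(2) b \<delta> by force
  have "finite {z \<in> K. b z = 0}"
  \<comment> \<open>All zeros of \<open>b\<close> lie in the compact set \<open>K\<close>, so they
    are finite in number unless \<open>b\<close> is constant. A constant \<open>b\<close> is nonzero
    because the half plane is not exhausted by \<open>K\<close>.\<close>
  proof (cases "b constant_on ?U")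
    case True
    then obtain c where c: "\<And>z. z \<in> ?U \<Longrightarrow> b z = c" by (auto simp: constant_on_def)
    obtain B where "K \<subseteq> ball 0 B" "0 < B" using K(1) by (meson bounded_subset_ballD compact_imp_bounded)
    then have "\<i> * of_real B \<in> ?U - K" by (auto simp: norm_mult)
    then have "c \<noteq> 0" using b \<delta> c by force
    then have "{z \<in> K. b z = 0} = {}" using c K(2) by auto
    then show ?thesis by (simp only: finite.emptyI)
  next
    case False
    then show ?thesis
      using holomorphic_compact_finite_zeros[OF hol(3) open_upper_half_plane conn K] by blast
  qed
  then have fin: "finite {z \<in> ?U. b z = 0}" unfolding zK .
  have "\<i> \<in> ?U" by simp
  then have "?U \<noteq> {}" by blast
  \<comment> \<open>The zeros of \<open>b\<close> are split off as \<open>p\<close>. The remaining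
    \<open>1 / g\<close> then has polynomial growth: it is bounded on \<open>K\<close> by
    compactness, and off \<open>K\<close> it equals \<open>p / b\<close> with \<open>b\<close>
    bounded below.\<close>
  then obtain p g where p: "p \<noteq> 0" "g holomorphic_on ?U"
    and g: "\<And>z. z \<in> ?U \<Longrightarrow> g z \<noteq> 0" "\<And>z. z \<in> ?U \<Longrightarrow> b z = poly p z * g z"
    using holomorphic_factor_finite_zeros[OF open_upper_half_plane conn _ hol(3) fin] by blast
  define p' where "p' = map_poly cnj p"
  have p'0: "p' \<noteq> 0" using p(1) by (simp add: p'_def map_poly_eq_0_iff)
  have p'x: "poly p' (of_real x) = cnj (poly p (of_real x))" for x
    unfolding p'_def by (metis poly_cnj complex_cnj_complex_of_real)
  have g': "(\<lambda>z. 1 / g z) holomorphic_on ?U" using p g by (intro holomorphic_intros) auto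
  have grow: "poly_growth (\<lambda>z. 1 / g z)"
  proof -
    have "compact ((\<lambda>z. 1 / g z) ` K)"
      by (intro compact_continuous_image K continuous_on_subset[OF holomorphic_on_imp_continuous_on[OF g'] K(2)])
    then obtain B where B: "\<And>z. z \<in> K \<Longrightarrow> cmod (1 / g z) \<le> B"
      by (meson bounded_iff compact_imp_bounded image_eqI)
    obtain C N where C: "0 \<le> C" "\<And>z. z \<in> ?U \<Longrightarrow> cmod (poly p z) \<le> C * (1 + cmod z) ^ N"
      using poly_growthE[OF poly_growth_poly] by metis
    have "cmod (1 / g z) \<le> (C / \<delta> + \<bar>B\<bar>) * (1 + cmod z) ^ N" if z: "z \<in> ?U" for z
    proof (cases "z \<in> K")
      case True
      have "cmod (1 / g z) \<le> (C / \<delta> + \<bar>B\<bar>) * 1" using B[OF True] C \<delta> by (simp add: add_increasing)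
      also have "\<dots> \<le> (C / \<delta> + \<bar>B\<bar>) * (1 + cmod z) ^ N" using C \<delta> by (intro mult_left_mono) auto
      finally show ?thesis .
    next
      case False
      then have bz: "\<delta> \<le> cmod (b z)" using b z by auto
      then have "b z \<noteq> 0" using \<delta> by auto
      then have "1 / g z = poly p z / b z" using g[OF z] by simp
      then have "cmod (1 / g z) = cmod (poly p z) / cmod (b z)" by (simp add: norm_divide)
      also have "\<dots> \<le> (C * (1 + cmod z) ^ N) / \<delta>" using C(1) C(2)[OF z] bz \<delta> by (intro frac_le) auto
      also have "\<dots> \<le> (C / \<delta> + \<bar>B\<bar>) * (1 + cmod z) ^ N" by (simp add: algebra_simps)
      finally show ?thesis .
    qed
    then show ?thesis unfolding poly_growth_def by blast
  qed
  \<comment> \<open>This is \<open>p * p' * (c * r + cnj c * \<psi> / b)\<close> with the poles of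
    \<open>1 / b\<close> cleared. On the real line \<open>p'\<close> is the conjugate of
    \<open>p\<close>, so the boundary value is the squared modulus of \<open>p\<close> times
    \<open>2 * Re (c * r)\<close>.\<close>
  define H where "H c z = poly p z * poly p' z * (c * r z) + poly p' z * (cnj c * (\<psi> z * (1 / g z)))" for c z
  have poly: "\<exists>P. \<forall>z\<in>?U. H c z = poly P z" for c
  proof (rule polynomial_of_real_boundary)
    show "H c holomorphic_on ?U" unfolding H_def by (intro holomorphic_intros hol g')
    have "poly_growth r" using bd(1) by (rule poly_growth_bounded)
    moreover have "poly_growth \<psi>" using bd(2) by (rule poly_growth_bounded)
    moreover have "poly_growth (\<lambda>z. d)" for d by (rule poly_growth_bounded[of _ "cmod d"]) simp
    ultimately show "poly_growth (H c)" unfolding H_def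
      by (intro poly_growth_add poly_growth_mult poly_growth_poly grow)
    show "real_boundary (H c)" unfolding real_boundary_def using bdry
    proof eventually_elim
      case (elim x)
      then obtain r0 \<psi>0 b0 where l: "((\<lambda>\<epsilon>. r (Complex x \<epsilon>)) \<longlongrightarrow> r0) (at_right 0)"
        "((\<lambda>\<epsilon>. \<psi> (Complex x \<epsilon>)) \<longlongrightarrow> \<psi>0) (at_right 0)" "((\<lambda>\<epsilon>. b (Complex x \<epsilon>)) \<longlongrightarrow> b0) (at_right 0)"
        and eq: "cnj r0 * b0 = \<psi>0" by blast
      have ev: "eventually (\<lambda>\<epsilon>. Complex x \<epsilon> \<in> ?U - K) (at_right 0)"
        by (rule eventually_Complex_notin_compact[OF K])
      have "\<delta> \<le> cmod b0"
        by (rule tendsto_lowerbound[OF tendsto_norm[OF l(3)]])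
           (use ev b in \<open>auto elim: eventually_mono\<close>)
      then have b0: "b0 \<noteq> 0" using \<delta> by auto
      then have psib: "\<psi>0 / b0 = cnj r0" using eq by (auto simp: field_simps)
      have pl: "((\<lambda>\<epsilon>. poly q (Complex x \<epsilon>)) \<longlongrightarrow> poly q (of_real x)) (at_right 0)" for q
        by (intro tendsto_intros tendsto_Complex_at_right)
      let ?p = "poly p (of_real x)"
      have "((\<lambda>\<epsilon>. poly p (Complex x \<epsilon>) * poly p' (Complex x \<epsilon>) * (c * r (Complex x \<epsilon>))
          + poly p' (Complex x \<epsilon>) * (cnj c * (poly p (Complex x \<epsilon>) * (\<psi> (Complex x \<epsilon>) / b (Complex x \<epsilon>))))) \<longlongrightarrow>
          ?p * cnj ?p * (c * r0) + cnj ?p * (cnj c * (?p * (\<psi>0 / b0)))) (at_right 0)"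
        unfolding p'x[symmetric] by (intro tendsto_intros pl l b0)
      moreover have "eventually (\<lambda>\<epsilon>. poly p (Complex x \<epsilon>) * poly p' (Complex x \<epsilon>) * (c * r (Complex x \<epsilon>))
          + poly p' (Complex x \<epsilon>) * (cnj c * (poly p (Complex x \<epsilon>) * (\<psi> (Complex x \<epsilon>) / b (Complex x \<epsilon>))))
          = H c (Complex x \<epsilon>)) (at_right 0)"
        using ev
      proof eventually_elim
        case (elim \<epsilon>)
        then have "b (Complex x \<epsilon>) \<noteq> 0" using b[OF elim] \<delta> by auto
        then show ?case using elim g[of "Complex x \<epsilon>"] by (simp add: H_def)
      qed
      ultimately have "((\<lambda>\<epsilon>. H c (Complex x \<epsilon>)) \<longlongrightarrow>
          ?p * cnj ?p * (c * r0) + cnj ?p * (cnj c * (?p * (\<psi>0 / b0)))) (at_right 0)"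
        by (rule Lim_transform_eventually)
      moreover have "?p * cnj ?p * (c * r0) + cnj ?p * (cnj c * (?p * (\<psi>0 / b0)))
          = (?p * cnj ?p) * (c * r0 + cnj (c * r0))"
        unfolding psib by (simp add: algebra_simps)
      moreover have "\<dots> = of_real ((cmod ?p)\<^sup>2 * (2 * Re (c * r0)))"
        by (simp only: complex_norm_square[symmetric] complex_add_cnj of_real_mult)
      ultimately show ?case by metis
    qed
  qed
  obtain P1 P2 where P: "\<forall>z\<in>?U. H 1 z = poly P1 z" "\<forall>z\<in>?U. H \<i> z = poly P2 z" using poly by metis
  \<comment> \<open>In \<open>H 1 - \<i> * H \<i>\<close> the reflected terms cancel and the terms
    with \<open>r\<close> add up.\<close>
  have "poly (p * p') z * r z = poly ([:1/2:] * (P1 - [:\<i>:] * P2)) z" if "z \<in> ?U" for z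
  proof -
    have "poly ([:1/2:] * (P1 - [:\<i>:] * P2)) z = (1/2) * (H 1 z - \<i> * H \<i> z)"
      using P that by simp
    also have "\<dots> = poly (p * p') z * r z" by (simp add: H_def algebra_simps)
    finally show ?thesis by simp
  qed
  moreover have "p * p' \<noteq> 0" using p(1) p'0 by simp
  ultimately show ?thesis unfolding rational_on_uhp_def by blast
qed

subsection \<open>Rational functions on the upper half plane\<close>

lemma rational_on_uhp_poly: "rational_on_uhp (poly p)"
  unfolding rational_on_uhp_def by (intro exI[of _ p] exI[of _ 1]) auto

lemma rational_on_uhp_const: "rational_on_uhp (\<lambda>z. c)"
  using rational_on_uhp_poly[of "[:c:]"] by (simp add: rational_on_uhp_def)

lemma rational_on_uhp_ident: "rational_on_uhp (\<lambda>z. z)"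
  using rational_on_uhp_poly[of "[:0, 1:]"] by (simp add: rational_on_uhp_def)

lemma rational_on_uhp_cong:
  assumes "\<And>z. z \<in> upper_half_plane \<Longrightarrow> h z = k z"
  shows "rational_on_uhp h \<longleftrightarrow> rational_on_uhp k"
  using assms by (simp add: rational_on_uhp_def)

lemma rational_on_uhp_add:
  assumes "rational_on_uhp h" "rational_on_uhp k"
  shows "rational_on_uhp (\<lambda>z. h z + k z)"
proof -
  obtain P Q P' Q' where "Q \<noteq> 0" "\<forall>z\<in>upper_half_plane. poly Q z * h z = poly P z"
    and "Q' \<noteq> 0" "\<forall>z\<in>upper_half_plane. poly Q' z * k z = poly P' z"
    using assms unfolding rational_on_uhp_def by blast
  then show ?thesis unfolding rational_on_uhp_def
    by (intro exI[of _ "P * Q' + P' * Q"] exI[of _ "Q * Q'"]) (auto simp: algebra_simps)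
qed

lemma rational_on_uhp_mult:
  assumes "rational_on_uhp h" "rational_on_uhp k"
  shows "rational_on_uhp (\<lambda>z. h z * k z)"
proof -
  obtain P Q P' Q' where "Q \<noteq> 0" "\<forall>z\<in>upper_half_plane. poly Q z * h z = poly P z"
    and "Q' \<noteq> 0" "\<forall>z\<in>upper_half_plane. poly Q' z * k z = poly P' z"
    using assms unfolding rational_on_uhp_def by blast
  moreover have "poly (Q * Q') z * (h z * k z) = (poly Q z * h z) * (poly Q' z * k z)" for z
    by (simp only: poly_mult mult_ac)
  ultimately have "poly (Q * Q') z * (h z * k z) = poly (P * P') z" if "z \<in> upper_half_plane" for z
    using that by (metis poly_mult)
  moreover have "Q * Q' \<noteq> 0" using \<open>Q \<noteq> 0\<close> \<open>Q' \<noteq> 0\<close> by simp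
  ultimately show ?thesis unfolding rational_on_uhp_def by blast
qed

lemma rational_on_uhp_diff:
  assumes "rational_on_uhp h" "rational_on_uhp k"
  shows "rational_on_uhp (\<lambda>z. h z - k z)"
  using rational_on_uhp_add[OF assms(1) rational_on_uhp_mult[OF rational_on_uhp_const[of "-1"] assms(2)]]
  by simp

lemma rational_on_uhp_sum:
  assumes "\<And>i. i \<in> A \<Longrightarrow> rational_on_uhp (h i)"
  shows "rational_on_uhp (\<lambda>z. \<Sum>i\<in>A. h i z)"
  using assms by (induction A rule: infinite_finite_induct)
    (auto intro: rational_on_uhp_const rational_on_uhp_add)

lemma rational_on_uhp_prod:
  assumes "\<And>i. i \<in> A \<Longrightarrow> rational_on_uhp (h i)"
  shows "rational_on_uhp (\<lambda>z. \<Prod>i\<in>A. h i z)"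
  using assms by (induction A rule: infinite_finite_induct)
    (auto intro: rational_on_uhp_const rational_on_uhp_mult)

lemma rational_on_uhp_inverse:
  assumes "rational_on_uhp h" "\<And>z. z \<in> upper_half_plane \<Longrightarrow> h z \<noteq> 0"
  shows "rational_on_uhp (\<lambda>z. 1 / h z)"
proof -
  obtain P Q where PQ: "Q \<noteq> 0" "\<And>z. z \<in> upper_half_plane \<Longrightarrow> poly Q z * h z = poly P z"
    using assms unfolding rational_on_uhp_def by blast
  have "P \<noteq> 0"
  proof
    assume "P = 0"
    then have "upper_half_plane \<subseteq> {z. poly Q z = 0}" using PQ(2) assms(2) by auto
    then have "finite upper_half_plane" using poly_roots_finite[OF PQ(1)] finite_subset by blast
    moreover have "\<i> \<in> upper_half_plane" by simp
    ultimately show False using finite_imp_not_open open_upper_half_plane by blast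
  qed
  moreover have "poly P z * (1 / h z) = poly Q z" if "z \<in> upper_half_plane" for z
    using PQ(2)[OF that, symmetric] assms(2)[OF that] by simp
  ultimately show ?thesis unfolding rational_on_uhp_def by blast
qed

text \<open>Common roots of numerator and denominator are cancelled one at a time. After a
  cancellation the equation is only known away from the cancelled root; by continuity the set where
  it fails is open, and an open subset of a single point is empty. Once no common root is left, a
  zero of \<open>Q\<close> in the half plane would be a zero of \<open>P\<close> too.\<close>

lemma rational_on_uhp_reduced:
  assumes "rational_on_uhp h" and cont: "continuous_on upper_half_plane h"
  obtains P Q where "\<And>z. poly P z \<noteq> 0 \<or> poly Q z \<noteq> 0" "Q \<noteq> 0"
    "\<And>z. z \<in> upper_half_plane \<Longrightarrow> poly Q z \<noteq> 0"
    "\<And>z. z \<in> upper_half_plane \<Longrightarrow> h z = poly P z / poly Q z"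
proof -
  have ind: "\<exists>P' Q'. Q' \<noteq> 0 \<and> (\<forall>z\<in>upper_half_plane. poly Q' z * h z = poly P' z) \<and>
      (\<forall>z. poly P' z \<noteq> 0 \<or> poly Q' z \<noteq> 0)"
    if "Q \<noteq> 0" "\<And>z. z \<in> upper_half_plane \<Longrightarrow> poly Q z * h z = poly P z" for P Q
    using that
  proof (induction "degree Q" arbitrary: P Q rule: less_induct)
    case less
    show ?case
    proof (cases "\<exists>x. poly P x = 0 \<and> poly Q x = 0")
      case False
      then show ?thesis using less.prems by blast
    next
      case True
      then obtain x where "poly P x = 0" "poly Q x = 0" by blast
      then obtain P1 Q1 where P1: "P = [:-x, 1:] * P1" and Q1: "Q = [:-x, 1:] * Q1"
        unfolding poly_eq_0_iff_dvd by (elim dvdE)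
      have Q10: "Q1 \<noteq> 0" using less.prems(1) Q1 by auto
      have "degree Q1 < degree Q" unfolding Q1 using Q10 by (subst degree_mult_eq) auto
      moreover have "poly Q1 z * h z = poly P1 z" if z: "z \<in> upper_half_plane" for z
      proof (rule ccontr)
        assume nz: "poly Q1 z * h z \<noteq> poly P1 z"
        let ?f = "\<lambda>z. poly Q1 z * h z - poly P1 z"
        have "continuous_on upper_half_plane ?f" by (intro continuous_intros cont)
        then have "open (upper_half_plane \<inter> ?f -` (-{0}))"
          by (intro continuous_open_preimage open_upper_half_plane) auto
        moreover have "z \<in> upper_half_plane \<inter> ?f -` (-{0})" using nz z by auto
        moreover have "upper_half_plane \<inter> ?f -` (-{0}) \<subseteq> {x}"
        proof
          fix w assume w: "w \<in> upper_half_plane \<inter> ?f -` (-{0})"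
          have "(w - x) * ?f w = poly Q w * h w - poly P w" by (simp add: P1 Q1 algebra_simps)
          also have "\<dots> = 0" using w less.prems(2)[of w] by auto
          finally show "w \<in> {x}" using w by auto
        qed
        then have "finite (upper_half_plane \<inter> ?f -` (-{0}))" by (rule finite_subset) simp
        ultimately show False using finite_imp_not_open by blast
      qed
      ultimately show ?thesis using less.hyps[of Q1 P1] Q10 by blast
    qed
  qed
  obtain P0 Q0 where "Q0 \<noteq> 0" "\<And>z. z \<in> upper_half_plane \<Longrightarrow> poly Q0 z * h z = poly P0 z"
    using assms(1) unfolding rational_on_uhp_def by blast
  from ind[OF this] obtain P Q where PQ: "Q \<noteq> 0"
    "\<And>z. z \<in> upper_half_plane \<Longrightarrow> poly Q z * h z = poly P z"
    "\<And>z. poly P z \<noteq> 0 \<or> poly Q z \<noteq> 0"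
    by blast
  have nzQ: "poly Q z \<noteq> 0" if "z \<in> upper_half_plane" for z
    using PQ(2)[OF that] PQ(3)[of z] by auto
  show ?thesis
  proof (rule that[OF PQ(3) PQ(1) nzQ])
    fix z assume z: "z \<in> upper_half_plane"
    show "h z = poly P z / poly Q z" using PQ(2)[OF z] nzQ[OF z] by (simp add: field_simps)
  qed
qed

text \<open>The bridge from boundary data to polynomial identities, for which infinitely many points
  are enough.\<close>

lemma AE_lborel_infinite:
  fixes P :: "real \<Rightarrow> bool"
  assumes "AE x in lborel. P x"
  shows "infinite {x. P x}"
proof
  assume "finite {x. P x}"
  then have "{x. P x} \<in> null_sets lborel" by (rule finite_imp_null_set_lborel)
  then have "AE x in lborel. x \<notin> {x. P x}" by (rule AE_not_in)
  with assms have "AE x in (lborel :: real measure). False" by eventually_elim auto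
  then show False by (simp add: AE_iff_measurable[where N = UNIV])
qed

text \<open>As \<open>\<omega>\<close> runs through the upper half plane, \<open>\<omega>\<^sup>k\<close> with \<open>k \<ge> 2\<close> takes all arguments.\<close>

lemma Im_divide_power_nonneg:
  assumes "c \<noteq> 0" and nn: "\<And>\<omega>. \<omega> \<in> upper_half_plane \<Longrightarrow> 0 \<le> Im (c / \<omega> ^ k)"
  shows "k \<le> 1"
proof (rule ccontr)
  assume "\<not> k \<le> 1"
  then have k: "2 \<le> real k" by simp
  define \<alpha> where "\<alpha> = Arg c"
  have \<alpha>: "-pi < \<alpha>" "\<alpha> \<le> pi" by (simp_all add: \<alpha>_def Arg_bounded)
  have c: "c = of_real (cmod c) * cis \<alpha>"
    using rcis_cmod_Arg[of c] by (simp add: \<alpha>_def rcis_def)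
  \<comment> \<open>Since \<open>k \<ge> 2\<close>, every angle in the open interval from 0 to
    \<open>2 * pi\<close> is \<open>k\<close> times an angle of the upper half plane. The angle is
    chosen so that rotating \<open>c\<close> by its negative lands in the lower half plane: normally
    \<open>\<alpha> + pi / 2\<close>, and half of \<open>\<alpha> + pi\<close> when the former is
    not positive.\<close>
  obtain \<phi> where \<phi>: "0 < \<phi>" "\<phi> < 2 * pi" "sin (\<alpha> - \<phi>) < 0"
  proof (cases "-pi/2 < \<alpha>")
    case True
    show ?thesis by (rule that[of "\<alpha> + pi/2"]) (use True \<alpha> in \<open>auto simp: sin_diff sin_add cos_add cos_squared_eq\<close>)
  next
    case False
    have "0 < sin ((pi - \<alpha>) / 2)" by (rule sin_gt_zero) (use False \<alpha> in auto)
    moreover have "\<alpha> - (\<alpha> + pi) / 2 = - ((pi - \<alpha>) / 2)" by argo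
    ultimately have "sin (\<alpha> - (\<alpha> + pi) / 2) < 0" by (simp only: sin_minus)
    then show ?thesis by (rule that[rotated 2]) (use False \<alpha> in auto)
  qed
  define \<omega> where "\<omega> = cis (\<phi> / real k)"
  have "0 < \<phi> / real k" "\<phi> / real k < pi"
    using \<phi> k by (auto simp: field_simps intro: less_le_trans[OF \<phi>(2)])
  then have "\<omega> \<in> upper_half_plane" by (simp add: \<omega>_def sin_gt_zero)
  then have "0 \<le> Im (c / \<omega> ^ k)" by (rule nn)
  also have "\<omega> ^ k = cis \<phi>" using k by (simp add: \<omega>_def Complex.DeMoivre)
  also have "c / cis \<phi> = of_real (cmod c) * cis (\<alpha> - \<phi>)"
    by (subst (1) c) (simp only: times_divide_eq_right[symmetric] cis_divide)
  also have "Im \<dots> = cmod c * sin (\<alpha> - \<phi>)" by simp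
  also have "\<dots> < 0" using \<phi>(3) assms(1) by (simp add: mult_pos_neg)
  finally show False by simp
qed

text \<open>The coefficients are arbitrary complex numbers because off-diagonal matrix entries carry
  no sign. Self-adjointness and positivity are recovered later for the coefficient matrices as a
  whole.\<close>

definition real_simple_poles :: "(complex \<Rightarrow> complex) \<Rightarrow> bool" where
  "real_simple_poles h \<longleftrightarrow> (\<exists>S::real set. \<exists>c d a. finite S \<and>
     (\<forall>z\<in>upper_half_plane. h z = c + d * z + (\<Sum>l\<in>S. a l / (of_real l - z))))"

text \<open>One real root of \<open>Q\<close> is removed at a time. Simplicity makes the cofactor
  \<open>Q1\<close> nonzero at the root, so a multiple of \<open>1 / (z - x)\<close> takes away the
  pole, and the bound on the degrees survives.\<close>

lemma real_simple_poles_partial_fractions: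
  assumes "Q \<noteq> 0" "degree P \<le> degree Q + 1"
    and "\<And>x. poly Q x = 0 \<Longrightarrow> Im x = 0 \<and> Polynomial.order x Q \<le> 1"
  shows "\<exists>S::real set. \<exists>c d a. finite S \<and> (\<forall>l\<in>S. poly Q (of_real l) = 0) \<and>
     (\<forall>z. poly Q z \<noteq> 0 \<longrightarrow> poly P z / poly Q z = c + d * z + (\<Sum>l\<in>S. a l / (of_real l - z)))"
  using assms
proof (induction "degree Q" arbitrary: P Q)
  case 0
  then obtain q where q: "Q = [:q:]" "q \<noteq> 0" by (metis degree_eq_zeroE pCons_0_0)
  have "degree P \<le> 1" using 0 q by simp
  then have "P = [:coeff P 0, coeff P 1:]"
    by (intro poly_eqI) (auto simp: coeff_pCons coeff_eq_0 split: nat.splits)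
  then have "poly P z = coeff P 0 + coeff P 1 * z" for z
    by (metis poly_pCons poly_0 add.right_neutral mult.commute mult_zero_right)
  then show ?case using q
    by (intro exI[of _ "{}"] exI[of _ "coeff P 0 / q"] exI[of _ "coeff P 1 / q"]) (auto simp: field_simps)
next
  case (Suc m)
  then obtain x where x: "poly Q x = 0"
    by (metis constant_degree fundamental_theorem_of_algebra nat.distinct(1))
  define l where "l = Re x"
  have xl: "x = of_real l" using Suc.prems(3)[OF x] by (simp add: l_def complex_eq_iff)
  obtain Q1 where Q1: "Q = [:-x, 1:] * Q1" using x by (auto simp: poly_eq_0_iff_dvd)
  have Q10: "Q1 \<noteq> 0" using Suc.prems(1) Q1 by auto
  have ord: "Polynomial.order y Q = Polynomial.order y [:-x, 1:] + Polynomial.order y Q1" for y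
    using Suc.prems(1) unfolding Q1 by (rule order_mult)
  have ox: "Polynomial.order x [:-x, 1:] = 1" using order_power_n_n[of x 1] by simp
  have nz: "poly Q1 x \<noteq> 0" using ord[of x] ox Suc.prems(3)[OF x] Q10 by (auto simp: order_root)
  have deg: "degree Q = Suc (degree Q1)" unfolding Q1 using Q10 by (subst degree_mult_eq) auto
  \<comment> \<open>The residue at \<open>x\<close>, chosen so that \<open>P - a * Q1\<close> is
    divisible by \<open>z - x\<close>.\<close>
  define a where "a = poly P x / poly Q1 x"
  have "poly (P - [:a:] * Q1) x = 0" using nz by (simp add: a_def)
  then obtain P1 where P1: "P - [:a:] * Q1 = [:-x, 1:] * P1" unfolding poly_eq_0_iff_dvd by (elim dvdE)
  have "degree P1 \<le> degree Q1 + 1"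
  proof (cases "P1 = 0")
    case False
    then have "degree P1 + 1 = degree (P - [:a:] * Q1)" unfolding P1 by (subst degree_mult_eq) auto
    also have "\<dots> \<le> max (degree P) (degree ([:a:] * Q1))" by (rule degree_diff_le_max)
    also have "\<dots> \<le> degree Q1 + 2"
      using Suc.prems(2) deg degree_mult_le[of "[:a:]" Q1] by auto
    finally show ?thesis by simp
  qed auto
  moreover have "Im y = 0 \<and> Polynomial.order y Q1 \<le> 1" if "poly Q1 y = 0" for y
    using Suc.prems(3)[of y] ord[of y] that by (auto simp: Q1)
  moreover have "m = degree Q1" using Suc.hyps(2) deg by simp
  ultimately obtain S :: "real set" and c d b where S: "finite S" "\<forall>l\<in>S. poly Q1 (of_real l) = 0"
    "\<And>z. poly Q1 z \<noteq> 0 \<Longrightarrow> poly P1 z / poly Q1 z = c + d * z + (\<Sum>l\<in>S. b l / (of_real l - z))"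
    using Suc.hyps(1)[of Q1 P1] Q10 by blast
  have lS: "l \<notin> S" using S(2) nz xl by auto
  show ?case
  proof (rule exI[of _ "insert l S"], rule exI[of _ c], rule exI[of _ d], rule exI[of _ "b(l := -a)"],
      intro conjI allI impI ballI)
    show "finite (insert l S)" using S by simp
    show "poly Q (of_real r) = 0" if "r \<in> insert l S" for r
      using that S(2) xl by (auto simp: Q1)
    fix z assume z: "poly Q z \<noteq> 0"
    then have z1: "poly Q1 z \<noteq> 0" "z - x \<noteq> 0" by (auto simp: Q1)
    have "poly P z = a * poly Q1 z + (z - x) * poly P1 z"
      using arg_cong[OF P1, of "\<lambda>p. poly p z"] by (simp add: algebra_simps)
    then have "poly P z / poly Q z = a / (z - x) + poly P1 z / poly Q1 z"
      using z1 by (simp add: Q1 field_simps)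
    also have "a / (z - x) = - a / (of_real l - z)"
      using z1 by (simp add: xl divide_simps) (simp add: algebra_simps)
    also have "- a / (of_real l - z) + poly P1 z / poly Q1 z
       = c + d * z + (- a / (of_real l - z) + (\<Sum>r\<in>S. b r / (of_real r - z)))"
      using S(3)[OF z1(1)] by simp
    also have "(\<Sum>r\<in>S. b r / (of_real r - z)) = (\<Sum>r\<in>S. (b(l := -a)) r / (of_real r - z))"
      using lS by (intro sum.cong) auto
    finally show "poly P z / poly Q z = c + d * z + (\<Sum>r\<in>insert l S. (b(l := -a)) r / (of_real r - z))"
      using S(1) lS by simp
  qed
qed

lemma Im_of_real_times: "Im (of_real a * z) = a * Im z"
  by simp

lemma Im_limit_nonneg:
  assumes "(f \<longlongrightarrow> c) (at_right (0::real))" "\<And>r. 0 < r \<Longrightarrow> 0 \<le> Im (f r)"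
  shows "0 \<le> Im c"
  by (rule tendsto_lowerbound[OF tendsto_Im[OF assms(1)]])
     (use assms(2) eventually_at_right_less[of "0::real"] in \<open>auto elim: eventually_mono\<close>)

text \<open>Real boundary values make the reduced fraction equal to its own reflection, so it has no
  poles in the lower half plane either. Near a real pole of order at least 2, or at infinity with
  growth of order at least 2, the values would take all arguments, against the sign of the imaginary
  part.\<close>

lemma real_simple_poles_of_rational_Pick:
  assumes rat: "rational_on_uhp h" and cont: "continuous_on upper_half_plane h"
    and im: "\<And>z. z \<in> upper_half_plane \<Longrightarrow> 0 \<le> Im (h z)" and rb: "real_boundary h"
  shows "real_simple_poles h"
proof -
  obtain P Q where cop: "\<And>z. poly P z \<noteq> 0 \<or> poly Q z \<noteq> 0" and Q0: "Q \<noteq> 0"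
    and nz: "\<And>z. z \<in> upper_half_plane \<Longrightarrow> poly Q z \<noteq> 0"
    and h: "\<And>z. z \<in> upper_half_plane \<Longrightarrow> h z = poly P z / poly Q z"
    by (rule rational_on_uhp_reduced[OF rat cont]) (rule that)
  let ?c = "map_poly cnj"
  have cp: "poly (?c p) z = cnj (poly p (cnj z))" for p z
    by (metis poly_cnj complex_cnj_cnj)
  \<comment> \<open>Multiplied-out difference between the fraction and its reflection; it vanishes
    at almost every real point.\<close>
  define E where "E = P * ?c Q - ?c P * Q"
  have "AE x in lborel. poly E (of_real x) = 0"
    using rb unfolding real_boundary_def
  proof eventually_elim
    case (elim x)
    then obtain r :: real where r: "((\<lambda>\<epsilon>. h (Complex x \<epsilon>)) \<longlongrightarrow> of_real r) (at_right 0)" by blast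
    have "((\<lambda>\<epsilon>. poly Q (Complex x \<epsilon>) * h (Complex x \<epsilon>)) \<longlongrightarrow> poly Q (of_real x) * of_real r) (at_right 0)"
      by (intro tendsto_intros tendsto_Complex_at_right r)
    moreover have "eventually (\<lambda>\<epsilon>. poly Q (Complex x \<epsilon>) * h (Complex x \<epsilon>) = poly P (Complex x \<epsilon>)) (at_right 0)"
      using eventually_at_right_less[of 0]
    proof eventually_elim
      case (elim \<epsilon>)
      then show ?case using h[of "Complex x \<epsilon>"] nz[of "Complex x \<epsilon>"] by simp
    qed
    ultimately have "((\<lambda>\<epsilon>. poly P (Complex x \<epsilon>)) \<longlongrightarrow> poly Q (of_real x) * of_real r) (at_right 0)"
      by (rule Lim_transform_eventually)
    moreover have "((\<lambda>\<epsilon>. poly P (Complex x \<epsilon>)) \<longlongrightarrow> poly P (of_real x)) (at_right 0)"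
      by (intro tendsto_intros tendsto_Complex_at_right)
    ultimately have "poly P (of_real x) = poly Q (of_real x) * of_real r"
      using tendsto_unique trivial_limit_at_right_real by blast
    then show ?case by (simp add: E_def cp)
  qed
  then have "infinite {x::real. poly E (of_real x) = 0}" by (rule AE_lborel_infinite)
  moreover have "inj_on complex_of_real {x. poly E (of_real x) = 0}" by (auto simp: inj_on_def)
  ultimately have "infinite (complex_of_real ` {x. poly E (of_real x) = 0})" by (simp add: finite_image_iff)
  then have "infinite {z. poly E z = 0}" by (rule infinite_super[rotated]) auto
  then have E0: "E = 0" using poly_roots_finite by blast
  have real_roots: "Im x = 0" if x: "poly Q x = 0" for x
  proof -
    have "poly P x \<noteq> 0" using cop[of x] x by auto
    moreover have "poly E x = 0" using E0 by simp
    ultimately have "poly Q (cnj x) = 0" using x by (simp add: E_def cp)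
    then show ?thesis using nz[of x] nz[of "cnj x"] x by (cases "Im x > 0"; cases "Im x < 0") auto
  qed
  have ord: "Polynomial.order x Q \<le> 1" if x: "poly Q x = 0" for x
  proof -
    define k where "k = Polynomial.order x Q"
    obtain Q1 where Q1: "Q = [:-x, 1:] ^ k * Q1" "\<not> [:-x, 1:] dvd Q1"
      using order_decomp[OF Q0] unfolding k_def by blast
    have Q1x: "poly Q1 x \<noteq> 0" using Q1(2) by (simp add: poly_eq_0_iff_dvd)
    have Px: "poly P x \<noteq> 0" using cop[of x] x by auto
    show ?thesis unfolding k_def[symmetric]
    proof (rule Im_divide_power_nonneg)
      show "poly P x / poly Q1 x \<noteq> 0" using Px Q1x by simp
      fix \<omega> assume \<omega>: "\<omega> \<in> upper_half_plane"
      \<comment> \<open>The values of \<open>h\<close> along a ray from \<open>x\<close>, rescaled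
        by \<open>r ^ k\<close>. The limit is the leading coefficient at the pole divided by
        \<open>\<omega> ^ k\<close>, and the positive scaling keeps the sign of the imaginary
        part.\<close>
      define f where "f r = poly P (x + of_real r * \<omega>) / poly Q1 (x + of_real r * \<omega>) / \<omega> ^ k" for r :: real
      have "((\<lambda>r. x + of_real r * \<omega>) \<longlongrightarrow> x) (at_right 0)" by (auto intro!: tendsto_eq_intros)
      then have "(f \<longlongrightarrow> poly P x / poly Q1 x / \<omega> ^ k) (at_right 0)"
        unfolding f_def using Q1x \<omega> by (intro tendsto_intros) auto
      then show "0 \<le> Im (poly P x / poly Q1 x / \<omega> ^ k)"
      proof (rule Im_limit_nonneg)
        fix r :: real assume r: "0 < r"
        define z where "z = x + of_real r * \<omega>"
        have zU: "z \<in> upper_half_plane" using real_roots[OF x] r \<omega> by (simp add: z_def)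
        have "poly Q z = (of_real r * \<omega>) ^ k * poly Q1 z" by (simp add: Q1(1) z_def poly_power)
        then have "f r = of_real (r ^ k) * h z"
          using nz[OF zU] r \<omega> unfolding h[OF zU] f_def z_def[symmetric] by (auto simp: power_mult_distrib)
        then have "Im (f r) = r ^ k * Im (h z)" by (simp only: Im_of_real_times)
        then show "0 \<le> Im (f r)" using im[OF zU] r by simp
      qed
    qed
  qed
  have deg: "degree P \<le> degree Q + 1"
  proof (rule ccontr)
    assume d: "\<not> degree P \<le> degree Q + 1"
    define k where "k = degree P - degree Q"
    have P0: "P \<noteq> 0" using d by auto
    have "k \<le> 1"
    proof (rule Im_divide_power_nonneg)
      show "(-1) ^ k * lead_coeff P / lead_coeff Q \<noteq> 0" using P0 Q0 by simp
      fix \<omega>' assume \<omega>': "\<omega>' \<in> upper_half_plane"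
      \<comment> \<open>Inversion with a sign preserves the half plane; it turns the growth
        \<open>\<omega> ^ k\<close> at infinity into the form required by
        \<open>Im_divide_power_nonneg\<close>.\<close>
      define \<omega> where "\<omega> = - 1 / \<omega>'"
      have w0: "\<omega>' \<noteq> 0" using \<omega>' by auto
      have \<omega>: "\<omega> \<in> upper_half_plane"
        using \<omega>' w0 by (simp add: \<omega>_def Im_divide power2_eq_square sum_squares_gt_zero_iff complex_eq_iff)
      have \<omega>0: "\<omega> \<noteq> 0" using \<omega> by auto
      have "1 / \<omega>' ^ k = (- \<omega>) ^ k" by (simp add: \<omega>_def power_divide)
      also have "\<dots> = (-1) ^ k * \<omega> ^ k" by (rule power_minus)
      finally have eq: "(-1) ^ k * lead_coeff P / lead_coeff Q / \<omega>' ^ k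
         = \<omega> ^ k * (lead_coeff P / lead_coeff Q)"
        by (simp add: divide_inverse power_mult_distrib[symmetric])
      \<comment> \<open>With \<open>z = \<omega> / r\<close> the limit at infinity becomes a limit
        at 0, where the reflected polynomials take the leading coefficients as values.\<close>
      define f where "f r = \<omega> ^ k * (poly (reflect_poly P) (of_real r / \<omega>) / poly (reflect_poly Q) (of_real r / \<omega>))" for r :: real
      have "((\<lambda>r. of_real r / \<omega>) \<longlongrightarrow> 0) (at_right 0)" using \<omega>0 by (auto intro!: tendsto_eq_intros)
      then have "(f \<longlongrightarrow> \<omega> ^ k * (poly (reflect_poly P) 0 / poly (reflect_poly Q) 0)) (at_right 0)"
        unfolding f_def using Q0 by (intro tendsto_intros) auto
      then have "(f \<longlongrightarrow> \<omega> ^ k * (lead_coeff P / lead_coeff Q)) (at_right 0)" by simp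
      then show "0 \<le> Im ((-1) ^ k * lead_coeff P / lead_coeff Q / \<omega>' ^ k)"
        unfolding eq
      proof (rule Im_limit_nonneg)
        fix r :: real assume r: "0 < r"
        define z where "z = \<omega> / of_real r"
        have zU: "z \<in> upper_half_plane" using r \<omega> by (simp add: z_def)
        have z0: "z \<noteq> 0" using zU by auto
        have iz: "of_real r / \<omega> = inverse z" by (simp add: z_def)
        have rf: "poly (reflect_poly p) (inverse z) = poly p z / z ^ degree p" for p
          using poly_reflect_poly_nz[of "inverse z" p] z0 by (simp add: field_simps)
        have dk: "degree P = degree Q + k" using d by (simp add: k_def)
        have "f r = \<omega> ^ k * ((poly P z / z ^ degree P) / (poly Q z / z ^ degree Q))"
          by (simp add: f_def iz rf)
        also have "\<dots> = (\<omega> / z) ^ k * (poly P z / poly Q z)"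
          using z0 by (simp add: dk power_add power_divide field_simps)
        also have "\<omega> / z = of_real r" using \<omega>0 by (simp add: z_def)
        finally have "f r = of_real (r ^ k) * h z" using h[OF zU] by simp
        then have "Im (f r) = r ^ k * Im (h z)" by (simp only: Im_of_real_times)
        then show "0 \<le> Im (f r)" using im[OF zU] r by simp
      qed
    qed
    then show False using d by (simp add: k_def)
  qed
  show ?thesis
    using real_simple_poles_partial_fractions[OF Q0 deg] real_roots ord nz h
    unfolding real_simple_poles_def by metis
qed

lemma real_simple_poles_combine:
  assumes "real_simple_poles h" "real_simple_poles k"
  shows "real_simple_poles (\<lambda>z. s * h z + t * k z)"
proof -
  obtain S :: "real set" and c d a where h: "finite S"
    "\<And>z. z \<in> upper_half_plane \<Longrightarrow> h z = c + d * z + (\<Sum>l\<in>S. a l / (of_real l - z))"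
    using assms(1) unfolding real_simple_poles_def by blast
  obtain T :: "real set" and c' d' a' where k: "finite T"
    "\<And>z. z \<in> upper_half_plane \<Longrightarrow> k z = c' + d' * z + (\<Sum>l\<in>T. a' l / (of_real l - z))"
    using assms(2) unfolding real_simple_poles_def by blast
  define A where "A l = (if l \<in> S then a l else 0)" for l
  define A' where "A' l = (if l \<in> T then a' l else 0)" for l
  let ?b = "\<lambda>l. s * A l + t * A' l"
  have key: "s * h z + t * k z = (s * c + t * c') + (s * d + t * d') * z + (\<Sum>l\<in>S \<union> T. ?b l / (of_real l - z))"
    if z: "z \<in> upper_half_plane" for z
  proof -
    have 1: "(\<Sum>l\<in>S. a l / (of_real l - z)) = (\<Sum>l\<in>S \<union> T. A l / (of_real l - z))"
      unfolding A_def using h(1) k(1) by (intro sum.mono_neutral_cong_left) auto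
    have 2: "(\<Sum>l\<in>T. a' l / (of_real l - z)) = (\<Sum>l\<in>S \<union> T. A' l / (of_real l - z))"
      unfolding A'_def using h(1) k(1) by (intro sum.mono_neutral_cong_left) auto
    have 3: "(\<Sum>l\<in>S \<union> T. ?b l / (of_real l - z)) = s * (\<Sum>l\<in>S \<union> T. A l / (of_real l - z))
        + t * (\<Sum>l\<in>S \<union> T. A' l / (of_real l - z))"
      by (simp add: sum_distrib_left sum.distrib add_divide_distrib)
    show ?thesis unfolding h(2)[OF z] k(2)[OF z] 1 2 3
      by (simp add: algebra_simps)
  qed
  show ?thesis unfolding real_simple_poles_def
    by (rule exI[of _ "S \<union> T"], rule exI[of _ "s * c + t * c'"], rule exI[of _ "s * d + t * d'"],
        rule exI[of _ ?b]) (use h(1) k(1) key in simp)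
qed

subsection \<open>Counting zeros\<close>

text \<open>\<open>P\<close> and \<open>Q\<close> need not be coprime: a common root is a root of
  \<open>Q\<close>, hence outside the half plane, where nothing is counted.\<close>

definition zero_count :: "(complex \<Rightarrow> complex) \<Rightarrow> nat \<Rightarrow> bool" where
  "zero_count h d \<longleftrightarrow> (\<exists>P Q. P \<noteq> 0 \<and>
     (\<forall>z\<in>upper_half_plane. poly Q z \<noteq> 0 \<and> h z = poly P z / poly Q z) \<and>
     size {#z \<in># proots P. 0 < Im z#} = d)"

lemma zero_count_cong:
  assumes "\<And>z. z \<in> upper_half_plane \<Longrightarrow> h z = k z" "zero_count h d"
  shows "zero_count k d"
  using assms by (auto simp: zero_count_def)

text \<open>Two representations satisfy \<open>P * Q' = P' * Q\<close> on an infinite set, hence as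
  polynomials, and the roots of \<open>Q\<close> and \<open>Q'\<close> all lie outside the half
  plane.\<close>

lemma zero_count_unique:
  assumes "zero_count h d" "zero_count h e"
  shows "d = e"
proof -
  obtain P Q where P: "P \<noteq> 0" "\<And>z. z \<in> upper_half_plane \<Longrightarrow> poly Q z \<noteq> 0 \<and> h z = poly P z / poly Q z"
     "size {#z \<in># proots P. 0 < Im z#} = d"
    using assms(1) unfolding zero_count_def by blast
  obtain P' Q' where P': "P' \<noteq> 0" "\<And>z. z \<in> upper_half_plane \<Longrightarrow> poly Q' z \<noteq> 0 \<and> h z = poly P' z / poly Q' z"
     "size {#z \<in># proots P'. 0 < Im z#} = e"
    using assms(2) unfolding zero_count_def by blast
  have "\<i> \<in> upper_half_plane" by simp
  then have Q0: "Q \<noteq> 0" "Q' \<noteq> 0" using P(2) P'(2) by (metis poly_0)+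
  have "upper_half_plane \<subseteq> {z. poly (P * Q' - P' * Q) z = 0}"
  proof
    fix z assume "z \<in> upper_half_plane"
    then show "z \<in> {z. poly (P * Q' - P' * Q) z = 0}"
      using P(2)[of z] P'(2)[of z] by (simp add: field_simps)
  qed
  moreover have "infinite upper_half_plane"
    using finite_imp_not_open open_upper_half_plane \<open>\<i> \<in> upper_half_plane\<close> by blast
  ultimately have "P * Q' - P' * Q = 0" using poly_roots_finite finite_subset by blast
  then have "proots P + proots Q' = proots P' + proots Q"
    using P(1) P'(1) Q0 by (simp add: proots_mult[symmetric])
  then have "size {#z \<in># proots P + proots Q'. 0 < Im z#} = size {#z \<in># proots P' + proots Q. 0 < Im z#}"
    by simp
  moreover have "{#z \<in># proots Q. 0 < Im z#} = {#}" "{#z \<in># proots Q'. 0 < Im z#} = {#}"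
    using P(2) P'(2) Q0 by (auto simp: filter_mset_eq_mempty_iff)
  ultimately show ?thesis using P(3) P'(3) by simp
qed

lemma zero_count_mult:
  assumes "zero_count h d" "zero_count k e"
  shows "zero_count (\<lambda>z. h z * k z) (d + e)"
proof -
  obtain P Q where P: "P \<noteq> 0" "\<And>z. z \<in> upper_half_plane \<Longrightarrow> poly Q z \<noteq> 0 \<and> h z = poly P z / poly Q z"
     "size {#z \<in># proots P. 0 < Im z#} = d"
    using assms(1) unfolding zero_count_def by blast
  obtain P' Q' where P': "P' \<noteq> 0" "\<And>z. z \<in> upper_half_plane \<Longrightarrow> poly Q' z \<noteq> 0 \<and> k z = poly P' z / poly Q' z"
     "size {#z \<in># proots P'. 0 < Im z#} = e"
    using assms(2) unfolding zero_count_def by blast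
  show ?thesis unfolding zero_count_def
    by (rule exI[of _ "P * P'"], rule exI[of _ "Q * Q'"]) (use P P' in \<open>auto simp: proots_mult\<close>)
qed

lemma zero_count_const: "c \<noteq> 0 \<Longrightarrow> zero_count (\<lambda>z. c) 0"
  unfolding zero_count_def by (rule exI[of _ "[:c:]"], rule exI[of _ 1]) auto

lemma zero_count_inverse:
  assumes "zero_count h 0"
  shows "zero_count (\<lambda>z. 1 / h z) 0"
proof -
  obtain P Q where P: "P \<noteq> 0" "\<And>z. z \<in> upper_half_plane \<Longrightarrow> poly Q z \<noteq> 0 \<and> h z = poly P z / poly Q z"
     "size {#z \<in># proots P. 0 < Im z#} = 0"
    using assms unfolding zero_count_def by blast
  have "\<i> \<in> upper_half_plane" by simp
  then have Q0: "Q \<noteq> 0" using P(2) by (metis poly_0)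
  show ?thesis unfolding zero_count_def
    by (rule exI[of _ Q], rule exI[of _ P]) (use P Q0 in \<open>auto simp: filter_mset_eq_mempty_iff\<close>)
qed

lemma zero_count_nonvanishing:
  assumes "rational_on_uhp h" "continuous_on upper_half_plane h" "\<And>z. z \<in> upper_half_plane \<Longrightarrow> h z \<noteq> 0"
  shows "zero_count h 0"
proof -
  obtain P Q where "\<And>z. poly P z \<noteq> 0 \<or> poly Q z \<noteq> 0" and
    Q: "Q \<noteq> 0" "\<And>z. z \<in> upper_half_plane \<Longrightarrow> poly Q z \<noteq> 0"
    "\<And>z. z \<in> upper_half_plane \<Longrightarrow> h z = poly P z / poly Q z"
    by (rule rational_on_uhp_reduced[OF assms(1,2)]) (rule that)
  have "\<i> \<in> upper_half_plane" by simp
  then have "P \<noteq> 0" using Q(3)[of \<i>] assms(3)[of \<i>] by auto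
  moreover have "{#z \<in># proots P. 0 < Im z#} = {#}"
    using assms(3) Q \<open>P \<noteq> 0\<close> by (force simp: filter_mset_eq_mempty_iff)
  ultimately show ?thesis unfolding zero_count_def using Q by (intro exI[of _ P] exI[of _ Q]) auto
qed

lemma zero_count_pos_imp_zero:
  assumes "zero_count h d" "0 < d"
  obtains z where "z \<in> upper_half_plane" "h z = 0"
proof -
  obtain P Q where P: "P \<noteq> 0" "\<And>z. z \<in> upper_half_plane \<Longrightarrow> poly Q z \<noteq> 0 \<and> h z = poly P z / poly Q z"
     "size {#z \<in># proots P. 0 < Im z#} = d"
    using assms(1) unfolding zero_count_def by blast
  then have "{#z \<in># proots P. 0 < Im z#} \<noteq> {#}" using assms(2) by (metis size_empty less_irrefl)
  then obtain z where "poly P z = 0" "0 < Im z"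
    using P(1) set_count_proots[OF P(1)] unfolding filter_mset_eq_mempty_iff by blast
  then show ?thesis using P(2)[of z] that[of z] by simp
qed

text \<open>The list \<open>\<mu>s z\<close> stands for the eigenvalues of a matrix function with spectrum in the upper
  half plane.\<close>

lemma zero_count_eigenvalues:
  assumes h: "zero_count h d"
    and \<mu>: "\<And>z. z \<in> upper_half_plane \<Longrightarrow> set (\<mu>s z) \<subseteq> upper_half_plane \<and> length (\<mu>s z) = n"
    and cnt: "\<And>\<alpha>. \<alpha> \<in> upper_half_plane \<Longrightarrow> zero_count (\<lambda>z. \<Prod>\<mu>\<leftarrow>\<mu>s z. \<mu> - \<alpha>) e"
    and rat: "\<And>\<alpha>. rational_on_uhp (\<lambda>z. \<Prod>\<mu>\<leftarrow>\<mu>s z. \<mu> - \<alpha>)"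
    and cont: "\<And>\<alpha>. continuous_on upper_half_plane (\<lambda>z. \<Prod>\<mu>\<leftarrow>\<mu>s z. \<mu> - \<alpha>)"
  shows "zero_count (\<lambda>z. \<Prod>\<mu>\<leftarrow>\<mu>s z. h \<mu>) (d * e)"
proof -
  obtain P Q where P: "P \<noteq> 0" "\<And>z. z \<in> upper_half_plane \<Longrightarrow> poly Q z \<noteq> 0 \<and> h z = poly P z / poly Q z"
     "size {#z \<in># proots P. 0 < Im z#} = d"
    using h unfolding zero_count_def by blast
  have "\<i> \<in> upper_half_plane" by simp
  then have Q0: "Q \<noteq> 0" using P(2) by (metis poly_0)
  \<comment> \<open>Splitting numerator and denominator of \<open>h\<close> into linear factors
    reduces the claim to products of \<open>\<mu> - \<alpha>\<close>. A root \<alpha> outside the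
    half plane contributes nothing, because no eigenvalue can equal it.\<close>
  have lin: "zero_count (\<lambda>z. \<Prod>\<mu>\<leftarrow>\<mu>s z. \<mu> - \<alpha>) (if 0 < Im \<alpha> then e else 0)" for \<alpha>
  proof (cases "0 < Im \<alpha>")
    case False
    have "zero_count (\<lambda>z. \<Prod>\<mu>\<leftarrow>\<mu>s z. \<mu> - \<alpha>) 0"
    proof (rule zero_count_nonvanishing[OF rat cont])
      fix z assume "z \<in> upper_half_plane"
      then have "\<alpha> \<notin> set (\<mu>s z)" using \<mu>[of z] False by auto
      then show "(\<Prod>\<mu>\<leftarrow>\<mu>s z. \<mu> - \<alpha>) \<noteq> 0" by (auto simp: prod_list_zero_iff)
    qed
    then show ?thesis using False by simp
  qed (use cnt in simp)
  have A: "zero_count (\<lambda>z. \<Prod>\<mu>\<leftarrow>\<mu>s z. \<Prod>x\<in>#A. \<mu> - x) (size {#z \<in># A. 0 < Im z#} * e)" for A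
  proof (induction A)
    case empty
    show ?case using zero_count_const[of 1] by (simp add: prod_list_replicate map_replicate_const)
  next
    case (add x A)
    have "(\<Prod>\<mu>\<leftarrow>xs. \<Prod>x\<in>#add_mset x A. \<mu> - x) = (\<Prod>\<mu>\<leftarrow>xs. \<mu> - x) * (\<Prod>\<mu>\<leftarrow>xs. \<Prod>x\<in>#A. \<mu> - x)" for xs
      by (induction xs) (auto simp: algebra_simps)
    moreover have "size {#z \<in># add_mset x A. 0 < Im z#} * e = (if 0 < Im x then e else 0) + size {#z \<in># A. 0 < Im z#} * e"
      by simp
    ultimately show ?case using zero_count_mult[OF lin add] by simp
  qed
  have pol: "zero_count (\<lambda>z. \<Prod>\<mu>\<leftarrow>\<mu>s z. poly R \<mu>) (size {#z \<in># proots R. 0 < Im z#} * e)" if "R \<noteq> 0" for R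
  proof -
    have R: "poly R \<mu> = lead_coeff R * (\<Prod>x\<in>#proots R. \<mu> - x)" for \<mu>
    proof -
      have "poly (\<Prod>x\<in>#A. [:- x, 1:]) \<mu> = (\<Prod>x\<in>#A. \<mu> - x)" for A
        by (induction A) (auto simp: algebra_simps)
      then show ?thesis by (subst (1) complex_poly_decompose_multiset[symmetric]) (simp add: poly_smult)
    qed
    have "(\<Prod>\<mu>\<leftarrow>xs. poly R \<mu>) = lead_coeff R ^ length xs * (\<Prod>\<mu>\<leftarrow>xs. \<Prod>x\<in>#proots R. \<mu> - x)" for xs
      by (induction xs) (auto simp: R algebra_simps)
    then have eq: "lead_coeff R ^ n * (\<Prod>\<mu>\<leftarrow>\<mu>s z. \<Prod>x\<in>#proots R. \<mu> - x) = (\<Prod>\<mu>\<leftarrow>\<mu>s z. poly R \<mu>)"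
      if "z \<in> upper_half_plane" for z using \<mu>[OF that] by simp
    have "lead_coeff R ^ n \<noteq> 0" using that by simp
    then show ?thesis
      using zero_count_cong[OF eq zero_count_mult[OF zero_count_const A]] by simp
  qed
  have "{#z \<in># proots Q. 0 < Im z#} = {#}" using P(2) Q0 by (auto simp: filter_mset_eq_mempty_iff)
  then have "zero_count (\<lambda>z. 1 / (\<Prod>\<mu>\<leftarrow>\<mu>s z. poly Q \<mu>)) 0"
    using pol[OF Q0] by (intro zero_count_inverse) (simp only: size_empty mult_zero_left)
  then have "zero_count (\<lambda>z. (\<Prod>\<mu>\<leftarrow>\<mu>s z. poly P \<mu>) * (1 / (\<Prod>\<mu>\<leftarrow>\<mu>s z. poly Q \<mu>))) (d * e)"
    using zero_count_mult[OF pol[OF P(1)], of _ 0] by (simp only: P(3) add_0_right)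
  moreover have "(\<Prod>\<mu>\<leftarrow>\<mu>s z. poly P \<mu>) * (1 / (\<Prod>\<mu>\<leftarrow>\<mu>s z. poly Q \<mu>)) = (\<Prod>\<mu>\<leftarrow>\<mu>s z. h \<mu>)"
    if "z \<in> upper_half_plane" for z
  proof -
    have "(\<Prod>\<mu>\<leftarrow>\<mu>s z. h \<mu>) = (\<Prod>\<mu>\<leftarrow>\<mu>s z. poly P \<mu> / poly Q \<mu>)"
      using \<mu>[OF that] P(2) by (intro arg_cong[where f = prod_list] map_cong) auto
    moreover have "(\<Prod>\<mu>\<leftarrow>xs. poly P \<mu> / poly Q \<mu>) = (\<Prod>\<mu>\<leftarrow>xs. poly P \<mu>) / (\<Prod>\<mu>\<leftarrow>xs. poly Q \<mu>)" for xs
      by (induction xs) auto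
    ultimately show ?thesis by simp
  qed
  ultimately show ?thesis by (rule zero_count_cong[rotated])
qed

no_notation fps_nth (infixl \<open>$\<close> 75)

subsection \<open>Rational Pick functions from rational entries\<close>

definition quad_form :: "nat \<Rightarrow> complex mat \<Rightarrow> complex vec \<Rightarrow> complex" where
  "quad_form n A v = (\<Sum>i<n. \<Sum>j<n. A $$ (i, j) * v $ j * cnj (v $ i))"

lemma mult_mat_vec_index_sum:
  assumes "A \<in> carrier_mat nr n" "v \<in> carrier_vec n" "i < nr"
  shows "(A *\<^sub>v v) $ i = (\<Sum>j<n. A $$ (i, j) * v $ j)"
  using assms by (auto simp: scalar_prod_def atLeast0LessThan intro!: sum.cong)

lemma mult_mat_index_sum:
  assumes "A \<in> carrier_mat nr n" "B \<in> carrier_mat n nc" "i < nr" "j < nc"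
  shows "(A * B) $$ (i, j) = (\<Sum>k<n. A $$ (i, k) * B $$ (k, j))"
  using assms by (auto simp: scalar_prod_def atLeast0LessThan intro!: sum.cong)

lemma cscalar_prod_sum:
  fixes v w :: "complex vec"
  assumes "w \<in> carrier_vec n"
  shows "v \<bullet>c w = (\<Sum>i<n. v $ i * cnj (w $ i))"
  using assms by (auto simp: scalar_prod_def atLeast0LessThan intro!: sum.cong)

lemma cscalar_prod_quad_form:
  assumes "A \<in> carrier_mat n n" "v \<in> carrier_vec n"
  shows "(A *\<^sub>v v) \<bullet>c v = quad_form n A v"
  unfolding quad_form_def cscalar_prod_sum[OF assms(2)]
  by (intro sum.cong refl, subst mult_mat_vec_index_sum[OF assms]) (auto simp: sum_distrib_right)

lemma mat_adjoint_dim [simp]: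
  "dim_row (mat_adjoint A) = dim_col A" "dim_col (mat_adjoint A) = dim_row A"
  by (auto simp: mat_adjoint_def)

lemma mat_adjoint_carrier: "A \<in> carrier_mat nr nc \<Longrightarrow> mat_adjoint A \<in> carrier_mat nc nr"
  by (intro carrier_matI) (simp_all only: mat_adjoint_dim carrier_matD)

lemma mat_adjoint_index [simp]:
  fixes A :: "complex mat"
  assumes "i < dim_col A" "j < dim_row A"
  shows "mat_adjoint A $$ (i, j) = cnj (A $$ (j, i))"
  using assms by (simp add: mat_adjoint_def mat_of_rows_def)

lemma self_adjoint_iff:
  "self_adjoint n A \<longleftrightarrow> A \<in> carrier_mat n n \<and> (\<forall>i<n. \<forall>j<n. A $$ (i, j) = cnj (A $$ (j, i)))"
proof
  assume "self_adjoint n A"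
  then have A: "A \<in> carrier_mat n n" "mat_adjoint A = A" by (auto simp: self_adjoint_def)
  have "A $$ (i, j) = cnj (A $$ (j, i))" if "i < n" "j < n" for i j
  proof -
    have "mat_adjoint A $$ (i, j) = cnj (A $$ (j, i))" using A(1) that by (intro mat_adjoint_index) auto
    then show ?thesis unfolding A(2) .
  qed
  then show "A \<in> carrier_mat n n \<and> (\<forall>i<n. \<forall>j<n. A $$ (i, j) = cnj (A $$ (j, i)))"
    using A(1) by blast
next
  assume A: "A \<in> carrier_mat n n \<and> (\<forall>i<n. \<forall>j<n. A $$ (i, j) = cnj (A $$ (j, i)))"
  then have c: "A \<in> carrier_mat n n" by blast
  have "mat_adjoint A = A"
  proof (rule eq_matI)
    fix i j assume "i < dim_row A" "j < dim_col A"
    then have ij: "i < n" "j < n" using c by auto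
    have "mat_adjoint A $$ (i, j) = cnj (A $$ (j, i))" using c ij by (intro mat_adjoint_index) auto
    also have "\<dots> = A $$ (i, j)" using A ij by metis
    finally show "mat_adjoint A $$ (i, j) = A $$ (i, j)" .
  qed (use c in auto)
  then show "self_adjoint n A" using A by (simp add: self_adjoint_def)
qed

lemma quad_form_adjoint:
  assumes "A \<in> carrier_mat n n"
  shows "quad_form n (mat_adjoint A) v = cnj (quad_form n A v)"
proof -
  have "quad_form n (mat_adjoint A) v = (\<Sum>i<n. \<Sum>j<n. cnj (A $$ (j, i)) * v $ j * cnj (v $ i))"
    using assms unfolding quad_form_def by (intro sum.cong) auto
  also have "\<dots> = (\<Sum>j<n. \<Sum>i<n. cnj (A $$ (j, i)) * v $ j * cnj (v $ i))" by (rule sum.swap)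
  also have "\<dots> = cnj (quad_form n A v)" by (simp add: quad_form_def mult_ac)
  finally show ?thesis .
qed

lemma quad_form_self_adjoint:
  assumes "self_adjoint n A"
  shows "Im (quad_form n A v) = 0"
proof -
  have "cnj (quad_form n A v) = quad_form n A v"
    using quad_form_adjoint[of A n v] assms by (simp add: self_adjoint_def)
  then show ?thesis by (simp add: complex_eq_iff)
qed

lemma psd_Im_part_iff:
  assumes F: "F \<in> carrier_mat n n"
  shows "psd n ((1 / (2 * \<i>)) \<cdot>\<^sub>m (F - mat_adjoint F)) \<longleftrightarrow> (\<forall>v\<in>carrier_vec n. 0 \<le> Im (quad_form n F v))"
proof -
  let ?G = "(1 / (2 * \<i>)) \<cdot>\<^sub>m (F - mat_adjoint F)"
  have F': "mat_adjoint F \<in> carrier_mat n n" using F by (rule mat_adjoint_carrier)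
  then have G: "?G \<in> carrier_mat n n" by (intro smult_carrier_mat minus_carrier_mat)
  have "(?G *\<^sub>v v) \<bullet>c v = of_real (Im (quad_form n F v))" if v: "v \<in> carrier_vec n" for v
  proof -
    have "(?G *\<^sub>v v) \<bullet>c v = (\<Sum>i<n. \<Sum>j<n. 1 / (2 * \<i>) * (F $$ (i, j) * v $ j * cnj (v $ i) - mat_adjoint F $$ (i, j) * v $ j * cnj (v $ i)))"
      unfolding cscalar_prod_quad_form[OF G v] quad_form_def
    proof (intro sum.cong refl)
      fix i j assume "i \<in> {..<n}" "j \<in> {..<n}"
      then have e: "?G $$ (i, j) = 1 / (2 * \<i>) * (F $$ (i, j) - mat_adjoint F $$ (i, j))"
        using F by simp
      show "?G $$ (i, j) * v $ j * cnj (v $ i)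
        = 1 / (2 * \<i>) * (F $$ (i, j) * v $ j * cnj (v $ i) - mat_adjoint F $$ (i, j) * v $ j * cnj (v $ i))"
        unfolding e by (simp only: left_diff_distrib mult.assoc right_diff_distrib)
    qed
    also have "\<dots> = 1 / (2 * \<i>) * (quad_form n F v - quad_form n (mat_adjoint F) v)"
      unfolding quad_form_def by (simp only: sum_distrib_left[symmetric] sum_subtractf)
    also have "\<dots> = of_real (Im (quad_form n F v))"
      unfolding quad_form_adjoint[OF F] by (simp add: complex_eq_iff)
    finally show ?thesis .
  qed
  then show ?thesis using G by (simp add: psd_def less_eq_complex_def)
qed

lemma psd_iff:
  "psd n A \<longleftrightarrow> A \<in> carrier_mat n n \<and>
     (\<forall>v\<in>carrier_vec n. 0 \<le> Re (quad_form n A v) \<and> Im (quad_form n A v) = 0)"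
  by (auto simp: psd_def cscalar_prod_quad_form less_eq_complex_def)

lemma Pick_R_iff:
  "F \<in> Pick_R n \<longleftrightarrow> holomorphic_mat n F \<and>
     (\<forall>z\<in>upper_half_plane. \<forall>v\<in>carrier_vec n. 0 \<le> Im (quad_form n (F z) v)) \<and>
     (AE x in lborel. \<exists>B. has_boundary_mat n F x B \<and> self_adjoint n B)"
proof -
  have "(\<forall>z\<in>upper_half_plane. psd n ((1 / (2 * \<i>)) \<cdot>\<^sub>m (F z - mat_adjoint (F z)))) \<longleftrightarrow>
     (\<forall>z\<in>upper_half_plane. \<forall>v\<in>carrier_vec n. 0 \<le> Im (quad_form n (F z) v))"
    if "holomorphic_mat n F"
    using that psd_Im_part_iff unfolding holomorphic_mat_def by blast
  then show ?thesis unfolding Pick_R_def by blast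
qed

lemma tendsto_quad_form:
  assumes "\<And>i j. i < n \<Longrightarrow> j < n \<Longrightarrow> ((\<lambda>t. A t $$ (i, j)) \<longlongrightarrow> B $$ (i, j)) F"
  shows "((\<lambda>t. quad_form n (A t) v) \<longlongrightarrow> quad_form n B v) F"
  unfolding quad_form_def using assms by (intro tendsto_sum tendsto_mult tendsto_const) auto

lemma Pick_R_quad_form_simple_poles:
  assumes F: "F \<in> Pick_R n"
    and rat: "\<And>i j. i < n \<Longrightarrow> j < n \<Longrightarrow> rational_on_uhp (\<lambda>z. F z $$ (i, j))"
    and v: "v \<in> carrier_vec n"
  shows "real_simple_poles (\<lambda>z. quad_form n (F z) v)"
proof (rule real_simple_poles_of_rational_Pick)
  have hol: "\<And>i j. i < n \<Longrightarrow> j < n \<Longrightarrow> continuous_on upper_half_plane (\<lambda>z. F z $$ (i, j))"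
    using F by (auto simp: Pick_R_iff holomorphic_mat_def intro: holomorphic_on_imp_continuous_on)
  show "rational_on_uhp (\<lambda>z. quad_form n (F z) v)" unfolding quad_form_def
    by (intro rational_on_uhp_sum rational_on_uhp_mult rational_on_uhp_const rat) auto
  show "continuous_on upper_half_plane (\<lambda>z. quad_form n (F z) v)" unfolding quad_form_def
    by (intro continuous_intros hol) auto
  show "0 \<le> Im (quad_form n (F z) v)" if "z \<in> upper_half_plane" for z
    using F that v by (auto simp: Pick_R_iff)
  show "real_boundary (\<lambda>z. quad_form n (F z) v)"
  proof -
    have "AE x in lborel. \<exists>B. has_boundary_mat n F x B \<and> self_adjoint n B" using F by (simp add: Pick_R_iff)
    then show ?thesis unfolding real_boundary_def
    proof eventually_elim
      case (elim x)
      then obtain B where B: "has_boundary_mat n F x B" "self_adjoint n B" by blast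
      have "((\<lambda>\<epsilon>. quad_form n (F (Complex x \<epsilon>)) v) \<longlongrightarrow> quad_form n B v) (at_right 0)"
        using B(1) by (intro tendsto_quad_form) (auto simp: has_boundary_mat_def)
      moreover have "quad_form n B v = of_real (Re (quad_form n B v))"
        using quad_form_self_adjoint[OF B(2)] by (simp add: complex_eq_iff)
      ultimately show ?case by metis
    qed
  qed
qed

text \<open>Polarization: a sesquilinear form is determined by its quadratic form. It carries
  results on the scalar functions \<open>quad_form n (F z) v\<close>, which again have nonnegative
  imaginary part, over to single matrix entries.\<close>

lemma quad_form_polarization:
  assumes "i < n" "j < n"
  shows "A $$ (i, j) = (1/2) * (quad_form n A (unit_vec n i + unit_vec n j)
      - \<i> * quad_form n A (unit_vec n i + \<i> \<cdot>\<^sub>v unit_vec n j))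
      + ((\<i> - 1) / 2) * (quad_form n A (unit_vec n i) + quad_form n A (unit_vec n j))"
proof -
  have q: "quad_form n A (s \<cdot>\<^sub>v unit_vec n i + t \<cdot>\<^sub>v unit_vec n j)
    = A $$ (i, i) * s * cnj s + A $$ (i, j) * t * cnj s + A $$ (j, i) * s * cnj t + A $$ (j, j) * t * cnj t" for s t
  proof -
    have e: "(s \<cdot>\<^sub>v unit_vec n i + t \<cdot>\<^sub>v unit_vec n j) $ b = (if b = i then s else 0) + (if b = j then t else 0)"
      if "b < n" for b using that assms by auto
    have "quad_form n A (s \<cdot>\<^sub>v unit_vec n i + t \<cdot>\<^sub>v unit_vec n j)
      = (\<Sum>a<n. \<Sum>b<n. A $$ (a, b) * ((if b = i then s else 0) + (if b = j then t else 0))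
          * (cnj (if a = i then s else 0) + cnj (if a = j then t else 0)))"
      unfolding quad_form_def by (intro sum.cong refl) (simp only: e complex_cnj_add lessThan_iff)
    also have "\<dots> = (\<Sum>a<n. (A $$ (a, i) * s + A $$ (a, j) * t) * (cnj (if a = i then s else 0) + cnj (if a = j then t else 0)))"
      using assms by (simp only: sum_distrib_right[symmetric] distrib_left sum.distrib) (simp add: sum.delta' if_distrib cong: if_cong)
    also have "\<dots> = (A $$ (i, i) * s + A $$ (i, j) * t) * cnj s + (A $$ (j, i) * s + A $$ (j, j) * t) * cnj t"
      using assms by (simp only: distrib_left sum.distrib) (simp add: if_distrib cong: if_cong)
    finally show ?thesis by (simp add: algebra_simps)
  qed
  have u: "1 \<cdot>\<^sub>v unit_vec n k = (unit_vec n k :: complex vec)" "unit_vec n k + 0 \<cdot>\<^sub>v unit_vec n j = (unit_vec n k :: complex vec)" for k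
    by auto
  have "quad_form n A (unit_vec n j) = quad_form n A (0 \<cdot>\<^sub>v unit_vec n i + 1 \<cdot>\<^sub>v unit_vec n j)"
    by (rule arg_cong[where f = "quad_form n A"]) auto
  then have qj: "quad_form n A (unit_vec n j) = A $$ (j, j)" unfolding q by simp
  have q1: "quad_form n A (unit_vec n i + unit_vec n j) = A $$ (i, i) + A $$ (i, j) + A $$ (j, i) + A $$ (j, j)"
    and qi: "quad_form n A (unit_vec n i) = A $$ (i, i)"
    and q2: "quad_form n A (unit_vec n i + \<i> \<cdot>\<^sub>v unit_vec n j) = A $$ (i, i) + A $$ (i, j) * \<i> - A $$ (j, i) * \<i> + A $$ (j, j)"
    using q[of 1 1] q[of 1 0] q[of 1 \<i>] by (simp_all add: u mult.assoc)
  show ?thesis unfolding q1 qi q2 qj by (simp add: field_simps)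
qed

lemma real_simple_poles_uniform:
  assumes "finite I" "\<And>i. i \<in> I \<Longrightarrow> real_simple_poles (h i)"
  shows "\<exists>S::real set. \<exists>c d a. finite S \<and>
     (\<forall>i\<in>I. \<forall>z\<in>upper_half_plane. h i z = c i + d i * z + (\<Sum>l\<in>S. a i l / (of_real l - z)))"
proof -
  have "\<forall>i\<in>I. \<exists>S::real set. \<exists>c d a. finite S \<and>
     (\<forall>z\<in>upper_half_plane. h i z = c + d * z + (\<Sum>l\<in>S. a l / (of_real l - z)))"
    using assms(2) by (simp add: real_simple_poles_def)
  from bchoice[OF this] obtain S :: "_ \<Rightarrow> real set" where "\<forall>i\<in>I. \<exists>c d a. finite (S i) \<and>
     (\<forall>z\<in>upper_half_plane. h i z = c + d * z + (\<Sum>l\<in>S i. a l / (of_real l - z)))" by blast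
  from bchoice[OF this] obtain c where "\<forall>i\<in>I. \<exists>d a. finite (S i) \<and>
     (\<forall>z\<in>upper_half_plane. h i z = c i + d * z + (\<Sum>l\<in>S i. a l / (of_real l - z)))" by blast
  from bchoice[OF this] obtain d where "\<forall>i\<in>I. \<exists>a. finite (S i) \<and>
     (\<forall>z\<in>upper_half_plane. h i z = c i + d i * z + (\<Sum>l\<in>S i. a l / (of_real l - z)))" by blast
  from bchoice[OF this] obtain a where S: "\<And>i. i \<in> I \<Longrightarrow> finite (S i)"
      "\<And>i z. i \<in> I \<Longrightarrow> z \<in> upper_half_plane \<Longrightarrow> h i z = c i + d i * z + (\<Sum>l\<in>S i. a i l / (of_real l - z))"
    by blast
  let ?S = "\<Union>i\<in>I. S i"
  let ?a = "\<lambda>i l. if l \<in> S i then a i l else 0"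
  have fin: "finite ?S" using assms(1) S(1) by auto
  have "(\<Sum>l\<in>S i. a i l / (of_real l - z)) = (\<Sum>l\<in>?S. ?a i l / (of_real l - z))" if "i \<in> I" for i z
    using fin that by (intro sum.mono_neutral_cong_left) auto
  then have "\<forall>i\<in>I. \<forall>z\<in>upper_half_plane. h i z = c i + d i * z + (\<Sum>l\<in>?S. ?a i l / (of_real l - z))"
    using S(2) by simp
  then show ?thesis
    by (intro exI[of _ ?S] exI[of _ "\<lambda>i. c i"] exI[of _ ?a] exI[of _ "\<lambda>i. d i"] conjI fin)
qed

text \<open>Clearing denominators gives a polynomial with infinitely many roots, hence zero. At a
  point of \<open>S\<close> all summands but one vanish, which isolates the coefficient
  there.\<close>

lemma partial_fraction_zero:
  fixes S :: "real set" and a :: "real \<Rightarrow> complex"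
  assumes S: "finite S" and inf: "infinite X"
    and eq: "\<And>x::real. x \<in> X \<Longrightarrow> x \<notin> S \<Longrightarrow> c + d * of_real x + (\<Sum>l\<in>S. a l / (of_real l - of_real x)) = 0"
  shows "c = 0 \<and> d = 0 \<and> (\<forall>l\<in>S. a l = 0)"
proof -
  define N where "N T = (\<Prod>l\<in>T. [:complex_of_real l, -1:])" for T :: "real set"
  have N: "poly (N T) (of_real x) = (\<Prod>l\<in>T. of_real l - of_real x)" for T x
    by (simp add: N_def poly_prod)
  define E where "E = [:c, d:] * N S + (\<Sum>l\<in>S. [:a l:] * N (S - {l}))"
  have X: "infinite (X - S)" using inf S by simp
  have "poly E (of_real x) = 0" if x: "x \<in> X - S" for x
  proof -
    have nz: "of_real l - complex_of_real x \<noteq> 0" if "l \<in> S" for l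
      using x that by (auto simp flip: of_real_diff)
    have "(\<Sum>l\<in>S. a l * poly (N (S - {l})) (of_real x)) = (\<Sum>l\<in>S. a l / (of_real l - of_real x)) * poly (N S) (of_real x)"
      unfolding sum_distrib_right
    proof (rule sum.cong[OF refl])
      fix l assume l: "l \<in> S"
      have "poly (N S) (of_real x) = (of_real l - of_real x) * poly (N (S - {l})) (of_real x)"
        unfolding N using S l by (rule prod.remove)
      then show "a l * poly (N (S - {l})) (of_real x) = a l / (of_real l - of_real x) * poly (N S) (of_real x)"
        using nz[OF l] by simp
    qed
    then have "poly E (of_real x) = (c + d * of_real x + (\<Sum>l\<in>S. a l / (of_real l - of_real x))) * poly (N S) (of_real x)"
      by (simp add: E_def poly_sum algebra_simps)
    then show ?thesis using eq[of x] x by simp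
  qed
  then have "complex_of_real ` (X - S) \<subseteq> {z. poly E z = 0}" by auto
  moreover have "infinite (complex_of_real ` (X - S))"
    using X by (simp add: finite_image_iff inj_on_def)
  ultimately have E0: "E = 0" using poly_roots_finite finite_subset by blast
  have a0: "a r = 0" if r: "r \<in> S" for r
  proof -
    have "(\<Sum>l\<in>S. a l * poly (N (S - {l})) (of_real r)) = a r * poly (N (S - {r})) (of_real r)"
    proof -
      have "poly (N (S - {l})) (of_real r) = 0" if "l \<noteq> r" for l
        unfolding N using S r that by (intro prod_zero) auto
      then show ?thesis using S r by (subst sum.remove[of S r]) auto
    qed
    moreover have "poly (N S) (of_real r) = 0" unfolding N using S r by (intro prod_zero) auto
    moreover have "poly E (of_real r) = 0" using E0 by simp
    ultimately have "a r * poly (N (S - {r})) (of_real r) = 0" by (simp add: E_def poly_sum)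
    moreover have "poly (N (S - {r})) (of_real r) \<noteq> 0" unfolding N using S by (auto simp flip: of_real_diff)
    ultimately show ?thesis by simp
  qed
  then have "E = [:c, d:] * N S" by (simp add: E_def)
  moreover have "N S \<noteq> 0" unfolding N_def using S by (simp add: prod_zero_iff)
  ultimately have "[:c, d:] = 0" using E0 by (metis mult_eq_0_iff)
  then show ?thesis using a0 by simp
qed

text \<open>Multiplying by \<open>y > 0\<close> preserves the sign of the imaginary part. Along
  \<open>z = \<i> / y\<close> the limit for \<open>y\<close> to 0 is \<open>\<i> * d\<close>, and
  along \<open>z = l + \<i> * y\<close> it is \<open>\<i> * a l\<close>.\<close>

lemma partial_fraction_nonneg:
  fixes S :: "real set" and a :: "real \<Rightarrow> complex"
  assumes S: "finite S"
    and nn: "\<And>z. z \<in> upper_half_plane \<Longrightarrow> 0 \<le> Im (c + d * z + (\<Sum>l\<in>S. a l / (of_real l - z)))"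
  shows "0 \<le> Re d" "l \<in> S \<Longrightarrow> 0 \<le> Re (a l)"
proof -
  have "((\<lambda>y::real. of_real y * c + \<i> * d + (\<Sum>l\<in>S. of_real y * (of_real y * a l) / (of_real y * of_real l - \<i>))) \<longlongrightarrow>
     of_real 0 * c + \<i> * d + (\<Sum>l\<in>S. of_real 0 * (of_real 0 * a l) / (of_real 0 * of_real l - \<i>))) (at_right 0)"
    by (intro tendsto_intros) auto
  then have "0 \<le> Im (of_real 0 * c + \<i> * d + (\<Sum>l\<in>S. of_real 0 * (of_real 0 * a l) / (of_real 0 * of_real l - \<i>)))"
  proof (rule Im_limit_nonneg)
    fix y :: real assume y: "0 < y"
    define z where "z = \<i> / of_real y"
    have zU: "z \<in> upper_half_plane" using y by (simp add: z_def)
    have 1: "of_real y * (of_real y * b) / (of_real y * of_real l - \<i>) = of_real y * (b / (of_real l - z))" for b l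
    proof -
      have "of_real y * of_real l - \<i> = of_real y * (of_real l - z)" using y by (simp add: z_def algebra_simps)
      then show ?thesis using y by simp
    qed
    have "\<i> = of_real y * z" using y by (simp add: z_def)
    then have "of_real y * c + \<i> * d + (\<Sum>l\<in>S. of_real y * (of_real y * a l) / (of_real y * of_real l - \<i>))
      = of_real y * (c + d * z + (\<Sum>l\<in>S. a l / (of_real l - z)))"
      unfolding 1 by (simp add: sum_distrib_left algebra_simps)
    then show "0 \<le> Im (of_real y * c + \<i> * d + (\<Sum>l\<in>S. of_real y * (of_real y * a l) / (of_real y * of_real l - \<i>)))"
      using nn[OF zU] y by simp
  qed
  then show "0 \<le> Re d" by simp
  assume l: "l \<in> S"
  define z where "z y = of_real l + \<i> * of_real y" for y :: real
  define f where "f y = of_real y * (c + d * z y) + \<i> * a l + (\<Sum>k\<in>S - {l}. of_real y * a k / (of_real k - z y))" for y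
  have "k \<noteq> l \<Longrightarrow> of_real k - z 0 \<noteq> 0" for k by (auto simp: z_def simp flip: of_real_diff)
  moreover have "(z \<longlongrightarrow> z 0) (at_right 0)" unfolding z_def by (intro tendsto_intros)
  ultimately have "(f \<longlongrightarrow> of_real 0 * (c + d * z 0) + \<i> * a l + (\<Sum>k\<in>S - {l}. of_real 0 * a k / (of_real k - z 0))) (at_right 0)"
    unfolding f_def by (intro tendsto_intros) auto
  then have "0 \<le> Im (of_real 0 * (c + d * z 0) + \<i> * a l + (\<Sum>k\<in>S - {l}. of_real 0 * a k / (of_real k - z 0)))"
  proof (rule Im_limit_nonneg)
    fix y :: real assume y: "0 < y"
    have zU: "z y \<in> upper_half_plane" using y by (simp add: z_def)
    have "of_real y * (a l / (of_real l - z y)) = \<i> * a l" using y by (simp add: z_def field_simps)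
    then have "f y = of_real y * (c + d * z y + (\<Sum>l\<in>S. a l / (of_real l - z y)))"
      unfolding f_def using S l by (subst sum.remove[of S l]) (simp_all add: sum_distrib_left algebra_simps)
    then show "0 \<le> Im (f y)" using nn[OF zU] y by simp
  qed
  then show "0 \<le> Re (a l)" by simp
qed

text \<open>By polarization all entries have partial fractions with simple real poles, over one
  common pole set. The coefficient matrices are self-adjoint since the boundary values are, at
  infinitely many real points, and comparing the quadratic forms with
  \<open>partial_fraction_nonneg\<close> makes all of them except the constant term positive
  semidefinite.\<close>

theorem rational_Pick_of_rational_entries:
  assumes F: "F \<in> Pick_R n"
    and rat: "\<And>i j. i < n \<Longrightarrow> j < n \<Longrightarrow> rational_on_uhp (\<lambda>z. F z $$ (i, j))"
  shows "rational_Pick n F"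
proof -
  let ?I = "{..<n} \<times> {..<n}"
  have ent: "real_simple_poles (\<lambda>z. F z $$ p)" if p: "p \<in> ?I" for p
  proof -
    obtain i j where ij: "p = (i, j)" "i < n" "j < n" using p by auto
    have sp: "real_simple_poles (\<lambda>z. quad_form n (F z) v)" if "v \<in> carrier_vec n" for v
      using Pick_R_quad_form_simple_poles[OF F rat that] .
    have "real_simple_poles (\<lambda>z. 1 * ((1/2) * quad_form n (F z) (unit_vec n i + unit_vec n j)
        + (- \<i> / 2) * quad_form n (F z) (unit_vec n i + \<i> \<cdot>\<^sub>v unit_vec n j))
      + 1 * (((\<i> - 1) / 2) * quad_form n (F z) (unit_vec n i) + ((\<i> - 1) / 2) * quad_form n (F z) (unit_vec n j)))"
      by (intro real_simple_poles_combine sp) auto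
    moreover have "(\<lambda>z. 1 * ((1/2) * quad_form n (F z) (unit_vec n i + unit_vec n j)
        + (- \<i> / 2) * quad_form n (F z) (unit_vec n i + \<i> \<cdot>\<^sub>v unit_vec n j))
      + 1 * (((\<i> - 1) / 2) * quad_form n (F z) (unit_vec n i) + ((\<i> - 1) / 2) * quad_form n (F z) (unit_vec n j)))
      = (\<lambda>z. F z $$ p)"
      unfolding ij(1) quad_form_polarization[OF ij(2,3), of "F _"] by (rule ext) (simp add: field_simps)
    ultimately show ?thesis by simp
  qed
  obtain S :: "real set" and c d a where S: "finite S" and
    FS: "\<And>p z. p \<in> ?I \<Longrightarrow> z \<in> upper_half_plane \<Longrightarrow>
        F z $$ p = c p + d p * z + (\<Sum>l\<in>S. a p l / (of_real l - z))"
    using real_simple_poles_uniform[of ?I "\<lambda>p z. F z $$ p"] ent by auto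
  define C D where "C = mat n n c" and "D = mat n n d"
  define A where "A l = mat n n (\<lambda>p. a p l)" for l
  have carr: "C \<in> carrier_mat n n" "D \<in> carrier_mat n n" "A l \<in> carrier_mat n n" for l
    by (auto simp: C_def D_def A_def)
  define X where "X = {x::real. \<exists>B. has_boundary_mat n F x B \<and> self_adjoint n B}"
  have infX: "infinite X"
    unfolding X_def using F by (intro AE_lborel_infinite) (simp add: Pick_R_iff)
  have herm: "c (i, j) = cnj (c (j, i)) \<and> d (i, j) = cnj (d (j, i)) \<and> (\<forall>l\<in>S. a (i, j) l = cnj (a (j, i) l))"
    if ij: "i < n" "j < n" for i j
  proof -
    have "c (i, j) - cnj (c (j, i)) = 0 \<and> d (i, j) - cnj (d (j, i)) = 0 \<and>
        (\<forall>l\<in>S. a (i, j) l - cnj (a (j, i) l) = 0)"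
    proof (rule partial_fraction_zero[OF S infX])
      fix x assume x: "x \<in> X" "x \<notin> S"
      then obtain B where B: "has_boundary_mat n F x B" "self_adjoint n B" by (auto simp: X_def)
      have Bpq: "B $$ (p, q) = c (p, q) + d (p, q) * of_real x + (\<Sum>l\<in>S. a (p, q) l / (of_real l - of_real x))"
        if pq: "p < n" "q < n" for p q
      proof -
        have nz: "of_real l - complex_of_real x \<noteq> 0" if "l \<in> S" for l
          using x that by (auto simp flip: of_real_diff)
        have "((\<lambda>\<epsilon>. c (p, q) + d (p, q) * Complex x \<epsilon> + (\<Sum>l\<in>S. a (p, q) l / (of_real l - Complex x \<epsilon>))) \<longlongrightarrow>
           c (p, q) + d (p, q) * of_real x + (\<Sum>l\<in>S. a (p, q) l / (of_real l - of_real x))) (at_right 0)"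
          using nz by (intro tendsto_intros tendsto_Complex_at_right)
        moreover have "eventually (\<lambda>\<epsilon>. c (p, q) + d (p, q) * Complex x \<epsilon> + (\<Sum>l\<in>S. a (p, q) l / (of_real l - Complex x \<epsilon>))
            = F (Complex x \<epsilon>) $$ (p, q)) (at_right 0)"
          using eventually_at_right_less[of 0] by eventually_elim (use FS[of "(p, q)"] pq in auto)
        ultimately have "((\<lambda>\<epsilon>. F (Complex x \<epsilon>) $$ (p, q)) \<longlongrightarrow>
           c (p, q) + d (p, q) * of_real x + (\<Sum>l\<in>S. a (p, q) l / (of_real l - of_real x))) (at_right 0)"
          by (rule Lim_transform_eventually)
        moreover have "((\<lambda>\<epsilon>. F (Complex x \<epsilon>) $$ (p, q)) \<longlongrightarrow> B $$ (p, q)) (at_right 0)"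
          using B(1) pq by (simp add: has_boundary_mat_def)
        ultimately show ?thesis using tendsto_unique trivial_limit_at_right_real by blast
      qed
      have "B $$ (i, j) = cnj (B $$ (j, i))" using B(2) ij unfolding self_adjoint_iff by blast
      then have 1: "c (i, j) + d (i, j) * of_real x + (\<Sum>l\<in>S. a (i, j) l / (of_real l - of_real x))
          = cnj (c (j, i)) + cnj (d (j, i)) * of_real x + (\<Sum>l\<in>S. cnj (a (j, i) l) / (of_real l - of_real x))"
        unfolding Bpq[OF ij] Bpq[OF ij(2,1)] by (simp add: cnj_sum)
      have 2: "(\<Sum>l\<in>S. (a (i, j) l - cnj (a (j, i) l)) / (of_real l - of_real x))
          = (\<Sum>l\<in>S. a (i, j) l / (of_real l - of_real x)) - (\<Sum>l\<in>S. cnj (a (j, i) l) / (of_real l - of_real x))"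
        by (simp only: diff_divide_distrib sum_subtractf)
      show "c (i, j) - cnj (c (j, i)) + (d (i, j) - cnj (d (j, i))) * of_real x
          + (\<Sum>l\<in>S. (a (i, j) l - cnj (a (j, i) l)) / (of_real l - of_real x)) = 0"
        unfolding 2 left_diff_distrib using 1 by (simp only: algebra_simps) (simp add: algebra_simps)
    qed
    then show ?thesis by simp
  qed
  have sa: "self_adjoint n C" "self_adjoint n D" "\<And>l. l \<in> S \<Longrightarrow> self_adjoint n (A l)"
  proof -
    have h: "C $$ (i, j) = cnj (C $$ (j, i))" "D $$ (i, j) = cnj (D $$ (j, i))"
      "l \<in> S \<Longrightarrow> A l $$ (i, j) = cnj (A l $$ (j, i))" if ij: "i < n" "j < n" for i j l
      unfolding C_def D_def A_def using herm[OF ij] ij by (simp_all only: index_mat prod.case)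
    show "self_adjoint n C" unfolding self_adjoint_iff using carr(1) h(1) by blast
    show "self_adjoint n D" unfolding self_adjoint_iff using carr(2) h(2) by blast
    show "self_adjoint n (A l)" if "l \<in> S" for l unfolding self_adjoint_iff using carr(3) h(3) that by blast
  qed
  have qf: "quad_form n (F z) v = quad_form n C v + quad_form n D v * z + (\<Sum>l\<in>S. quad_form n (A l) v / (of_real l - z))"
    if z: "z \<in> upper_half_plane" for z v
  proof -
    have "quad_form n (F z) v = (\<Sum>i<n. \<Sum>j<n. (c (i, j) * v $ j * cnj (v $ i) + (d (i, j) * v $ j * cnj (v $ i)) * z)
        + (\<Sum>l\<in>S. (a (i, j) l * v $ j * cnj (v $ i)) / (of_real l - z)))"
      unfolding quad_form_def
    proof (intro sum.cong refl)
      fix i j assume "i \<in> {..<n}" "j \<in> {..<n}"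
      then have "F z $$ (i, j) = c (i, j) + d (i, j) * z + (\<Sum>l\<in>S. a (i, j) l / (of_real l - z))"
        using FS[of "(i, j)"] z by auto
      then show "F z $$ (i, j) * v $ j * cnj (v $ i) = (c (i, j) * v $ j * cnj (v $ i) + (d (i, j) * v $ j * cnj (v $ i)) * z)
        + (\<Sum>l\<in>S. (a (i, j) l * v $ j * cnj (v $ i)) / (of_real l - z))"
        by (simp add: algebra_simps sum_distrib_left)
    qed
    also have "\<dots> = (\<Sum>i<n. \<Sum>j<n. c (i, j) * v $ j * cnj (v $ i)) + (\<Sum>i<n. \<Sum>j<n. d (i, j) * v $ j * cnj (v $ i)) * z
        + (\<Sum>i<n. \<Sum>j<n. \<Sum>l\<in>S. (a (i, j) l * v $ j * cnj (v $ i)) / (of_real l - z))"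
      by (simp only: sum.distrib sum_distrib_right)
    also have "(\<Sum>i<n. \<Sum>j<n. \<Sum>l\<in>S. (a (i, j) l * v $ j * cnj (v $ i)) / (of_real l - z))
       = (\<Sum>i<n. \<Sum>l\<in>S. \<Sum>j<n. (a (i, j) l * v $ j * cnj (v $ i)) / (of_real l - z))"
      by (intro sum.cong refl sum.swap)
    also have "\<dots> = (\<Sum>l\<in>S. \<Sum>i<n. \<Sum>j<n. (a (i, j) l * v $ j * cnj (v $ i)) / (of_real l - z))"
      by (rule sum.swap)
    also have "(\<Sum>i<n. \<Sum>j<n. c (i, j) * v $ j * cnj (v $ i)) = quad_form n C v"
      by (simp add: quad_form_def C_def)
    also have "(\<Sum>i<n. \<Sum>j<n. d (i, j) * v $ j * cnj (v $ i)) = quad_form n D v"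
      by (simp add: quad_form_def D_def)
    also have "(\<Sum>l\<in>S. \<Sum>i<n. \<Sum>j<n. (a (i, j) l * v $ j * cnj (v $ i)) / (of_real l - z))
        = (\<Sum>l\<in>S. quad_form n (A l) v / (of_real l - z))"
      by (simp add: quad_form_def A_def sum_divide_distrib)
    finally show ?thesis .
  qed
  have nn: "0 \<le> Im (quad_form n C v + quad_form n D v * z + (\<Sum>l\<in>S. quad_form n (A l) v / (of_real l - z)))"
    if "v \<in> carrier_vec n" "z \<in> upper_half_plane" for v z
    using F that unfolding qf[OF that(2), symmetric] by (simp add: Pick_R_iff)
  have psdD: "psd n D" "\<And>l. l \<in> S \<Longrightarrow> psd n (A l)"
    using carr sa quad_form_self_adjoint partial_fraction_nonneg[OF S nn] by (auto simp: psd_iff)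
  obtain l where l: "bij_betw l {1..card S} S" using ex_bij_betw_nat_finite_1[OF S] by blast
  have "rational_rep n F C D (card S) l (\<lambda>k. A (l k))"
    unfolding rational_rep_def
  proof (intro conjI ballI allI impI)
    show "self_adjoint n C" "psd n D" by (fact sa psdD)+
    show "psd n (A (l k))" if "k \<in> {1..card S}" for k using psdD(2) bij_betwE[OF l] that by blast
    show "inj_on l {1..card S}" using l by (simp add: bij_betw_def)
    fix z i j assume z: "z \<in> upper_half_plane" and ij: "i < n" "j < n"
    have "(\<Sum>k=1..card S. 1 / (of_real (l k) - z) * A (l k) $$ (i, j)) = (\<Sum>r\<in>S. 1 / (of_real r - z) * A r $$ (i, j))"
      by (rule sum.reindex_bij_betw[OF l])
    also have "\<dots> = (\<Sum>r\<in>S. a (i, j) r / (of_real r - z))" using ij by (simp add: A_def)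
    finally show "F z $$ (i, j) = C $$ (i, j) + z * D $$ (i, j) + (\<Sum>k=1..card S. 1 / (of_real (l k) - z) * A (l k) $$ (i, j))"
      using FS[of "(i, j)" z] ij z by (simp add: C_def D_def)
  qed
  then show ?thesis unfolding rational_Pick_def by blast
qed

subsection \<open>Rank factorisation of positive semidefinite matrices\<close>

lemma quad_form_add_unit:
  assumes j: "j < n" and v: "v \<in> carrier_vec n"
  shows "quad_form n A (v + t \<cdot>\<^sub>v unit_vec n j) = quad_form n A v + t * (\<Sum>p<n. A $$ (p, j) * cnj (v $ p))
     + cnj t * (\<Sum>q<n. A $$ (j, q) * v $ q) + t * cnj t * A $$ (j, j)"
proof -
  have e: "(v + t \<cdot>\<^sub>v unit_vec n j) $ b = v $ b + (if b = j then t else 0)" if "b < n" for b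
    using that v j by auto
  have "quad_form n A (v + t \<cdot>\<^sub>v unit_vec n j)
    = (\<Sum>a<n. \<Sum>b<n. A $$ (a, b) * (v $ b + (if b = j then t else 0)) * (cnj (v $ a) + cnj (if a = j then t else 0)))"
    unfolding quad_form_def by (intro sum.cong refl) (simp only: e complex_cnj_add lessThan_iff)
  also have "\<dots> = (\<Sum>a<n. ((\<Sum>b<n. A $$ (a, b) * v $ b) + A $$ (a, j) * t) * (cnj (v $ a) + cnj (if a = j then t else 0)))"
    using j by (simp only: sum_distrib_right[symmetric] distrib_left sum.distrib) (simp add: if_distrib cong: if_cong)
  also have "\<dots> = (\<Sum>a<n. (\<Sum>b<n. A $$ (a, b) * v $ b) * cnj (v $ a)) + (\<Sum>a<n. A $$ (a, j) * t * cnj (v $ a))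
      + ((\<Sum>b<n. A $$ (j, b) * v $ b) * cnj t + A $$ (j, j) * t * cnj t)"
    using j by (simp only: distrib_left distrib_right sum.distrib) (simp add: if_distrib cong: if_cong)
  finally show ?thesis
    by (simp add: quad_form_def sum_distrib_left sum_distrib_right mult_ac)
qed

lemma quad_form_unit:
  assumes "j < n"
  shows "quad_form n A (unit_vec n j) = A $$ (j, j)"
proof -
  have "unit_vec n j = 0\<^sub>v n + 1 \<cdot>\<^sub>v (unit_vec n j :: complex vec)" by auto
  then have "quad_form n A (unit_vec n j) = quad_form n A (0\<^sub>v n + 1 \<cdot>\<^sub>v unit_vec n j)" by simp
  also have "\<dots> = A $$ (j, j)"
    by (subst quad_form_add_unit[OF assms]) (simp_all add: quad_form_def)
  finally show ?thesis .
qed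

lemma psd_imp_self_adjoint:
  assumes "psd n A"
  shows "self_adjoint n A"
proof -
  have A: "A \<in> carrier_mat n n" using assms by (simp add: psd_iff)
  have q: "quad_form n (mat_adjoint A) v = quad_form n A v" if "v \<in> carrier_vec n" for v
    using assms that unfolding quad_form_adjoint[OF A] by (simp add: psd_iff complex_eq_iff)
  have "A $$ (i, j) = cnj (A $$ (j, i))" if "i < n" "j < n" for i j
  proof -
    have "A $$ (i, j) = mat_adjoint A $$ (i, j)"
      unfolding quad_form_polarization[OF that] by (simp add: q)
    also have "\<dots> = cnj (A $$ (j, i))" using A that by (intro mat_adjoint_index) auto
    finally show ?thesis .
  qed
  then show ?thesis using A unfolding self_adjoint_iff by blast
qed

text \<open>With a zero diagonal entry the quadratic form is real-affine in \<open>t\<close> along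
  \<open>unit_vec n p + t * unit_vec n j\<close>; an affine function bounded below on a whole line
  is constant, so the off-diagonal coefficient vanishes.\<close>

lemma psd_zero_diagonal:
  assumes psd: "psd n A" and jp: "j < n" "p < n" and z: "A $$ (j, j) = 0"
  shows "A $$ (p, j) = 0" "A $$ (j, p) = 0"
proof -
  have h: "A $$ (j, p) = cnj (A $$ (p, j))"
    using psd_imp_self_adjoint[OF psd] jp unfolding self_adjoint_iff by blast
  show *: "A $$ (p, j) = 0"
  proof (rule ccontr)
    assume nz: "A $$ (p, j) \<noteq> 0"
    define a where "a = (cmod (A $$ (p, j)))\<^sup>2"
    have a: "0 < a" using nz by (simp add: a_def)
    \<comment> \<open>Chosen so that the quadratic form takes the value -1.\<close>
    define K where "K = (Re (A $$ (p, p)) + 1) / (2 * a)"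
    define t where "t = - of_real K * cnj (A $$ (p, j))"
    have s: "(\<Sum>k<n. A $$ (k, j) * cnj (unit_vec n p $ k)) = A $$ (p, j)"
      "(\<Sum>k<n. A $$ (j, k) * unit_vec n p $ k) = A $$ (j, p)"
      using jp by (simp_all add: unit_vec_def if_distrib cong: if_cong)
    have q: "quad_form n A (unit_vec n p) = A $$ (p, p)"
      using jp(2) by (rule quad_form_unit)
    have "0 \<le> Re (quad_form n A (unit_vec n p + t \<cdot>\<^sub>v unit_vec n j))"
      using psd by (simp add: psd_iff)
    also have "quad_form n A (unit_vec n p + t \<cdot>\<^sub>v unit_vec n j)
        = A $$ (p, p) + t * A $$ (p, j) + cnj (t * A $$ (p, j))"
      by (subst quad_form_add_unit[OF jp(1)]) (simp_all add: s q z h)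
    also have "t * A $$ (p, j) = - of_real K * (A $$ (p, j) * cnj (A $$ (p, j)))" by (simp add: t_def)
    also have "\<dots> = - of_real (K * a)" by (simp only: a_def complex_norm_square[symmetric]) simp
    also have "K * a = (Re (A $$ (p, p)) + 1) / 2" using a by (simp add: K_def)
    finally show False by simp
  qed
  show "A $$ (j, p) = 0" using h * by simp
qed

text \<open>Independence of a list, not of its set of entries: a repeated vector counts as a
  dependence, so the length of the list is the rank.\<close>

definition lin_indep_list :: "nat \<Rightarrow> complex vec list \<Rightarrow> bool" where
  "lin_indep_list n bs \<longleftrightarrow> (\<forall>x. (\<forall>p<n. (\<Sum>i<length bs. x i * bs ! i $ p) = 0) \<longrightarrow> (\<forall>i<length bs. x i = 0))"

text \<open>Cholesky factorisation, skipping zero pivots.\<close>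

lemma psd_dyads_from:
  assumes "psd n A" "\<And>p q. p < n \<Longrightarrow> q < n \<Longrightarrow> p < j \<or> q < j \<Longrightarrow> A $$ (p, q) = 0"
  shows "\<exists>bs. set bs \<subseteq> carrier_vec n \<and> (\<forall>p<n. \<forall>q<n. A $$ (p, q) = (\<Sum>b\<leftarrow>bs. b $ p * cnj (b $ q))) \<and>
    (\<forall>b\<in>set bs. \<forall>p<n. p < j \<longrightarrow> b $ p = 0) \<and> lin_indep_list n bs"
  using assms
proof (induction "n - j" arbitrary: A j)
  case 0
  then show ?case by (intro exI[of _ "[]"]) (auto simp: lin_indep_list_def)
next
  case (Suc m)
  then have j: "j < n" "m = n - Suc j" by auto
  have A: "A \<in> carrier_mat n n" using Suc.prems by (simp add: psd_iff)
  have herm: "A $$ (p, q) = cnj (A $$ (q, p))" if "p < n" "q < n" for p q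
    using psd_imp_self_adjoint[OF Suc.prems(1)] that unfolding self_adjoint_iff by blast
  define d where "d = Re (A $$ (j, j))"
  have d: "A $$ (j, j) = of_real d" using herm[OF j(1) j(1)] by (simp add: d_def complex_eq_iff)
  have q: "quad_form n A (unit_vec n j) = A $$ (j, j)"
    using j(1) by (rule quad_form_unit)
  have d0: "0 \<le> d" using Suc.prems(1) q by (auto simp: psd_iff d_def dest!: bspec[of _ _ "unit_vec n j"])
  show ?case
  proof (cases "d = 0")
    case True
    have "A $$ (p, q) = 0" if "p < n" "q < n" "p < Suc j \<or> q < Suc j" for p q
      using Suc.prems(2)[OF that(1,2)] psd_zero_diagonal[OF Suc.prems(1) j(1)] that d True
      by (auto simp: less_Suc_eq)
    from Suc.hyps(1)[OF j(2) Suc.prems(1) this] obtain bs where "set bs \<subseteq> carrier_vec n"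
      "\<forall>p<n. \<forall>q<n. A $$ (p, q) = (\<Sum>b\<leftarrow>bs. b $ p * cnj (b $ q))"
      "\<forall>b\<in>set bs. \<forall>p<n. p < Suc j \<longrightarrow> b $ p = 0" "lin_indep_list n bs" by blast
    then show ?thesis by (intro exI[of _ bs]) auto
  next
    case False
    then have dpos: "0 < d" using d0 by simp
    \<comment> \<open>The pivot column divided by the square root of the pivot: its dyad agrees with
      \<open>A\<close> in row and column \<open>j\<close>, and subtracting it leaves the Schur
      complement.\<close>
    define b where "b = vec n (\<lambda>p. A $$ (p, j) / of_real (sqrt d))"
    have b: "b \<in> carrier_vec n" by (simp add: b_def)
    have sd: "complex_of_real (sqrt d) * of_real (sqrt d) = of_real d"
      using dpos by (metis of_real_mult real_sqrt_mult_self abs_of_pos)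
    have bb: "b $ p * cnj (b $ q) = A $$ (p, j) * A $$ (j, q) / of_real d" if "p < n" "q < n" for p q
      using that herm[OF j(1) that(2)] by (simp add: b_def sd)
    define A' where "A' = mat n n (\<lambda>(p, q). A $$ (p, q) - A $$ (p, j) * A $$ (j, q) / of_real d)"
    have A': "A' \<in> carrier_mat n n" by (simp add: A'_def)
    have "psd n A'"
    proof (unfold psd_iff, intro conjI ballI A')
      fix v :: "complex vec" assume v: "v \<in> carrier_vec n"
      define S where "S = (\<Sum>q<n. A $$ (j, q) * v $ q)"
      have S': "(\<Sum>p<n. A $$ (p, j) * cnj (v $ p)) = cnj S"
        unfolding S_def cnj_sum
      proof (rule sum.cong[OF refl])
        fix p assume "p \<in> {..<n}"
        then have "A $$ (p, j) = cnj (A $$ (j, p))" using herm j by blast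
        then show "A $$ (p, j) * cnj (v $ p) = cnj (A $$ (j, p) * v $ p)" by simp
      qed
      \<comment> \<open>The minimizer of the quadratic form of \<open>A\<close> along
        \<open>v + t * unit_vec n j\<close>. The Schur complement takes exactly this minimal value
        at \<open>v\<close>, so it is positive semidefinite.\<close>
      define t where "t = - S / of_real d"
      have "quad_form n A' v = (\<Sum>p<n. \<Sum>q<n. A $$ (p, q) * v $ q * cnj (v $ p) - (A $$ (p, j) * cnj (v $ p)) * (A $$ (j, q) * v $ q) / of_real d)"
        unfolding quad_form_def by (intro sum.cong refl) (simp add: A'_def algebra_simps diff_divide_distrib)
      also have "\<dots> = quad_form n A v - cnj S * S / of_real d"
        unfolding sum_subtractf sum_divide_distrib[symmetric] sum_product[symmetric] S' S_def[symmetric]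
        by (simp add: quad_form_def)
      also have "\<dots> = quad_form n A (v + t \<cdot>\<^sub>v unit_vec n j)"
        unfolding quad_form_add_unit[OF j(1) v] S' S_def[symmetric] d
        using dpos by (simp add: t_def field_simps)
      finally have eq: "quad_form n A' v = quad_form n A (v + t \<cdot>\<^sub>v unit_vec n j)" .
      have "v + t \<cdot>\<^sub>v unit_vec n j \<in> carrier_vec n" using v by simp
      then show "0 \<le> Re (quad_form n A' v)" "Im (quad_form n A' v) = 0"
        unfolding eq using Suc.prems(1) by (auto simp: psd_iff)
    qed
    moreover have "A' $$ (p, q) = 0" if "p < n" "q < n" "p < Suc j \<or> q < Suc j" for p q
    proof -
      have "(p < j \<or> q < j) \<or> p = j \<or> q = j" using that(3) by (auto simp: less_Suc_eq)
      then consider "p < j \<or> q < j" | "p = j" | "q = j" by blast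
      then show ?thesis
      proof cases
        case 1
        then show ?thesis using Suc.prems(2) that j by (auto simp: A'_def)
      next
        case 2
        show ?thesis unfolding 2 A'_def using j(1) that(2) dpos by (simp add: d)
      next
        case 3
        show ?thesis unfolding 3 A'_def using j(1) that(1) dpos by (simp add: d)
      qed
    qed
    ultimately obtain bs where bs: "set bs \<subseteq> carrier_vec n"
      "\<forall>p<n. \<forall>q<n. A' $$ (p, q) = (\<Sum>b\<leftarrow>bs. b $ p * cnj (b $ q))"
      "\<forall>b\<in>set bs. \<forall>p<n. p < Suc j \<longrightarrow> b $ p = 0" "lin_indep_list n bs"
      using Suc.hyps(1)[OF j(2), of A'] by blast
    \<comment> \<open>Among all dyad vectors only the new one has a nonzero entry at
      \<open>j\<close>; in a linear relation its coefficient is therefore killed first.\<close>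
    have bj: "b $ j \<noteq> 0" using j d dpos by (simp add: b_def)
    have "lin_indep_list n (b # bs)"
      unfolding lin_indep_list_def
    proof (rule allI, rule impI)
      fix x :: "nat \<Rightarrow> complex"
      assume "\<forall>p<n. (\<Sum>i<length (b # bs). x i * (b # bs) ! i $ p) = 0"
      then have x: "x 0 * b $ p + (\<Sum>i<length bs. x (Suc i) * bs ! i $ p) = 0" if "p < n" for p
        using that by (simp add: sum.lessThan_Suc_shift del: sum.lessThan_Suc)
      have "(\<Sum>i<length bs. x (Suc i) * bs ! i $ j) = 0" using bs(3) j by (intro sum.neutral) auto
      then have x0: "x 0 = 0" using x[OF j(1)] bj by simp
      then have "\<forall>p<n. (\<Sum>i<length bs. x (Suc i) * bs ! i $ p) = 0" using x by simp
      then have "\<forall>i<length bs. x (Suc i) = 0"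
        using bs(4)[unfolded lin_indep_list_def, THEN spec, of "\<lambda>i. x (Suc i)"] by blast
      then show "\<forall>i<length (b # bs). x i = 0" using x0 by (auto simp: less_Suc_eq_0_disj)
    qed
    moreover have "A $$ (p, q) = (\<Sum>c\<leftarrow>b # bs. c $ p * cnj (c $ q))" if "p < n" "q < n" for p q
    proof -
      have "A $$ (p, q) = b $ p * cnj (b $ q) + A' $$ (p, q)"
        unfolding bb[OF that] using that by (simp add: A'_def)
      also have "A' $$ (p, q) = (\<Sum>b\<leftarrow>bs. b $ p * cnj (b $ q))" using bs(2) that by blast
      finally show ?thesis by simp
    qed
    moreover have "b $ p = 0" if "p < n" "p < j" for p
      using Suc.prems(2)[of p j] that j by (simp add: b_def)
    ultimately show ?thesis using bs(1,3) b by (intro exI[of _ "b # bs"]) auto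
  qed
qed

lemma psd_dyads:
  assumes "psd n A"
  obtains bs where "set bs \<subseteq> carrier_vec n" "\<And>p q. p < n \<Longrightarrow> q < n \<Longrightarrow> A $$ (p, q) = (\<Sum>b\<leftarrow>bs. b $ p * cnj (b $ q))"
    "lin_indep_list n bs"
  using psd_dyads_from[OF assms, of 0] by auto

lemma cscalar_prod_adjoint:
  fixes B :: "complex mat"
  assumes "B \<in> carrier_mat n r" "y \<in> carrier_vec n" "x \<in> carrier_vec r"
  shows "(mat_adjoint B *\<^sub>v y) \<bullet>c x = y \<bullet>c (B *\<^sub>v x)"
proof -
  have B': "mat_adjoint B \<in> carrier_mat r n" using assms(1) by (rule mat_adjoint_carrier)
  have "(mat_adjoint B *\<^sub>v y) \<bullet>c x = (\<Sum>i<r. \<Sum>p<n. cnj (B $$ (p, i)) * y $ p * cnj (x $ i))"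
    unfolding cscalar_prod_sum[OF assms(3)]
    by (intro sum.cong refl, subst mult_mat_vec_index_sum[OF B' assms(2)])
       (use assms in \<open>auto simp: sum_distrib_right\<close>)
  also have "\<dots> = (\<Sum>p<n. \<Sum>i<r. cnj (B $$ (p, i)) * y $ p * cnj (x $ i))" by (rule sum.swap)
  also have "\<dots> = (\<Sum>p<n. y $ p * cnj ((B *\<^sub>v x) $ p))"
    by (intro sum.cong refl, subst mult_mat_vec_index_sum[OF assms(1,3)])
       (auto simp: sum_distrib_left mult_ac)
  also have "\<dots> = y \<bullet>c (B *\<^sub>v x)" using assms by (subst cscalar_prod_sum[where n = n]) auto
  finally show ?thesis .
qed

lemma cscalar_prod_self:
  fixes v :: "complex vec"
  assumes "v \<in> carrier_vec n"
  shows "v \<bullet>c v = of_real (\<Sum>i<n. (cmod (v $ i))\<^sup>2)"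
  unfolding cscalar_prod_sum[OF assms] by (simp only: complex_norm_square[symmetric] of_real_sum)

lemma sum_norm_sq_eq_0:
  fixes v :: "complex vec"
  assumes "v \<in> carrier_vec n"
  shows "(\<Sum>i<n. (cmod (v $ i))\<^sup>2) = 0 \<longleftrightarrow> v = 0\<^sub>v n"
proof -
  have "(\<Sum>i<n. (cmod (v $ i))\<^sup>2) = 0 \<longleftrightarrow> (\<forall>i<n. v $ i = 0)"
    by (subst sum_nonneg_eq_0_iff) auto
  also have "\<dots> \<longleftrightarrow> v = 0\<^sub>v n" using assms by (auto intro!: eq_vecI)
  finally show ?thesis .
qed

text \<open>\<open>A\<close> is \<open>B\<close> times its adjoint, where the columns of
  \<open>B\<close> are the given vectors. Independence makes \<open>B\<close> injective, hence the
  Gram matrix \<Gamma> invertible, hence the column spaces of \<open>A\<close> and \<open>B\<close>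
  equal.\<close>

lemma rank_dyads:
  assumes A: "A \<in> carrier_mat n n" and bs: "set bs \<subseteq> carrier_vec n"
    and Abs: "\<And>p q. p < n \<Longrightarrow> q < n \<Longrightarrow> A $$ (p, q) = (\<Sum>b\<leftarrow>bs. b $ p * cnj (b $ q))"
    and indep: "lin_indep_list n bs"
  shows "vec_space.rank n A = length bs"
proof -
  interpret vec_space "TYPE(complex)" n .
  define r where "r = length bs"
  define B where "B = mat_of_cols n bs"
  have B: "B \<in> carrier_mat n r" by (simp add: B_def r_def)
  have colsB: "cols B = bs" unfolding B_def using bs by (rule cols_mat_of_cols)
  have Bpi: "B $$ (p, i) = bs ! i $ p" if "p < n" "i < r" for p i
    using that by (simp add: B_def r_def mat_of_cols_index)
  have B': "mat_adjoint B \<in> carrier_mat r n" using B by (rule mat_adjoint_carrier)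
  have AB: "A = B * mat_adjoint B"
  proof (rule eq_matI)
    fix p q assume "p < dim_row (B * mat_adjoint B)" "q < dim_col (B * mat_adjoint B)"
    then have pq: "p < n" "q < n" using B by auto
    show "A $$ (p, q) = (B * mat_adjoint B) $$ (p, q)"
      unfolding mult_mat_index_sum[OF B B' pq] Abs[OF pq] using pq B
      by (simp add: sum_list_sum_nth r_def atLeast0LessThan Bpi)
  qed (use A B in auto)
  have inj: "x = 0\<^sub>v r" if x: "x \<in> carrier_vec r" "B *\<^sub>v x = 0\<^sub>v n" for x
  proof -
    have "(\<Sum>i<length bs. x $ i * bs ! i $ p) = 0" if p: "p < n" for p
    proof -
      have "(B *\<^sub>v x) $ p = 0" using x(2) p by simp
      then show ?thesis unfolding mult_mat_vec_index_sum[OF B x(1) p] using p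
        by (simp add: r_def Bpi mult.commute)
    qed
    then have "\<forall>i<r. x $ i = 0" using indep unfolding lin_indep_list_def r_def by blast
    then show ?thesis using x(1) by (intro eq_vecI) auto
  qed
  have distinct: "distinct (cols B)"
    unfolding colsB distinct_conv_nth
  proof (intro allI impI notI)
    fix i k assume ik: "i < length bs" "k < length bs" "i \<noteq> k" "bs ! i = bs ! k"
    \<comment> \<open>A repeated column would put the difference of two unit vectors into the kernel
      of \<open>B\<close>.\<close>
    define x where "x = vec r (\<lambda>a. if a = i then 1 else if a = k then -1 else (0::complex))"
    have "B *\<^sub>v x = 0\<^sub>v n"
    proof (rule eq_vecI)
      fix p assume "p < dim_vec (0\<^sub>v n :: complex vec)"
      then have p: "p < n" by simp
      have "(B *\<^sub>v x) $ p = (\<Sum>a<r. (if a = i then B $$ (p, a) else 0) - (if a = k then B $$ (p, a) else 0))"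
        using p B ik(3) by (subst mult_mat_vec_index_sum[OF B _ p]) (auto simp: x_def intro!: sum.cong)
      also have "\<dots> = B $$ (p, i) - B $$ (p, k)" using ik by (simp add: sum_subtractf r_def)
      also have "\<dots> = 0" using ik p by (simp add: Bpi r_def)
      finally show "(B *\<^sub>v x) $ p = 0\<^sub>v n $ p" using p by simp
    qed (use B in auto)
    then have "x = 0\<^sub>v r" by (intro inj) (simp_all add: x_def)
    then have "x $ i = 0" using ik by (simp add: r_def)
    then show False using ik by (simp add: x_def r_def)
  qed
  have "lin_indpt (set (cols B))"
  proof
    assume "lin_dep (set (cols B))"
    then obtain v where "v \<in> carrier_vec r" "v \<noteq> 0\<^sub>v r" "B *\<^sub>v v = 0\<^sub>v n"
      using lin_depE[OF B _ distinct] by blast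
    then show False using inj by blast
  qed
  then have rB: "rank B = r" using lin_indpt_full_rank[OF B distinct] by simp
  define \<Gamma> where "\<Gamma> = mat_adjoint B * B"
  have \<Gamma>: "\<Gamma> \<in> carrier_mat r r" unfolding \<Gamma>_def using B B' by simp
  have "det \<Gamma> \<noteq> 0"
  proof
    assume "det \<Gamma> = 0"
    then obtain x where x: "x \<in> carrier_vec r" "x \<noteq> 0\<^sub>v r" "\<Gamma> *\<^sub>v x = 0\<^sub>v r"
      using det_0_iff_vec_prod_zero_field[OF \<Gamma>] by blast
    have Bx: "B *\<^sub>v x \<in> carrier_vec n" using B x by auto
    have "(\<Gamma> *\<^sub>v x) \<bullet>c x = (B *\<^sub>v x) \<bullet>c (B *\<^sub>v x)"
      unfolding \<Gamma>_def using B B' x by (subst assoc_mult_mat_vec[OF B' B x(1)]) (simp add: cscalar_prod_adjoint[OF B Bx x(1)])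
    moreover have "(\<Gamma> *\<^sub>v x) \<bullet>c x = 0" unfolding x(3) using x(1) by (simp add: cscalar_prod_sum)
    ultimately have "complex_of_real (\<Sum>i<n. (cmod ((B *\<^sub>v x) $ i))\<^sup>2) = 0"
      unfolding cscalar_prod_self[OF Bx] by simp
    then have "B *\<^sub>v x = 0\<^sub>v n" using sum_norm_sq_eq_0[OF Bx] by (simp only: of_real_eq_0_iff)
    then show False using inj x by blast
  qed
  then obtain \<Gamma>i where \<Gamma>i: "\<Gamma>i \<in> carrier_mat r r" "\<Gamma> * \<Gamma>i = 1\<^sub>m r"
    using det_non_zero_imp_unit[OF \<Gamma>] by (auto simp: Units_def ring_mat_def)
  have "col_space A = col_space B"
  proof
    show "col_space A \<subseteq> col_space B"
    proof
      fix y assume "y \<in> col_space A"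
      then obtain x where y: "y \<in> carrier_vec n" "x \<in> carrier_vec n" "A *\<^sub>v x = y"
        unfolding col_space_eq[OF A] using A by auto
      then have "B *\<^sub>v (mat_adjoint B *\<^sub>v x) = y"
        unfolding AB using assoc_mult_mat_vec[OF B B' y(2)] by simp
      then show "y \<in> col_space B" unfolding col_space_eq[OF B] using B B' y
        by (auto intro!: bexI[of _ "mat_adjoint B *\<^sub>v x"])
    qed
    show "col_space B \<subseteq> col_space A"
    proof
      fix y assume "y \<in> col_space B"
      then obtain x where y: "y \<in> carrier_vec n" "x \<in> carrier_vec r" "B *\<^sub>v x = y"
        unfolding col_space_eq[OF B] using B by auto
      have u: "\<Gamma>i *\<^sub>v x \<in> carrier_vec r" using \<Gamma>i y by auto
      then have Bu: "B *\<^sub>v (\<Gamma>i *\<^sub>v x) \<in> carrier_vec n" using B by auto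
      have "mat_adjoint B *\<^sub>v (B *\<^sub>v (\<Gamma>i *\<^sub>v x)) = \<Gamma> *\<^sub>v (\<Gamma>i *\<^sub>v x)"
        unfolding \<Gamma>_def using assoc_mult_mat_vec[OF B' B u] by simp
      also have "\<dots> = x" using assoc_mult_mat_vec[OF \<Gamma> \<Gamma>i(1) y(2)] \<Gamma>i(2) y(2) by simp
      finally have "A *\<^sub>v (B *\<^sub>v (\<Gamma>i *\<^sub>v x)) = y"
        unfolding AB using assoc_mult_mat_vec[OF B B' Bu] y(3) by simp
      then show "y \<in> col_space A" unfolding col_space_eq[OF A] using A y Bu
        by (auto intro!: bexI[of _ "B *\<^sub>v (\<Gamma>i *\<^sub>v x)"])
    qed
  qed
  then have "rank A = rank B" unfolding rank_def col_space_def by simp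
  then show ?thesis using rB by (simp add: r_def)
qed

subsection \<open>Realizations\<close>

text \<open>Both sides are the determinant of the block matrix with rows \<open>X, V\<close> and
  \<open>-W, E\<close>, evaluated by eliminating with one or the other diagonal block.\<close>

lemma det_sylvester:
  fixes X :: "complex mat"
  assumes X: "X \<in> carrier_mat d d" "Xi \<in> carrier_mat d d" "X * Xi = 1\<^sub>m d"
    and E: "E \<in> carrier_mat n n" "Ei \<in> carrier_mat n n" "E * Ei = 1\<^sub>m n"
    and W: "W \<in> carrier_mat n d" and V: "V \<in> carrier_mat d n"
  shows "det X * det (E + W * (Xi * V)) = det E * det (X + V * (Ei * W))"
proof -
  have c: "Xi * V \<in> carrier_mat d n" "Ei * W \<in> carrier_mat n d" "W * (Xi * V) \<in> carrier_mat n n"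
    "V * (Ei * W) \<in> carrier_mat d d" "-W \<in> carrier_mat n d" "- (Ei * W) \<in> carrier_mat n d"
    using X E W V by auto
  let ?M = "four_block_mat X V (-W) E"
  have XV: "X * (Xi * V) = V" using assoc_mult_mat[OF X(1,2) V] X(3) V by simp
  have EW: "E * (Ei * W) = W" using assoc_mult_mat[OF E(1,2) W] E(3) W by simp
  have 1: "four_block_mat (X + V * (Ei * W)) V (0\<^sub>m n d) E * four_block_mat (1\<^sub>m d) (0\<^sub>m d n) (- (Ei * W)) (1\<^sub>m n) = ?M"
  proof (subst mult_four_block_mat[where ?nr1.0 = d and ?n1.0 = d and ?n2.0 = n and ?nr2.0 = n and ?nc1.0 = d and ?nc2.0 = n])
    have a: "V * - (Ei * W) = - (V * (Ei * W))" by (rule uminus_mult_right_mat) (use V E in auto)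
    have "E * - (Ei * W) = - (E * (Ei * W))" by (rule uminus_mult_right_mat) (use E in auto)
    then have b: "E * - (Ei * W) = - W" unfolding EW .
    have "P + Q + - Q = P" if "P \<in> carrier_mat d d" "Q \<in> carrier_mat d d" for P Q :: "complex mat"
      using that by (intro eq_matI) auto
    then have e: "X + V * (Ei * W) + - (V * (Ei * W)) = X" using X(1) c(4) by blast
    show "four_block_mat ((X + V * (Ei * W)) * 1\<^sub>m d + V * - (Ei * W)) ((X + V * (Ei * W)) * 0\<^sub>m d n + V * 1\<^sub>m n)
     (0\<^sub>m n d * 1\<^sub>m d + E * - (Ei * W)) (0\<^sub>m n d * 0\<^sub>m d n + E * 1\<^sub>m n) = four_block_mat X V (- W) E"
      unfolding a b using X V E W c e by (intro cong_four_block_mat) auto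
  qed (use X V E W c in auto)
  have 2: "four_block_mat X (0\<^sub>m d n) (-W) (E + W * (Xi * V)) * four_block_mat (1\<^sub>m d) (Xi * V) (0\<^sub>m n d) (1\<^sub>m n) = ?M"
  proof (subst mult_four_block_mat[where ?nr1.0 = d and ?n1.0 = d and ?n2.0 = n and ?nr2.0 = n and ?nc1.0 = d and ?nc2.0 = n])
    have a: "- W * (Xi * V) = - (W * (Xi * V))" by (rule uminus_mult_left_mat) (use W X in auto)
    have "- Q + (P + Q) = P" if "P \<in> carrier_mat n n" "Q \<in> carrier_mat n n" for P Q :: "complex mat"
      using that by (intro eq_matI) auto
    then have e: "- (W * (Xi * V)) + (E + W * (Xi * V)) = E" using E(1) c(3) by blast
    show "four_block_mat (X * 1\<^sub>m d + 0\<^sub>m d n * 0\<^sub>m n d) (X * (Xi * V) + 0\<^sub>m d n * 1\<^sub>m n)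
     (- W * 1\<^sub>m d + (E + W * (Xi * V)) * 0\<^sub>m n d) (- W * (Xi * V) + (E + W * (Xi * V)) * 1\<^sub>m n) = four_block_mat X V (- W) E"
      unfolding XV a using X V E W c e by (intro cong_four_block_mat) auto
  qed (use X V E W c in auto)
  have "det ?M = det (X + V * (Ei * W)) * det E"
    unfolding 1[symmetric] using X V E W c
    by (subst det_mult[where n = "d + n"])
       (auto simp: det_four_block_mat_lower_left_zero[where n = d and m = n]
        det_four_block_mat_upper_right_zero[where n = d and m = n])
  moreover have "det ?M = det X * det (E + W * (Xi * V))"
    unfolding 2[symmetric] using X V E W c
    by (subst det_mult[where n = "d + n"])
       (auto simp: det_four_block_mat_lower_left_zero[where n = d and m = n]
        det_four_block_mat_upper_right_zero[where n = d and m = n])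
  ultimately show ?thesis by (simp add: mult.commute)
qed

text \<open>A state-space realization with a diagonal state matrix in the variable
  \<open>s = 1 / (t - z)\<close>. The last clause is the Hautus test for the pair of this diagonal
  matrix and \<open>W\<close>: no nonzero eigenvector of the former lies in the kernel of the
  latter. It expresses minimality, and it will put the zeros strictly inside the half plane, so that
  all \<open>d\<close> of them are counted.\<close>

definition realization :: "nat \<Rightarrow> (complex \<Rightarrow> complex mat) \<Rightarrow> real \<Rightarrow> complex mat \<Rightarrow> complex mat \<Rightarrow>
    (nat \<Rightarrow> real) \<Rightarrow> nat \<Rightarrow> bool" where
  "realization n F t C W L d \<longleftrightarrow> self_adjoint n C \<and> W \<in> carrier_mat n d \<and>
     (\<forall>z\<in>upper_half_plane. \<forall>p<n. \<forall>q<n. F z $$ (p, q) = C $$ (p, q) +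
        (\<Sum>i<d. W $$ (p, i) * cnj (W $$ (q, i)) / (of_real (L i) - 1 / (of_real t - z)))) \<and>
     (\<forall>\<sigma> x. (\<forall>i<d. complex_of_real (L i) \<noteq> \<sigma> \<longrightarrow> x i = 0) \<longrightarrow>
        (\<forall>p<n. (\<Sum>i<d. x i * W $$ (p, i)) = 0) \<longrightarrow> (\<forall>i<d. x i = 0))"

text \<open>The substitution \<open>s = 1 / (t - z)\<close> moves the pole at infinity to \<open>s = 0\<close>.\<close>

lemma rational_rep_realization:
  assumes rep: "rational_rep n F C D m l A"
  obtains t C' W L where "realization n F t C' W L (vec_space.rank n D + (\<Sum>k=1..m. vec_space.rank n (A k)))"
proof -
  have C: "self_adjoint n C" and psdD: "psd n D" and psdA: "\<And>k. k \<in> {1..m} \<Longrightarrow> psd n (A k)"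
    and inj: "inj_on l {1..m}"
    and F: "\<And>z i j. z \<in> upper_half_plane \<Longrightarrow> i < n \<Longrightarrow> j < n \<Longrightarrow>
        F z $$ (i, j) = C $$ (i, j) + z * D $$ (i, j) + (\<Sum>k=1..m. 1 / (of_real (l k) - z) * A k $$ (i, j))"
    using rep by (auto simp: rational_rep_def)
  have "finite (l ` {1..m})" by simp
  \<comment> \<open>\<open>t\<close> avoids all finite poles, so that none of them is sent to
    infinity by the substitution.\<close>
  then obtain t where "t \<notin> l ` {1..m}" using ex_new_if_finite infinite_UNIV_char_0 by blast
  then have t: "l k \<noteq> t" if "k \<in> {1..m}" for k using that by blast
  \<comment> \<open>Index 0 stands for the pole at infinity, with residue \<open>D\<close>.\<close>
  define M where "M k = (if k = 0 then D else A k)" for k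
  have psdM: "psd n (M k)" if "k \<in> {0..m}" for k
    using that psdD psdA[of k] by (auto simp: M_def)
  have "\<forall>k\<in>{0..m}. \<exists>bs. set bs \<subseteq> carrier_vec n \<and>
      (\<forall>p<n. \<forall>q<n. M k $$ (p, q) = (\<Sum>b\<leftarrow>bs. b $ p * cnj (b $ q))) \<and> lin_indep_list n bs"
    using psdM by (metis psd_dyads)
  from bchoice[OF this] obtain bs where bs: "\<And>k. k \<in> {0..m} \<Longrightarrow> set (bs k) \<subseteq> carrier_vec n"
    "\<And>k p q. k \<in> {0..m} \<Longrightarrow> p < n \<Longrightarrow> q < n \<Longrightarrow> M k $$ (p, q) = (\<Sum>b\<leftarrow>bs k. b $ p * cnj (b $ q))"
    "\<And>k. k \<in> {0..m} \<Longrightarrow> lin_indep_list n (bs k)" by blast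
  define r where "r k = length (bs k)" for k
  have rank: "vec_space.rank n (M k) = r k" if "k \<in> {0..m}" for k
    unfolding r_def using psdM[OF that] bs that by (intro rank_dyads) (auto simp: psd_iff)
  define I where "I = (SIGMA k:{0..m}. {..<r k})"
  define d where "d = card I"
  have finI: "finite I" by (simp add: I_def)
  have d: "d = vec_space.rank n D + (\<Sum>k=1..m. vec_space.rank n (A k))"
  proof -
    have "d = (\<Sum>k=0..m. vec_space.rank n (M k))"
      unfolding d_def I_def by (subst card_SigmaI) (auto simp: rank intro!: sum.cong)
    also have "\<dots> = vec_space.rank n (M 0) + (\<Sum>k=Suc 0..m. vec_space.rank n (M k))"
      by (rule sum.atLeast_Suc_atMost) simp
    finally show ?thesis by (simp add: M_def)
  qed
  obtain e where e: "bij_betw e {..<d} I"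
    using ex_bij_betw_nat_finite[OF finI] by (auto simp: d_def atLeast0LessThan)
  \<comment> \<open>\<Lambda> is the image of each pole under the substitution. The squares of the
    weights \<open>wt\<close> are the factors picked up by the residues, as
    \<open>1 / (l k - z) = (wt k)^2 / (\<Lambda> k - s) + 1 / (l k - t)\<close>.\<close>
  define \<Lambda> where "\<Lambda> k = (if k = 0 then 0 else 1 / (t - l k))" for k
  define wt where "wt k = (if k = 0 then 1 else 1 / \<bar>l k - t\<bar>)" for k
  define W where "W = mat n d (\<lambda>(p, i). of_real (wt (fst (e i))) * (bs (fst (e i)) ! snd (e i)) $ p)"
  define L where "L i = \<Lambda> (fst (e i))" for i
  \<comment> \<open>Collects the constants released by the substitution: \<open>z * D\<close> is
    \<open>(z - t) * D + t * D\<close>, and each finite pole leaves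
    \<open>A k / (l k - t)\<close>.\<close>
  define C' where "C' = mat n n (\<lambda>(p, q). C $$ (p, q) + of_real t * D $$ (p, q)
      + (\<Sum>k=1..m. A k $$ (p, q) / of_real (l k - t)))"
  have inj\<Lambda>: "inj_on \<Lambda> {0..m}"
  proof (rule inj_onI)
    fix k k' assume k: "k \<in> {0..m}" "k' \<in> {0..m}" "\<Lambda> k = \<Lambda> k'"
    have nz: "\<Lambda> k \<noteq> 0" if "k \<in> {1..m}" for k using t[OF that] that by (auto simp: \<Lambda>_def)
    show "k = k'"
    proof (cases "k = 0 \<or> k' = 0")
      case True
      then show ?thesis using nz[of k] nz[of k'] k by (auto simp: \<Lambda>_def split: if_splits)
    next
      case False
      then have kk: "k \<in> {1..m}" "k' \<in> {1..m}" using k by auto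
      have "l k = l k'" using k(3) False t[OF kk(1)] t[OF kk(2)] by (simp add: \<Lambda>_def field_simps)
      then show ?thesis using inj kk by (auto dest: inj_onD)
    qed
  qed
  have sumI: "(\<Sum>i<d. f (e i)) = (\<Sum>k=0..m. \<Sum>a<r k. f (k, a))" for f :: "nat \<times> nat \<Rightarrow> complex"
    unfolding sum.reindex_bij_betw[OF e, of f] I_def by (subst sum.Sigma) auto
  have "realization n F t C' W L d"
    unfolding realization_def
  proof (intro conjI ballI allI impI)
    have "A k $$ (p, q) = cnj (A k $$ (q, p))" if "k \<in> {1..m}" "p < n" "q < n" for k p q
      using psd_imp_self_adjoint[OF psdA[OF that(1)]] that unfolding self_adjoint_iff by blast
    then have hA: "cnj (\<Sum>k=1..m. A k $$ (q, p) / of_real (l k - t)) = (\<Sum>k=1..m. A k $$ (p, q) / of_real (l k - t))"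
      if "p < n" "q < n" for p q
      unfolding cnj_sum by (intro sum.cong refl) (metis complex_cnj_divide complex_cnj_complex_of_real that)
    have hC: "cnj (C $$ (q, p)) = C $$ (p, q)" "cnj (D $$ (q, p)) = D $$ (p, q)" if "p < n" "q < n" for p q
      using C psd_imp_self_adjoint[OF psdD] that unfolding self_adjoint_iff by metis+
    have "C' $$ (p, q) = cnj (C' $$ (q, p))" if "p < n" "q < n" for p q
      using that by (simp only: C'_def index_mat prod.case complex_cnj_add complex_cnj_mult
        complex_cnj_complex_of_real hC[OF that] hA[OF that])
    moreover have "C' \<in> carrier_mat n n" by (simp add: C'_def)
    ultimately show "self_adjoint n C'" unfolding self_adjoint_iff by blast
    show "W \<in> carrier_mat n d" by (simp add: W_def)
  next
    fix z p q assume z: "z \<in> upper_half_plane" and pq: "p < n" "q < n"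
    let ?s = "1 / (of_real t - z)"
    have tz: "of_real x - z \<noteq> 0" for x using z by (auto simp: complex_eq_iff)
    have "(\<Sum>i<d. W $$ (p, i) * cnj (W $$ (q, i)) / (of_real (L i) - ?s))
      = (\<Sum>i<d. (\<lambda>(k, a). of_real (wt k)^2 * ((bs k ! a) $ p * cnj ((bs k ! a) $ q)) / (of_real (\<Lambda> k) - ?s)) (e i))"
      using pq by (intro sum.cong) (auto simp: W_def L_def power2_eq_square mult_ac split: prod.split)
    also have "\<dots> = (\<Sum>k=0..m. \<Sum>a<r k. of_real (wt k)^2 * ((bs k ! a) $ p * cnj ((bs k ! a) $ q)) / (of_real (\<Lambda> k) - ?s))"
      by (subst sumI) simp
    also have "\<dots> = (\<Sum>k=0..m. of_real (wt k)^2 / (of_real (\<Lambda> k) - ?s) * M k $$ (p, q))"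
      using bs(2) pq by (intro sum.cong) (auto simp: sum_distrib_left sum_list_sum_nth atLeast0LessThan r_def)
    also have "\<dots> = of_real (wt 0)^2 / (of_real (\<Lambda> 0) - ?s) * M 0 $$ (p, q)
       + (\<Sum>k=Suc 0..m. of_real (wt k)^2 / (of_real (\<Lambda> k) - ?s) * M k $$ (p, q))"
      by (rule sum.atLeast_Suc_atMost) simp
    also have "of_real (wt 0)^2 / (of_real (\<Lambda> 0) - ?s) * M 0 $$ (p, q) = (z - of_real t) * D $$ (p, q)"
      using tz[of t] by (simp add: wt_def \<Lambda>_def M_def)
    also have "(\<Sum>k=Suc 0..m. of_real (wt k)^2 / (of_real (\<Lambda> k) - ?s) * M k $$ (p, q))
       = (\<Sum>k=1..m. 1 / (of_real (l k) - z) * A k $$ (p, q) - A k $$ (p, q) / of_real (l k - t))"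
    proof (intro sum.cong)
      fix k assume k: "k \<in> {1..m}"
      define a where "a = complex_of_real (l k) - of_real t"
      have a0: "a \<noteq> 0" using t[OF k] by (simp add: a_def)
      have w2: "complex_of_real (wt k)^2 = 1 / a^2"
        using k by (simp add: wt_def a_def power_divide flip: of_real_power of_real_diff)
      have lz: "of_real (l k) - z = a + (of_real t - z)" by (simp add: a_def)
      have id1: "- 1 / a - 1 / u = - (a + u) / (a * u)" if "u \<noteq> 0" for u
        using a0 that by (simp add: field_simps)
      have id2: "1 / a^2 / (- (a + u) / (a * u)) = 1 / (a + u) - 1 / a" if "u \<noteq> 0" "a + u \<noteq> 0" for u
      proof -
        have aux: "x / (- p - q) = - (x / (p + q))" for x p q :: complex
        proof -
          have "- p - q = - (p + q)" by simp
          then show ?thesis by (simp only: divide_minus_right)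
        qed
        show ?thesis using a0 that by (simp add: field_simps power2_eq_square aux)
      qed
      have "complex_of_real (\<Lambda> k) = - 1 / a"
        using k a0 t[OF k] by (simp add: \<Lambda>_def a_def field_simps)
      then have e1: "complex_of_real (\<Lambda> k) - ?s = - (of_real (l k) - z) / (a * (of_real t - z))"
        unfolding lz by (simp only: id1[OF tz[of t]])
      have nz: "a + (of_real t - z) \<noteq> 0" using tz[of "l k"] unfolding lz .
      have "of_real (wt k)^2 / (of_real (\<Lambda> k) - ?s) = 1 / (of_real (l k) - z) - 1 / a"
        unfolding w2 e1 unfolding lz by (rule id2[OF tz[of t] nz])
      then show "of_real (wt k)^2 / (of_real (\<Lambda> k) - ?s) * M k $$ (p, q)
          = 1 / (of_real (l k) - z) * A k $$ (p, q) - A k $$ (p, q) / of_real (l k - t)"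
        using k by (simp add: M_def a_def left_diff_distrib)
    qed simp
    finally show "F z $$ (p, q) = C' $$ (p, q) + (\<Sum>i<d. W $$ (p, i) * cnj (W $$ (q, i)) / (of_real (L i) - ?s))"
      using F[OF z pq] pq by (simp add: C'_def sum_subtractf algebra_simps)
  next
    fix \<sigma> :: complex and x i
    assume supp: "\<forall>i<d. complex_of_real (L i) \<noteq> \<sigma> \<longrightarrow> x i = 0"
      and zero: "\<forall>p<n. (\<Sum>i<d. x i * W $$ (p, i)) = 0" and i: "i < d"
    show "x i = 0"
    proof (rule ccontr)
      assume xi: "x i \<noteq> 0"
      obtain k a where ka: "e i = (k, a)" by (metis surj_pair)
      moreover have "e i \<in> I" using bij_betwE[OF e] i by blast
      ultimately have kaI: "(k, a) \<in> I" by simp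
      then have k: "k \<in> {0..m}" and a: "a < r k" by (auto simp: I_def)
      have sk: "complex_of_real (\<Lambda> k) = \<sigma>" using supp i xi by (auto simp: L_def ka)
      \<comment> \<open>The coefficients are regrouped by pole. Since \<Lambda> is injective, the
        support condition leaves a single block \<open>k\<close>, on which the independence of the
        dyads of \<open>M k\<close> applies.\<close>
      define X where "X y = x (the_inv_into {..<d} e y)" for y
      have X: "X (e j) = x j" if "j < d" for j
        using the_inv_into_f_f[of e "{..<d}" j] e that by (simp add: X_def bij_betw_def)
      have X0: "X (k', b) = 0" if "k' \<in> {0..m}" "b < r k'" "k' \<noteq> k" for k' b
      proof -
        have "(k', b) \<in> I" using that by (simp add: I_def)
        then obtain j where j: "j < d" "e j = (k', b)" using e by (metis bij_betw_iff_bijections lessThan_iff)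
        have "\<Lambda> k' \<noteq> \<Lambda> k" using inj\<Lambda> that k by (auto dest: inj_onD)
        then have "complex_of_real (L j) \<noteq> \<sigma>" using j sk by (auto simp: L_def)
        then show ?thesis using supp j X[OF j(1)] by auto
      qed
      have wt0: "complex_of_real (wt k) \<noteq> 0" using t[of k] k by (auto simp: wt_def)
      have "(\<Sum>b<r k. X (k, b) * (bs k ! b) $ p) = 0" if p: "p < n" for p
      proof -
        have "0 = (\<Sum>i<d. x i * W $$ (p, i))" using zero p by simp
        also have "\<dots> = (\<Sum>i<d. (\<lambda>(k, b). X (k, b) * (of_real (wt k) * (bs k ! b) $ p)) (e i))"
          using p X by (intro sum.cong) (simp_all add: W_def split_def)
        also have "\<dots> = (\<Sum>k=0..m. \<Sum>b<r k. X (k, b) * (of_real (wt k) * (bs k ! b) $ p))"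
          by (subst sumI) simp
        also have "\<dots> = (\<Sum>b<r k. X (k, b) * (of_real (wt k) * (bs k ! b) $ p))"
          using k X0 by (subst sum.remove[of _ k]) (auto intro!: sum.neutral)
        also have "\<dots> = of_real (wt k) * (\<Sum>b<r k. X (k, b) * (bs k ! b) $ p)"
          by (simp add: sum_distrib_left mult_ac)
        finally show ?thesis using wt0 by simp
      qed
      then have "\<forall>b<r k. X (k, b) = 0"
        using bs(3)[OF k, unfolded lin_indep_list_def, THEN spec, of "\<lambda>b. X (k, b)"] unfolding r_def by blast
      then show False using a xi X[OF i] ka by simp
    qed
  qed
  then show ?thesis using that unfolding d by blast
qed

section \<open>Determinants of a shifted matrix and its eigenvalues\<close>

lemma det_minus_scalar_eigenvalues:
  fixes A :: "complex mat"
  assumes A: "A \<in> carrier_mat n n"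
  obtains \<sigma>s where "length \<sigma>s = n" "\<And>w. det (A - w \<cdot>\<^sub>m 1\<^sub>m n) = (\<Prod>\<sigma>\<leftarrow>\<sigma>s. \<sigma> - w)"
    "char_poly A = (\<Prod>\<sigma>\<leftarrow>\<sigma>s. [:- \<sigma>, 1:])"
proof -
  obtain \<sigma>s where s: "char_poly A = (\<Prod>a\<leftarrow>\<sigma>s. [:- a, 1:])" "length \<sigma>s = n"
    using char_poly_factorized[OF A] by blast
  have "det (A - w \<cdot>\<^sub>m 1\<^sub>m n) = (\<Prod>\<sigma>\<leftarrow>\<sigma>s. \<sigma> - w)" for w
  proof -
    have c: "A - w \<cdot>\<^sub>m 1\<^sub>m n = (-1) \<cdot>\<^sub>m (- (char_matrix A w))"
      using A by (intro eq_matI) (auto simp: char_matrix_def)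
    have "char_matrix A w \<in> carrier_mat n n" using A by simp
    then have "det (A - w \<cdot>\<^sub>m 1\<^sub>m n) = (-1) ^ n * poly (char_poly A) w"
      unfolding c char_poly_matrix[OF A] by (simp add: carrier_matD(2))
    also have "poly (char_poly A) w = (\<Prod>\<sigma>\<leftarrow>\<sigma>s. w - \<sigma>)"
      unfolding s(1) by (induction \<sigma>s) (auto simp: algebra_simps)
    also have "(-1) ^ n * (\<Prod>\<sigma>\<leftarrow>\<sigma>s. w - \<sigma>) = (\<Prod>\<sigma>\<leftarrow>\<sigma>s. \<sigma> - w)"
      unfolding s(2)[symmetric] by (induction \<sigma>s) (auto simp: algebra_simps)
    finally show ?thesis .
  qed
  then show ?thesis using that s by blast
qed

lemma smult_one_mat_vec:
  fixes v :: "complex vec"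
  assumes v: "v \<in> carrier_vec n"
  shows "(w \<cdot>\<^sub>m 1\<^sub>m n) *\<^sub>v v = w \<cdot>\<^sub>v v"
proof (rule eq_vecI)
  fix i assume "i < dim_vec (w \<cdot>\<^sub>v v)"
  then have i: "i < n" using v by simp
  have c: "w \<cdot>\<^sub>m 1\<^sub>m n \<in> carrier_mat n n" by simp
  show "((w \<cdot>\<^sub>m 1\<^sub>m n) *\<^sub>v v) $ i = (w \<cdot>\<^sub>v v) $ i"
    unfolding mult_mat_vec_index_sum[OF c v i] using i v
    by (simp add: if_distrib if_distribR cong: if_cong)
qed (use v in simp)

lemma minus_scalar_mult_vec:
  fixes A :: "complex mat"
  assumes "A \<in> carrier_mat n n" "v \<in> carrier_vec n"
  shows "(A - w \<cdot>\<^sub>m 1\<^sub>m n) *\<^sub>v v = A *\<^sub>v v - w \<cdot>\<^sub>v v"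
proof -
  have "(A - w \<cdot>\<^sub>m 1\<^sub>m n) *\<^sub>v v = A *\<^sub>v v - (w \<cdot>\<^sub>m 1\<^sub>m n) *\<^sub>v v"
    using assms by (intro minus_mult_distrib_mat_vec) auto
  then show ?thesis unfolding smult_one_mat_vec[OF assms(2)] .
qed

lemma minus_vec_eq_0_iff:
  fixes x y :: "complex vec"
  assumes "x \<in> carrier_vec n" "y \<in> carrier_vec n"
  shows "x - y = 0\<^sub>v n \<longleftrightarrow> x = y"
  using assms by (auto simp: vec_eq_iff)

lemma det_eq_0_eigenvector:
  fixes A :: "complex mat"
  assumes A: "A \<in> carrier_mat n n"
  shows "det (A - w \<cdot>\<^sub>m 1\<^sub>m n) = 0 \<longleftrightarrow> (\<exists>v\<in>carrier_vec n. v \<noteq> 0\<^sub>v n \<and> A *\<^sub>v v = w \<cdot>\<^sub>v v)"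
proof -
  have c: "A - w \<cdot>\<^sub>m 1\<^sub>m n \<in> carrier_mat n n" using A by auto
  have "(A - w \<cdot>\<^sub>m 1\<^sub>m n) *\<^sub>v v = 0\<^sub>v n \<longleftrightarrow> A *\<^sub>v v = w \<cdot>\<^sub>v v" if v: "v \<in> carrier_vec n" for v
    unfolding minus_scalar_mult_vec[OF A v] using A v by (intro minus_vec_eq_0_iff) auto
  then show ?thesis unfolding det_0_iff_vec_prod_zero_field[OF c] by blast
qed

lemma det_nonzero_inverse:
  fixes A :: "complex mat"
  assumes "A \<in> carrier_mat n n" "det A \<noteq> 0"
  obtains B where "B \<in> carrier_mat n n" "A * B = 1\<^sub>m n" "B * A = 1\<^sub>m n"
  using det_non_zero_imp_unit[OF assms] by (auto simp: Units_def ring_mat_def)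

lemma det_self_adjoint_minus_nonreal:
  assumes C: "self_adjoint n C" and w: "Im w \<noteq> 0"
  shows "det (C - w \<cdot>\<^sub>m 1\<^sub>m n) \<noteq> 0"
proof
  have Cc: "C \<in> carrier_mat n n" using C by (simp add: self_adjoint_def)
  assume "det (C - w \<cdot>\<^sub>m 1\<^sub>m n) = 0"
  then obtain v where v: "v \<in> carrier_vec n" "v \<noteq> 0\<^sub>v n" "C *\<^sub>v v = w \<cdot>\<^sub>v v"
    using det_eq_0_eigenvector[OF Cc] by blast
  have "quad_form n C v = (C *\<^sub>v v) \<bullet>c v" using cscalar_prod_quad_form[OF Cc v(1)] by simp
  also have "\<dots> = w * (v \<bullet>c v)" unfolding v(3) using v(1) by simp
  finally have "Im w * (\<Sum>i<n. (cmod (v $ i))\<^sup>2) = 0"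
    using quad_form_self_adjoint[OF C, of v] unfolding cscalar_prod_self[OF v(1)] by simp
  then show False using w v sum_norm_sq_eq_0[OF v(1)] by simp
qed

lemma det_mat_diag: "det (mat_diag n f) = (\<Prod>i<n. f i)"
proof -
  have "upper_triangular (mat_diag n f)" by (auto simp: mat_diag_def)
  then have "det (mat_diag n f) = prod_list (diag_mat (mat_diag n f))"
    by (rule det_upper_triangular[OF _ mat_diag_dim])
  also have "\<dots> = (\<Prod>i<n. f i)" unfolding prod_list_diag_prod
    by (simp add: mat_diag_def atLeast0LessThan)
  finally show ?thesis .
qed

text \<open>Sylvester's identity replaces \<open>F z - w\<close> by \<open>T - s\<close>, where
  \<open>T\<close> is the diagonal matrix plus the adjoint of \<open>W\<close> times
  \<open>(C - w)\<^sup>-\<^sup>1 * W\<close>; the \<open>\<sigma>s\<close> are the eigenvalues of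
  \<open>T\<close>. For an eigenvector \<open>x\<close> of \<open>T\<close> and
  \<open>u = (C - w)\<^sup>-\<^sup>1 W x\<close>, taking imaginary parts of the quadratic form gives
  that \<open>Im \<sigma>\<close> times the squared norm of \<open>x\<close> is \<open>Im w\<close>
  times the squared norm of \<open>u\<close>. This places \<sigma> in the closed upper half plane
  when \<open>Im w > 0\<close>, and minimality makes it strict.\<close>

lemma realization_factor:
  assumes R: "realization n F t C W L d" and Fc: "\<And>z. z \<in> upper_half_plane \<Longrightarrow> F z \<in> carrier_mat n n"
    and w: "Im w \<noteq> 0"
  obtains c \<sigma>s where "c \<noteq> 0" "length \<sigma>s = d" "0 < Im w \<Longrightarrow> set \<sigma>s \<subseteq> upper_half_plane"
    "\<And>z. z \<in> upper_half_plane \<Longrightarrow> det (F z - w \<cdot>\<^sub>m 1\<^sub>m n) * (\<Prod>i<d. of_real (L i) - 1 / (of_real t - z))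
       = c * (\<Prod>\<sigma>\<leftarrow>\<sigma>s. \<sigma> - 1 / (of_real t - z))"
proof -
  have C: "self_adjoint n C" "C \<in> carrier_mat n n" and W: "W \<in> carrier_mat n d"
    using R by (simp_all add: realization_def self_adjoint_def)
  have F: "\<And>z p q. z \<in> upper_half_plane \<Longrightarrow> p < n \<Longrightarrow> q < n \<Longrightarrow> F z $$ (p, q) = C $$ (p, q) +
        (\<Sum>i<d. W $$ (p, i) * cnj (W $$ (q, i)) / (of_real (L i) - 1 / (of_real t - z)))"
    using R unfolding realization_def by blast
  have ind: "\<And>\<sigma> x. (\<forall>i<d. complex_of_real (L i) \<noteq> \<sigma> \<longrightarrow> x i = 0) \<Longrightarrow>
        (\<forall>p<n. (\<Sum>i<d. x i * W $$ (p, i)) = 0) \<Longrightarrow> (\<forall>i<d. x i = 0)"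
    using R unfolding realization_def by blast
  define E where "E = C - w \<cdot>\<^sub>m 1\<^sub>m n"
  have E: "E \<in> carrier_mat n n" unfolding E_def by (intro minus_carrier_mat smult_carrier_mat one_carrier_mat)
  have detE: "det E \<noteq> 0" unfolding E_def using det_self_adjoint_minus_nonreal[OF C(1) w] .
  obtain Ei where Ei: "Ei \<in> carrier_mat n n" "E * Ei = 1\<^sub>m n" "Ei * E = 1\<^sub>m n"
    using det_nonzero_inverse[OF E detE] by blast
  define V where "V = mat_adjoint W"
  have V: "V \<in> carrier_mat d n" unfolding V_def using W by (rule mat_adjoint_carrier)
  define T where "T = mat_diag d (\<lambda>i. complex_of_real (L i)) + V * (Ei * W)"
  have VEW: "V * (Ei * W) \<in> carrier_mat d d" using V Ei W by auto
  then have T: "T \<in> carrier_mat d d" by (auto simp: T_def)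
  obtain \<sigma>s where s: "length \<sigma>s = d" "\<And>w. det (T - w \<cdot>\<^sub>m 1\<^sub>m d) = (\<Prod>\<sigma>\<leftarrow>\<sigma>s. \<sigma> - w)"
    using det_minus_scalar_eigenvalues[OF T] by metis
  have "set \<sigma>s \<subseteq> upper_half_plane" if w0: "0 < Im w"
  proof
    fix \<sigma> assume "\<sigma> \<in> set \<sigma>s"
    then have "det (T - \<sigma> \<cdot>\<^sub>m 1\<^sub>m d) = 0" unfolding s(2) by (auto simp: prod_list_zero_iff)
    then obtain x where x: "x \<in> carrier_vec d" "x \<noteq> 0\<^sub>v d" "T *\<^sub>v x = \<sigma> \<cdot>\<^sub>v x"
      using det_eq_0_eigenvector[OF T] by blast
    define y where "y = W *\<^sub>v x"
    define u where "u = Ei *\<^sub>v y"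
    have y: "y \<in> carrier_vec n" and u: "u \<in> carrier_vec n" using W Ei x by (auto simp: y_def u_def)
    have Eu: "E *\<^sub>v u = y" unfolding u_def using assoc_mult_mat_vec[OF E Ei(1) y] Ei(2) y by simp
    have Lx: "mat_diag d (\<lambda>i. complex_of_real (L i)) *\<^sub>v x = vec d (\<lambda>i. of_real (L i) * x $ i)"
    proof (rule eq_vecI)
      fix i assume "i < dim_vec (vec d (\<lambda>i. of_real (L i) * x $ i))"
      then have i: "i < d" by simp
      show "(mat_diag d (\<lambda>i. complex_of_real (L i)) *\<^sub>v x) $ i = vec d (\<lambda>i. of_real (L i) * x $ i) $ i"
        unfolding mult_mat_vec_index_sum[OF mat_diag_dim x(1) i] using i
        by (simp add: mat_diag_def if_distrib if_distribR cong: if_cong)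
    qed (simp add: mat_diag_def)
    have VEWx: "(V * (Ei * W)) *\<^sub>v x = V *\<^sub>v u"
      unfolding u_def y_def using V Ei W x by (simp add: assoc_mult_mat_vec[of _ d n _ d] assoc_mult_mat_vec[of _ n n _ d])
    have Tx: "T *\<^sub>v x = vec d (\<lambda>i. of_real (L i) * x $ i) + V *\<^sub>v u"
      unfolding T_def Lx[symmetric] VEWx[symmetric] using x VEW by (intro add_mult_distrib_mat_vec) auto
    have Vu: "V *\<^sub>v u \<in> carrier_vec d" using V u by auto
    have "\<sigma> * (x \<bullet>c x) = (T *\<^sub>v x) \<bullet>c x" unfolding x(3) using x by simp
    also have "\<dots> = vec d (\<lambda>i. of_real (L i) * x $ i) \<bullet>c x + (V *\<^sub>v u) \<bullet>c x"
      unfolding Tx using x Vu by (intro add_scalar_prod_distrib) auto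
    also have "vec d (\<lambda>i. of_real (L i) * x $ i) \<bullet>c x = of_real (\<Sum>i<d. L i * (cmod (x $ i))\<^sup>2)"
      unfolding cscalar_prod_sum[OF x(1)] of_real_sum
      by (intro sum.cong) (auto simp: mult.assoc complex_norm_square[symmetric])
    also have "(V *\<^sub>v u) \<bullet>c x = u \<bullet>c y"
      unfolding V_def y_def by (rule cscalar_prod_adjoint[OF W u x(1)])
    also have "u \<bullet>c y = cnj (y \<bullet>c u)"
      unfolding cscalar_prod_sum[OF y] cscalar_prod_sum[OF u] by (simp add: cnj_sum mult.commute)
    also have "y \<bullet>c u = quad_form n C u - w * (u \<bullet>c u)"
    proof -
      have "y = C *\<^sub>v u - w \<cdot>\<^sub>v u"
        unfolding Eu[symmetric] E_def using C(2) u by (rule minus_scalar_mult_vec)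
      then have "y \<bullet>c u = (\<Sum>i<n. ((C *\<^sub>v u) $ i - w * u $ i) * cnj (u $ i))"
        unfolding cscalar_prod_sum[OF u] using u C by (intro sum.cong) auto
      also have "\<dots> = (C *\<^sub>v u) \<bullet>c u - w * (u \<bullet>c u)"
        unfolding cscalar_prod_sum[OF u] by (simp add: left_diff_distrib sum_subtractf sum_distrib_left mult.assoc)
      finally show ?thesis unfolding cscalar_prod_quad_form[OF C(2) u] .
    qed
    finally have "Im (\<sigma> * (x \<bullet>c x)) = Im w * (\<Sum>i<n. (cmod (u $ i))\<^sup>2)"
      unfolding cscalar_prod_self[OF u] using quad_form_self_adjoint[OF C(1), of u] by simp
    then have im: "Im \<sigma> * (\<Sum>i<d. (cmod (x $ i))\<^sup>2) = Im w * (\<Sum>i<n. (cmod (u $ i))\<^sup>2)"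
      unfolding cscalar_prod_self[OF x(1)] by simp
    have xp: "0 < (\<Sum>i<d. (cmod (x $ i))\<^sup>2)"
      using sum_norm_sq_eq_0[OF x(1)] x(2) by (simp add: order_less_le sum_nonneg)
    show "\<sigma> \<in> upper_half_plane"
    proof (rule ccontr)
      assume "\<sigma> \<notin> upper_half_plane"
      then have "Im \<sigma> * (\<Sum>i<d. (cmod (x $ i))\<^sup>2) \<le> 0" using xp by (simp add: mult_nonpos_nonneg)
      moreover have "0 \<le> (\<Sum>i<n. (cmod (u $ i))\<^sup>2)" by (simp add: sum_nonneg)
      ultimately have "(\<Sum>i<n. (cmod (u $ i))\<^sup>2) = 0" using im w0
        by (metis mult_le_0_iff order_antisym_conv not_le)
      then have u0: "u = 0\<^sub>v n" using sum_norm_sq_eq_0[OF u] by simp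
      have "E *\<^sub>v 0\<^sub>v n = 0\<^sub>v n" using E by (intro eq_vecI) auto
      then have y0: "y = 0\<^sub>v n" using Eu u0 by simp
      have "V *\<^sub>v u = 0\<^sub>v d" unfolding u0 using V by (intro eq_vecI) auto
      \<comment> \<open>With \<open>u = 0\<close> the vector \<open>x\<close> is an eigenvector of
        the diagonal part that lies in the kernel of \<open>W\<close>, which the last clause of
        \<open>realization\<close> excludes.\<close>
      then have Lsx: "of_real (L i) * x $ i = \<sigma> * x $ i" if "i < d" for i
        using arg_cong[OF Tx[unfolded x(3)], of "\<lambda>v. v $ i"] that x by auto
      have "\<forall>i<d. x $ i = 0"
      proof (rule ind[of \<sigma>])
        show "\<forall>i<d. complex_of_real (L i) \<noteq> \<sigma> \<longrightarrow> x $ i = 0" using Lsx by auto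
        show "\<forall>p<n. (\<Sum>i<d. x $ i * W $$ (p, i)) = 0"
        proof (intro allI impI)
          fix p assume p: "p < n"
          have "(W *\<^sub>v x) $ p = 0" using y0 p by (simp add: y_def)
          then show "(\<Sum>i<d. x $ i * W $$ (p, i)) = 0"
            unfolding mult_mat_vec_index_sum[OF W x(1) p] by (simp add: mult.commute)
        qed
      qed
      then show False using x by (auto simp: vec_eq_iff)
    qed
  qed
  moreover have "det (F z - w \<cdot>\<^sub>m 1\<^sub>m n) * (\<Prod>i<d. of_real (L i) - 1 / (of_real t - z))
       = det E * (\<Prod>\<sigma>\<leftarrow>\<sigma>s. \<sigma> - 1 / (of_real t - z))" if z: "z \<in> upper_half_plane" for z
  proof -
    define s where "s = 1 / (of_real t - z)"
    have Ims: "0 < Im s" using z by (simp add: s_def Im_divide sum_power2_gt_zero_iff)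
    have Ls: "complex_of_real (L i) - s \<noteq> 0" for i using Ims by (auto simp: complex_eq_iff)
    define X where "X = mat_diag d (\<lambda>i. complex_of_real (L i) - s)"
    define Xi where "Xi = mat_diag d (\<lambda>i. 1 / (complex_of_real (L i) - s))"
    have X: "X \<in> carrier_mat d d" "Xi \<in> carrier_mat d d" by (simp_all add: X_def Xi_def)
    have XX: "X * Xi = 1\<^sub>m d" unfolding X_def Xi_def using Ls by simp
    have XiV: "Xi * V = mat d n (\<lambda>(i, q). cnj (W $$ (q, i)) / (of_real (L i) - s))"
      unfolding Xi_def mat_diag_mult_left[OF V] using W by (intro eq_matI) (auto simp: V_def)
    have 1: "E + W * (Xi * V) = F z - w \<cdot>\<^sub>m 1\<^sub>m n"
    proof (rule eq_matI)
      fix p q assume "p < dim_row (F z - w \<cdot>\<^sub>m 1\<^sub>m n)" "q < dim_col (F z - w \<cdot>\<^sub>m 1\<^sub>m n)"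
      then have pq: "p < n" "q < n" by auto
      have c: "Xi * V \<in> carrier_mat d n" using X V by auto
      have "(W * (Xi * V)) $$ (p, q) = (\<Sum>i<d. W $$ (p, i) * cnj (W $$ (q, i)) / (of_real (L i) - s))"
        unfolding mult_mat_index_sum[OF W c pq] using pq by (intro sum.cong) (auto simp: XiV)
      moreover have "(E + W * (Xi * V)) $$ (p, q) = E $$ (p, q) + (W * (Xi * V)) $$ (p, q)"
        using E W c pq by auto
      ultimately show "(E + W * (Xi * V)) $$ (p, q) = (F z - w \<cdot>\<^sub>m 1\<^sub>m n) $$ (p, q)"
        using pq C Fc[OF z] F[OF z pq] by (simp add: E_def s_def)
    qed (use E W X V in auto)
    have 2: "X + V * (Ei * W) = T - s \<cdot>\<^sub>m 1\<^sub>m d"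
      using VEW X V W by (intro eq_matI) (auto simp: X_def T_def mat_diag_def)
    have "det X * det (E + W * (Xi * V)) = det E * det (X + V * (Ei * W))"
      by (rule det_sylvester[OF X XX E Ei(1,2) W V])
    then show ?thesis unfolding 1 2 s(2) unfolding X_def det_mat_diag s_def by (simp add: mult.commute)
  qed
  ultimately show ?thesis using that[of "det E" \<sigma>s] detE s(1) by blast
qed

text \<open>The factor of \<sigma> vanishes exactly at \<open>t - 1 / \<sigma>\<close>, which lies
  in the upper half plane together with \<sigma>.\<close>

lemma zero_count_linear_factors:
  assumes "set \<sigma>s \<subseteq> upper_half_plane"
  shows "zero_count (\<lambda>z. \<Prod>\<sigma>\<leftarrow>\<sigma>s. \<sigma> * (of_real t - z) - 1) (length \<sigma>s)"
  using assms
proof (induction \<sigma>s)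
  case Nil
  show ?case using zero_count_const[of 1] by simp
next
  case (Cons \<sigma> \<sigma>s)
  have \<sigma>: "0 < Im \<sigma>" "\<sigma> \<noteq> 0" using Cons.prems by auto
  define P where "P = Polynomial.smult (-\<sigma>) [:- (of_real t - 1 / \<sigma>), 1:]"
  have "poly P z = \<sigma> * (of_real t - z) - 1" for z
    using \<sigma> by (simp add: P_def field_simps)
  moreover have "0 < Im (of_real t - 1 / \<sigma>)"
    using \<sigma> by (simp add: Im_divide sum_power2_gt_zero_iff complex_eq_iff)
  then have "size {#z \<in># proots P. 0 < Im z#} = 1"
    using \<sigma> unfolding P_def by (subst proots_smult) (simp_all only: proots_linear_factor, simp_all)
  moreover have "P \<noteq> 0" using \<sigma> by (simp add: P_def)
  ultimately have "zero_count (\<lambda>z. \<sigma> * (of_real t - z) - 1) 1"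
    unfolding zero_count_def by (intro exI[of _ P] exI[of _ "1 :: complex poly"]) auto
  from zero_count_mult[OF this Cons.IH] Cons.prems show ?case by simp
qed

text \<open>Rewritten in \<open>z\<close>, both products of \<open>realization_factor\<close> have
  \<open>d\<close> factors, so the powers of \<open>t - z\<close> cancel. The denominator has only
  real zeros; all zeros come from the \<open>d\<close> eigenvalues \<sigma>.\<close>

lemma realization_zero_count:
  assumes R: "realization n F t C W L d" and Fc: "\<And>z. z \<in> upper_half_plane \<Longrightarrow> F z \<in> carrier_mat n n"
    and w: "w \<in> upper_half_plane"
  shows "zero_count (\<lambda>z. det (F z - w \<cdot>\<^sub>m 1\<^sub>m n)) d"
proof -
  have "Im w \<noteq> 0" using w by simp
  then obtain c \<sigma>s where c: "c \<noteq> 0" "length \<sigma>s = d" "0 < Im w \<Longrightarrow> set \<sigma>s \<subseteq> upper_half_plane"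
    "\<And>z. z \<in> upper_half_plane \<Longrightarrow> det (F z - w \<cdot>\<^sub>m 1\<^sub>m n) * (\<Prod>i<d. of_real (L i) - 1 / (of_real t - z))
       = c * (\<Prod>\<sigma>\<leftarrow>\<sigma>s. \<sigma> - 1 / (of_real t - z))"
    using realization_factor[OF R Fc] by metis
  define Q where "Q z = (\<Prod>i<d. of_real (L i) * (of_real t - z) - 1)" for z :: complex
  have Q0: "Q z \<noteq> 0" if z: "z \<in> upper_half_plane" for z
  proof -
    have "of_real (L i) * (of_real t - z) - 1 \<noteq> 0" for i
      using z by (auto simp: complex_eq_iff)
    then show ?thesis unfolding Q_def by (simp add: prod_zero_iff)
  qed
  have "zero_count Q 0"
  proof (rule zero_count_nonvanishing[OF _ _ Q0])
    show "rational_on_uhp Q" unfolding Q_def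
      by (intro rational_on_uhp_prod rational_on_uhp_diff rational_on_uhp_mult rational_on_uhp_const rational_on_uhp_ident)
    show "continuous_on upper_half_plane Q" unfolding Q_def by (intro continuous_intros)
  qed
  then have zc: "zero_count (\<lambda>z. c * (\<Prod>\<sigma>\<leftarrow>\<sigma>s. \<sigma> * (of_real t - z) - 1) * (1 / Q z)) (0 + length \<sigma>s + 0)"
    using c w by (intro zero_count_mult zero_count_const zero_count_linear_factors zero_count_inverse) auto
  have eq: "c * (\<Prod>\<sigma>\<leftarrow>\<sigma>s. \<sigma> * (of_real t - z) - 1) * (1 / Q z) = det (F z - w \<cdot>\<^sub>m 1\<^sub>m n)"
    if z: "z \<in> upper_half_plane" for z
  proof -
    define u where "u = of_real t - z"
    have u: "u \<noteq> 0" using z by (auto simp: u_def complex_eq_iff)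
    have "(\<Prod>\<sigma>\<leftarrow>xs. \<sigma> - 1 / u) = (\<Prod>\<sigma>\<leftarrow>xs. \<sigma> * u - 1) / u ^ length xs" for xs
      by (induction xs) (use u in \<open>auto simp: field_simps\<close>)
    then have 1: "(\<Prod>\<sigma>\<leftarrow>\<sigma>s. \<sigma> - 1 / u) = (\<Prod>\<sigma>\<leftarrow>\<sigma>s. \<sigma> * u - 1) / u ^ d" using c(2) by simp
    have "(\<Prod>i<d. of_real (L i) - 1 / u) = (\<Prod>i<d. (of_real (L i) * u - 1) / u)"
      using u by (intro prod.cong) (auto simp: field_simps)
    also have "\<dots> = Q z / u ^ d" by (simp add: prod_dividef Q_def u_def)
    finally have "det (F z - w \<cdot>\<^sub>m 1\<^sub>m n) * (Q z / u ^ d) = c * ((\<Prod>\<sigma>\<leftarrow>\<sigma>s. \<sigma> * u - 1) / u ^ d)"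
      using c(4)[OF z] 1 by (simp add: u_def)
    then have "det (F z - w \<cdot>\<^sub>m 1\<^sub>m n) * Q z = c * (\<Prod>\<sigma>\<leftarrow>\<sigma>s. \<sigma> * u - 1)" using u by simp
    then show ?thesis using Q0[OF z] unfolding u_def by (simp add: divide_simps)
  qed
  show ?thesis using zero_count_cong[OF eq zc] c(2) by simp
qed

text \<open>For a scalar function this says that \<open>F\<close> stays away from \<open>w\<close> near the boundary; comparing with
  \<open>cnj w\<close> keeps the condition meaningful when some eigenvalues are large.\<close>

definition proper_at :: "nat \<Rightarrow> (complex \<Rightarrow> complex mat) \<Rightarrow> complex \<Rightarrow> bool" where
  "proper_at n F w \<longleftrightarrow> (\<exists>K \<delta>. compact K \<and> K \<subseteq> upper_half_plane \<and> 0 < \<delta> \<and>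
     (\<forall>z\<in>upper_half_plane - K. \<delta> * cmod (det (F z - cnj w \<cdot>\<^sub>m 1\<^sub>m n)) \<le> cmod (det (F z - w \<cdot>\<^sub>m 1\<^sub>m n))))"

text \<open>If \<open>s\<close> keeps distance \<rho> from \<sigma>, then
  \<open>cmod (\<tau> - s)\<close> is at most \<open>1 + cmod (\<tau> - \<sigma>) / \<rho>\<close>
  times \<open>cmod (\<sigma> - s)\<close>, however large \<open>s\<close> is. Pairing the factors
  of the two products gives a constant that does not depend on \<open>s\<close>.\<close>

lemma prod_list_compare:
  assumes "length \<sigma>s = length \<tau>s" "\<And>\<sigma>. \<sigma> \<in> set \<sigma>s \<Longrightarrow> (0::real) < \<rho> \<sigma>"
  shows "\<exists>\<eta>>0. \<forall>s. (\<forall>\<sigma>\<in>set \<sigma>s. \<rho> \<sigma> \<le> cmod (\<sigma> - s)) \<longrightarrow>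
    \<eta> * cmod (\<Prod>\<tau>\<leftarrow>\<tau>s. \<tau> - s) \<le> cmod (\<Prod>\<sigma>\<leftarrow>\<sigma>s. \<sigma> - s)"
  using assms
proof (induction \<sigma>s \<tau>s rule: list_induct2)
  case Nil
  show ?case by (intro exI[of _ 1]) auto
next
  case (Cons \<sigma> \<sigma>s \<tau> \<tau>s)
  then obtain \<eta> where \<eta>: "0 < \<eta>" "\<And>s. (\<forall>\<sigma>\<in>set \<sigma>s. \<rho> \<sigma> \<le> cmod (\<sigma> - s)) \<Longrightarrow>
    \<eta> * cmod (\<Prod>\<tau>\<leftarrow>\<tau>s. \<tau> - s) \<le> cmod (\<Prod>\<sigma>\<leftarrow>\<sigma>s. \<sigma> - s)" by auto
  define k where "k = 1 + cmod (\<tau> - \<sigma>) / \<rho> \<sigma>"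
  have \<rho>: "0 < \<rho> \<sigma>" using Cons.prems by simp
  have k: "1 \<le> k" using \<rho> by (simp add: k_def)
  show ?case
  proof (intro exI[of _ "\<eta> / k"] conjI allI impI)
    show "0 < \<eta> / k" using \<eta> k by simp
    fix s assume s: "\<forall>x\<in>set (\<sigma> # \<sigma>s). \<rho> x \<le> cmod (x - s)"
    have "cmod (\<tau> - s) \<le> cmod (\<sigma> - s) + cmod (\<tau> - \<sigma>)"
      using norm_triangle_ineq[of "\<sigma> - s" "\<tau> - \<sigma>"] by simp
    also have "cmod (\<tau> - \<sigma>) = cmod (\<tau> - \<sigma>) / \<rho> \<sigma> * \<rho> \<sigma>" using \<rho> by simp
    also have "\<dots> \<le> cmod (\<tau> - \<sigma>) / \<rho> \<sigma> * cmod (\<sigma> - s)" using s \<rho> by (intro mult_left_mono) auto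
    finally have 1: "cmod (\<tau> - s) \<le> k * cmod (\<sigma> - s)" by (simp add: k_def algebra_simps)
    have 2: "\<eta> * cmod (\<Prod>\<tau>\<leftarrow>\<tau>s. \<tau> - s) \<le> cmod (\<Prod>\<sigma>\<leftarrow>\<sigma>s. \<sigma> - s)" using \<eta>(2) s by simp
    have "cmod (\<tau> - s) * (\<eta> * cmod (\<Prod>\<tau>\<leftarrow>\<tau>s. \<tau> - s)) \<le> (k * cmod (\<sigma> - s)) * cmod (\<Prod>\<sigma>\<leftarrow>\<sigma>s. \<sigma> - s)"
      using 1 2 \<eta>(1) k by (intro mult_mono) auto
    then have "\<eta> * (cmod (\<tau> - s) * cmod (\<Prod>\<tau>\<leftarrow>\<tau>s. \<tau> - s)) \<le> k * (cmod (\<sigma> - s) * cmod (\<Prod>\<sigma>\<leftarrow>\<sigma>s. \<sigma> - s))"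
      by (simp add: mult_ac)
    then show "\<eta> / k * cmod (\<Prod>\<tau>\<leftarrow>\<tau> # \<tau>s. \<tau> - s) \<le> cmod (\<Prod>\<sigma>\<leftarrow>\<sigma> # \<sigma>s. \<sigma> - s)"
      unfolding list.map prod_list.Cons norm_mult using k by (simp add: field_simps)
  qed
qed

text \<open>By \<open>realization_factor\<close> the determinants at \<open>w\<close> and
  \<open>cnj w\<close> share their denominator, and their numerators have the same number of linear
  factors in \<open>s\<close>. Outside disks of radius \<open>Im \<sigma> / 2\<close> around the
  zeros for \<open>w\<close> the two numerators are comparable; \<open>K\<close> is the image of
  these disks in the variable \<open>z\<close>.\<close>

lemma realization_proper:
  assumes R: "realization n F t C W L d" and Fc: "\<And>z. z \<in> upper_half_plane \<Longrightarrow> F z \<in> carrier_mat n n"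
    and w: "w \<in> upper_half_plane"
  shows "proper_at n F w"
proof -
  have im: "Im w \<noteq> 0" "Im (cnj w) \<noteq> 0" using w by simp_all
  obtain c \<sigma>s where c: "c \<noteq> 0" "length \<sigma>s = d" "0 < Im w \<Longrightarrow> set \<sigma>s \<subseteq> upper_half_plane"
    "\<And>z. z \<in> upper_half_plane \<Longrightarrow> det (F z - w \<cdot>\<^sub>m 1\<^sub>m n) * (\<Prod>i<d. of_real (L i) - 1 / (of_real t - z))
       = c * (\<Prod>\<sigma>\<leftarrow>\<sigma>s. \<sigma> - 1 / (of_real t - z))"
    using realization_factor[OF R Fc im(1)] by metis
  obtain c' \<tau>s where c': "c' \<noteq> 0" "length \<tau>s = d"
    "\<And>z. z \<in> upper_half_plane \<Longrightarrow> det (F z - cnj w \<cdot>\<^sub>m 1\<^sub>m n) * (\<Prod>i<d. of_real (L i) - 1 / (of_real t - z))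
       = c' * (\<Prod>\<tau>\<leftarrow>\<tau>s. \<tau> - 1 / (of_real t - z))"
    using realization_factor[OF R Fc im(2)] by metis
  have \<sigma>U: "set \<sigma>s \<subseteq> upper_half_plane" using c(3) w by simp
  then have "\<And>\<sigma>. \<sigma> \<in> set \<sigma>s \<Longrightarrow> 0 < Im \<sigma> / 2" by auto
  then obtain \<eta> where \<eta>: "0 < \<eta>" "\<And>s. (\<forall>\<sigma>\<in>set \<sigma>s. Im \<sigma> / 2 \<le> cmod (\<sigma> - s)) \<Longrightarrow>
    \<eta> * cmod (\<Prod>\<tau>\<leftarrow>\<tau>s. \<tau> - s) \<le> cmod (\<Prod>\<sigma>\<leftarrow>\<sigma>s. \<sigma> - s)"
    using prod_list_compare[of \<sigma>s \<tau>s "\<lambda>\<sigma>. Im \<sigma> / 2"] c(2) c'(2) by auto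
  define Ks where "Ks = (\<Union>\<sigma>\<in>set \<sigma>s. cball \<sigma> (Im \<sigma> / 2))"
  have Ks: "compact Ks" unfolding Ks_def by (intro compact_UN) auto
  have KsU: "Ks \<subseteq> upper_half_plane"
  proof
    fix s assume "s \<in> Ks"
    then obtain \<sigma> where \<sigma>: "\<sigma> \<in> set \<sigma>s" "cmod (\<sigma> - s) \<le> Im \<sigma> / 2" by (auto simp: Ks_def dist_norm)
    then have "\<bar>Im (\<sigma> - s)\<bar> \<le> Im \<sigma> / 2" using abs_Im_le_cmod order_trans by blast
    moreover have "0 < Im \<sigma>" using \<sigma>(1) \<sigma>U by auto
    ultimately have "\<bar>Im \<sigma> - Im s\<bar> \<le> Im \<sigma> / 2" "0 < Im \<sigma>" by simp_all
    then have "0 < Im s" by linarith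
    then show "s \<in> upper_half_plane" by simp
  qed
  define K where "K = (\<lambda>s. of_real t - 1 / s) ` Ks"
  have "compact K" unfolding K_def
    using KsU by (intro compact_continuous_image Ks continuous_intros) auto
  moreover have "K \<subseteq> upper_half_plane"
  proof
    fix z assume "z \<in> K"
    then obtain s where "s \<in> upper_half_plane" "z = of_real t - 1 / s" using KsU by (auto simp: K_def)
    then show "z \<in> upper_half_plane"
      by (auto simp: Im_divide sum_power2_gt_zero_iff)
  qed
  moreover have "\<eta> * cmod c / cmod c' * cmod (det (F z - cnj w \<cdot>\<^sub>m 1\<^sub>m n)) \<le> cmod (det (F z - w \<cdot>\<^sub>m 1\<^sub>m n))"
    if z: "z \<in> upper_half_plane - K" for z
  proof -
    define s where "s = 1 / (of_real t - z)"
    have tz: "of_real t - z \<noteq> 0" using z by (auto simp: complex_eq_iff)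
    have zs: "z = of_real t - 1 / s" using tz by (simp add: s_def)
    have "s \<notin> Ks" using z zs by (auto simp: K_def)
    then have "\<forall>\<sigma>\<in>set \<sigma>s. Im \<sigma> / 2 \<le> cmod (\<sigma> - s)" by (auto simp: Ks_def dist_norm)
    then have le: "\<eta> * cmod (\<Prod>\<tau>\<leftarrow>\<tau>s. \<tau> - s) \<le> cmod (\<Prod>\<sigma>\<leftarrow>\<sigma>s. \<sigma> - s)" by (rule \<eta>(2))
    define \<Delta> where "\<Delta> = (\<Prod>i<d. complex_of_real (L i) - s)"
    have "Im s \<noteq> 0" using z by (auto simp: s_def Im_divide sum_power2_eq_zero_iff)
    then have "complex_of_real (L i) - s \<noteq> 0" for i by (auto simp: complex_eq_iff)
    then have \<Delta>: "0 < cmod \<Delta>" by (simp add: \<Delta>_def prod_zero_iff)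
    have a: "cmod (det (F z - w \<cdot>\<^sub>m 1\<^sub>m n)) * cmod \<Delta> = cmod c * cmod (\<Prod>\<sigma>\<leftarrow>\<sigma>s. \<sigma> - s)"
      using arg_cong[OF c(4)[of z], of cmod] z by (simp add: norm_mult \<Delta>_def s_def)
    have b: "cmod (det (F z - cnj w \<cdot>\<^sub>m 1\<^sub>m n)) * cmod \<Delta> = cmod c' * cmod (\<Prod>\<tau>\<leftarrow>\<tau>s. \<tau> - s)"
      using arg_cong[OF c'(3)[of z], of cmod] z by (simp add: norm_mult \<Delta>_def s_def)
    have "(\<eta> * cmod c / cmod c' * cmod (det (F z - cnj w \<cdot>\<^sub>m 1\<^sub>m n))) * cmod \<Delta>
      = cmod c * (\<eta> * cmod (\<Prod>\<tau>\<leftarrow>\<tau>s. \<tau> - s))"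
      using b c'(1) by (simp add: field_simps)
    also have "\<dots> \<le> cmod c * cmod (\<Prod>\<sigma>\<leftarrow>\<sigma>s. \<sigma> - s)" using le by (intro mult_left_mono) auto
    also have "\<dots> = cmod (det (F z - w \<cdot>\<^sub>m 1\<^sub>m n)) * cmod \<Delta>" using a by simp
    finally show ?thesis using \<Delta> by (rule mult_right_le_imp_le)
  qed
  moreover have "0 < \<eta> * cmod c / cmod c'" using \<eta>(1) c(1) c'(1) by simp
  ultimately show ?thesis unfolding proper_at_def by blast
qed

text \<open>The zero count at \<i> does not mention the representation, so all representations have
  the same rank sum and the definite description in \<open>Pick_deg\<close> denotes it.\<close>

lemma rational_Pick_degree:
  assumes rat: "rational_Pick n F" and Fc: "\<And>z. z \<in> upper_half_plane \<Longrightarrow> F z \<in> carrier_mat n n"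
  obtains d where "Pick_deg n F = enat d"
    "\<And>w. w \<in> upper_half_plane \<Longrightarrow> zero_count (\<lambda>z. det (F z - w \<cdot>\<^sub>m 1\<^sub>m n)) d"
    "\<And>w. w \<in> upper_half_plane \<Longrightarrow> proper_at n F w"
    "d = 0 \<Longrightarrow> \<exists>C. self_adjoint n C \<and> (\<forall>z\<in>upper_half_plane. F z = C)"
proof -
  obtain C D m l A where rep: "rational_rep n F C D m l A" using rat by (auto simp: rational_Pick_def)
  define d where "d = vec_space.rank n D + (\<Sum>k=1..m. vec_space.rank n (A k))"
  obtain t C' W L where R: "realization n F t C' W L d"
    unfolding d_def by (rule rational_rep_realization[OF rep])
  have zc: "zero_count (\<lambda>z. det (F z - w \<cdot>\<^sub>m 1\<^sub>m n)) d" if "w \<in> upper_half_plane" for w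
    using realization_zero_count[OF R Fc that] .
  have uniq: "e = d" if rep': "rational_rep n F C D m l A" and e: "e = vec_space.rank n D + (\<Sum>k=1..m. vec_space.rank n (A k))"
    for C D m l A e
  proof -
    obtain t C' W L where "realization n F t C' W L e"
      unfolding e by (rule rational_rep_realization[OF rep'])
    then have "zero_count (\<lambda>z. det (F z - \<i> \<cdot>\<^sub>m 1\<^sub>m n)) e" by (intro realization_zero_count Fc) auto
    then show ?thesis using zc[of \<i>] by (intro zero_count_unique) auto
  qed
  have "(THE d. \<exists>C D m l A. rational_rep n F C D m l A \<and>
             d = vec_space.rank n D + (\<Sum>k=1..m. vec_space.rank n (A k))) = d"
    by (rule the_equality) (use rep d_def uniq in blast)+
  then have deg: "Pick_deg n F = enat d" using rat by (simp add: Pick_deg_def)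
  have const: "\<exists>C. self_adjoint n C \<and> (\<forall>z\<in>upper_half_plane. F z = C)" if d0: "d = 0"
  proof (intro exI[of _ C'] conjI ballI)
    show "self_adjoint n C'" using R by (simp add: realization_def)
    then have C'c: "C' \<in> carrier_mat n n" by (simp add: self_adjoint_def)
    fix z assume z: "z \<in> upper_half_plane"
    show "F z = C'"
    proof (rule eq_matI)
      fix i j assume "i < dim_row C'" "j < dim_col C'"
      then have "i < n" "j < n" using C'c by auto
      then show "F z $$ (i, j) = C' $$ (i, j)" using R z d0 by (simp add: realization_def)
    qed (use Fc[OF z] C'c in auto)
  qed
  show ?thesis
    by (rule that[OF deg zc realization_proper[OF R Fc] const])
qed

text \<open>Excludes degree 0 for a nontrivial space: a self-adjoint matrix of positive size has an
  eigenvalue, and that eigenvalue is real.\<close>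

lemma rational_Pick_degree_pos:
  assumes n: "0 < n" and C: "self_adjoint n C" and F: "F \<i> = C"
    and spec: "\<And>w. det (F \<i> - w \<cdot>\<^sub>m 1\<^sub>m n) = 0 \<Longrightarrow> w \<in> upper_half_plane"
  shows False
proof -
  have Cc: "C \<in> carrier_mat n n" using C by (simp add: self_adjoint_def)
  obtain \<sigma>s where s: "length \<sigma>s = n" "\<And>w. det (C - w \<cdot>\<^sub>m 1\<^sub>m n) = (\<Prod>\<sigma>\<leftarrow>\<sigma>s. \<sigma> - w)"
    using det_minus_scalar_eigenvalues[OF Cc] by metis
  obtain \<sigma> where "\<sigma> \<in> set \<sigma>s" using s(1) n by (cases \<sigma>s) auto
  then have d0: "det (C - \<sigma> \<cdot>\<^sub>m 1\<^sub>m n) = 0" unfolding s(2) by (auto simp: prod_list_zero_iff)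
  then have "\<sigma> \<in> upper_half_plane" using spec F by simp
  then show False using det_self_adjoint_minus_nonreal[OF C, of \<sigma>] d0 by simp
qed

subsection \<open>Proper Pick functions are rational\<close>

text \<open>Conjugation with Cayley transforms centred at \<open>b\<close> and \<open>f b\<close>
  reduces this to Schwarz's lemma. The ratio is the pseudohyperbolic distance; the comparison of
  \<open>w\<close> with \<open>cnj w\<close> in \<open>proper_at\<close> is a product of such ratios
  over the eigenvalues.\<close>

lemma Schwarz_Pick_upper_half_plane:
  assumes hol: "f holomorphic_on upper_half_plane" and f: "f ` upper_half_plane \<subseteq> upper_half_plane"
    and a: "a \<in> upper_half_plane" and b: "b \<in> upper_half_plane"
  shows "cmod (f a - f b) / cmod (f a - cnj (f b)) \<le> cmod (a - b) / cmod (a - cnj b)"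
proof -
  have fb: "0 < Im (f b)" "0 < Im (f a)" using f a b by force+
  \<comment> \<open>The inverse of the Cayley transform \<open>(a - b) / (a - cnj b)\<close> in the
    variable \<open>a\<close>; it maps the disk to the half plane and 0 to \<open>b\<close>.\<close>
  define \<psi> where "\<psi> \<zeta> = (b - cnj b * \<zeta>) / (1 - \<zeta>)" for \<zeta>
  have \<psi>U: "\<psi> \<zeta> \<in> upper_half_plane" if \<zeta>: "cmod \<zeta> < 1" for \<zeta>
  proof -
    have n: "1 - \<zeta> \<noteq> 0" using \<zeta> by auto
    have "\<psi> \<zeta> = (b - cnj b * \<zeta>) * cnj (1 - \<zeta>) / of_real ((cmod (1 - \<zeta>))\<^sup>2)"
      using n unfolding \<psi>_def complex_norm_square by (simp add: divide_simps)
    then have "Im (\<psi> \<zeta>) = Im ((b - cnj b * \<zeta>) * cnj (1 - \<zeta>)) / (cmod (1 - \<zeta>))\<^sup>2"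
      by (simp only: Im_divide_of_real)
    also have "Im ((b - cnj b * \<zeta>) * cnj (1 - \<zeta>)) = Im b * (1 - (cmod \<zeta>)\<^sup>2)"
      unfolding cmod_power2 by (simp add: power2_eq_square algebra_simps)
    finally have "Im (\<psi> \<zeta>) = Im b * (1 - (cmod \<zeta>)\<^sup>2) / (cmod (1 - \<zeta>))\<^sup>2" .
    moreover have "(cmod \<zeta>)\<^sup>2 < 1" using \<zeta> by (simp add: power_less_one_iff)
    ultimately show ?thesis using b n by simp
  qed
  define \<phi> where "\<phi> \<zeta> = (f (\<psi> \<zeta>) - f b) / (f (\<psi> \<zeta>) - cnj (f b))" for \<zeta>
  have ratio: "cmod (w - f b) < cmod (w - cnj (f b))" if "w \<in> upper_half_plane" for w
  proof -
    have "(cmod (w - cnj (f b)))\<^sup>2 - (cmod (w - f b))\<^sup>2 = 4 * Im w * Im (f b)"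
      unfolding cmod_power2 by (simp add: power2_eq_square algebra_simps)
    then have "(cmod (w - f b))\<^sup>2 < (cmod (w - cnj (f b)))\<^sup>2" using mult_pos_pos[of "Im w" "Im (f b)"] that fb
      unfolding mem_upper_half_plane by linarith
    then show ?thesis by (rule power_less_imp_less_base) simp
  qed
  have den: "f z - cnj (f b) \<noteq> 0" if "z \<in> upper_half_plane" for z
    using ratio[of "f z"] f that by force
  have \<phi>hol: "\<phi> holomorphic_on ball 0 1"
  proof -
    have "\<psi> holomorphic_on ball 0 1" unfolding \<psi>_def by (intro holomorphic_intros) auto
    then have "(f \<circ> \<psi>) holomorphic_on ball 0 1"
      by (rule holomorphic_on_compose_gen[OF _ hol]) (use \<psi>U in auto)
    then have "(\<lambda>\<zeta>. f (\<psi> \<zeta>)) holomorphic_on ball 0 1" by (simp add: o_def)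
    then show ?thesis unfolding \<phi>_def
      using den \<psi>U by (intro holomorphic_intros) auto
  qed
  have \<phi>0: "\<phi> 0 = 0" by (simp add: \<phi>_def \<psi>_def)
  have \<phi>1: "cmod (\<phi> \<zeta>) < 1" if "cmod \<zeta> < 1" for \<zeta>
  proof -
    have "f (\<psi> \<zeta>) \<in> upper_half_plane" using f \<psi>U[OF that] by blast
    then show ?thesis using ratio[of "f (\<psi> \<zeta>)"] norm_ge_zero[of "f (\<psi> \<zeta>) - f b"]
      unfolding \<phi>_def norm_divide by (metis divide_less_eq_1_pos le_less_trans)
  qed
  define \<zeta> where "\<zeta> = (a - b) / (a - cnj b)"
  have ab: "a - cnj b \<noteq> 0" using a b by (auto simp: complex_eq_iff)
  have bb: "b - cnj b \<noteq> 0" using b by (auto simp: complex_eq_iff)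
  have "(cmod (a - cnj b))\<^sup>2 - (cmod (a - b))\<^sup>2 = 4 * Im a * Im b"
    unfolding cmod_power2 by (simp add: power2_eq_square algebra_simps)
  then have "(cmod (a - b))\<^sup>2 < (cmod (a - cnj b))\<^sup>2" using mult_pos_pos[of "Im a" "Im b"] a b
    unfolding mem_upper_half_plane by linarith
  then have "cmod (a - b) < cmod (a - cnj b)" by (rule power_less_imp_less_base) simp
  then have \<zeta>1: "cmod \<zeta> < 1" using ab by (simp add: \<zeta>_def norm_divide)
  have "1 - \<zeta> = (b - cnj b) / (a - cnj b)" using ab by (simp add: \<zeta>_def field_simps)
  moreover have "b - cnj b * \<zeta> = a * (b - cnj b) / (a - cnj b)" using ab by (simp add: \<zeta>_def field_simps)
  ultimately have "\<psi> \<zeta> = a" using ab bb by (simp add: \<psi>_def)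
  then have "cmod (\<phi> \<zeta>) = cmod (f a - f b) / cmod (f a - cnj (f b))" by (simp add: \<phi>_def norm_divide)
  moreover have "cmod (\<phi> \<zeta>) \<le> cmod \<zeta>" by (rule Schwarz_Lemma(1)[OF \<phi>hol \<phi>0 \<phi>1 \<zeta>1])
  ultimately show ?thesis by (simp add: \<zeta>_def norm_divide)
qed

section \<open>Determinants and adjugates as polynomials in the entries\<close>

lemma det_as_sum:
  fixes A :: "complex mat"
  assumes "A \<in> carrier_mat n n"
  shows "det A = (\<Sum>p | p permutes {0..<n}. signof p * (\<Prod>i = 0..<n. A $$ (i, p i)))"
  using assms by (simp add: det_def)

lemma permutes_lt: "p permutes {0..<n::nat} \<Longrightarrow> i < n \<Longrightarrow> p i < n"
  using permutes_in_image[of p "{0..<n}" i] by simp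

lemma holomorphic_on_det:
  assumes A: "\<And>z. z \<in> S \<Longrightarrow> A z \<in> carrier_mat n n"
    and "\<And>i j. i < n \<Longrightarrow> j < n \<Longrightarrow> (\<lambda>z. A z $$ (i, j)) holomorphic_on S"
  shows "(\<lambda>z. det (A z)) holomorphic_on S"
proof (rule holomorphic_transform)
  show "(\<lambda>z. \<Sum>p | p permutes {0..<n}. signof p * (\<Prod>i = 0..<n. A z $$ (i, p i))) holomorphic_on S"
    using assms(2) by (intro holomorphic_intros) (auto simp: permutes_lt)
qed (simp add: det_as_sum[OF A])

lemma continuous_on_det:
  assumes A: "\<And>z. z \<in> S \<Longrightarrow> A z \<in> carrier_mat n n"
    and "\<And>i j. i < n \<Longrightarrow> j < n \<Longrightarrow> continuous_on S (\<lambda>z. A z $$ (i, j) :: complex)"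
  shows "continuous_on S (\<lambda>z. det (A z))"
proof -
  have "continuous_on S (\<lambda>z. \<Sum>p | p permutes {0..<n}. signof p * (\<Prod>i = 0..<n. A z $$ (i, p i)))"
    using assms(2) by (intro continuous_intros) (auto simp: permutes_lt)
  then show ?thesis by (rule continuous_on_eq) (simp add: det_as_sum[OF A])
qed

lemma rational_on_uhp_det:
  assumes A: "\<And>z. z \<in> upper_half_plane \<Longrightarrow> A z \<in> carrier_mat n n"
    and "\<And>i j. i < n \<Longrightarrow> j < n \<Longrightarrow> rational_on_uhp (\<lambda>z. A z $$ (i, j))"
  shows "rational_on_uhp (\<lambda>z. det (A z))"
proof -
  have "rational_on_uhp (\<lambda>z. \<Sum>p | p permutes {0..<n}. signof p * (\<Prod>i = 0..<n. A z $$ (i, p i)))"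
    using assms(2) by (intro rational_on_uhp_sum rational_on_uhp_mult rational_on_uhp_const rational_on_uhp_prod)
      (auto simp: permutes_lt)
  then show ?thesis by (subst rational_on_uhp_cong) (simp_all add: det_as_sum[OF A])
qed

lemma tendsto_det:
  assumes A: "eventually (\<lambda>t. A t \<in> carrier_mat n n) G" and B: "B \<in> carrier_mat n n"
    and "\<And>i j. i < n \<Longrightarrow> j < n \<Longrightarrow> ((\<lambda>t. A t $$ (i, j)) \<longlongrightarrow> (B $$ (i, j) :: complex)) G"
  shows "((\<lambda>t. det (A t)) \<longlongrightarrow> det B) G"
proof -
  have "((\<lambda>t. \<Sum>p | p permutes {0..<n}. signof p * (\<Prod>i = 0..<n. A t $$ (i, p i))) \<longlongrightarrow> det B) G"
    unfolding det_as_sum[OF B] using assms(3) by (intro tendsto_intros) (auto simp: permutes_lt)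
  moreover have "eventually (\<lambda>t. (\<Sum>p | p permutes {0..<n}. signof p * (\<Prod>i = 0..<n. A t $$ (i, p i))) = det (A t)) G"
    using A by eventually_elim (simp add: det_as_sum)
  ultimately show ?thesis by (rule Lim_transform_eventually)
qed

lemma det_bounded:
  obtains C where "\<And>A :: complex mat. A \<in> carrier_mat n n \<Longrightarrow> (\<And>i j. i < n \<Longrightarrow> j < n \<Longrightarrow> cmod (A $$ (i, j)) \<le> B)
     \<Longrightarrow> cmod (det A) \<le> C"
proof
  fix A :: "complex mat" assume A: "A \<in> carrier_mat n n" and B: "\<And>i j. i < n \<Longrightarrow> j < n \<Longrightarrow> cmod (A $$ (i, j)) \<le> B"
  have "cmod (det A) \<le> (\<Sum>p | p permutes {0..<n}. cmod (signof p * (\<Prod>i = 0..<n. A $$ (i, p i))))"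
    unfolding det_as_sum[OF A] by (rule norm_sum)
  also have "\<dots> \<le> (\<Sum>p | p permutes {0..<n}. 1 * (\<Prod>i = 0..<n. B))"
    using B permutes_lt
    by (intro sum_mono) (auto simp: norm_mult prod_norm[symmetric] sign_def intro!: prod_mono simp del: prod_constant)
  finally show "cmod (det A) \<le> (\<Sum>p | p permutes {0..<n}. 1 * (\<Prod>i = 0..<n. B))" .
qed

lemma adj_mat_index:
  fixes A :: "complex mat"
  assumes "A \<in> carrier_mat n n" "i < n" "j < n"
  shows "adj_mat A $$ (i, j) = (-1) ^ (j + i) * det (mat_delete A j i)"
  using assms by (simp add: adj_mat_def cofactor_def)

lemma mat_delete_entry:
  assumes "A \<in> carrier_mat n n" "i < n - 1" "j < n - 1"
  shows "mat_delete A k l $$ (i, j) = A $$ (if i < k then i else Suc i, if j < l then j else Suc j)"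
  using assms by (auto simp: mat_delete_def)

lemma mat_delete_carrier': "A \<in> carrier_mat n n \<Longrightarrow> mat_delete A k l \<in> carrier_mat (n - 1) (n - 1)"
  by (auto simp: mat_delete_def)

lemma holomorphic_on_adj_mat:
  assumes A: "\<And>z. z \<in> S \<Longrightarrow> A z \<in> carrier_mat n n"
    and hol: "\<And>i j. i < n \<Longrightarrow> j < n \<Longrightarrow> (\<lambda>z. A z $$ (i, j)) holomorphic_on S" and ij: "i < n" "j < n"
  shows "(\<lambda>z. adj_mat (A z) $$ (i, j)) holomorphic_on S"
proof (rule holomorphic_transform)
  have "(\<lambda>z. mat_delete (A z) j i $$ (k, l)) holomorphic_on S" if "k < n - 1" "l < n - 1" for k l
    by (rule holomorphic_transform[OF hol[of "if k < j then k else Suc k" "if l < i then l else Suc l"]])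
      (use that in \<open>simp_all add: mat_delete_entry[OF A that] split del: if_split, auto\<close>)
  then show "(\<lambda>z. (-1) ^ (j + i) * det (mat_delete (A z) j i)) holomorphic_on S"
    using A by (intro holomorphic_intros holomorphic_on_det[where n = "n - 1"] mat_delete_carrier') auto
qed (simp add: adj_mat_index[OF A ij])

lemma rational_on_uhp_adj_mat:
  assumes A: "\<And>z. z \<in> upper_half_plane \<Longrightarrow> A z \<in> carrier_mat n n"
    and rat: "\<And>i j. i < n \<Longrightarrow> j < n \<Longrightarrow> rational_on_uhp (\<lambda>z. A z $$ (i, j))" and ij: "i < n" "j < n"
  shows "rational_on_uhp (\<lambda>z. adj_mat (A z) $$ (i, j))"
proof -
  have "rational_on_uhp (\<lambda>z. mat_delete (A z) j i $$ (k, l))" if "k < n - 1" "l < n - 1" for k l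
  proof -
    have "rational_on_uhp (\<lambda>z. A z $$ (if k < j then k else Suc k, if l < i then l else Suc l))"
      using that by (intro rat) auto
    then show ?thesis by (subst rational_on_uhp_cong) (simp_all add: mat_delete_entry[OF A that] split del: if_split)
  qed
  then have "rational_on_uhp (\<lambda>z. (-1) ^ (j + i) * det (mat_delete (A z) j i))"
    using A by (intro rational_on_uhp_mult rational_on_uhp_const rational_on_uhp_det[where n = "n - 1"] mat_delete_carrier') auto
  then show ?thesis by (subst rational_on_uhp_cong) (simp_all add: adj_mat_index[OF A ij])
qed

lemma tendsto_adj_mat:
  assumes A: "eventually (\<lambda>t. A t \<in> carrier_mat n n) G" and B: "B \<in> carrier_mat n n"
    and lim: "\<And>i j. i < n \<Longrightarrow> j < n \<Longrightarrow> ((\<lambda>t. A t $$ (i, j)) \<longlongrightarrow> (B $$ (i, j) :: complex)) G"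
    and ij: "i < n" "j < n"
  shows "((\<lambda>t. adj_mat (A t) $$ (i, j)) \<longlongrightarrow> adj_mat B $$ (i, j)) G"
proof -
  have "((\<lambda>t. mat_delete (A t) j i $$ (k, l)) \<longlongrightarrow> mat_delete B j i $$ (k, l)) G" if kl: "k < n - 1" "l < n - 1" for k l
  proof -
    have "((\<lambda>t. A t $$ (if k < j then k else Suc k, if l < i then l else Suc l)) \<longlongrightarrow> mat_delete B j i $$ (k, l)) G"
      unfolding mat_delete_entry[OF B kl] using kl by (intro lim) auto
    moreover have "eventually (\<lambda>t. A t $$ (if k < j then k else Suc k, if l < i then l else Suc l)
        = mat_delete (A t) j i $$ (k, l)) G"
      using A by eventually_elim (simp add: mat_delete_entry[OF _ kl] split del: if_split)
    ultimately show ?thesis by (rule Lim_transform_eventually)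
  qed
  then have "((\<lambda>t. (-1) ^ (j + i) * det (mat_delete (A t) j i)) \<longlongrightarrow> adj_mat B $$ (i, j)) G"
    unfolding adj_mat_index[OF B ij] using A B
    by (intro tendsto_intros tendsto_det[where n = "n - 1"] mat_delete_carrier')
       (auto elim!: eventually_mono intro: mat_delete_carrier')
  moreover have "eventually (\<lambda>t. (-1) ^ (j + i) * det (mat_delete (A t) j i) = adj_mat (A t) $$ (i, j)) G"
    using A by eventually_elim (simp add: adj_mat_index[OF _ ij])
  ultimately show ?thesis by (rule Lim_transform_eventually)
qed

lemma adj_mat_bounded:
  obtains C where "\<And>A :: complex mat. A \<in> carrier_mat n n \<Longrightarrow> (\<And>i j. i < n \<Longrightarrow> j < n \<Longrightarrow> cmod (A $$ (i, j)) \<le> B)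
     \<Longrightarrow> (\<And>i j. i < n \<Longrightarrow> j < n \<Longrightarrow> cmod (adj_mat A $$ (i, j)) \<le> C)"
proof (rule det_bounded[where n = "n - 1" and B = B])
  fix C assume C: "\<And>A :: complex mat. A \<in> carrier_mat (n - 1) (n - 1) \<Longrightarrow>
     (\<And>i j. i < n - 1 \<Longrightarrow> j < n - 1 \<Longrightarrow> cmod (A $$ (i, j)) \<le> B) \<Longrightarrow> cmod (det A) \<le> C"
  show ?thesis
  proof (rule that)
    fix A :: "complex mat" and i j
    assume A: "A \<in> carrier_mat n n" and B: "\<And>i j. i < n \<Longrightarrow> j < n \<Longrightarrow> cmod (A $$ (i, j)) \<le> B" and ij: "i < n" "j < n"
    have "cmod (det (mat_delete A j i)) \<le> C"
      using A B by (intro C mat_delete_carrier') (auto simp: mat_delete_entry)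
    then show "cmod (adj_mat A $$ (i, j)) \<le> C"
      unfolding adj_mat_index[OF A ij] by (simp add: norm_mult norm_power)
  qed
qed

section \<open>The resolvent at a point of the lower half plane and its adjoint\<close>

lemma mat_adjoint_mult:
  fixes A B :: "complex mat"
  assumes A: "A \<in> carrier_mat n k" and B: "B \<in> carrier_mat k m"
  shows "mat_adjoint (A * B) = mat_adjoint B * mat_adjoint A"
proof (rule eq_matI)
  have A': "mat_adjoint A \<in> carrier_mat k n" and B': "mat_adjoint B \<in> carrier_mat m k"
    using A B by (auto intro: mat_adjoint_carrier)
  have AB: "A * B \<in> carrier_mat n m" using A B by simp
  fix i j assume "i < dim_row (mat_adjoint B * mat_adjoint A)" "j < dim_col (mat_adjoint B * mat_adjoint A)"
  then have ij: "i < m" "j < n" using A B by auto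
  have "mat_adjoint (A * B) $$ (i, j) = cnj ((A * B) $$ (j, i))" using AB ij by (intro mat_adjoint_index) auto
  also have "\<dots> = (\<Sum>l<k. mat_adjoint B $$ (i, l) * mat_adjoint A $$ (l, j))"
    unfolding mult_mat_index_sum[OF A B ij(2,1)] cnj_sum using A B ij by (intro sum.cong) auto
  also have "\<dots> = (mat_adjoint B * mat_adjoint A) $$ (i, j)"
    by (rule mult_mat_index_sum[OF B' A' ij, symmetric])
  finally show "mat_adjoint (A * B) $$ (i, j) = (mat_adjoint B * mat_adjoint A) $$ (i, j)" .
qed (use A B in auto)

lemma mat_adjoint_one: "mat_adjoint (1\<^sub>m n :: complex mat) = 1\<^sub>m n"
  by (intro eq_matI) auto

lemma adj_mat_inverse:
  fixes A :: "complex mat"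
  assumes A: "A \<in> carrier_mat n n" "det A \<noteq> 0"
  defines "N \<equiv> mat n n (\<lambda>(i, j). 1 / det A * adj_mat A $$ (i, j))"
  shows "N * A = 1\<^sub>m n" "A * N = 1\<^sub>m n"
proof -
  note adj = adj_mat[OF A(1)]
  have N: "N = (1 / det A) \<cdot>\<^sub>m adj_mat A" using adj(1) by (intro eq_matI) (auto simp: N_def)
  have Nc: "N \<in> carrier_mat n n" by (simp add: N_def)
  have "A * N = (1 / det A) \<cdot>\<^sub>m (det A \<cdot>\<^sub>m 1\<^sub>m n)"
    unfolding N using mult_smult_distrib[OF A(1) adj(1)] adj(2) by simp
  also have "\<dots> = 1\<^sub>m n" using A(2) by (intro eq_matI) auto
  finally show AN: "A * N = 1\<^sub>m n" .
  show "N * A = 1\<^sub>m n" by (rule mat_mult_left_right_inverse[OF A(1) Nc AN])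
qed

text \<open>On the boundary \<open>F\<close> is self-adjoint, so the adjoint of \<open>R = (F - cnj w)\<^sup>-\<^sup>1\<close> is
  \<open>(F - w)\<^sup>-\<^sup>1 = R adj (1 - 2 \<i> v R) / det (1 - 2 \<i> v R)\<close> with \<open>v = Im w\<close>, which has only finitely many poles.\<close>

lemma inverse_adjoint_reflection:
  fixes B R :: "complex mat"
  assumes B: "self_adjoint n B" and R: "R \<in> carrier_mat n n"
    and MR: "(B - cnj w \<cdot>\<^sub>m 1\<^sub>m n) * R = 1\<^sub>m n" and ij: "i < n" "j < n"
  defines "S \<equiv> 1\<^sub>m n - (2 * \<i> * of_real (Im w)) \<cdot>\<^sub>m R"
  shows "cnj (R $$ (i, j)) * det S = (R * adj_mat S) $$ (j, i)"
proof -
  have Bc: "B \<in> carrier_mat n n" "mat_adjoint B = B" using B by (auto simp: self_adjoint_def)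
  define M where "M = B - cnj w \<cdot>\<^sub>m 1\<^sub>m n"
  have M: "M \<in> carrier_mat n n" unfolding M_def by (intro minus_carrier_mat smult_carrier_mat one_carrier_mat)
  have S: "S \<in> carrier_mat n n" unfolding S_def by (intro minus_carrier_mat smult_carrier_mat R)
  have MR: "M * R = 1\<^sub>m n" using MR by (simp add: M_def)
  have RM: "R * M = 1\<^sub>m n" by (rule mat_mult_left_right_inverse[OF M R MR])
  define R' where "R' = mat_adjoint R"
  have R': "R' \<in> carrier_mat n n" unfolding R'_def using R by (rule mat_adjoint_carrier)
  have M'c: "mat_adjoint M \<in> carrier_mat n n" using M by (rule mat_adjoint_carrier)
  have RM': "R' * mat_adjoint M = 1\<^sub>m n"
    unfolding R'_def mat_adjoint_mult[OF M R, symmetric] MR mat_adjoint_one ..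
  have cw: "cnj (cnj w) = cnj w + 2 * \<i> * of_real (Im w)" by (simp add: complex_eq_iff)
  \<comment> \<open>As \<open>B\<close> is self-adjoint, passing to the adjoint only replaces
    \<open>cnj w\<close> by \<open>w = cnj w + 2 * \<i> * Im w\<close>. The difference is a multiple
    of \<open>R * M = 1\<close>, which lets \<open>M\<close> be factored out on the right.\<close>
  have M': "mat_adjoint M = S * M"
  proof (rule eq_matI)
    fix p q assume "p < dim_row (S * M)" "q < dim_col (S * M)"
    then have pq: "p < n" "q < n" using S M by auto
    have Bpq: "B $$ (p, q) = cnj (B $$ (q, p))" using B pq unfolding self_adjoint_iff by blast
    have RMc: "(2 * \<i> * of_real (Im w)) \<cdot>\<^sub>m R \<in> carrier_mat n n" using R by simp
    have "S * M = 1\<^sub>m n * M - ((2 * \<i> * of_real (Im w)) \<cdot>\<^sub>m R) * M"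
      unfolding S_def by (rule minus_mult_distrib_mat[OF _ RMc M]) simp
    also have "((2 * \<i> * of_real (Im w)) \<cdot>\<^sub>m R) * M = (2 * \<i> * of_real (Im w)) \<cdot>\<^sub>m 1\<^sub>m n"
      using mult_smult_assoc_mat[OF R M] RM by simp
    finally have "(S * M) $$ (p, q) = M $$ (p, q) - (if p = q then 2 * \<i> * of_real (Im w) else 0)"
      using M pq by simp
    moreover have "mat_adjoint M $$ (p, q) = cnj (M $$ (q, p))" using M pq by (intro mat_adjoint_index) auto
    moreover have "cnj (M $$ (q, p)) = B $$ (p, q) - (if p = q then cnj (cnj w) else 0)"
      unfolding Bpq using pq Bc by (simp add: M_def)
    moreover have "M $$ (p, q) = B $$ (p, q) - (if p = q then cnj w else 0)" using pq Bc by (simp add: M_def)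
    ultimately show "mat_adjoint M $$ (p, q) = (S * M) $$ (p, q)" unfolding cw by simp
  qed (use S M in auto)
  have "R' * S = R' * S * (M * R)" unfolding MR using R' S by simp
  also have "\<dots> = R' * (S * M) * R"
    using R' S M R by (simp add: assoc_mult_mat[of _ n n _ n _ n])
  also have "\<dots> = R" unfolding M'[symmetric] RM' using R by simp
  finally have RS: "R' * S = R" .
  note adj = adj_mat[OF S]
  have "R * adj_mat S = R' * (S * adj_mat S)"
    using assoc_mult_mat[OF R' S adj(1)] unfolding RS by simp
  also have "\<dots> = det S \<cdot>\<^sub>m R'" unfolding adj(2) using R' by (simp add: mult_smult_distrib[OF R' one_carrier_mat])
  finally have "(R * adj_mat S) $$ (j, i) = det S * R' $$ (j, i)" using R' ij by simp
  moreover have "R' $$ (j, i) = cnj (R $$ (i, j))" unfolding R'_def using R ij by (intro mat_adjoint_index) auto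
  ultimately show ?thesis by (simp add: mult.commute)
qed

text \<open>For a column \<open>x\<close> of \<open>R\<close>, mapped by \<open>F - cnj w\<close> to
  a unit vector, the imaginary part of the quadratic form is at least \<open>Im w\<close> times the
  squared norm of \<open>x\<close> and at most the modulus of one coordinate. So the norm of
  \<open>x\<close> is at most \<open>1 / Im w\<close>.\<close>

lemma dissipative_inverse_bound:
  fixes F R :: "complex mat"
  assumes F: "F \<in> carrier_mat n n" and im: "\<And>v. v \<in> carrier_vec n \<Longrightarrow> 0 \<le> Im (quad_form n F v)"
    and R: "R \<in> carrier_mat n n" "(F - cnj w \<cdot>\<^sub>m 1\<^sub>m n) * R = 1\<^sub>m n" and w: "0 < Im w" and ij: "i < n" "j < n"
  shows "cmod (R $$ (i, j)) \<le> 1 / Im w"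
proof -
  define M where "M = F - cnj w \<cdot>\<^sub>m 1\<^sub>m n"
  have M: "M \<in> carrier_mat n n" unfolding M_def by (intro minus_carrier_mat smult_carrier_mat one_carrier_mat)
  define x where "x = col R j"
  have x: "x \<in> carrier_vec n" using R(1) by (auto simp: x_def)
  have xi: "x $ k = R $$ (k, j)" if "k < n" for k using R(1) ij that by (simp add: x_def)
  define N where "N = (\<Sum>k<n. (cmod (x $ k))\<^sup>2)"
  have "M *\<^sub>v x = col (M * R) j" using M R(1) ij by (intro eq_vecI) (auto simp: x_def)
  also have "\<dots> = unit_vec n j" using R(2) ij by (simp add: M_def)
  finally have Mx: "M *\<^sub>v x = unit_vec n j" .
  have "(M *\<^sub>v x) \<bullet>c x = (\<Sum>k<n. (F *\<^sub>v x) $ k * cnj (x $ k) - cnj w * (x $ k * cnj (x $ k)))"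
    unfolding M_def minus_scalar_mult_vec[OF F x] cscalar_prod_sum[OF x]
    using F x by (intro sum.cong) (auto simp: algebra_simps)
  also have "\<dots> = quad_form n F x - cnj w * of_real N"
    unfolding sum_subtractf cscalar_prod_sum[OF x, symmetric] cscalar_prod_quad_form[OF F x]
      sum_distrib_left[symmetric] cscalar_prod_self[OF x] N_def ..
  finally have "Im ((M *\<^sub>v x) \<bullet>c x) = Im (quad_form n F x) + Im w * N" by simp
  then have "Im w * N \<le> Im ((M *\<^sub>v x) \<bullet>c x)" using im[OF x] by simp
  also have "(M *\<^sub>v x) \<bullet>c x = cnj (x $ j)"
    unfolding Mx cscalar_prod_sum[OF x] using ij by (simp add: unit_vec_def if_distrib if_distribR cong: if_cong)
  also have "Im (cnj (x $ j)) \<le> cmod (x $ j)" using abs_Im_le_cmod[of "cnj (x $ j)"] by simp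
  finally have 1: "Im w * N \<le> cmod (x $ j)" .
  have le: "(cmod (x $ k))\<^sup>2 \<le> N" if "k < n" for k
    unfolding N_def by (rule member_le_sum) (use that in auto)
  have N0: "0 \<le> N" by (simp add: N_def sum_nonneg)
  have "(Im w * N)\<^sup>2 \<le> (cmod (x $ j))\<^sup>2" using 1 w N0 by (intro power_mono) auto
  then have "(Im w)\<^sup>2 * N * N \<le> 1 * N" using le[OF ij(2)] by (simp add: power2_eq_square mult_ac)
  then have "(Im w)\<^sup>2 * N \<le> 1 \<or> N = 0" using N0 by (metis mult_le_cancel_right order_le_less not_le)
  then have "(Im w)\<^sup>2 * N \<le> 1" by auto
  then have "(Im w)\<^sup>2 * (cmod (x $ i))\<^sup>2 \<le> 1\<^sup>2" using le[OF ij(1)] w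
    by (smt (verit) mult_left_mono one_power2 zero_le_power2)
  then have "(Im w * cmod (x $ i))\<^sup>2 \<le> 1\<^sup>2" by (simp add: power_mult_distrib)
  then have "Im w * cmod (x $ i) \<le> 1" using power2_le_imp_le by (metis zero_le_one)
  then show ?thesis using w xi[OF ij(1)] by (simp add: field_simps)
qed

lemma det_dissipative_nonzero:
  fixes F :: "complex mat"
  assumes F: "F \<in> carrier_mat n n" and im: "\<And>v. v \<in> carrier_vec n \<Longrightarrow> 0 \<le> Im (quad_form n F v)"
    and w: "Im w < 0"
  shows "det (F - w \<cdot>\<^sub>m 1\<^sub>m n) \<noteq> 0"
proof
  assume "det (F - w \<cdot>\<^sub>m 1\<^sub>m n) = 0"
  then obtain v where v: "v \<in> carrier_vec n" "v \<noteq> 0\<^sub>v n" "F *\<^sub>v v = w \<cdot>\<^sub>v v"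
    using det_eq_0_eigenvector[OF F] by blast
  have "quad_form n F v = (F *\<^sub>v v) \<bullet>c v" using cscalar_prod_quad_form[OF F v(1)] by simp
  also have "\<dots> = w * (v \<bullet>c v)" unfolding v(3) using v(1) by simp
  finally have "0 \<le> Im w * (\<Sum>i<n. (cmod (v $ i))\<^sup>2)"
    using im[OF v(1)] unfolding cscalar_prod_self[OF v(1)] by simp
  moreover have "0 < (\<Sum>i<n. (cmod (v $ i))\<^sup>2)"
    using sum_norm_sq_eq_0[OF v(1)] v(2) by (simp add: order_less_le sum_nonneg)
  ultimately show False using w by (simp add: zero_le_mult_iff)
qed

text \<open>\<open>F\<close> may be unbounded, so rationality is shown for
  \<open>R = (F - cnj w)\<^sup>-\<^sup>1\<close> and then transferred by inverting \<open>R\<close>.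
  The function \<open>b = det (1 - 2 \<i> (Im w) R)\<close> equals the quotient of the determinants
  of \<open>F - w\<close> and \<open>F - cnj w\<close>, so \<open>proper_at\<close> is precisely the
  lower bound that the reflection argument asks of \<open>b\<close>.\<close>

theorem proper_Pick_rational_entries:
  assumes F: "F \<in> Pick_R n" and w: "w \<in> upper_half_plane" and proper: "proper_at n F w"
    and ij: "i < n" "j < n"
  shows "rational_on_uhp (\<lambda>z. F z $$ (i, j))"
proof -
  let ?U = upper_half_plane
  have w0: "0 < Im w" using w by simp
  have Fc: "F z \<in> carrier_mat n n" if "z \<in> ?U" for z using F that by (auto simp: Pick_R_iff holomorphic_mat_def)
  have Fhol: "(\<lambda>z. F z $$ (i, j)) holomorphic_on ?U" if "i < n" "j < n" for i j
    using F that by (auto simp: Pick_R_iff holomorphic_mat_def)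
  have Fim: "0 \<le> Im (quad_form n (F z) v)" if "z \<in> ?U" "v \<in> carrier_vec n" for z v
    using F that by (auto simp: Pick_R_iff)
  obtain K \<delta> where K: "compact K" "K \<subseteq> ?U" and \<delta>: "0 < \<delta>" and
    K\<delta>: "\<And>z. z \<in> ?U - K \<Longrightarrow> \<delta> * cmod (det (F z - cnj w \<cdot>\<^sub>m 1\<^sub>m n)) \<le> cmod (det (F z - w \<cdot>\<^sub>m 1\<^sub>m n))"
    using proper unfolding proper_at_def by blast
  define sh where "sh A = A - cnj w \<cdot>\<^sub>m 1\<^sub>m n" for A :: "complex mat"
  have shc: "sh A \<in> carrier_mat n n" for A
    unfolding sh_def by (intro minus_carrier_mat smult_carrier_mat one_carrier_mat)
  have shi: "sh A $$ (p, q) = A $$ (p, q) - (if p = q then cnj w else 0)" if "A \<in> carrier_mat n n" "p < n" "q < n" for A p q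
    using that by (simp add: sh_def)
  \<comment> \<open>Cramer's rule as a total function: holomorphy, rationality and limits pass to
    the inverse entry by entry.\<close>
  define minv where "minv A = mat n n (\<lambda>(p, q). 1 / det A * adj_mat A $$ (p, q))" for A :: "complex mat"
  have minvc: "minv A \<in> carrier_mat n n" for A by (simp add: minv_def)
  have minv: "A * minv A = 1\<^sub>m n" if "A \<in> carrier_mat n n" "det A \<noteq> 0" for A
    unfolding minv_def by (rule adj_mat_inverse(2)[OF that])
  define R where "R z = minv (sh (F z))" for z
  define SS where "SS A = 1\<^sub>m n - (2 * \<i> * of_real (Im w)) \<cdot>\<^sub>m A" for A :: "complex mat"
  have SSc: "SS A \<in> carrier_mat n n" if "A \<in> carrier_mat n n" for A
    unfolding SS_def using that by (intro minus_carrier_mat smult_carrier_mat)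
  have SSi: "SS A $$ (p, q) = (if p = q then 1 else 0) - 2 * \<i> * of_real (Im w) * A $$ (p, q)"
    if "A \<in> carrier_mat n n" "p < n" "q < n" for A p q using that by (simp add: SS_def)
  define b where "b z = det (SS (R z))" for z
  define \<Psi> where "\<Psi> z = R z * adj_mat (SS (R z))" for z
  have Rc: "R z \<in> carrier_mat n n" for z by (simp add: R_def minvc)
  have adjc: "adj_mat (SS (R z)) \<in> carrier_mat n n" for z using adj_mat(1)[OF SSc[OF Rc]] .
  have detM: "det (sh (F z)) \<noteq> 0" if "z \<in> ?U" for z
    unfolding sh_def using w0 that by (intro det_dissipative_nonzero Fc Fim) auto
  have MR: "sh (F z) * R z = 1\<^sub>m n" if "z \<in> ?U" for z
    unfolding R_def by (rule minv[OF shc detM[OF that]])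
  have shhol: "(\<lambda>z. sh (F z) $$ (p, q)) holomorphic_on ?U" if "p < n" "q < n" for p q
  proof (rule holomorphic_transform)
    show "(\<lambda>z. F z $$ (p, q) - (if p = q then cnj w else 0)) holomorphic_on ?U"
      using that by (intro holomorphic_intros Fhol)
  qed (use that Fc in \<open>simp add: shi\<close>)
  have Rhol: "(\<lambda>z. R z $$ (p, q)) holomorphic_on ?U" if pq: "p < n" "q < n" for p q
  proof (rule holomorphic_transform)
    show "(\<lambda>z. 1 / det (sh (F z)) * adj_mat (sh (F z)) $$ (p, q)) holomorphic_on ?U"
      using pq detM by (intro holomorphic_intros holomorphic_on_det[where n = n] holomorphic_on_adj_mat[where n = n] shc shhol) auto
  qed (use pq in \<open>simp add: R_def minv_def\<close>)
  have Shol: "(\<lambda>z. SS (R z) $$ (p, q)) holomorphic_on ?U" if pq: "p < n" "q < n" for p q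
  proof (rule holomorphic_transform)
    show "(\<lambda>z. (if p = q then 1 else 0) - 2 * \<i> * of_real (Im w) * R z $$ (p, q)) holomorphic_on ?U"
      using pq by (intro holomorphic_intros Rhol)
  qed (use pq Rc in \<open>simp add: SSi\<close>)
  have bhol: "b holomorphic_on ?U" unfolding b_def
    by (rule holomorphic_on_det[where n = n]) (use SSc Rc Shol in auto)
  have \<Psi>i: "\<Psi> z $$ (p, q) = (\<Sum>k<n. R z $$ (p, k) * adj_mat (SS (R z)) $$ (k, q))" if "p < n" "q < n" for z p q
    unfolding \<Psi>_def by (rule mult_mat_index_sum[OF Rc adjc that])
  have \<Psi>hol: "(\<lambda>z. \<Psi> z $$ (p, q)) holomorphic_on ?U" if pq: "p < n" "q < n" for p q
    unfolding \<Psi>i[OF pq] using pq SSc Rc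
    by (intro holomorphic_intros Rhol holomorphic_on_adj_mat[where n = n] Shol) auto
  have Rbd: "cmod (R z $$ (p, q)) \<le> 1 / Im w" if "z \<in> ?U" "p < n" "q < n" for z p q
    by (rule dissipative_inverse_bound[OF Fc[OF that(1)] Fim[OF that(1)] Rc _ w0 that(2,3)])
       (assumption, rule MR[OF that(1), unfolded sh_def])
  \<comment> \<open>The 3 is \<open>1 + 2 * Im w * (1 / Im w)\<close>.\<close>
  have Sbd: "cmod (SS (R z) $$ (p, q)) \<le> 3" if z: "z \<in> ?U" and pq: "p < n" "q < n" for z p q
  proof -
    have "cmod (SS (R z) $$ (p, q)) \<le> cmod (if p = q then 1 else 0) + cmod (2 * \<i> * of_real (Im w) * R z $$ (p, q))"
      unfolding SSi[OF Rc pq] by (rule norm_triangle_ineq4)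
    also have "cmod (2 * \<i> * of_real (Im w) * R z $$ (p, q)) = 2 * Im w * cmod (R z $$ (p, q))"
      using w0 by (simp add: norm_mult)
    also have "\<dots> \<le> 2 * Im w * (1 / Im w)" using w0 Rbd[OF z pq] by (intro mult_left_mono) auto
    also have "\<dots> = 2" using w0 by simp
    finally show ?thesis by (auto split: if_splits)
  qed
  obtain Cb where Cb: "\<And>(A :: complex mat) i j. A \<in> carrier_mat n n \<Longrightarrow> (\<And>i j. i < n \<Longrightarrow> j < n \<Longrightarrow> cmod (A $$ (i, j)) \<le> 3)
     \<Longrightarrow> i < n \<Longrightarrow> j < n \<Longrightarrow> cmod (adj_mat A $$ (i, j)) \<le> Cb"
    using adj_mat_bounded[of n 3] by blast
  have \<Psi>bd: "cmod (\<Psi> z $$ (p, q)) \<le> real n * (1 / Im w * Cb)" if z: "z \<in> ?U" and pq: "p < n" "q < n" for z p q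
  proof -
    have "cmod (\<Psi> z $$ (p, q)) \<le> (\<Sum>k<n. cmod (R z $$ (p, k) * adj_mat (SS (R z)) $$ (k, q)))"
      unfolding \<Psi>i[OF pq] by (rule norm_sum)
    also have "\<dots> \<le> (\<Sum>k<n. 1 / Im w * Cb)"
    proof (rule sum_mono)
      fix k assume "k \<in> {..<n}"
      then have k: "k < n" by simp
      show "cmod (R z $$ (p, k) * adj_mat (SS (R z)) $$ (k, q)) \<le> 1 / Im w * Cb"
        unfolding norm_mult using Rbd[OF z pq(1) k] Cb[OF SSc[OF Rc] Sbd[OF z] k pq(2)] w0
        by (intro mult_mono) auto
    qed
    finally show ?thesis by simp
  qed
  have bK: "\<delta> \<le> cmod (b z)" if z: "z \<in> ?U - K" for z
  proof -
    have zU: "z \<in> ?U" using z by simp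
    have RR: "R z * sh (F z) = 1\<^sub>m n" by (rule mat_mult_left_right_inverse[OF shc Rc MR[OF zU]])
    have "SS (R z) * sh (F z) = F z - w \<cdot>\<^sub>m 1\<^sub>m n"
    proof -
      have RMc: "(2 * \<i> * of_real (Im w)) \<cdot>\<^sub>m R z \<in> carrier_mat n n" using Rc by simp
      have "SS (R z) * sh (F z) = 1\<^sub>m n * sh (F z) - ((2 * \<i> * of_real (Im w)) \<cdot>\<^sub>m R z) * sh (F z)"
        unfolding SS_def by (rule minus_mult_distrib_mat[OF _ RMc shc]) simp
      also have "((2 * \<i> * of_real (Im w)) \<cdot>\<^sub>m R z) * sh (F z) = (2 * \<i> * of_real (Im w)) \<cdot>\<^sub>m 1\<^sub>m n"
        using mult_smult_assoc_mat[OF Rc shc] RR by simp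
      also have "1\<^sub>m n * sh (F z) = sh (F z)" by (rule left_mult_one_mat[OF shc])
      also have "sh (F z) - (2 * \<i> * of_real (Im w)) \<cdot>\<^sub>m 1\<^sub>m n = F z - w \<cdot>\<^sub>m 1\<^sub>m n"
        using Fc[OF zU] by (intro eq_matI) (auto simp: sh_def complex_eq_iff)
      finally show ?thesis .
    qed
    then have "b z * det (sh (F z)) = det (F z - w \<cdot>\<^sub>m 1\<^sub>m n)"
      unfolding b_def using det_mult[OF SSc[OF Rc] shc, of z "F z"] by simp
    then have "\<delta> * cmod (det (sh (F z))) \<le> cmod (b z) * cmod (det (sh (F z)))"
      using K\<delta>[OF z] unfolding sh_def[symmetric] by (metis norm_mult)
    then show ?thesis using detM[OF zU] by simp
  qed
  have "rational_on_uhp (\<lambda>z. R z $$ (p, q))" if pq: "p < n" "q < n" for p q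
  \<comment> \<open>The entry of \<Psi> is transposed because reflection replaces \<open>R\<close>
    by its adjoint.\<close>
  proof (rule rational_of_boundary_reflection[OF Rhol[OF pq] \<Psi>hol[OF pq(2,1)] bhol _ _ K \<delta> bK])
    let ?M = "max (1 / Im w) (real n * (1 / Im w * Cb))"
    show "cmod (R z $$ (p, q)) \<le> ?M" if "z \<in> ?U" for z using Rbd[OF that pq] by simp
    show "cmod (\<Psi> z $$ (q, p)) \<le> ?M" if "z \<in> ?U" for z using \<Psi>bd[OF that pq(2,1)] by simp
    have "AE x in lborel. \<exists>B. has_boundary_mat n F x B \<and> self_adjoint n B" using F by (simp add: Pick_R_iff)
    then show "AE x in lborel. \<exists>r0 \<psi>0 b0. ((\<lambda>\<epsilon>. R (Complex x \<epsilon>) $$ (p, q)) \<longlongrightarrow> r0) (at_right 0) \<and>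
        ((\<lambda>\<epsilon>. \<Psi> (Complex x \<epsilon>) $$ (q, p)) \<longlongrightarrow> \<psi>0) (at_right 0) \<and>
        ((\<lambda>\<epsilon>. b (Complex x \<epsilon>)) \<longlongrightarrow> b0) (at_right 0) \<and> cnj r0 * b0 = \<psi>0"
    proof eventually_elim
      case (elim x)
      then obtain B where B: "has_boundary_mat n F x B" "self_adjoint n B" by blast
      have Bc: "B \<in> carrier_mat n n" using B(2) by (simp add: self_adjoint_def)
      let ?G = "at_right (0::real)"
      let ?z = "\<lambda>\<epsilon>. Complex x \<epsilon>"
      define R0 where "R0 = minv (sh B)"
      have R0c: "R0 \<in> carrier_mat n n" by (simp add: R0_def minvc)
      have ev: "eventually (\<lambda>\<epsilon>. ?z \<epsilon> \<in> ?U) ?G" using eventually_at_right_less[of 0] by eventually_elim simp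
      have dB: "det (sh B) \<noteq> 0" unfolding sh_def using w0 by (intro det_self_adjoint_minus_nonreal B) simp
      have shl: "((\<lambda>\<epsilon>. sh (F (?z \<epsilon>)) $$ (k, l)) \<longlongrightarrow> sh B $$ (k, l)) ?G" if kl: "k < n" "l < n" for k l
      proof -
        have "((\<lambda>\<epsilon>. F (?z \<epsilon>) $$ (k, l) - (if k = l then cnj w else 0)) \<longlongrightarrow> B $$ (k, l) - (if k = l then cnj w else 0)) ?G"
          using B(1) kl by (intro tendsto_intros) (auto simp: has_boundary_mat_def)
        moreover have "eventually (\<lambda>\<epsilon>. F (?z \<epsilon>) $$ (k, l) - (if k = l then cnj w else 0) = sh (F (?z \<epsilon>)) $$ (k, l)) ?G"
          using ev by eventually_elim (use kl Fc shi in auto)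
        ultimately show ?thesis unfolding shi[OF Bc kl] by (rule Lim_transform_eventually)
      qed
      have Rl: "((\<lambda>\<epsilon>. R (?z \<epsilon>) $$ (k, l)) \<longlongrightarrow> R0 $$ (k, l)) ?G" if kl: "k < n" "l < n" for k l
      proof -
        have "((\<lambda>\<epsilon>. 1 / det (sh (F (?z \<epsilon>))) * adj_mat (sh (F (?z \<epsilon>))) $$ (k, l)) \<longlongrightarrow> 1 / det (sh B) * adj_mat (sh B) $$ (k, l)) ?G"
          using kl shc dB by (intro tendsto_intros tendsto_det[where n = n] tendsto_adj_mat[where n = n] shl) auto
        then show ?thesis using kl by (simp add: R_def R0_def minv_def)
      qed
      have Sl: "((\<lambda>\<epsilon>. SS (R (?z \<epsilon>)) $$ (k, l)) \<longlongrightarrow> SS R0 $$ (k, l)) ?G" if kl: "k < n" "l < n" for k l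
        unfolding SSi[OF Rc kl] SSi[OF R0c kl] by (intro tendsto_intros Rl kl)
      have bl: "((\<lambda>\<epsilon>. b (?z \<epsilon>)) \<longlongrightarrow> det (SS R0)) ?G"
        unfolding b_def using SSc Rc R0c by (intro tendsto_det[where n = n] Sl) auto
      have al: "((\<lambda>\<epsilon>. adj_mat (SS (R (?z \<epsilon>))) $$ (k, l)) \<longlongrightarrow> adj_mat (SS R0) $$ (k, l)) ?G" if kl: "k < n" "l < n" for k l
        using SSc Rc R0c kl by (intro tendsto_adj_mat[where n = n] Sl) auto
      have adj0: "adj_mat (SS R0) \<in> carrier_mat n n" using adj_mat(1)[OF SSc[OF R0c]] .
      have \<Psi>l: "((\<lambda>\<epsilon>. \<Psi> (?z \<epsilon>) $$ (q, p)) \<longlongrightarrow> (R0 * adj_mat (SS R0)) $$ (q, p)) ?G"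
        unfolding \<Psi>i[OF pq(2,1)] mult_mat_index_sum[OF R0c adj0 pq(2,1)]
        using pq by (intro tendsto_intros Rl al) auto
      have "(B - cnj w \<cdot>\<^sub>m 1\<^sub>m n) * R0 = 1\<^sub>m n"
        using minv[OF shc dB] by (simp add: R0_def sh_def)
      then have "cnj (R0 $$ (p, q)) * det (SS R0) = (R0 * adj_mat (SS R0)) $$ (q, p)"
        unfolding SS_def by (rule inverse_adjoint_reflection[OF B(2) R0c _ pq])
      then show ?case using Rl[OF pq] \<Psi>l bl by blast
    qed
  qed
  note Rrat = this
  have detR: "det (R z) \<noteq> 0" if "z \<in> ?U" for z
  proof
    assume "det (R z) = 0"
    then have "det (sh (F z) * R z) = 0" using det_mult[OF shc Rc] by simp
    then show False unfolding MR[OF that] by simp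
  qed
  have Frep: "F z $$ (i, j) = (if i = j then cnj w else 0) + 1 / det (R z) * adj_mat (R z) $$ (i, j)" if z: "z \<in> ?U" for z
  proof -
    have "sh (F z) = sh (F z) * (R z * minv (R z))" unfolding minv[OF Rc detR[OF z]] by (rule right_mult_one_mat[OF shc, symmetric])
    also have "\<dots> = minv (R z)" unfolding assoc_mult_mat[OF shc Rc minvc, symmetric] MR[OF z] by (rule left_mult_one_mat[OF minvc])
    finally have "sh (F z) $$ (i, j) = minv (R z) $$ (i, j)" by simp
    then have "F z $$ (i, j) - (if i = j then cnj w else 0) = 1 / det (R z) * adj_mat (R z) $$ (i, j)"
      unfolding shi[OF Fc[OF z] ij] using ij by (simp add: minv_def)
    then show ?thesis by (simp only: diff_eq_eq add.commute)
  qed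
  have "rational_on_uhp (\<lambda>z. (if i = j then cnj w else 0) + 1 / det (R z) * adj_mat (R z) $$ (i, j))"
    using Rc detR ij
    by (intro rational_on_uhp_add rational_on_uhp_const rational_on_uhp_mult rational_on_uhp_inverse
        rational_on_uhp_det[where n = n] rational_on_uhp_adj_mat[where n = n] Rrat) auto
  then show ?thesis by (subst rational_on_uhp_cong[OF Frep])
qed

subsection \<open>The spectrum of regular Pick functions\<close>

text \<open>An open image in the closed upper half plane cannot touch the real line, so
  \<open>h\<close> is constant.\<close>

lemma holomorphic_Im_nonneg_zero:
  assumes hol: "h holomorphic_on upper_half_plane"
    and im: "\<And>z. z \<in> upper_half_plane \<Longrightarrow> 0 \<le> Im (h z)"
    and z0: "z0 \<in> upper_half_plane" "Im (h z0) = 0" and z: "z \<in> upper_half_plane"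
  shows "Im (h z) = 0"
proof -
  have "h constant_on upper_half_plane"
  proof (rule ccontr)
    assume nc: "\<not> h constant_on upper_half_plane"
    have "open (h ` upper_half_plane)"
      by (rule open_mapping_thm[OF hol open_upper_half_plane convex_connected[OF convex_upper_half_plane]
          open_upper_half_plane order_refl nc])
    then obtain e where e: "0 < e" "ball (h z0) e \<subseteq> h ` upper_half_plane"
      using z0 by (meson openE imageI)
    have "h z0 - \<i> * of_real (e / 2) \<in> ball (h z0) e" using e by (simp add: dist_norm norm_mult)
    then obtain y where "y \<in> upper_half_plane" "h y = h z0 - \<i> * of_real (e / 2)"
      using e(2) by (metis imageE subsetD)
    then show False using im[of y] z0(2) e(1) by simp
  qed
  then obtain c where "\<And>y. y \<in> upper_half_plane \<Longrightarrow> h y = c" by (auto simp: constant_on_def)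
  then show ?thesis using z0 z by metis
qed

text \<open>A null vector of the form minimizes it, so the first variation in each coordinate
  direction vanishes.\<close>

lemma psd_quad_form_zero:
  assumes psd: "psd n G" and v: "v \<in> carrier_vec n" and z: "quad_form n G v = 0" and j: "j < n"
  shows "(\<Sum>q<n. G $$ (j, q) * v $ q) = 0"
proof (rule ccontr)
  define g where "g = (\<Sum>q<n. G $$ (j, q) * v $ q)"
  assume "(\<Sum>q<n. G $$ (j, q) * v $ q) \<noteq> 0"
  then have g: "0 < (cmod g)\<^sup>2" by (simp add: g_def)
  have sa: "self_adjoint n G" by (rule psd_imp_self_adjoint[OF psd])
  have g': "(\<Sum>p<n. G $$ (p, j) * cnj (v $ p)) = cnj g"
    unfolding g_def cnj_sum
  proof (rule sum.cong[OF refl])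
    fix p assume "p \<in> {..<n}"
    then have "G $$ (p, j) = cnj (G $$ (j, p))" using sa j unfolding self_adjoint_iff by blast
    then show "G $$ (p, j) * cnj (v $ p) = cnj (G $$ (j, p) * v $ p)" by simp
  qed
  define a where "a = Re (G $$ (j, j))"
  \<comment> \<open>Small enough for the negative first-order term to dominate the second-order term
    with coefficient \<open>a\<close>.\<close>
  define \<epsilon> where "\<epsilon> = 1 / (\<bar>a\<bar> + 1)"
  have \<epsilon>: "0 < \<epsilon>" "\<epsilon> * \<bar>a\<bar> < 2" by (simp_all add: \<epsilon>_def field_simps)
  define t where "t = - of_real \<epsilon> * g"
  have gg: "g * cnj g = of_real ((cmod g)\<^sup>2)" by (rule complex_norm_square[symmetric])
  have "v + t \<cdot>\<^sub>v unit_vec n j \<in> carrier_vec n" using v by simp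
  then have "0 \<le> Re (quad_form n G (v + t \<cdot>\<^sub>v unit_vec n j))" using psd by (auto simp: psd_iff)
  also have "quad_form n G (v + t \<cdot>\<^sub>v unit_vec n j) = t * cnj g + cnj (t * cnj g) + t * cnj t * G $$ (j, j)"
    by (simp add: quad_form_add_unit[OF j v] z g' g_def[symmetric])
  also have "t * cnj g = - of_real (\<epsilon> * (cmod g)\<^sup>2)"
    using gg by (simp add: t_def mult.assoc)
  also have "t * cnj t = of_real (\<epsilon>\<^sup>2 * (cmod g)\<^sup>2)"
  proof -
    have "t * cnj t = of_real \<epsilon> * of_real \<epsilon> * (g * cnj g)" by (simp add: t_def mult_ac)
    then show ?thesis unfolding gg by (simp add: power2_eq_square)
  qed
  also have "Re (- complex_of_real (\<epsilon> * (cmod g)\<^sup>2) + cnj (- complex_of_real (\<epsilon> * (cmod g)\<^sup>2))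
      + of_real (\<epsilon>\<^sup>2 * (cmod g)\<^sup>2) * G $$ (j, j)) = \<epsilon> * (cmod g)\<^sup>2 * (\<epsilon> * a - 2)"
    by (simp add: a_def power2_eq_square algebra_simps)
  finally have "0 \<le> \<epsilon> * (cmod g)\<^sup>2 * (\<epsilon> * a - 2)" .
  moreover have "\<epsilon> * a \<le> \<epsilon> * \<bar>a\<bar>" using \<epsilon> by (intro mult_left_mono) auto
  then have "\<epsilon> * a - 2 < 0" using \<epsilon> by linarith
  then have "\<epsilon> * (cmod g)\<^sup>2 * (\<epsilon> * a - 2) < 0" using \<epsilon> g by (intro mult_pos_neg) auto
  ultimately show False by simp
qed

text \<open>The quadratic form of \<open>F z\<close> at \<open>v\<close> has nonnegative imaginary
  part, with value 0 at \<open>z0\<close>, so this part vanishes everywhere. Hence \<open>v\<close>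
  is a null vector of the positive semidefinite imaginary part of \<open>F z\<close>, and
  \<open>F z\<close> agrees with its adjoint on \<open>v\<close>. The components of
  \<open>F z v\<close> are thus both holomorphic and antiholomorphic, so they are constant.\<close>

lemma Pick_R_real_eigenvector_constant:
  assumes F: "F \<in> Pick_R n" and v: "v \<in> carrier_vec n"
    and z0: "z0 \<in> upper_half_plane" "F z0 *\<^sub>v v = \<mu> \<cdot>\<^sub>v v" "Im \<mu> = 0" and z: "z \<in> upper_half_plane"
  shows "F z *\<^sub>v v = \<mu> \<cdot>\<^sub>v v"
proof -
  let ?U = upper_half_plane
  have Fc: "F z \<in> carrier_mat n n" if "z \<in> ?U" for z using F that by (auto simp: Pick_R_iff holomorphic_mat_def)
  have Fhol: "(\<lambda>z. F z $$ (i, j)) holomorphic_on ?U" if "i < n" "j < n" for i j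
    using F that by (auto simp: Pick_R_iff holomorphic_mat_def)
  have Im0: "Im (quad_form n (F z) v) = 0" if z: "z \<in> ?U" for z
  proof (rule holomorphic_Im_nonneg_zero[OF _ _ z0(1) _ z])
    show "(\<lambda>z. quad_form n (F z) v) holomorphic_on ?U"
      unfolding quad_form_def by (intro holomorphic_intros Fhol) auto
    show "0 \<le> Im (quad_form n (F z) v)" if "z \<in> ?U" for z using F v that by (auto simp: Pick_R_iff)
    have "quad_form n (F z0) v = (F z0 *\<^sub>v v) \<bullet>c v" using cscalar_prod_quad_form[OF Fc[OF z0(1)] v] by simp
    also have "\<dots> = \<mu> * (v \<bullet>c v)" unfolding z0(2) using v by simp
    finally show "Im (quad_form n (F z0) v) = 0" unfolding cscalar_prod_self[OF v] using z0(3) by simp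
  qed
  define h where "h j z = (\<Sum>q<n. F z $$ (j, q) * v $ q)" for j z
  have cnjh: "cnj (h j z) = (\<Sum>q<n. F z $$ (q, j) * cnj (v $ q))" if z: "z \<in> ?U" and j: "j < n" for j z
  proof -
    let ?G = "(1 / (2 * \<i>)) \<cdot>\<^sub>m (F z - mat_adjoint (F z))"
    have F'c: "mat_adjoint (F z) \<in> carrier_mat n n" using Fc[OF z] by (rule mat_adjoint_carrier)
    have psd: "psd n ?G" using F z by (simp add: Pick_R_def)
    have Gi: "?G $$ (p, q) = 1 / (2 * \<i>) * (F z $$ (p, q) - cnj (F z $$ (q, p)))" if "p < n" "q < n" for p q
    proof -
      have "mat_adjoint (F z) $$ (p, q) = cnj (F z $$ (q, p))" using Fc[OF z] that by (intro mat_adjoint_index) auto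
      moreover have "?G $$ (p, q) = 1 / (2 * \<i>) * (F z $$ (p, q) - mat_adjoint (F z) $$ (p, q))"
        using Fc[OF z] that by simp
      ultimately show ?thesis by simp
    qed
    have "quad_form n ?G v = (\<Sum>i<n. \<Sum>k<n. 1 / (2 * \<i>) * (F z $$ (i, k) * v $ k * cnj (v $ i) - mat_adjoint (F z) $$ (i, k) * v $ k * cnj (v $ i)))"
      unfolding quad_form_def
    proof (intro sum.cong refl)
      fix i k assume "i \<in> {..<n}" "k \<in> {..<n}"
      then have ik: "i < n" "k < n" by auto
      have e: "?G $$ (i, k) = 1 / (2 * \<i>) * (F z $$ (i, k) - mat_adjoint (F z) $$ (i, k))"
        using Fc[OF z] ik by simp
      show "?G $$ (i, k) * v $ k * cnj (v $ i) = 1 / (2 * \<i>) * (F z $$ (i, k) * v $ k * cnj (v $ i) - mat_adjoint (F z) $$ (i, k) * v $ k * cnj (v $ i))"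
        unfolding e by (simp only: left_diff_distrib mult.assoc right_diff_distrib)
    qed
    also have "\<dots> = 1 / (2 * \<i>) * (quad_form n (F z) v - quad_form n (mat_adjoint (F z)) v)"
      unfolding quad_form_def by (simp only: sum_distrib_left[symmetric] sum_subtractf)
    also have "\<dots> = 0" unfolding quad_form_adjoint[OF Fc[OF z]] using Im0[OF z] by (simp add: complex_eq_iff)
    finally have z1: "(\<Sum>q<n. ?G $$ (j, q) * v $ q) = 0" by (rule psd_quad_form_zero[OF psd v _ j])
    have z2: "(\<Sum>q<n. ?G $$ (j, q) * v $ q) = (\<Sum>q<n. 1 / (2 * \<i>) * (F z $$ (j, q) * v $ q - cnj (F z $$ (q, j)) * v $ q))"
      by (intro sum.cong refl) (use j in \<open>simp only: Gi lessThan_iff left_diff_distrib mult.assoc right_diff_distrib\<close>)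
    have "1 / (2 * \<i>) * (h j z - (\<Sum>q<n. cnj (F z $$ (q, j)) * v $ q)) = 0"
      using trans[OF sym[OF z2] z1] unfolding sum_distrib_left[symmetric] sum_subtractf h_def .
    then have "h j z = (\<Sum>q<n. cnj (F z $$ (q, j)) * v $ q)" by simp
    then show ?thesis by (simp add: cnj_sum)
  qed
  have hhol: "h j holomorphic_on ?U" if "j < n" for j
    unfolding h_def using that by (intro holomorphic_intros Fhol) auto
  have hhol': "(\<lambda>z. cnj (h j z)) holomorphic_on ?U" if j: "j < n" for j
  proof (rule holomorphic_transform)
    show "(\<lambda>z. \<Sum>q<n. F z $$ (q, j) * cnj (v $ q)) holomorphic_on ?U"
      using j by (intro holomorphic_intros Fhol) auto
  qed (simp add: cnjh j)
  have hconst: "h j z = h j z0" if j: "j < n" for j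
  proof -
    \<comment> \<open>Both \<open>h j\<close> and its conjugate are holomorphic, so twice the real
      part and -2 times the imaginary part of \<open>h j\<close> are holomorphic and real, hence
      constant.\<close>
    have "Im (h j y + cnj (h j y)) = 0" for y by simp
    then obtain c where c: "\<And>y. y \<in> ?U \<Longrightarrow> h j y + cnj (h j y) = c"
      using holomorphic_Im_0_constant[OF holomorphic_on_add[OF hhol[OF j] hhol'[OF j]]] by blast
    have "Im (\<i> * (h j y - cnj (h j y))) = 0" for y by simp
    moreover have "(\<lambda>y. \<i> * (h j y - cnj (h j y))) holomorphic_on ?U"
      by (intro holomorphic_intros hhol hhol' j)
    ultimately obtain d where d: "\<And>y. y \<in> ?U \<Longrightarrow> \<i> * (h j y - cnj (h j y)) = d"
      using holomorphic_Im_0_constant by blast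
    have "2 * h j y = c - \<i> * d" if "y \<in> ?U" for y
      using c[OF that, symmetric] d[OF that, symmetric] by (simp add: complex_eq_iff)
    then have "2 * h j z = 2 * h j z0" using z z0 by metis
    then show ?thesis by simp
  qed
  show ?thesis
  proof (rule eq_vecI)
    fix j assume "j < dim_vec (\<mu> \<cdot>\<^sub>v v)"
    then have j: "j < n" using v by simp
    have "(F z *\<^sub>v v) $ j = (F z0 *\<^sub>v v) $ j"
      using hconst[OF j] unfolding h_def mult_mat_vec_index_sum[OF Fc[OF z] v j] mult_mat_vec_index_sum[OF Fc[OF z0(1)] v j] .
    then show "(F z *\<^sub>v v) $ j = (\<mu> \<cdot>\<^sub>v v) $ j" unfolding z0(2) .
  qed (use Fc[OF z] v in auto)
qed

lemma pow_mat_eigenvector: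
  fixes A :: "complex mat"
  assumes A: "A \<in> carrier_mat n n" and v: "v \<in> carrier_vec n" "A *\<^sub>v v = \<mu> \<cdot>\<^sub>v v"
  shows "A ^\<^sub>m k *\<^sub>v v = \<mu> ^ k \<cdot>\<^sub>v v"
proof (induction k)
  case 0
  show ?case using A v by simp
next
  case (Suc k)
  have Ak: "A ^\<^sub>m k \<in> carrier_mat n n" using A by simp
  have "A ^\<^sub>m Suc k *\<^sub>v v = A ^\<^sub>m k *\<^sub>v (A *\<^sub>v v)" using Ak A v by (simp add: assoc_mult_mat_vec[of _ n n _ n])
  also have "\<dots> = \<mu> \<cdot>\<^sub>v (A ^\<^sub>m k *\<^sub>v v)" unfolding v(2) using Ak v(1) by (simp add: mult_mat_vec)
  also have "\<dots> = \<mu> ^ Suc k \<cdot>\<^sub>v v" unfolding Suc.IH by (simp add: smult_smult_assoc)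
  finally show ?case .
qed

text \<open>The exponential is defined entry by entry. The bound \<open>(n * M) ^ k\<close> on the
  entries of the powers makes all these series converge, so the finite sum over columns may be
  exchanged with them.\<close>

lemma mat_exp_eigenvector:
  assumes A: "A \<in> carrier_mat n n" and v: "v \<in> carrier_vec n" "A *\<^sub>v v = \<mu> \<cdot>\<^sub>v v"
  shows "mat_exp n A *\<^sub>v v = exp \<mu> \<cdot>\<^sub>v v"
proof -
  define M where "M = (\<Sum>i<n. \<Sum>j<n. cmod (A $$ (i, j)))"
  have M0: "0 \<le> M" unfolding M_def by (intro sum_nonneg) auto
  have M: "cmod (A $$ (i, j)) \<le> M" if "i < n" "j < n" for i j
  proof -
    have "cmod (A $$ (i, j)) \<le> (\<Sum>j<n. cmod (A $$ (i, j)))" by (rule member_le_sum) (use that in auto)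
    also have "\<dots> \<le> M" unfolding M_def
      by (rule member_le_sum[of _ _ "\<lambda>i. \<Sum>j<n. cmod (A $$ (i, j))"]) (use that in \<open>auto intro: sum_nonneg\<close>)
    finally show ?thesis .
  qed
  have Ak: "A ^\<^sub>m k \<in> carrier_mat n n" for k using A by simp
  have bd: "cmod ((A ^\<^sub>m k) $$ (i, j)) \<le> (real n * M) ^ k" if "i < n" "j < n" for i j k
    using that
  proof (induction k arbitrary: j)
    case 0
    then show ?case using A by simp
  next
    case (Suc k)
    have "(A ^\<^sub>m Suc k) $$ (i, j) = (\<Sum>l<n. (A ^\<^sub>m k) $$ (i, l) * A $$ (l, j))"
      using mult_mat_index_sum[OF Ak A Suc.prems] by simp
    also have "cmod \<dots> \<le> (\<Sum>l<n. cmod ((A ^\<^sub>m k) $$ (i, l) * A $$ (l, j)))" by (rule norm_sum)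
    also have "\<dots> \<le> (\<Sum>l<n. (real n * M) ^ k * M)"
      unfolding norm_mult using Suc M M0 by (intro sum_mono mult_mono) auto
    also have "\<dots> = (real n * M) ^ Suc k" by simp
    finally show ?case .
  qed
  have summ: "summable (\<lambda>k. (A ^\<^sub>m k) $$ (i, j) / fact k)" if ij: "i < n" "j < n" for i j
  proof (rule summable_comparison_test[OF _ summable_exp[of "real n * M"]])
    have "norm ((A ^\<^sub>m k) $$ (i, j) / fact k) \<le> inverse (fact k) * (real n * M) ^ k" for k
    proof -
      have "norm ((A ^\<^sub>m k) $$ (i, j) / fact k) = inverse (fact k) * cmod ((A ^\<^sub>m k) $$ (i, j))"
        by (subst norm_divide) (simp add: divide_inverse)
      also have "\<dots> \<le> inverse (fact k) * (real n * M) ^ k" by (intro mult_left_mono bd ij) simp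
      finally show ?thesis .
    qed
    then show "\<exists>N. \<forall>k\<ge>N. norm ((A ^\<^sub>m k) $$ (i, j) / fact k) \<le> inverse (fact k) * (real n * M) ^ k" by blast
  qed
  have ec: "mat_exp n A \<in> carrier_mat n n" by (simp add: mat_exp_def)
  show ?thesis
  proof (rule eq_vecI)
    fix i assume "i < dim_vec (exp \<mu> \<cdot>\<^sub>v v)"
    then have i: "i < n" using v by simp
    have "(mat_exp n A *\<^sub>v v) $ i = (\<Sum>j<n. (\<Sum>k. (A ^\<^sub>m k) $$ (i, j) / fact k) * v $ j)"
      unfolding mult_mat_vec_index_sum[OF ec v(1) i] using i by (intro sum.cong) (auto simp: mat_exp_def)
    also have "\<dots> = (\<Sum>j<n. \<Sum>k. (A ^\<^sub>m k) $$ (i, j) / fact k * v $ j)"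
      using i summ by (intro sum.cong suminf_mult2) auto
    also have "\<dots> = (\<Sum>k. \<Sum>j<n. (A ^\<^sub>m k) $$ (i, j) / fact k * v $ j)"
      using i summ by (intro suminf_sum[symmetric] summable_mult2) auto
    also have "(\<lambda>k. \<Sum>j<n. (A ^\<^sub>m k) $$ (i, j) / fact k * v $ j) = (\<lambda>k. \<mu> ^ k /\<^sub>R fact k * v $ i)"
    proof
      fix k
      have "(\<Sum>j<n. (A ^\<^sub>m k) $$ (i, j) / fact k * v $ j) = (\<Sum>j<n. (A ^\<^sub>m k) $$ (i, j) * v $ j) / fact k"
        by (simp add: sum_divide_distrib)
      also have "(\<Sum>j<n. (A ^\<^sub>m k) $$ (i, j) * v $ j) = (A ^\<^sub>m k *\<^sub>v v) $ i"
        by (rule mult_mat_vec_index_sum[OF Ak v(1) i, symmetric])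
      also have "\<dots> = \<mu> ^ k * v $ i" unfolding pow_mat_eigenvector[OF A v] using i v by simp
      finally show "(\<Sum>j<n. (A ^\<^sub>m k) $$ (i, j) / fact k * v $ j) = \<mu> ^ k /\<^sub>R fact k * v $ i"
        by (simp add: scaleR_conv_of_real field_simps)
    qed
    also have "(\<Sum>k. \<mu> ^ k /\<^sub>R fact k * v $ i) = exp \<mu> * v $ i"
      unfolding exp_def by (rule suminf_mult2[symmetric, OF summable_exp_generic])
    finally show "(mat_exp n A *\<^sub>v v) $ i = (exp \<mu> \<cdot>\<^sub>v v) $ i" using i v by simp
  qed (use ec v in auto)
qed

text \<open>Eigenvalues in the lower half plane are excluded by dissipativity. For a real \<mu> the
  eigenvector \<open>v\<close> belongs to all \<open>F z\<close> and thus to the boundary values. On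
  functions with values in the span of \<open>v\<close>, multiplication by the exponential is then
  multiplication by the scalar \<open>exp (\<i> * t * \<mu>)\<close>, which preserves the Hardy
  space; so \<open>v / (x + \<i>)\<close> lies in every space of the intersection.\<close>

theorem regular_Pick_spectrum:
  assumes F: "F \<in> Pick_R n" and reg: "regular_Pick n F"
    and z0: "z0 \<in> upper_half_plane" and det0: "det (F z0 - \<mu> \<cdot>\<^sub>m 1\<^sub>m n) = 0"
  shows "\<mu> \<in> upper_half_plane"
proof (rule ccontr)
  let ?U = upper_half_plane
  assume "\<mu> \<notin> ?U"
  have Fc: "F z \<in> carrier_mat n n" if "z \<in> ?U" for z using F that by (auto simp: Pick_R_iff holomorphic_mat_def)
  have Fim: "0 \<le> Im (quad_form n (F z) v)" if "z \<in> ?U" "v \<in> carrier_vec n" for z v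
    using F that by (auto simp: Pick_R_iff)
  have "\<not> Im \<mu> < 0" using det_dissipative_nonzero[OF Fc[OF z0] Fim[OF z0]] det0 by blast
  then have \<mu>0: "Im \<mu> = 0" using \<open>\<mu> \<notin> ?U\<close> by simp
  obtain v where v: "v \<in> carrier_vec n" "v \<noteq> 0\<^sub>v n" "F z0 *\<^sub>v v = \<mu> \<cdot>\<^sub>v v"
    using det0 det_eq_0_eigenvector[OF Fc[OF z0]] by blast
  have Fv: "F z *\<^sub>v v = \<mu> \<cdot>\<^sub>v v" if "z \<in> ?U" for z
    by (rule Pick_R_real_eigenvector_constant[OF F v(1) z0 v(3) \<mu>0 that])
  \<comment> \<open>\<open>1 / (z + \<i>)\<close> is an element of the scalar Hardy space. The
    factor \<open>c\<close> is left free so that it can cancel the exponential for each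
    \<open>t\<close>.\<close>
  define h where "h c z = (c / (z + \<i>)) \<cdot>\<^sub>v v" for c z :: complex
  have hc: "h c z \<in> carrier_vec n" for c z using v by (simp add: h_def)
  have hi: "h c z $ i = c / (z + \<i>) * v $ i" if "i < n" for c z i using v that by (simp add: h_def)
  have zi: "z + \<i> \<noteq> 0" if "0 \<le> Im z" for z using that by (auto simp: complex_eq_iff)
  define V where "V = (\<Sum>i<n. (cmod (v $ i))\<^sup>2)"
  have V0: "0 \<le> V" by (simp add: V_def sum_nonneg)
  have L2le: "L2_sq (\<lambda>x. h c (Complex x y)) \<le> ennreal ((cmod c)\<^sup>2 * V) * (\<integral>\<^sup>+x. ennreal (inverse (1 + x\<^sup>2)) \<partial>lborel)"
    if y: "0 \<le> y" for c y
  proof -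
    have "norm_sq (h c (Complex x y)) \<le> (cmod c)\<^sup>2 * V * inverse (1 + x\<^sup>2)" for x
    proof -
      have "norm_sq (h c (Complex x y)) = (\<Sum>i<n. (cmod (c / (Complex x y + \<i>)))\<^sup>2 * (cmod (v $ i))\<^sup>2)"
        unfolding norm_sq_def carrier_vecD[OF hc]
        by (intro sum.cong refl) (simp add: hi norm_mult norm_divide power_mult_distrib power_divide)
      also have "\<dots> = (cmod c)\<^sup>2 * V * inverse ((cmod (Complex x y + \<i>))\<^sup>2)"
        unfolding norm_divide power_divide sum_distrib_left[symmetric] V_def by (simp add: divide_inverse mult_ac)
      also have "(cmod (Complex x y + \<i>))\<^sup>2 = x\<^sup>2 + (y + 1)\<^sup>2" unfolding cmod_power2 by simp
      also have "inverse (x\<^sup>2 + (y + 1)\<^sup>2) \<le> inverse (1 + x\<^sup>2)"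
        using y by (intro le_imp_inverse_le) (auto simp: power2_eq_square add_pos_nonneg algebra_simps)
      finally show ?thesis using V0 by (simp add: mult_left_mono)
    qed
    then have "L2_sq (\<lambda>x. h c (Complex x y)) \<le> (\<integral>\<^sup>+x. ennreal ((cmod c)\<^sup>2 * V * inverse (1 + x\<^sup>2)) \<partial>lborel)"
      unfolding L2_sq_def by (intro nn_integral_mono ennreal_leI) simp
    also have "\<dots> = (\<integral>\<^sup>+x. ennreal ((cmod c)\<^sup>2 * V) * ennreal (inverse (1 + x\<^sup>2)) \<partial>lborel)"
      using V0 by (simp add: ennreal_mult[symmetric])
    also have "\<dots> = ennreal ((cmod c)\<^sup>2 * V) * (\<integral>\<^sup>+x. ennreal (inverse (1 + x\<^sup>2)) \<partial>lborel)"
      by (rule nn_integral_cmult) measurable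
    finally show ?thesis .
  qed
  have Jfin: "(\<integral>\<^sup>+x. ennreal (inverse (1 + x\<^sup>2)) \<partial>(lborel :: real measure)) < \<infinity>"
    using integrable_inverse_one_plus_square unfolding integrable_iff_bounded by simp
  then have Bfin: "ennreal ((cmod c)\<^sup>2 * V) * (\<integral>\<^sup>+x. ennreal (inverse (1 + x\<^sup>2)) \<partial>(lborel :: real measure)) < \<infinity>" for c
    by (simp add: ennreal_mult_less_top)
  have real: "complex_of_real x = Complex x 0" for x by (simp add: complex_eq_iff)
  have L2: "(\<lambda>x. h c (of_real x)) \<in> L2 n" for c
    unfolding L2_def
  proof (intro CollectI conjI allI impI)
    show "h c (of_real x) \<in> carrier_vec n" for x by (rule hc)
    show "(\<lambda>x. h c (of_real x) $ i) \<in> borel_measurable lborel" if "i < n" for i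
    proof -
      have "continuous_on UNIV (\<lambda>x::real. c / (of_real x + \<i>) * v $ i)"
        using zi by (intro continuous_intros) auto
      then show ?thesis unfolding hi[OF that] using borel_measurable_continuous_onI by simp
    qed
    show "L2_sq (\<lambda>x. h c (of_real x)) < \<infinity>"
      unfolding real using L2le[of 0 c] Bfin[of c] by (rule le_less_trans[OF _ ]) simp
  qed
  have bdry: "(\<lambda>x. h c (of_real x)) \<in> Hardy2_boundary n" for c
    unfolding Hardy2_boundary_def
  proof (intro CollectI conjI L2 bexI[of _ "h c"] AE_I2)
    show "h c \<in> Hardy2 n" unfolding Hardy2_def
    proof (intro CollectI conjI)
      have "(\<lambda>z. h c z $ i) holomorphic_on ?U" if "i < n" for i
        unfolding hi[OF that] using zi by (intro holomorphic_intros) (auto simp: less_imp_le)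
      then show "holomorphic_vec n (h c)" using hc by (simp add: holomorphic_vec_def)
      have "(SUP y\<in>{0<..}. L2_sq (\<lambda>x. h c (Complex x y))) \<le> ennreal ((cmod c)\<^sup>2 * V) * (\<integral>\<^sup>+x. ennreal (inverse (1 + x\<^sup>2)) \<partial>lborel)"
        by (rule SUP_least) (use L2le in auto)
      then show "(SUP y\<in>{0<..}. L2_sq (\<lambda>x. h c (Complex x y))) < \<infinity>"
        using Bfin by (rule le_less_trans)
    qed
    fix x :: real
    show "has_boundary_vec n (h c) x (h c (of_real x))"
      unfolding has_boundary_vec_def
    proof (intro conjI hc allI impI)
      fix i assume i: "i < n"
      show "((\<lambda>\<epsilon>. h c (Complex x \<epsilon>) $ i) \<longlongrightarrow> h c (of_real x) $ i) (at_right 0)"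
        unfolding hi[OF i] using zi[of "of_real x"]
        by (intro tendsto_intros tendsto_Complex_at_right) auto
    qed
  qed
  have "(\<lambda>x. h 1 (of_real x)) \<in> exp_Hardy2 n F t" for t
    unfolding exp_Hardy2_def
  proof (intro CollectI conjI L2 bexI[OF _ bdry])
    have "AE x in lborel. \<exists>B. has_boundary_mat n F x B \<and> self_adjoint n B" using F by (simp add: Pick_R_iff)
    then show "AE x in lborel. h 1 (of_real x) = mat_exp n ((\<i> * of_real t) \<cdot>\<^sub>m boundary_mat n F x) *\<^sub>v h (exp (- (\<i> * of_real t * \<mu>))) (of_real x)"
    proof eventually_elim
      case (elim x)
      then obtain B where B: "has_boundary_mat n F x B" by blast
      have Bc: "B \<in> carrier_mat n n" using B by (simp add: has_boundary_mat_def)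
      have Bl: "((\<lambda>\<epsilon>. F (Complex x \<epsilon>) $$ (i, j)) \<longlongrightarrow> B $$ (i, j)) (at_right 0)" if "i < n" "j < n" for i j
        using B that by (simp add: has_boundary_mat_def)
      have bB: "boundary_mat n F x = B"
        using Bc tendsto_Lim[OF trivial_limit_at_right_real Bl] by (intro eq_matI) (auto simp: boundary_mat_def)
      have Bv: "B *\<^sub>v v = \<mu> \<cdot>\<^sub>v v"
      proof (rule eq_vecI)
        fix i assume "i < dim_vec (\<mu> \<cdot>\<^sub>v v)"
        then have i: "i < n" using v by simp
        have "((\<lambda>\<epsilon>. \<Sum>j<n. F (Complex x \<epsilon>) $$ (i, j) * v $ j) \<longlongrightarrow> (\<Sum>j<n. B $$ (i, j) * v $ j)) (at_right 0)"
          using i by (intro tendsto_intros Bl) auto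
        moreover have "eventually (\<lambda>\<epsilon>. (\<Sum>j<n. F (Complex x \<epsilon>) $$ (i, j) * v $ j) = \<mu> * v $ i) (at_right 0)"
          using eventually_at_right_less[of 0]
        proof eventually_elim
          case (elim \<epsilon>)
          then have U: "Complex x \<epsilon> \<in> ?U" by simp
          show ?case unfolding mult_mat_vec_index_sum[OF Fc[OF U] v(1) i, symmetric] Fv[OF U] using i v by simp
        qed
        ultimately have "((\<lambda>\<epsilon>. \<mu> * v $ i) \<longlongrightarrow> (\<Sum>j<n. B $$ (i, j) * v $ j)) (at_right (0::real))"
          by (rule Lim_transform_eventually)
        then have "(\<Sum>j<n. B $$ (i, j) * v $ j) = \<mu> * v $ i"
          using tendsto_unique[OF trivial_limit_at_right_real _ tendsto_const] by blast
        then show "(B *\<^sub>v v) $ i = (\<mu> \<cdot>\<^sub>v v) $ i"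
          unfolding mult_mat_vec_index_sum[OF Bc v(1) i] using i v by simp
      qed (use Bc v in auto)
      let ?A = "(\<i> * of_real t) \<cdot>\<^sub>m B"
      let ?c = "exp (- (\<i> * of_real t * \<mu>))"
      have A: "?A \<in> carrier_mat n n" using Bc by simp
      have hcv: "h ?c (of_real x) \<in> carrier_vec n" by (rule hc)
      have Ah: "?A *\<^sub>v h ?c (of_real x) = (\<i> * of_real t * \<mu>) \<cdot>\<^sub>v h ?c (of_real x)"
      proof -
        have "?A *\<^sub>v h ?c (of_real x) = (\<i> * of_real t) \<cdot>\<^sub>v ((?c / (of_real x + \<i>)) \<cdot>\<^sub>v (B *\<^sub>v v))"
          unfolding h_def using Bc v(1) by (auto intro!: eq_vecI simp: mult_mat_vec)
        then show ?thesis unfolding Bv h_def by (simp add: smult_smult_assoc mult_ac)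
      qed
      have "mat_exp n ?A *\<^sub>v h ?c (of_real x) = exp (\<i> * of_real t * \<mu>) \<cdot>\<^sub>v h ?c (of_real x)"
        by (rule mat_exp_eigenvector[OF A hcv Ah])
      also have "\<dots> = h 1 (of_real x)"
        unfolding h_def by (simp add: smult_smult_assoc exp_minus)
      finally show ?case unfolding bB by simp
    qed
  qed
  then have "(\<lambda>x. h 1 (of_real x)) \<in> L2_zero n" using reg unfolding regular_Pick_def by blast
  then have "AE x::real in lborel. h 1 (of_real x) = 0\<^sub>v n" by (simp add: L2_zero_def)
  then have "infinite {x::real. h 1 (of_real x) = 0\<^sub>v n}" by (rule AE_lborel_infinite)
  then obtain x :: real where x: "h 1 (of_real x) = 0\<^sub>v n" by (metis (mono_tags, lifting) Collect_empty_eq finite.emptyI)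
  have "v = 0\<^sub>v n"
  proof (rule eq_vecI)
    fix i assume "i < dim_vec (0\<^sub>v n :: complex vec)"
    then have i: "i < n" by simp
    have "1 / (of_real x + \<i>) * v $ i = 0" using hi[OF i, of 1 "of_real x"] x i by simp
    then show "v $ i = 0\<^sub>v n $ i" using zi[of "of_real x"] i by simp
  qed (use v in simp)
  then show False using v by simp
qed

subsection \<open>Holomorphic functional calculus\<close>

text \<open>The disks centred at \<open>\<i> * R\<close> with radius \<open>R\<close> exhaust the
  half plane: \<sigma> belongs to one as soon as
  \<open>(cmod \<sigma>)^2 < 2 * R * Im \<sigma>\<close>, and summing over the spectrum gives one
  \<open>R\<close> for all its points. A radius between the largest distance from the centre and
  \<open>R\<close> keeps the circle off both the spectrum and the real line.\<close>

lemma calc_contour_exists: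
  assumes fin: "finite (spectrum A)" and sub: "spectrum A \<subseteq> upper_half_plane"
  shows "\<exists>\<gamma>. calc_contour A \<gamma>"
proof -
  let ?S = "spectrum A"
  define R where "R = 1 + (\<Sum>\<sigma>\<in>?S. (cmod \<sigma>)\<^sup>2 / (2 * Im \<sigma>))"
  have nn: "0 \<le> (cmod \<sigma>)\<^sup>2 / (2 * Im \<sigma>)" if "\<sigma> \<in> ?S" for \<sigma> using that sub by force
  have "0 \<le> (\<Sum>\<sigma>\<in>?S. (cmod \<sigma>)\<^sup>2 / (2 * Im \<sigma>))" by (rule sum_nonneg) (rule nn)
  then have R: "0 < R" unfolding R_def by linarith
  have lt: "cmod (\<sigma> - \<i> * of_real R) < R" if s: "\<sigma> \<in> ?S" for \<sigma>
  proof -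
    have i: "0 < Im \<sigma>" using s sub by auto
    have "(cmod \<sigma>)\<^sup>2 / (2 * Im \<sigma>) \<le> (\<Sum>\<sigma>\<in>?S. (cmod \<sigma>)\<^sup>2 / (2 * Im \<sigma>))"
      by (rule member_le_sum[OF s _ fin]) (use nn in auto)
    then have "(cmod \<sigma>)\<^sup>2 / (2 * Im \<sigma>) < R" by (simp add: R_def)
    then have "(cmod \<sigma>)\<^sup>2 < 2 * R * Im \<sigma>" using i by (simp add: field_simps)
    moreover have "(cmod (\<sigma> - \<i> * of_real R))\<^sup>2 = (cmod \<sigma>)\<^sup>2 - 2 * R * Im \<sigma> + R\<^sup>2"
      unfolding cmod_power2 by (simp add: power2_eq_square algebra_simps)
    ultimately have "(cmod (\<sigma> - \<i> * of_real R))\<^sup>2 < R\<^sup>2" by linarith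
    then show ?thesis using R by (intro power_less_imp_less_base[of _ 2 R]) auto
  qed
  define m where "m = Max (insert 0 ((\<lambda>\<sigma>. cmod (\<sigma> - \<i> * of_real R)) ` ?S))"
  have m: "m < R" unfolding m_def using fin lt R by (subst Max_less_iff) auto
  have m0: "0 \<le> m" unfolding m_def using fin by (intro Max_ge) auto
  have ml: "cmod (\<sigma> - \<i> * of_real R) \<le> m" if "\<sigma> \<in> ?S" for \<sigma>
    unfolding m_def using fin that by (intro Max_ge) auto
  define r where "r = (m + R) / 2"
  have r: "m < r" "r < R" "0 < r" using m m0 by (simp_all add: r_def)
  have "calc_contour A (circlepath (\<i> * of_real R) r)"
    unfolding calc_contour_def
  proof (intro conjI ballI subsetI)
    show "winding_number (circlepath (\<i> * of_real R) r) \<mu> = 1" if "\<mu> \<in> ?S" for \<mu>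
      using ml[OF that] r by (intro winding_number_circlepath) simp
    fix z assume "z \<in> path_image (circlepath (\<i> * of_real R) r)"
    then have z: "cmod (z - \<i> * of_real R) = r" using r by (simp add: dist_norm norm_minus_commute)
    have "\<bar>Im (z - \<i> * of_real R)\<bar> \<le> r" using abs_Im_le_cmod[of "z - \<i> * of_real R"] z by simp
    then have "0 < Im z" using r by simp
    moreover have "z \<notin> ?S" using ml[of z] z r by auto
    ultimately show "z \<in> upper_half_plane - ?S" by simp
  qed simp_all
  then show ?thesis by blast
qed

text \<open>Back substitution, starting from the last row.\<close>

lemma upper_triangular_inverse:
  fixes X Y :: "complex mat"
  assumes X: "X \<in> carrier_mat n n" and Y: "Y \<in> carrier_mat n n" and XY: "X * Y = 1\<^sub>m n"
    and ut: "\<And>i j. i < n \<Longrightarrow> j < i \<Longrightarrow> X $$ (i, j) = 0" and d: "\<And>i. i < n \<Longrightarrow> X $$ (i, i) \<noteq> 0"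
  shows "i < n \<Longrightarrow> j < i \<Longrightarrow> Y $$ (i, j) = 0" "i < n \<Longrightarrow> Y $$ (i, i) = 1 / X $$ (i, i)"
proof -
  have row: "(\<Sum>k<n. X $$ (i, k) * Y $$ (k, j)) = (if i = j then 1 else 0)" if "i < n" "j < n" for i j
    using mult_mat_index_sum[OF X Y that] XY that by simp
  have low: "Y $$ (i, j) = 0" if "i < n" "j < i" for i j
    using that
  proof (induction "n - i" arbitrary: i rule: less_induct)
    case less
    have "(\<Sum>k<n. X $$ (i, k) * Y $$ (k, j)) = X $$ (i, i) * Y $$ (i, j)"
    proof (subst sum.remove[of _ i])
      have "(\<Sum>k\<in>{..<n} - {i}. X $$ (i, k) * Y $$ (k, j)) = 0"
      proof (intro sum.neutral ballI)
        fix k assume k: "k \<in> {..<n} - {i}"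
        show "X $$ (i, k) * Y $$ (k, j) = 0"
        proof (cases "k < i")
          case False
          then have "Y $$ (k, j) = 0" using k less by (intro less.hyps) auto
          then show ?thesis by simp
        qed (use ut less.prems in simp)
      qed
      then show "X $$ (i, i) * Y $$ (i, j) + (\<Sum>k\<in>{..<n} - {i}. X $$ (i, k) * Y $$ (k, j)) = X $$ (i, i) * Y $$ (i, j)"
        by simp
    qed (use less.prems in auto)
    then show ?case using row[of i j] less.prems d[of i] by simp
  qed
  then show "i < n \<Longrightarrow> j < i \<Longrightarrow> Y $$ (i, j) = 0" .
  assume i: "i < n"
  have "(\<Sum>k<n. X $$ (i, k) * Y $$ (k, i)) = X $$ (i, i) * Y $$ (i, i)"
  proof (subst sum.remove[of _ i])
    have "(\<Sum>k\<in>{..<n} - {i}. X $$ (i, k) * Y $$ (k, i)) = 0"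
    proof (intro sum.neutral ballI)
      fix k assume k: "k \<in> {..<n} - {i}"
      then have "k < i \<or> i < k" by auto
      then show "X $$ (i, k) * Y $$ (k, i) = 0" using ut[OF i, of k] low[of k i] k by auto
    qed
    then show "X $$ (i, i) * Y $$ (i, i) + (\<Sum>k\<in>{..<n} - {i}. X $$ (i, k) * Y $$ (k, i)) = X $$ (i, i) * Y $$ (i, i)"
      by simp
  qed (use i in auto)
  then show "Y $$ (i, i) = 1 / X $$ (i, i)" using row[OF i i] d[OF i] by (simp add: field_simps)
qed

lemma spectrum_iff_det:
  fixes A :: "complex mat"
  assumes A: "A \<in> carrier_mat n n"
  shows "\<mu> \<in> spectrum A \<longleftrightarrow> det (A - \<mu> \<cdot>\<^sub>m 1\<^sub>m n) = 0"
proof -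
  have "\<mu> \<in> spectrum A \<longleftrightarrow> eigenvalue A \<mu>" by (simp add: spectrum_def)
  also have "\<dots> \<longleftrightarrow> det (A - \<mu> \<cdot>\<^sub>m 1\<^sub>m n) = 0"
    unfolding det_eq_0_eigenvector[OF A] eigenvalue_def eigenvector_def using A by auto
  finally show ?thesis .
qed

lemma resolvent_props:
  assumes A: "A \<in> carrier_mat n n" and z: "\<zeta> \<notin> spectrum A"
  shows "resolvent n A \<zeta> \<in> carrier_mat n n" "(\<zeta> \<cdot>\<^sub>m 1\<^sub>m n - A) * resolvent n A \<zeta> = 1\<^sub>m n"
    "resolvent n A \<zeta> * (\<zeta> \<cdot>\<^sub>m 1\<^sub>m n - A) = 1\<^sub>m n" "det (\<zeta> \<cdot>\<^sub>m 1\<^sub>m n - A) \<noteq> 0"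
proof -
  let ?M = "\<zeta> \<cdot>\<^sub>m 1\<^sub>m n - A"
  have M: "?M \<in> carrier_mat n n" using A by (intro minus_carrier_mat)
  have neg: "?M = (-1) \<cdot>\<^sub>m (A - \<zeta> \<cdot>\<^sub>m 1\<^sub>m n)" using A by (intro eq_matI) auto
  have "det ?M = (-1) ^ n * det (A - \<zeta> \<cdot>\<^sub>m 1\<^sub>m n)" unfolding neg by (simp add: carrier_matD(2)[of _ n n])
  then show d: "det ?M \<noteq> 0" using z spectrum_iff_det[OF A] by simp
  have "mat_inverse ?M \<noteq> None" using mat_inverse(1)[OF M, of "()"] det_non_zero_imp_unit[OF M d, of "()"] by auto
  then obtain B where B: "mat_inverse ?M = Some B" by auto
  then show "resolvent n A \<zeta> \<in> carrier_mat n n" "?M * resolvent n A \<zeta> = 1\<^sub>m n" "resolvent n A \<zeta> * ?M = 1\<^sub>m n"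
    using mat_inverse(2)[OF M B] by (simp_all add: resolvent_def)
qed

lemma resolvent_entry_holomorphic:
  assumes A: "A \<in> carrier_mat n n" and ij: "i < n" "j < n"
  shows "(\<lambda>\<zeta>. resolvent n A \<zeta> $$ (i, j)) holomorphic_on - spectrum A"
proof (rule holomorphic_transform)
  let ?M = "\<lambda>\<zeta>. \<zeta> \<cdot>\<^sub>m 1\<^sub>m n - A"
  have M: "?M \<zeta> \<in> carrier_mat n n" for \<zeta> using A by (intro minus_carrier_mat)
  have "(\<lambda>\<zeta>. ?M \<zeta> $$ (k, l)) holomorphic_on - spectrum A" if "k < n" "l < n" for k l
  proof (rule holomorphic_transform)
    show "(\<lambda>\<zeta>. (if k = l then \<zeta> else 0) - A $$ (k, l)) holomorphic_on - spectrum A"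
      by (cases "k = l") (auto intro!: holomorphic_intros)
  qed (use that A in simp)
  then show "(\<lambda>\<zeta>. 1 / det (?M \<zeta>) * adj_mat (?M \<zeta>) $$ (i, j)) holomorphic_on - spectrum A"
    using ij resolvent_props(4)[OF A] M
    by (intro holomorphic_intros holomorphic_on_det[where n = n] holomorphic_on_adj_mat[where n = n]) auto
  fix \<zeta> assume "\<zeta> \<in> - spectrum A"
  then have z: "\<zeta> \<notin> spectrum A" by simp
  note R = resolvent_props[OF A z] and adj = adj_mat[OF M[of \<zeta>]]
  have "adj_mat (?M \<zeta>) = adj_mat (?M \<zeta>) * (?M \<zeta> * resolvent n A \<zeta>)" unfolding R(2) using adj(1) by simp
  also have "\<dots> = (det (?M \<zeta>) \<cdot>\<^sub>m 1\<^sub>m n) * resolvent n A \<zeta>"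
    unfolding adj(3)[symmetric] by (rule assoc_mult_mat[OF adj(1) M R(1), symmetric])
  also have "\<dots> = det (?M \<zeta>) \<cdot>\<^sub>m resolvent n A \<zeta>" using R(1) by (simp add: mult_smult_assoc_mat[OF one_carrier_mat R(1)])
  finally have "adj_mat (?M \<zeta>) $$ (i, j) = det (?M \<zeta>) * resolvent n A \<zeta> $$ (i, j)" using R(1) ij by simp
  then show "1 / det (?M \<zeta>) * adj_mat (?M \<zeta>) $$ (i, j) = resolvent n A \<zeta> $$ (i, j)" using R(4) by simp
qed

lemma contour_integrable_resolvent:
  assumes A: "A \<in> carrier_mat n n" and ij: "i < n" "j < n" and \<gamma>: "calc_contour A \<gamma>"
    and f: "f holomorphic_on upper_half_plane"
  shows "(\<lambda>\<zeta>. f \<zeta> * resolvent n A \<zeta> $$ (i, j)) contour_integrable_on \<gamma>"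
proof (rule contour_integrable_holomorphic_simple)
  have fin: "finite (spectrum A)" using card_finite_spectrum[OF A] by simp
  show "(\<lambda>\<zeta>. f \<zeta> * resolvent n A \<zeta> $$ (i, j)) holomorphic_on upper_half_plane - spectrum A"
    by (intro holomorphic_intros holomorphic_on_subset[OF f] holomorphic_on_subset[OF resolvent_entry_holomorphic[OF A ij]]) auto
  show "open (upper_half_plane - spectrum A)"
    using fin open_upper_half_plane by (intro open_Diff finite_imp_closed)
qed (use \<gamma> in \<open>auto simp: calc_contour_def\<close>)

text \<open>Spectral mapping with multiplicities. In triangular Schur coordinates the resolvent is
  upper triangular with diagonal \<open>1 / (\<zeta> - B $$ (k, k))\<close>, so the contour integral
  is upper triangular with \<open>f\<close> of the eigenvalues on its diagonal, by Cauchy's formula.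
  One list serves \<open>A\<close> and all \<open>f\<close>, which links the determinants of
  \<open>A - w\<close> and of \<open>hol_calc n f A - w\<close>.\<close>

lemma hol_calc_eigenvalues:
  assumes A: "A \<in> carrier_mat n n" and sub: "spectrum A \<subseteq> upper_half_plane"
  obtains \<mu>s where "length \<mu>s = n" "set \<mu>s \<subseteq> upper_half_plane"
    "\<And>w. det (A - w \<cdot>\<^sub>m 1\<^sub>m n) = (\<Prod>\<mu>\<leftarrow>\<mu>s. \<mu> - w)"
    "\<And>f w. f holomorphic_on upper_half_plane \<Longrightarrow> det (hol_calc n f A - w \<cdot>\<^sub>m 1\<^sub>m n) = (\<Prod>\<mu>\<leftarrow>\<mu>s. f \<mu> - w)"
proof -
  let ?U = upper_half_plane
  have fin: "finite (spectrum A)" using card_finite_spectrum[OF A] by simp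
  define \<gamma> where "\<gamma> = (SOME \<gamma>. calc_contour A \<gamma>)"
  have \<gamma>: "calc_contour A \<gamma>" unfolding \<gamma>_def by (rule someI_ex[OF calc_contour_exists[OF fin sub]])
  obtain es where es: "char_poly A = (\<Prod>a\<leftarrow>es. [:- a, 1:])" using char_poly_factorized[OF A] by blast
  obtain B where B: "B \<in> carrier_mat n n" "upper_triangular B" "similar_mat A B"
    using schur_decomposition_exists[OF A es] by blast
  obtain P Q where w: "similar_mat_wit A B P Q" using B(3) by (auto simp: similar_mat_def)
  have "n = dim_row A" using A by simp
  note PQ = similar_mat_witD[OF this w]
  have P: "P \<in> carrier_mat n n" and Q: "Q \<in> carrier_mat n n" using PQ by auto
  have Bl: "B $$ (i, j) = 0" if "i < n" "j < i" for i j
    using B(2) that B(1) by (auto simp: upper_triangular_def)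
  have detconj: "det (P * X * Q - w \<cdot>\<^sub>m 1\<^sub>m n) = det (X - w \<cdot>\<^sub>m 1\<^sub>m n)" if X: "X \<in> carrier_mat n n" for X w
  proof -
    have Y: "X - w \<cdot>\<^sub>m 1\<^sub>m n \<in> carrier_mat n n" by (intro minus_carrier_mat smult_carrier_mat one_carrier_mat)
    have "P * (X - w \<cdot>\<^sub>m 1\<^sub>m n) * Q = (P * X - P * (w \<cdot>\<^sub>m 1\<^sub>m n)) * Q"
      using mult_minus_distrib_mat[OF P X, of "w \<cdot>\<^sub>m 1\<^sub>m n"] by simp
    also have "P * (w \<cdot>\<^sub>m 1\<^sub>m n) = w \<cdot>\<^sub>m P" using mult_smult_distrib[OF P one_carrier_mat] P by simp
    also have "(P * X - w \<cdot>\<^sub>m P) * Q = P * X * Q - (w \<cdot>\<^sub>m P) * Q"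
      using P X Q by (intro minus_mult_distrib_mat) auto
    also have "(w \<cdot>\<^sub>m P) * Q = w \<cdot>\<^sub>m 1\<^sub>m n" using mult_smult_assoc_mat[OF P Q] PQ(1) by simp
    finally have "det (P * X * Q - w \<cdot>\<^sub>m 1\<^sub>m n) = det (P * (X - w \<cdot>\<^sub>m 1\<^sub>m n) * Q)" by simp
    also have "\<dots> = det P * det (X - w \<cdot>\<^sub>m 1\<^sub>m n) * det Q"
      using P Q Y by (subst det_mult[OF _ Q]) (auto simp: det_mult[OF P Y])
    also have "\<dots> = det (X - w \<cdot>\<^sub>m 1\<^sub>m n) * det (P * Q)" by (simp add: det_mult[OF P Q])
    finally show ?thesis using PQ(1) by simp
  qed
  have uttri: "det (X - w \<cdot>\<^sub>m 1\<^sub>m n) = (\<Prod>x\<leftarrow>map (\<lambda>i. X $$ (i, i)) [0..<n]. x - w)"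
    if X: "X \<in> carrier_mat n n" "\<And>i j. i < n \<Longrightarrow> j < i \<Longrightarrow> X $$ (i, j) = 0" for X :: "complex mat" and w
  proof -
    have Y: "X - w \<cdot>\<^sub>m 1\<^sub>m n \<in> carrier_mat n n" by (intro minus_carrier_mat smult_carrier_mat one_carrier_mat)
    have "upper_triangular (X - w \<cdot>\<^sub>m 1\<^sub>m n)" using X by (auto simp: upper_triangular_def)
    then have "det (X - w \<cdot>\<^sub>m 1\<^sub>m n) = prod_list (diag_mat (X - w \<cdot>\<^sub>m 1\<^sub>m n))" by (rule det_upper_triangular[OF _ Y])
    also have "diag_mat (X - w \<cdot>\<^sub>m 1\<^sub>m n) = map (\<lambda>i. X $$ (i, i) - w) [0..<n]"
      using X(1) by (auto simp: diag_mat_def)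
    finally show ?thesis by (simp add: o_def)
  qed
  define \<mu>s where "\<mu>s = map (\<lambda>i. B $$ (i, i)) [0..<n]"
  have len: "length \<mu>s = n" by (simp add: \<mu>s_def)
  have detA: "det (A - w \<cdot>\<^sub>m 1\<^sub>m n) = (\<Prod>\<mu>\<leftarrow>\<mu>s. \<mu> - w)" for w
    using detconj[OF B(1), of w] uttri[OF B(1) Bl] unfolding PQ(3)[symmetric] \<mu>s_def by simp
  have spec: "set \<mu>s = spectrum A"
    using spectrum_iff_det[OF A] unfolding detA by (auto simp: prod_list_zero_iff)
  have Bii: "B $$ (i, i) \<in> spectrum A" if "i < n" for i
    unfolding spec[symmetric] using that by (auto simp: \<mu>s_def)
  have "det (hol_calc n f A - w \<cdot>\<^sub>m 1\<^sub>m n) = (\<Prod>\<mu>\<leftarrow>\<mu>s. f \<mu> - w)" if f: "f holomorphic_on ?U" for f w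
  proof -
    let ?R = "resolvent n A"
    define RB where "RB \<zeta> = Q * ?R \<zeta> * P" for \<zeta>
    have Rc: "?R \<zeta> \<in> carrier_mat n n" if "\<zeta> \<notin> spectrum A" for \<zeta> using resolvent_props(1)[OF A that] .
    have RBc: "RB \<zeta> \<in> carrier_mat n n" if "\<zeta> \<notin> spectrum A" for \<zeta>
      unfolding RB_def using P Q Rc[OF that] by auto
    have RBi: "RB \<zeta> $$ (k, l) = (\<Sum>b<n. \<Sum>a<n. Q $$ (k, a) * ?R \<zeta> $$ (a, b) * P $$ (b, l))"
      if z: "\<zeta> \<notin> spectrum A" and kl: "k < n" "l < n" for \<zeta> k l
    proof -
      have QR: "Q * ?R \<zeta> \<in> carrier_mat n n" using Q Rc[OF z] by auto
      show ?thesis unfolding RB_def mult_mat_index_sum[OF QR P kl]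
        by (intro sum.cong refl) (use kl in \<open>simp add: mult_mat_index_sum[OF Q Rc[OF z]] sum_distrib_right del: index_mult_mat\<close>)
    qed
    have RPQ: "?R \<zeta> = P * RB \<zeta> * Q" if z: "\<zeta> \<notin> spectrum A" for \<zeta>
    proof -
      have "P * RB \<zeta> * Q = (P * Q) * ?R \<zeta> * (P * Q)"
        unfolding RB_def using P Q Rc[OF z] by (simp add: assoc_mult_mat[of _ n n _ n _ n])
      then show ?thesis unfolding PQ(1) using Rc[OF z] by simp
    qed
    have Ri: "?R \<zeta> $$ (i, j) = (\<Sum>l<n. \<Sum>k<n. P $$ (i, k) * RB \<zeta> $$ (k, l) * Q $$ (l, j))"
      if z: "\<zeta> \<notin> spectrum A" and ij: "i < n" "j < n" for \<zeta> i j
    proof -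
      have PR: "P * RB \<zeta> \<in> carrier_mat n n" using P RBc[OF z] by auto
      show ?thesis unfolding RPQ[OF z] mult_mat_index_sum[OF PR Q ij]
        by (intro sum.cong refl) (use ij in \<open>simp add: mult_mat_index_sum[OF P RBc[OF z]] sum_distrib_right del: index_mult_mat\<close>)
    qed
    have RBinv: "(\<zeta> \<cdot>\<^sub>m 1\<^sub>m n - B) * RB \<zeta> = 1\<^sub>m n" if z: "\<zeta> \<notin> spectrum A" for \<zeta>
    proof -
      let ?M = "\<zeta> \<cdot>\<^sub>m 1\<^sub>m n - A" and ?N = "\<zeta> \<cdot>\<^sub>m 1\<^sub>m n - B"
      have M: "?M \<in> carrier_mat n n" "?N \<in> carrier_mat n n" using A B by (auto intro: minus_carrier_mat)
      have z1: "\<zeta> \<cdot>\<^sub>m 1\<^sub>m n \<in> carrier_mat n n" by simp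
      have QA: "Q * A = B * Q"
      proof -
        have "Q * (P * B * Q) = (Q * P) * B * Q" using P Q B by (simp add: assoc_mult_mat[of _ n n _ n _ n])
        then show ?thesis using PQ(2,3) B(1) Q by simp
      qed
      have "?N * Q = (\<zeta> \<cdot>\<^sub>m 1\<^sub>m n) * Q - B * Q" by (rule minus_mult_distrib_mat[OF z1 B(1) Q])
      also have "(\<zeta> \<cdot>\<^sub>m 1\<^sub>m n) * Q = \<zeta> \<cdot>\<^sub>m Q" using mult_smult_assoc_mat[OF one_carrier_mat Q] Q by simp
      also have "\<zeta> \<cdot>\<^sub>m Q = Q * (\<zeta> \<cdot>\<^sub>m 1\<^sub>m n)" using mult_smult_distrib[OF Q one_carrier_mat] Q by simp
      also have "Q * (\<zeta> \<cdot>\<^sub>m 1\<^sub>m n) - B * Q = Q * ?M"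
        unfolding QA[symmetric] by (rule mult_minus_distrib_mat[OF Q z1 A, symmetric])
      finally have NQ: "?N * Q = Q * ?M" .
      have "?N * RB \<zeta> = (?N * Q) * ?R \<zeta> * P"
        unfolding RB_def using M P Q Rc[OF z] by (simp add: assoc_mult_mat[of _ n n _ n _ n])
      also have "\<dots> = Q * (?M * ?R \<zeta>) * P"
        unfolding NQ using M P Q Rc[OF z] by (simp add: assoc_mult_mat[of _ n n _ n _ n])
      also have "\<dots> = 1\<^sub>m n" unfolding resolvent_props(2)[OF A z] using Q PQ(2) by simp
      finally show ?thesis .
    qed
    have RBlow: "RB \<zeta> $$ (k, l) = 0" if z: "\<zeta> \<notin> spectrum A" and "k < n" "l < k" for \<zeta> k l
    proof (rule upper_triangular_inverse(1)[OF _ RBc[OF z] RBinv[OF z]])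
      show "\<zeta> \<cdot>\<^sub>m 1\<^sub>m n - B \<in> carrier_mat n n" using B by (intro minus_carrier_mat)
      show "(\<zeta> \<cdot>\<^sub>m 1\<^sub>m n - B) $$ (i, j) = 0" if "i < n" "j < i" for i j using that B(1) Bl by simp
      show "(\<zeta> \<cdot>\<^sub>m 1\<^sub>m n - B) $$ (i, i) \<noteq> 0" if "i < n" for i using that B(1) Bii[OF that] z by auto
    qed fact+
    have RBdiag: "RB \<zeta> $$ (k, k) = 1 / (\<zeta> - B $$ (k, k))" if z: "\<zeta> \<notin> spectrum A" and k: "k < n" for \<zeta> k
    proof -
      have "RB \<zeta> $$ (k, k) = 1 / (\<zeta> \<cdot>\<^sub>m 1\<^sub>m n - B) $$ (k, k)"
      proof (rule upper_triangular_inverse(2)[OF _ RBc[OF z] RBinv[OF z]])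
        show "\<zeta> \<cdot>\<^sub>m 1\<^sub>m n - B \<in> carrier_mat n n" using B by (intro minus_carrier_mat)
        show "(\<zeta> \<cdot>\<^sub>m 1\<^sub>m n - B) $$ (i, j) = 0" if "i < n" "j < i" for i j using that B(1) Bl by simp
        show "(\<zeta> \<cdot>\<^sub>m 1\<^sub>m n - B) $$ (i, i) \<noteq> 0" if "i < n" for i using that B(1) Bii[OF that] z by auto
      qed fact
      then show ?thesis using k B(1) by simp
    qed
    have img: "\<zeta> \<notin> spectrum A" if "\<zeta> \<in> path_image \<gamma>" for \<zeta> using \<gamma> that by (auto simp: calc_contour_def)
    have intR: "(\<lambda>\<zeta>. f \<zeta> * ?R \<zeta> $$ (i, j)) contour_integrable_on \<gamma>" if "i < n" "j < n" for i j
      by (rule contour_integrable_resolvent[OF A that \<gamma> f])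
    have intRB: "(\<lambda>\<zeta>. f \<zeta> * RB \<zeta> $$ (k, l)) contour_integrable_on \<gamma>" if kl: "k < n" "l < n" for k l
    proof -
      have "(\<lambda>\<zeta>. \<Sum>b<n. \<Sum>a<n. (Q $$ (k, a) * P $$ (b, l)) * (f \<zeta> * ?R \<zeta> $$ (a, b))) contour_integrable_on \<gamma>"
        by (intro contour_integrable_sum contour_integrable_lmul intR) auto
      then show ?thesis
        by (rule contour_integrable_eq) (use img kl in \<open>auto simp: RBi sum_distrib_left mult_ac\<close>)
    qed
    define c where "c = 1 / (2 * pi * \<i>)"
    define T where "T = mat n n (\<lambda>(k, l). c * contour_integral \<gamma> (\<lambda>\<zeta>. f \<zeta> * RB \<zeta> $$ (k, l)))"
    have T: "T \<in> carrier_mat n n" by (simp add: T_def)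
    have "hol_calc n f A = P * T * Q"
    proof (rule eq_matI)
      fix i j assume "i < dim_row (P * T * Q)" "j < dim_col (P * T * Q)"
      then have ij: "i < n" "j < n" using P Q by auto
      have PT: "P * T \<in> carrier_mat n n" using P T by auto
      have "contour_integral \<gamma> (\<lambda>\<zeta>. f \<zeta> * ?R \<zeta> $$ (i, j))
        = contour_integral \<gamma> (\<lambda>\<zeta>. \<Sum>l<n. \<Sum>k<n. (P $$ (i, k) * Q $$ (l, j)) * (f \<zeta> * RB \<zeta> $$ (k, l)))"
        by (rule contour_integral_eq) (use img ij in \<open>auto simp: Ri sum_distrib_left mult_ac\<close>)
      also have "\<dots> = (\<Sum>l<n. \<Sum>k<n. (P $$ (i, k) * Q $$ (l, j)) * contour_integral \<gamma> (\<lambda>\<zeta>. f \<zeta> * RB \<zeta> $$ (k, l)))"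
        by (intro contour_integral_unique has_contour_integral_sum has_contour_integral_lmul has_contour_integral_integral intRB) auto
      finally have ci: "contour_integral \<gamma> (\<lambda>\<zeta>. f \<zeta> * ?R \<zeta> $$ (i, j)) = \<dots>" .
      have "hol_calc n f A $$ (i, j) = c * contour_integral \<gamma> (\<lambda>\<zeta>. f \<zeta> * ?R \<zeta> $$ (i, j))"
        using ij by (simp add: hol_calc_def Let_def \<gamma>_def[symmetric] c_def)
      also have "\<dots> = (\<Sum>l<n. \<Sum>k<n. P $$ (i, k) * T $$ (k, l) * Q $$ (l, j))"
        unfolding ci by (simp add: T_def sum_distrib_left mult_ac)
      also have "\<dots> = (P * T * Q) $$ (i, j)"
        unfolding mult_mat_index_sum[OF PT Q ij]
        by (intro sum.cong refl) (use ij in \<open>simp add: mult_mat_index_sum[OF P T] sum_distrib_right del: index_mult_mat\<close>)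
      finally show "hol_calc n f A $$ (i, j) = (P * T * Q) $$ (i, j)" .
    qed (use P Q in \<open>auto simp: hol_calc_def Let_def\<close>)
    moreover have "T $$ (k, l) = 0" if kl: "k < n" "l < k" for k l
    proof -
      have "contour_integral \<gamma> (\<lambda>\<zeta>. f \<zeta> * RB \<zeta> $$ (k, l)) = contour_integral \<gamma> (\<lambda>\<zeta>. 0)"
        by (rule contour_integral_eq) (use img kl RBlow in auto)
      then show ?thesis using kl by (simp add: T_def)
    qed
    moreover have "T $$ (k, k) = f (B $$ (k, k))" if k: "k < n" for k
    proof -
      let ?b = "B $$ (k, k)"
      have b: "?b \<in> spectrum A" by (rule Bii[OF k])
      have "((\<lambda>\<zeta>. f \<zeta> / (\<zeta> - ?b)) has_contour_integral (2 * pi * \<i> * winding_number \<gamma> ?b * f ?b)) \<gamma>"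
        using \<gamma> b sub unfolding calc_contour_def
        by (intro Cauchy_integral_formula_convex_simple[OF convex_upper_half_plane f])
           (auto simp: interior_open[OF open_upper_half_plane])
      then have "contour_integral \<gamma> (\<lambda>\<zeta>. f \<zeta> / (\<zeta> - ?b)) = 2 * pi * \<i> * f ?b"
        using \<gamma> b by (simp add: contour_integral_unique calc_contour_def)
      moreover have "contour_integral \<gamma> (\<lambda>\<zeta>. f \<zeta> * RB \<zeta> $$ (k, k)) = contour_integral \<gamma> (\<lambda>\<zeta>. f \<zeta> / (\<zeta> - ?b))"
        by (rule contour_integral_eq) (use img k RBdiag in auto)
      ultimately show ?thesis using k by (simp add: T_def c_def)
    qed
    then have "map (\<lambda>i. T $$ (i, i)) [0..<n] = map f \<mu>s" by (auto simp: \<mu>s_def)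
    ultimately show ?thesis using detconj[OF T] uttri[OF T] by (simp add: o_def)
  qed
  then show ?thesis using that[OF len _ detA] spec sub by blast
qed

text \<open>By the residue theorem the integral is the same for all curves winding once about the
  spectrum, so the contour may be traded for a large circle about 0; it may leave the half plane,
  since the resolvent is holomorphic off the spectrum. There the resolvent is
  \<open>1 / \<zeta>\<close> times the identity up to an error of order
  \<open>1 / \<zeta>^2\<close>.\<close>

lemma contour_integral_resolvent:
  assumes A: "A \<in> carrier_mat n n" and ij: "i < n" "j < n" and \<gamma>: "calc_contour A \<gamma>"
  shows "contour_integral \<gamma> (\<lambda>\<zeta>. resolvent n A \<zeta> $$ (i, j)) = 2 * pi * \<i> * (if i = j then 1 else 0)"
proof -
  let ?R = "\<lambda>\<zeta>. resolvent n A \<zeta>"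
  let ?h = "\<lambda>\<zeta>. ?R \<zeta> $$ (i, j)"
  have fin: "finite (spectrum A)" using card_finite_spectrum[OF A] by simp
  have hol: "?h holomorphic_on UNIV - spectrum A" using resolvent_entry_holomorphic[OF A ij] by (simp add: Compl_eq_Diff_UNIV)
  have res: "contour_integral g ?h = 2 * pi * \<i> * (\<Sum>p\<in>spectrum A. residue ?h p)"
    if g: "valid_path g" "pathfinish g = pathstart g" "path_image g \<subseteq> - spectrum A"
      "\<And>p. p \<in> spectrum A \<Longrightarrow> winding_number g p = 1" for g
    using Residue_theorem[OF open_UNIV connected_UNIV fin hol g(1,2)] g(3,4) by (simp add: Compl_eq_Diff_UNIV)
  define M where "M = (\<Sum>k<n. \<Sum>l<n. cmod (A $$ (k, l)))"
  have M0: "0 \<le> M" unfolding M_def by (intro sum_nonneg) auto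
  have rowM: "(\<Sum>k<n. cmod (A $$ (k, l))) \<le> M" if "l < n" for l
  proof -
    have "(\<Sum>k<n. cmod (A $$ (k, l))) \<le> (\<Sum>l<n. \<Sum>k<n. cmod (A $$ (k, l)))"
      by (rule member_le_sum[of _ _ "\<lambda>l. \<Sum>k<n. cmod (A $$ (k, l))"]) (use that in \<open>auto intro: sum_nonneg\<close>)
    also have "\<dots> = M" unfolding M_def by (rule sum.swap)
    finally show ?thesis .
  qed
  have eqn: "\<zeta> * ?R \<zeta> $$ (k, j) = (if k = j then 1 else 0) + (\<Sum>l<n. A $$ (k, l) * ?R \<zeta> $$ (l, j))"
    if z: "\<zeta> \<notin> spectrum A" and k: "k < n" for \<zeta> k
  proof -
    note R = resolvent_props[OF A z]
    have Mc: "\<zeta> \<cdot>\<^sub>m 1\<^sub>m n - A \<in> carrier_mat n n" using A by (intro minus_carrier_mat)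
    have "(\<Sum>l<n. (\<zeta> \<cdot>\<^sub>m 1\<^sub>m n - A) $$ (k, l) * ?R \<zeta> $$ (l, j)) = (if k = j then 1 else 0)"
      using mult_mat_index_sum[OF Mc R(1) k ij(2)] R(2) k ij by simp
    moreover have "(\<Sum>l<n. (\<zeta> \<cdot>\<^sub>m 1\<^sub>m n - A) $$ (k, l) * ?R \<zeta> $$ (l, j))
       = (\<Sum>l<n. (if l = k then \<zeta> * ?R \<zeta> $$ (l, j) else 0) - A $$ (k, l) * ?R \<zeta> $$ (l, j))"
      using k A by (intro sum.cong) (auto simp: algebra_simps)
    moreover have "\<dots> = \<zeta> * ?R \<zeta> $$ (k, j) - (\<Sum>l<n. A $$ (k, l) * ?R \<zeta> $$ (l, j))"
      using k by (simp add: sum_subtractf)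
    ultimately have "\<zeta> * ?R \<zeta> $$ (k, j) - (\<Sum>l<n. A $$ (k, l) * ?R \<zeta> $$ (l, j)) = (if k = j then 1 else 0)" by simp
    then show ?thesis by (simp only: diff_eq_eq)
  qed
  \<comment> \<open>The column sum absorbs its own error term:
    \<open>cmod \<zeta> * s \<le> 1 + M * s\<close> gives
    \<open>s \<le> 1 / (cmod \<zeta> - M)\<close> on large circles.\<close>
  define s where "s \<zeta> = (\<Sum>k<n. cmod (?R \<zeta> $$ (k, j)))" for \<zeta>
  have Abd: "(\<Sum>k<n. cmod (\<Sum>l<n. A $$ (k, l) * ?R \<zeta> $$ (l, j))) \<le> M * s \<zeta>" for \<zeta>
  proof -
    have "(\<Sum>k<n. cmod (\<Sum>l<n. A $$ (k, l) * ?R \<zeta> $$ (l, j))) \<le> (\<Sum>k<n. \<Sum>l<n. cmod (A $$ (k, l)) * cmod (?R \<zeta> $$ (l, j)))"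
      by (intro sum_mono order_trans[OF norm_sum]) (simp add: norm_mult)
    also have "\<dots> = (\<Sum>l<n. (\<Sum>k<n. cmod (A $$ (k, l))) * cmod (?R \<zeta> $$ (l, j)))"
      unfolding sum_distrib_right by (rule sum.swap)
    also have "\<dots> \<le> (\<Sum>l<n. M * cmod (?R \<zeta> $$ (l, j)))"
      using rowM by (intro sum_mono mult_right_mono) auto
    also have "\<dots> = M * s \<zeta>" by (simp add: s_def sum_distrib_left)
    finally show ?thesis .
  qed
  have sbd: "cmod \<zeta> * s \<zeta> \<le> 1 + M * s \<zeta>" if z: "\<zeta> \<notin> spectrum A" for \<zeta>
  proof -
    have "cmod \<zeta> * s \<zeta> = (\<Sum>k<n. cmod (\<zeta> * ?R \<zeta> $$ (k, j)))" by (simp add: s_def sum_distrib_left norm_mult)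
    also have "\<dots> \<le> (\<Sum>k<n. (if k = j then 1 else 0) + cmod (\<Sum>l<n. A $$ (k, l) * ?R \<zeta> $$ (l, j)))"
      using eqn[OF z] by (intro sum_mono) (auto intro: order_trans[OF norm_triangle_ineq])
    also have "\<dots> = 1 + (\<Sum>k<n. cmod (\<Sum>l<n. A $$ (k, l) * ?R \<zeta> $$ (l, j)))"
      using ij by (simp add: sum.distrib)
    also have "\<dots> \<le> 1 + M * s \<zeta>" using Abd by simp
    finally show ?thesis .
  qed
  define J where "J = 2 * pi * \<i> * (\<Sum>p\<in>spectrum A. residue ?h p)"
  define \<delta> where "\<delta> = (if i = j then 1 else 0 :: complex)"
  define B where "B = (\<Sum>\<sigma>\<in>spectrum A. cmod \<sigma>)"
  have bound: "cmod (J - 2 * pi * \<i> * \<delta>) \<le> 2 * pi * M / (\<rho> - M)" if \<rho>: "B < \<rho>" "M < \<rho>" for \<rho>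
  proof -
    have \<rho>0: "0 < \<rho>" using \<rho> M0 by linarith
    have lt: "cmod p < \<rho>" if "p \<in> spectrum A" for p
      using member_le_sum[OF that _ fin, of cmod] \<rho> by (simp add: B_def)
    have img: "path_image (circlepath 0 \<rho>) \<subseteq> - spectrum A"
    proof
      fix z assume "z \<in> path_image (circlepath 0 \<rho>)"
      then have "cmod z = \<rho>" using \<rho>0 by simp
      then show "z \<in> - spectrum A" using lt[of z] by auto
    qed
    have h: "(?h has_contour_integral J) (circlepath 0 \<rho>)"
    proof -
      have "contour_integral (circlepath 0 \<rho>) ?h = J"
        unfolding J_def using lt img by (intro res) (auto intro!: winding_number_circlepath)
      moreover have "?h contour_integrable_on circlepath 0 \<rho>"
        using hol fin img by (intro contour_integrable_holomorphic_simple[of _ "UNIV - spectrum A"])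
          (auto intro: open_Diff finite_imp_closed)
      ultimately show ?thesis using has_contour_integral_integral by metis
    qed
    have "((\<lambda>\<zeta>. \<delta> / (\<zeta> - 0)) has_contour_integral 2 * pi * \<i> * winding_number (circlepath 0 \<rho>) 0 * \<delta>) (circlepath 0 \<rho>)"
      by (rule Cauchy_integral_formula_convex_simple[of UNIV "\<lambda>_. \<delta>"]) (use \<rho>0 in auto)
    moreover have "winding_number (circlepath 0 \<rho>) 0 = 1" using \<rho>0 by (rule winding_number_circlepath_centre)
    ultimately have "((\<lambda>\<zeta>. \<delta> / \<zeta>) has_contour_integral 2 * pi * \<i> * \<delta>) (circlepath 0 \<rho>)" by simp
    from has_contour_integral_diff[OF h this]
    have "cmod (J - 2 * pi * \<i> * \<delta>) \<le> (M / ((\<rho> - M) * \<rho>)) * (2 * pi * \<rho>)"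
    proof (rule has_contour_integral_bound_circlepath)
      show "0 \<le> M / ((\<rho> - M) * \<rho>)" using M0 \<rho> \<rho>0 by simp
      show "0 < \<rho>" by (rule \<rho>0)
      fix \<zeta> assume z: "cmod (\<zeta> - 0) = \<rho>"
      then have zs: "\<zeta> \<notin> spectrum A" using lt[of \<zeta>] by auto
      have z0: "\<zeta> \<noteq> 0" using z \<rho>0 by auto
      have "\<rho> * s \<zeta> \<le> 1 + M * s \<zeta>" using sbd[OF zs] z by simp
      then have "s \<zeta> \<le> 1 / (\<rho> - M)" using \<rho> by (simp add: field_simps)
      then have Ms: "M * s \<zeta> \<le> M / (\<rho> - M)" using mult_left_mono[OF _ M0] by fastforce
      have "cmod (\<Sum>l<n. A $$ (i, l) * ?R \<zeta> $$ (l, j)) \<le> (\<Sum>k<n. cmod (\<Sum>l<n. A $$ (k, l) * ?R \<zeta> $$ (l, j)))"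
        by (rule member_le_sum[of _ _ "\<lambda>k. cmod (\<Sum>l<n. A $$ (k, l) * ?R \<zeta> $$ (l, j))"]) (use ij in auto)
      also have "\<dots> \<le> M / (\<rho> - M)" using Abd[of \<zeta>] Ms by linarith
      finally have b: "cmod (\<Sum>l<n. A $$ (i, l) * ?R \<zeta> $$ (l, j)) \<le> M / (\<rho> - M)" .
      have "?h \<zeta> - \<delta> / \<zeta> = (\<Sum>l<n. A $$ (i, l) * ?R \<zeta> $$ (l, j)) / \<zeta>"
        using eqn[OF zs ij(1)] z0 unfolding \<delta>_def by (simp add: field_simps)
      then have "cmod (?h \<zeta> - \<delta> / \<zeta>) = cmod (\<Sum>l<n. A $$ (i, l) * ?R \<zeta> $$ (l, j)) / \<rho>" using z by (simp add: norm_divide)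
      also have "\<dots> \<le> M / (\<rho> - M) / \<rho>" using b \<rho>0 by (intro divide_right_mono) auto
      finally show "cmod (?h \<zeta> - \<delta> / \<zeta>) \<le> M / ((\<rho> - M) * \<rho>)" by simp
    qed
    also have "\<dots> = (2 * pi * M) * \<rho> / ((\<rho> - M) * \<rho>)" by (simp add: mult_ac)
    also have "\<dots> = 2 * pi * M / (\<rho> - M)" using \<rho>0 by (intro nonzero_mult_divide_mult_cancel_right) auto
    finally show ?thesis .
  qed
  have "((\<lambda>\<rho>. 2 * pi * M / (\<rho> - M)) \<longlongrightarrow> 0) at_top" by real_asymp
  moreover have "eventually (\<lambda>\<rho>. cmod (J - 2 * pi * \<i> * \<delta>) \<le> 2 * pi * M / (\<rho> - M)) at_top"
    using eventually_gt_at_top[of B] eventually_gt_at_top[of M] by eventually_elim (rule bound)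
  ultimately have "cmod (J - 2 * pi * \<i> * \<delta>) \<le> 0"
    by (intro tendsto_lowerbound) auto
  then have "J = 2 * pi * \<i> * \<delta>" by simp
  moreover have "contour_integral \<gamma> ?h = J"
    unfolding J_def using \<gamma> by (intro res) (auto simp: calc_contour_def)
  ultimately show ?thesis by (simp add: \<delta>_def)
qed

text \<open>By linearity three integrals suffice. Up to the factor \<open>2 * pi * \<i>\<close> the
  resolvent gives the identity, \<zeta> times the resolvent gives \<open>A\<close>, and the
  resolvent over \<open>l k - \<zeta>\<close> gives \<open>- N k\<close>. The last two follow from
  \<open>\<zeta> * R = 1 + A * R\<close> and \<open>(\<zeta> - l k) * N k * R = R + N k\<close>,
  because terms holomorphic on the half plane integrate to 0.\<close>

lemma hol_calc_rational:
  assumes A: "A \<in> carrier_mat n n" and sub: "spectrum A \<subseteq> upper_half_plane"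
    and S: "finite S" and N: "\<And>k. k \<in> S \<Longrightarrow> N k \<in> carrier_mat n n \<and> N k * (A - of_real (l k) \<cdot>\<^sub>m 1\<^sub>m n) = 1\<^sub>m n"
    and f: "\<And>z. z \<in> upper_half_plane \<Longrightarrow> f z = c + d * z + (\<Sum>k\<in>S. a k / (of_real (l k) - z))"
    and ij: "i < n" "j < n"
  shows "hol_calc n f A $$ (i, j) = (if i = j then c else 0) + d * A $$ (i, j) - (\<Sum>k\<in>S. a k * N k $$ (i, j))"
proof -
  let ?U = upper_half_plane
  have fin: "finite (spectrum A)" using card_finite_spectrum[OF A] by simp
  define \<gamma> where "\<gamma> = (SOME \<gamma>. calc_contour A \<gamma>)"
  have \<gamma>: "calc_contour A \<gamma>" unfolding \<gamma>_def by (rule someI_ex[OF calc_contour_exists[OF fin sub]])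
  let ?R = "resolvent n A"
  have img: "\<zeta> \<notin> spectrum A" "\<zeta> \<in> ?U" if "\<zeta> \<in> path_image \<gamma>" for \<zeta> using \<gamma> that by (auto simp: calc_contour_def)
  have lz: "of_real x - \<zeta> \<noteq> 0" if "\<zeta> \<in> ?U" for x \<zeta> using that by (auto simp: complex_eq_iff)
  have R0: "((\<lambda>\<zeta>. ?R \<zeta> $$ (p, q)) has_contour_integral 2 * pi * \<i> * (if p = q then 1 else 0)) \<gamma>"
    if pq: "p < n" "q < n" for p q
  proof -
    have "(\<lambda>\<zeta>. 1 * ?R \<zeta> $$ (p, q)) contour_integrable_on \<gamma>"
      by (rule contour_integrable_resolvent[OF A pq \<gamma>]) simp
    then show ?thesis using contour_integral_resolvent[OF A pq \<gamma>] has_contour_integral_integral by fastforce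
  qed
  have zero: "(h has_contour_integral 0) \<gamma>" if "h holomorphic_on ?U" for h
    using \<gamma> by (intro Cauchy_theorem_convex_simple[OF that convex_upper_half_plane]) (auto simp: calc_contour_def)
  have R1: "((\<lambda>\<zeta>. \<zeta> * ?R \<zeta> $$ (i, j)) has_contour_integral 2 * pi * \<i> * A $$ (i, j)) \<gamma>"
  proof -
    have "((\<lambda>\<zeta>. (if i = j then 1 else 0) + (\<Sum>k<n. A $$ (i, k) * ?R \<zeta> $$ (k, j))) has_contour_integral
        0 + (\<Sum>k<n. A $$ (i, k) * (2 * pi * \<i> * (if k = j then 1 else 0)))) \<gamma>"
      using ij by (intro has_contour_integral_add has_contour_integral_sum has_contour_integral_lmul R0 zero) auto
    moreover have "(\<Sum>k<n. A $$ (i, k) * (2 * pi * \<i> * (if k = j then 1 else 0))) = 2 * pi * \<i> * A $$ (i, j)"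
      using ij by (simp add: if_distrib mult_ac cong: if_cong)
    ultimately have "((\<lambda>\<zeta>. (if i = j then 1 else 0) + (\<Sum>k<n. A $$ (i, k) * ?R \<zeta> $$ (k, j))) has_contour_integral
        2 * pi * \<i> * A $$ (i, j)) \<gamma>" by simp
    then show ?thesis
    proof (rule has_contour_integral_eq)
      fix \<zeta> assume "\<zeta> \<in> path_image \<gamma>"
      note R = resolvent_props[OF A img(1)[OF this]]
      have Mc: "\<zeta> \<cdot>\<^sub>m 1\<^sub>m n - A \<in> carrier_mat n n" using A by (intro minus_carrier_mat)
      have "(\<Sum>k<n. (\<zeta> \<cdot>\<^sub>m 1\<^sub>m n - A) $$ (i, k) * ?R \<zeta> $$ (k, j)) = (if i = j then 1 else 0)"
        using mult_mat_index_sum[OF Mc R(1) ij] R(2) ij by simp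
      moreover have "(\<Sum>k<n. (\<zeta> \<cdot>\<^sub>m 1\<^sub>m n - A) $$ (i, k) * ?R \<zeta> $$ (k, j))
         = (\<Sum>k<n. (if k = i then \<zeta> * ?R \<zeta> $$ (k, j) else 0) - A $$ (i, k) * ?R \<zeta> $$ (k, j))"
        using ij A by (intro sum.cong) (auto simp: algebra_simps)
      moreover have "\<dots> = \<zeta> * ?R \<zeta> $$ (i, j) - (\<Sum>k<n. A $$ (i, k) * ?R \<zeta> $$ (k, j))"
        using ij by (simp add: sum_subtractf)
      ultimately have "\<zeta> * ?R \<zeta> $$ (i, j) - (\<Sum>k<n. A $$ (i, k) * ?R \<zeta> $$ (k, j)) = (if i = j then 1 else 0)" by simp
      then show "(if i = j then 1 else 0) + (\<Sum>k<n. A $$ (i, k) * ?R \<zeta> $$ (k, j)) = \<zeta> * ?R \<zeta> $$ (i, j)"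
        by (simp only: diff_eq_eq)
    qed
  qed
  have R2: "((\<lambda>\<zeta>. 1 / (of_real (l k) - \<zeta>) * ?R \<zeta> $$ (i, j)) has_contour_integral - (2 * pi * \<i> * N k $$ (i, j))) \<gamma>"
    if k: "k \<in> S" for k
  proof -
    have Nk: "N k \<in> carrier_mat n n" "N k * (A - of_real (l k) \<cdot>\<^sub>m 1\<^sub>m n) = 1\<^sub>m n" using N[OF k] by auto
    have "((\<lambda>\<zeta>. - ((\<Sum>p<n. N k $$ (i, p) * ?R \<zeta> $$ (p, j)) + 1 / (of_real (l k) - \<zeta>) * N k $$ (i, j))) has_contour_integral
        - ((\<Sum>p<n. N k $$ (i, p) * (2 * pi * \<i> * (if p = j then 1 else 0))) + 0)) \<gamma>"
      using ij lz by (intro has_contour_integral_neg has_contour_integral_add has_contour_integral_sum has_contour_integral_lmul R0 zero)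
        (auto intro!: holomorphic_intros)
    moreover have "(\<Sum>p<n. N k $$ (i, p) * (2 * pi * \<i> * (if p = j then 1 else 0))) = 2 * pi * \<i> * N k $$ (i, j)"
      using ij by (simp add: if_distrib mult_ac cong: if_cong)
    ultimately have "((\<lambda>\<zeta>. - ((\<Sum>p<n. N k $$ (i, p) * ?R \<zeta> $$ (p, j)) + 1 / (of_real (l k) - \<zeta>) * N k $$ (i, j))) has_contour_integral
        - (2 * pi * \<i> * N k $$ (i, j))) \<gamma>" by simp
    then show ?thesis
    proof (rule has_contour_integral_eq)
      fix \<zeta> assume z: "\<zeta> \<in> path_image \<gamma>"
      note R = resolvent_props[OF A img(1)[OF z]]
      let ?L = "of_real (l k) :: complex"
      have c: "A - ?L \<cdot>\<^sub>m 1\<^sub>m n \<in> carrier_mat n n" "\<zeta> \<cdot>\<^sub>m 1\<^sub>m n - A \<in> carrier_mat n n" "(\<zeta> - ?L) \<cdot>\<^sub>m 1\<^sub>m n \<in> carrier_mat n n"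
        using A by (auto intro: minus_carrier_mat)
      have NR: "N k * ?R \<zeta> \<in> carrier_mat n n" using Nk R by auto
      have split: "(\<zeta> - ?L) \<cdot>\<^sub>m 1\<^sub>m n = (A - ?L \<cdot>\<^sub>m 1\<^sub>m n) + (\<zeta> \<cdot>\<^sub>m 1\<^sub>m n - A)"
        using A by (intro eq_matI) auto
      have "(\<zeta> - ?L) \<cdot>\<^sub>m (N k * ?R \<zeta>) = N k * ((\<zeta> - ?L) \<cdot>\<^sub>m 1\<^sub>m n) * ?R \<zeta>"
        using Nk(1) R(1) by (simp add: mult_smult_distrib[OF Nk(1) one_carrier_mat] mult_smult_assoc_mat[OF Nk(1) R(1)])
      also have "\<dots> = (1\<^sub>m n + N k * (\<zeta> \<cdot>\<^sub>m 1\<^sub>m n - A)) * ?R \<zeta>"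
        unfolding split using mult_add_distrib_mat[OF Nk(1) c(1,2)] Nk(2) by simp
      also have "\<dots> = ?R \<zeta> + N k * (\<zeta> \<cdot>\<^sub>m 1\<^sub>m n - A) * ?R \<zeta>"
        using R(1) Nk(1) c(2) by (subst add_mult_distrib_mat[of _ n n]) auto
      also have "N k * (\<zeta> \<cdot>\<^sub>m 1\<^sub>m n - A) * ?R \<zeta> = N k"
        using assoc_mult_mat[OF Nk(1) c(2) R(1)] R(2) Nk(1) by simp
      finally have E: "(\<zeta> - ?L) \<cdot>\<^sub>m (N k * ?R \<zeta>) = ?R \<zeta> + N k" .
      have "(\<zeta> - ?L) * (N k * ?R \<zeta>) $$ (i, j) = ((\<zeta> - ?L) \<cdot>\<^sub>m (N k * ?R \<zeta>)) $$ (i, j)"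
        using carrier_matD[OF NR] ij by (simp del: index_mult_mat)
      also have "\<dots> = ?R \<zeta> $$ (i, j) + N k $$ (i, j)" unfolding E using R(1) Nk(1) ij by simp
      finally have "(\<zeta> - ?L) * (N k * ?R \<zeta>) $$ (i, j) = ?R \<zeta> $$ (i, j) + N k $$ (i, j)" .
      then have e: "(\<zeta> - ?L) * (\<Sum>p<n. N k $$ (i, p) * ?R \<zeta> $$ (p, j)) = ?R \<zeta> $$ (i, j) + N k $$ (i, j)"
        unfolding mult_mat_index_sum[OF Nk(1) R(1) ij] .
      have nz: "?L - \<zeta> \<noteq> 0" by (rule lz[OF img(2)[OF z]])
      have alg: "(?L - \<zeta>) * - (x + y) = (\<zeta> - ?L) * x - (?L - \<zeta>) * y" for x y by (simp add: algebra_simps)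
      have div: "y = 1 / b * x" if "b * y = x" "b \<noteq> 0" for b x y :: complex using that by auto
      have "(?L - \<zeta>) * - ((\<Sum>p<n. N k $$ (i, p) * ?R \<zeta> $$ (p, j)) + 1 / (?L - \<zeta>) * N k $$ (i, j)) = ?R \<zeta> $$ (i, j)"
        unfolding alg e using nz by simp
      then show "- ((\<Sum>p<n. N k $$ (i, p) * ?R \<zeta> $$ (p, j)) + 1 / (?L - \<zeta>) * N k $$ (i, j)) = 1 / (?L - \<zeta>) * ?R \<zeta> $$ (i, j)"
        by (rule div[OF _ nz])
    qed
  qed
  have "((\<lambda>\<zeta>. c * ?R \<zeta> $$ (i, j) + d * (\<zeta> * ?R \<zeta> $$ (i, j)) + (\<Sum>k\<in>S. a k * (1 / (of_real (l k) - \<zeta>) * ?R \<zeta> $$ (i, j))))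
     has_contour_integral c * (2 * pi * \<i> * (if i = j then 1 else 0)) + d * (2 * pi * \<i> * A $$ (i, j))
       + (\<Sum>k\<in>S. a k * - (2 * pi * \<i> * N k $$ (i, j)))) \<gamma>"
    using ij S by (intro has_contour_integral_add has_contour_integral_sum has_contour_integral_lmul R0 R1 R2) auto
  then have "((\<lambda>\<zeta>. f \<zeta> * ?R \<zeta> $$ (i, j)) has_contour_integral c * (2 * pi * \<i> * (if i = j then 1 else 0)) + d * (2 * pi * \<i> * A $$ (i, j))
       + (\<Sum>k\<in>S. a k * - (2 * pi * \<i> * N k $$ (i, j)))) \<gamma>"
    by (rule has_contour_integral_eq) (use f img(2) in \<open>simp add: algebra_simps sum_distrib_left sum_distrib_right\<close>)
  then have ci: "contour_integral \<gamma> (\<lambda>\<zeta>. f \<zeta> * ?R \<zeta> $$ (i, j)) = 2 * pi * \<i> *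
      ((if i = j then c else 0) + d * A $$ (i, j) - (\<Sum>k\<in>S. a k * N k $$ (i, j)))"
    by (subst contour_integral_unique) (auto simp: algebra_simps sum_distrib_left sum_negf)
  show ?thesis using ij by (simp add: hol_calc_def Let_def \<gamma>_def[symmetric] ci)
qed

subsection \<open>Degree of compositions\<close>

lemma det_scalar_op: "det (scalar_op f z - w \<cdot>\<^sub>m 1\<^sub>m 1) = f z - w"
proof -
  have "scalar_op f z - w \<cdot>\<^sub>m 1\<^sub>m 1 \<in> carrier_mat 1 1" by (intro minus_carrier_mat smult_carrier_mat one_carrier_mat)
  then show ?thesis by (simp only: det_single) (simp add: scalar_op_def)
qed

lemma scalar_op_carrier: "scalar_op f z \<in> carrier_mat 1 1"
  by (simp add: scalar_op_def)

lemma self_adjoint_index: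
  assumes "self_adjoint n A" "i < n" "j < n"
  shows "A $$ (i, j) = cnj (A $$ (j, i))"
  using assms unfolding self_adjoint_iff by blast

lemma self_adjointI:
  assumes "A \<in> carrier_mat n n" "\<And>i j. i < n \<Longrightarrow> j < n \<Longrightarrow> A $$ (i, j) = cnj (A $$ (j, i))"
  shows "self_adjoint n A"
  using assms unfolding self_adjoint_iff by blast

lemma Pick_R_scalar_op:
  assumes "scalar_op f \<in> Pick_R 1"
  shows "f holomorphic_on upper_half_plane"
    "AE x in lborel. \<exists>r. ((\<lambda>\<epsilon>. f (Complex x \<epsilon>)) \<longlongrightarrow> complex_of_real r) (at_right 0)"
proof -
  show "f holomorphic_on upper_half_plane"
    using assms by (simp add: Pick_R_iff holomorphic_mat_def scalar_op_def)
  have "AE x in lborel. \<exists>B. has_boundary_mat 1 (scalar_op f) x B \<and> self_adjoint 1 B"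
    using assms by (simp add: Pick_R_iff)
  then show "AE x in lborel. \<exists>r. ((\<lambda>\<epsilon>. f (Complex x \<epsilon>)) \<longlongrightarrow> complex_of_real r) (at_right 0)"
  proof eventually_elim
    case (elim x)
    then obtain B where B: "has_boundary_mat 1 (scalar_op f) x B" "self_adjoint 1 B" by blast
    have "B $$ (0, 0) = cnj (B $$ (0, 0))" by (rule self_adjoint_index[OF B(2)]) simp_all
    then have "B $$ (0, 0) = complex_of_real (Re (B $$ (0, 0)))" by (simp add: complex_eq_iff)
    moreover have "((\<lambda>\<epsilon>. f (Complex x \<epsilon>)) \<longlongrightarrow> B $$ (0, 0)) (at_right 0)"
      using B(1) by (simp add: has_boundary_mat_def scalar_op_def)
    ultimately show ?case by metis
  qed
qed

lemma rational_Pick_scalar_op: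
  assumes "rational_Pick 1 (scalar_op f)"
  obtains c d :: real and m and l a :: "nat \<Rightarrow> real"
  where "0 \<le> d" "\<And>k. k \<in> {1..m} \<Longrightarrow> 0 \<le> a k"
    "\<And>z. z \<in> upper_half_plane \<Longrightarrow>
       f z = of_real c + of_real d * z + (\<Sum>k=1..m. of_real (a k) / (of_real (l k) - z))"
proof -
  obtain C D m l A where rep: "rational_rep 1 (scalar_op f) C D m l A"
    using assms unfolding rational_Pick_def by blast
  have q: "quad_form 1 X (vec 1 (\<lambda>_. 1)) = X $$ (0, 0)" for X by (simp add: quad_form_def)
  have ps: "0 \<le> Re (X $$ (0, 0))" "X $$ (0, 0) = of_real (Re (X $$ (0, 0)))" if "psd 1 X" for X
  proof -
    have "vec 1 (\<lambda>_. 1) \<in> carrier_vec 1" by simp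
    then have "0 \<le> Re (X $$ (0, 0)) \<and> Im (X $$ (0, 0)) = 0"
      using that q[of X] unfolding psd_iff by metis
    then show "0 \<le> Re (X $$ (0, 0))" "X $$ (0, 0) = of_real (Re (X $$ (0, 0)))" by (simp_all add: complex_eq_iff)
  qed
  have "self_adjoint 1 C" using rep by (simp add: rational_rep_def)
  then have "C $$ (0, 0) = cnj (C $$ (0, 0))" by (rule self_adjoint_index) simp_all
  then have C: "C $$ (0, 0) = of_real (Re (C $$ (0, 0)))" by (simp add: complex_eq_iff)
  have D: "psd 1 D" and A: "\<And>k. k \<in> {1..m} \<Longrightarrow> psd 1 (A k)" using rep by (auto simp: rational_rep_def)
  show ?thesis
  proof (rule that)
    show "0 \<le> Re (D $$ (0, 0))" by (rule ps[OF D])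
    show "0 \<le> Re (A k $$ (0, 0))" if "k \<in> {1..m}" for k by (rule ps[OF A[OF that]])
    fix z assume z: "z \<in> upper_half_plane"
    have "f z = scalar_op f z $$ (0, 0)" by (simp add: scalar_op_def)
    also have "\<dots> = C $$ (0, 0) + z * D $$ (0, 0) + (\<Sum>k=1..m. 1 / (of_real (l k) - z) * A k $$ (0, 0))"
      using rep z by (auto simp: rational_rep_def)
    also have "(\<Sum>k=1..m. 1 / (of_real (l k) - z) * A k $$ (0, 0))
        = (\<Sum>k=1..m. of_real (Re (A k $$ (0, 0))) / (of_real (l k) - z))"
      by (intro sum.cong refl) (metis ps(2)[OF A] times_divide_eq_left mult_1)
    also have "z * D $$ (0, 0) = of_real (Re (D $$ (0, 0))) * z" using ps(2)[OF D] by (metis mult.commute)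
    finally show "f z = of_real (Re (C $$ (0, 0))) + of_real (Re (D $$ (0, 0))) * z
        + (\<Sum>k=1..m. of_real (Re (A k $$ (0, 0))) / (of_real (l k) - z))" using C by simp
  qed
qed

lemma rational_Pick_entries_compose:
  assumes rat: "rational_Pick n F" and g: "rational_on_uhp g"
    and gU: "\<And>z. z \<in> upper_half_plane \<Longrightarrow> g z \<in> upper_half_plane" and ij: "i < n" "j < n"
  shows "rational_on_uhp (\<lambda>z. F (g z) $$ (i, j))"
proof -
  obtain C D m l A where rep: "rational_rep n F C D m l A"
    using rat unfolding rational_Pick_def by blast
  have nz: "of_real (l k) - g z \<noteq> 0" if "z \<in> upper_half_plane" for k z
    using gU[OF that] by (auto simp: complex_eq_iff)
  have "rational_on_uhp (\<lambda>z. C $$ (i, j) + g z * D $$ (i, j) + (\<Sum>k=1..m. 1 / (of_real (l k) - g z) * A k $$ (i, j)))"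
    using nz by (intro rational_on_uhp_add rational_on_uhp_mult rational_on_uhp_sum rational_on_uhp_const g
        rational_on_uhp_inverse rational_on_uhp_diff) auto
  then show ?thesis
    by (subst rational_on_uhp_cong) (use rep gU ij in \<open>auto simp: rational_rep_def\<close>)
qed

lemma rational_on_uhp_scalar_op:
  assumes "rational_Pick 1 (scalar_op g)"
  shows "rational_on_uhp g"
  using rational_Pick_entries_compose[OF assms rational_on_uhp_ident, of 0 0] by (simp add: scalar_op_def)

text \<open>After reduction to \<open>P / Q\<close>, only the finitely many real roots of
  \<open>P * Q\<close> are exceptional. Applied to \<open>l - g\<close> and to determinants, it
  keeps boundary values away from poles.\<close>

lemma rational_boundary_nonzero:
  assumes rat: "rational_on_uhp h" and cont: "continuous_on upper_half_plane h"
    and nz: "\<And>z. z \<in> upper_half_plane \<Longrightarrow> h z \<noteq> 0"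
  shows "AE x in lborel. \<exists>c. c \<noteq> 0 \<and> ((\<lambda>\<epsilon>. h (Complex x \<epsilon>)) \<longlongrightarrow> c) (at_right 0)"
proof -
  obtain P Q where Q: "Q \<noteq> 0" and PQ: "\<And>z. z \<in> upper_half_plane \<Longrightarrow> h z = poly P z / poly Q z"
    by (rule rational_on_uhp_reduced[OF rat cont]) (rule that)
  have P: "P \<noteq> 0" using nz[of \<i>] PQ[of \<i>] by auto
  define Z where "Z = {x::real. poly (P * Q) (of_real x) = 0}"
  have "finite (complex_of_real -` {z. poly (P * Q) z = 0})"
    using P Q by (intro finite_vimageI poly_roots_finite) (auto simp: inj_on_def)
  then have "finite Z" by (simp add: Z_def vimage_def)
  then have "AE x in lborel. x \<notin> Z" by (intro AE_not_in finite_imp_null_set_lborel)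
  then show ?thesis
  proof eventually_elim
    case (elim x)
    then have x: "poly P (of_real x) \<noteq> 0" "poly Q (of_real x) \<noteq> 0" by (auto simp: Z_def)
    have "((\<lambda>\<epsilon>. poly P (Complex x \<epsilon>) / poly Q (Complex x \<epsilon>)) \<longlongrightarrow> poly P (of_real x) / poly Q (of_real x)) (at_right 0)"
      by (intro tendsto_intros tendsto_Complex_at_right x)
    moreover have "eventually (\<lambda>\<epsilon>. poly P (Complex x \<epsilon>) / poly Q (Complex x \<epsilon>) = h (Complex x \<epsilon>)) (at_right 0)"
      using eventually_at_right_less[of 0] by eventually_elim (simp add: PQ)
    ultimately have "((\<lambda>\<epsilon>. h (Complex x \<epsilon>)) \<longlongrightarrow> poly P (of_real x) / poly Q (of_real x)) (at_right 0)"
      by (rule Lim_transform_eventually)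
    then show ?case using x by (intro exI[of _ "poly P (of_real x) / poly Q (of_real x)"]) auto
  qed
qed

section \<open>Closure of the Pick class under composition and functional calculus\<close>

lemma Pick_R_entries:
  assumes "F \<in> Pick_R n"
  shows "z \<in> upper_half_plane \<Longrightarrow> F z \<in> carrier_mat n n"
    "i < n \<Longrightarrow> j < n \<Longrightarrow> (\<lambda>z. F z $$ (i, j)) holomorphic_on upper_half_plane"
    "z \<in> upper_half_plane \<Longrightarrow> v \<in> carrier_vec n \<Longrightarrow> 0 \<le> Im (quad_form n (F z) v)"
    "AE x in lborel. \<exists>B. has_boundary_mat n F x B \<and> self_adjoint n B"
  using assms by (auto simp: Pick_R_iff holomorphic_mat_def)

text \<open>The boundary behaviour is the delicate point: \<open>F\<close> has to be evaluated at
  the boundary values of \<open>g\<close>. Its partial fractions provide the value at every real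
  point that is not a pole, and \<open>g\<close> takes a pole as boundary value only on a null
  set.\<close>

lemma Pick_R_compose:
  assumes F: "F \<in> Pick_R n" and ratF: "rational_Pick n F"
    and g: "scalar_op g \<in> Pick_R 1" and ratg: "rational_Pick 1 (scalar_op g)"
    and gU: "\<And>z. z \<in> upper_half_plane \<Longrightarrow> g z \<in> upper_half_plane"
  shows "(\<lambda>z. F (g z)) \<in> Pick_R n"
  unfolding Pick_R_iff
proof (intro conjI ballI)
  let ?U = upper_half_plane
  note Fc = Pick_R_entries(1)[OF F] and Fhol = Pick_R_entries(2)[OF F] and Fim = Pick_R_entries(3)[OF F]
  have ghol: "g holomorphic_on ?U" by (rule Pick_R_scalar_op(1)[OF g])
  have "(\<lambda>z. F (g z) $$ (i, j)) holomorphic_on ?U" if "i < n" "j < n" for i j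
    using holomorphic_on_compose_gen[OF ghol Fhol[OF that]] gU by (auto simp: o_def image_subset_iff)
  then show "holomorphic_mat n (\<lambda>z. F (g z))" using Fc gU by (auto simp: holomorphic_mat_def)
  show "0 \<le> Im (quad_form n (F (g z)) v)" if "z \<in> ?U" "v \<in> carrier_vec n" for z v
    by (rule Fim[OF gU[OF that(1)] that(2)])
  obtain C D m l A where rep: "rational_rep n F C D m l A" using ratF unfolding rational_Pick_def by blast
  have sa: "self_adjoint n C" "self_adjoint n D" "\<And>k. k \<in> {1..m} \<Longrightarrow> self_adjoint n (A k)"
    using rep by (auto simp: rational_rep_def intro: psd_imp_self_adjoint)
  have "AE x in lborel. \<forall>k\<in>{1..m}. \<exists>c. c \<noteq> 0 \<and> ((\<lambda>\<epsilon>. of_real (l k) - g (Complex x \<epsilon>)) \<longlongrightarrow> c) (at_right 0)"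
  proof (intro eventually_ball_finite ballI)
    fix k
    show "AE x in lborel. \<exists>c. c \<noteq> 0 \<and> ((\<lambda>\<epsilon>. of_real (l k) - g (Complex x \<epsilon>)) \<longlongrightarrow> c) (at_right 0)"
    proof (rule rational_boundary_nonzero)
      show "rational_on_uhp (\<lambda>z. of_real (l k) - g z)"
        by (intro rational_on_uhp_diff rational_on_uhp_const rational_on_uhp_scalar_op ratg)
      show "continuous_on ?U (\<lambda>z. of_real (l k) - g z)"
        by (intro continuous_intros holomorphic_on_imp_continuous_on ghol)
      show "of_real (l k) - g z \<noteq> 0" if "z \<in> ?U" for z using gU[OF that] by (auto simp: complex_eq_iff)
    qed
  qed simp
  with Pick_R_scalar_op(2)[OF g]
  show "AE x in lborel. \<exists>B. has_boundary_mat n (\<lambda>z. F (g z)) x B \<and> self_adjoint n B"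
  proof eventually_elim
    case (elim x)
    obtain r where r: "((\<lambda>\<epsilon>. g (Complex x \<epsilon>)) \<longlongrightarrow> complex_of_real r) (at_right 0)" using elim(1) by blast
    have nz: "complex_of_real (l k) - of_real r \<noteq> 0" if k: "k \<in> {1..m}" for k
    proof -
      obtain c where c: "c \<noteq> 0" "((\<lambda>\<epsilon>. of_real (l k) - g (Complex x \<epsilon>)) \<longlongrightarrow> c) (at_right 0)"
        using elim(2) k by blast
      have "((\<lambda>\<epsilon>. of_real (l k) - g (Complex x \<epsilon>)) \<longlongrightarrow> of_real (l k) - of_real r) (at_right 0)"
        by (intro tendsto_intros r)
      then have "c = of_real (l k) - of_real r"
        by (rule tendsto_unique[OF trivial_limit_at_right_real c(2)])
      then show ?thesis using c(1) by simp
    qed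
    let ?b = "\<lambda>w i j. C $$ (i, j) + w * D $$ (i, j) + (\<Sum>k=1..m. 1 / (of_real (l k) - w) * A k $$ (i, j))"
    define B where "B = mat n n (\<lambda>(i, j). ?b (of_real r) i j)"
    have "((\<lambda>\<epsilon>. F (g (Complex x \<epsilon>)) $$ (i, j)) \<longlongrightarrow> B $$ (i, j)) (at_right 0)" if ij: "i < n" "j < n" for i j
    proof -
      have "((\<lambda>\<epsilon>. ?b (g (Complex x \<epsilon>)) i j) \<longlongrightarrow> ?b (of_real r) i j) (at_right 0)"
        by (intro tendsto_intros r nz)
      moreover have "eventually (\<lambda>\<epsilon>. ?b (g (Complex x \<epsilon>)) i j = F (g (Complex x \<epsilon>)) $$ (i, j)) (at_right 0)"
        using eventually_at_right_less[of 0]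
        by eventually_elim (use rep ij gU in \<open>simp add: rational_rep_def\<close>)
      ultimately have "((\<lambda>\<epsilon>. F (g (Complex x \<epsilon>)) $$ (i, j)) \<longlongrightarrow> ?b (of_real r) i j) (at_right 0)"
        by (rule Lim_transform_eventually)
      then show ?thesis using ij by (simp add: B_def)
    qed
    moreover have "B $$ (i, j) = cnj (B $$ (j, i))" if ij: "i < n" "j < n" for i j
    proof -
      have "cnj (?b (of_real r) j i) = ?b (of_real r) i j"
        using self_adjoint_index[OF sa(1) ij] self_adjoint_index[OF sa(2) ij] self_adjoint_index[OF sa(3) ij] by simp
      then show ?thesis using ij by (simp add: B_def)
    qed
    ultimately have "has_boundary_mat n (\<lambda>z. F (g z)) x B \<and> self_adjoint n B"
      unfolding self_adjoint_iff has_boundary_mat_def by (simp add: B_def)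
    then show ?case by blast
  qed
qed

lemma self_adjoint_inverse:
  fixes A N :: "complex mat"
  assumes A: "self_adjoint n A" and N: "N \<in> carrier_mat n n" "A * N = 1\<^sub>m n"
  shows "self_adjoint n N"
proof -
  have Ac: "A \<in> carrier_mat n n" "mat_adjoint A = A" using A by (auto simp: self_adjoint_def)
  have Nc: "mat_adjoint N \<in> carrier_mat n n" using N(1) by (rule mat_adjoint_carrier)
  have "mat_adjoint N * A = 1\<^sub>m n"
    using mat_adjoint_mult[OF Ac(1) N(1)] unfolding N(2) mat_adjoint_one Ac(2) by simp
  then have "N = (mat_adjoint N * A) * N" using N(1) by simp
  also have "\<dots> = mat_adjoint N" using assoc_mult_mat[OF Nc Ac(1) N(1)] N(2) right_mult_one_mat[OF Nc] by simp
  finally show ?thesis using N(1) by (simp add: self_adjoint_def)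
qed

text \<open>The negative of the inverse is again a Pick function: with \<open>y = N z v\<close>, the
  imaginary part of its form at \<open>v\<close> is that of \<open>\<Phi> z\<close> at
  \<open>y\<close>. At the boundary the inverse still exists almost everywhere, since the
  determinant is rational and has no zero in the half plane.\<close>

lemma Pick_R_resolvent:
  fixes l :: real
  assumes \<Phi>: "\<Phi> \<in> Pick_R n" and rat: "\<And>i j. i < n \<Longrightarrow> j < n \<Longrightarrow> rational_on_uhp (\<lambda>z. \<Phi> z $$ (i, j))"
    and nz: "\<And>z. z \<in> upper_half_plane \<Longrightarrow> det (\<Phi> z - of_real l \<cdot>\<^sub>m 1\<^sub>m n) \<noteq> 0"
  obtains N where "\<And>z. z \<in> upper_half_plane \<Longrightarrow> N z \<in> carrier_mat n n \<and> N z * (\<Phi> z - of_real l \<cdot>\<^sub>m 1\<^sub>m n) = 1\<^sub>m n"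
    "\<And>i j. i < n \<Longrightarrow> j < n \<Longrightarrow> rational_on_uhp (\<lambda>z. N z $$ (i, j))"
    "(\<lambda>z. mat n n (\<lambda>(i, j). - N z $$ (i, j))) \<in> Pick_R n"
proof -
  let ?U = upper_half_plane
  note \<Phi>c = Pick_R_entries(1)[OF \<Phi>] and \<Phi>hol = Pick_R_entries(2)[OF \<Phi>] and \<Phi>im = Pick_R_entries(3)[OF \<Phi>]
  define sh where "sh A = A - of_real l \<cdot>\<^sub>m 1\<^sub>m n" for A :: "complex mat"
  have shc: "sh A \<in> carrier_mat n n" for A
    unfolding sh_def by (intro minus_carrier_mat smult_carrier_mat one_carrier_mat)
  have shi: "sh A $$ (p, q) = A $$ (p, q) - (if p = q then of_real l else 0)"
    if "A \<in> carrier_mat n n" "p < n" "q < n" for A p q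
    using that by (simp add: sh_def)
  define minv where "minv A = mat n n (\<lambda>(p, q). 1 / det A * adj_mat A $$ (p, q))" for A :: "complex mat"
  have minvc: "minv A \<in> carrier_mat n n" for A by (simp add: minv_def)
  have minv: "minv A * A = 1\<^sub>m n" "A * minv A = 1\<^sub>m n" if "A \<in> carrier_mat n n" "det A \<noteq> 0" for A
    unfolding minv_def by (rule adj_mat_inverse[OF that])+
  have nz': "det (sh (\<Phi> z)) \<noteq> 0" if "z \<in> ?U" for z using nz[OF that] by (simp add: sh_def)
  define N where "N z = minv (sh (\<Phi> z))" for z
  have Ni: "N z $$ (p, q) = 1 / det (sh (\<Phi> z)) * adj_mat (sh (\<Phi> z)) $$ (p, q)" if "p < n" "q < n" for z p q
    using that by (simp add: N_def minv_def)
  have Nc: "N z \<in> carrier_mat n n" for z by (simp add: N_def minvc)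
  have shhol: "(\<lambda>z. sh (\<Phi> z) $$ (p, q)) holomorphic_on ?U" if "p < n" "q < n" for p q
  proof (rule holomorphic_transform)
    show "(\<lambda>z. \<Phi> z $$ (p, q) - (if p = q then of_real l else 0)) holomorphic_on ?U"
      using that by (intro holomorphic_intros \<Phi>hol)
  qed (use that \<Phi>c in \<open>simp add: shi\<close>)
  have shrat: "rational_on_uhp (\<lambda>z. sh (\<Phi> z) $$ (p, q))" if pq: "p < n" "q < n" for p q
  proof -
    have "rational_on_uhp (\<lambda>z. \<Phi> z $$ (p, q) - (if p = q then of_real l else 0))"
      using pq by (intro rational_on_uhp_diff rational_on_uhp_const rat)
    then show ?thesis by (subst rational_on_uhp_cong[OF shi[OF \<Phi>c pq]])
  qed
  have Nhol: "(\<lambda>z. N z $$ (p, q)) holomorphic_on ?U" if pq: "p < n" "q < n" for p q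
    unfolding Ni[OF pq] using pq nz'
    by (intro holomorphic_intros holomorphic_on_det[where n = n] holomorphic_on_adj_mat[where n = n] shc shhol) auto
  have dethol: "(\<lambda>z. det (sh (\<Phi> z))) holomorphic_on ?U"
    by (intro holomorphic_on_det[where n = n] shc shhol)
  have detrat: "rational_on_uhp (\<lambda>z. det (sh (\<Phi> z)))"
    by (intro rational_on_uhp_det[where n = n] shc shrat)
  show ?thesis
  proof (rule that)
    show "N z \<in> carrier_mat n n \<and> N z * (\<Phi> z - of_real l \<cdot>\<^sub>m 1\<^sub>m n) = 1\<^sub>m n" if "z \<in> ?U" for z
      using Nc minv(1)[OF shc nz'[OF that]] by (simp add: N_def sh_def)
    show "rational_on_uhp (\<lambda>z. N z $$ (p, q))" if pq: "p < n" "q < n" for p q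
      unfolding Ni[OF pq] using pq nz'
      by (intro rational_on_uhp_mult rational_on_uhp_inverse detrat rational_on_uhp_adj_mat[where n = n] shc shrat) auto
    let ?M = "\<lambda>z. mat n n (\<lambda>(i, j). - N z $$ (i, j))"
    show "?M \<in> Pick_R n" unfolding Pick_R_iff
    proof (intro conjI ballI)
      show "holomorphic_mat n ?M" unfolding holomorphic_mat_def by (auto intro!: holomorphic_intros Nhol)
      fix z and v :: "complex vec" assume z: "z \<in> ?U" and v: "v \<in> carrier_vec n"
      define y where "y = N z *\<^sub>v v"
      have y: "y \<in> carrier_vec n" unfolding y_def by (rule mult_mat_vec_carrier[OF Nc v])
      have Ly: "sh (\<Phi> z) *\<^sub>v y = v"
        unfolding y_def using assoc_mult_mat_vec[OF shc Nc v, of "\<Phi> z" z] minv(2)[OF shc nz'[OF z]] v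
        by (simp add: N_def)
      have "quad_form n (?M z) v = - quad_form n (N z) v" by (simp add: quad_form_def sum_negf)
      also have "quad_form n (N z) v = y \<bullet>c v" unfolding y_def by (rule cscalar_prod_quad_form[OF Nc v, symmetric])
      also have "\<dots> = cnj (v \<bullet>c y)" unfolding cscalar_prod_sum[OF v] cscalar_prod_sum[OF y] by (simp add: mult.commute)
      also have "v \<bullet>c y = quad_form n (sh (\<Phi> z)) y" using cscalar_prod_quad_form[OF shc y, of "\<Phi> z"] Ly by simp
      finally have "Im (quad_form n (?M z) v) = Im (quad_form n (sh (\<Phi> z)) y)"
        by (simp only: uminus_complex.sel cnj.sel minus_minus)
      also have "quad_form n (sh (\<Phi> z)) y
          = (\<Sum>p<n. \<Sum>q<n. \<Phi> z $$ (p, q) * y $ q * cnj (y $ p) - (if p = q then of_real l * y $ q * cnj (y $ p) else 0))"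
        unfolding quad_form_def by (intro sum.cong refl) (auto simp: shi[OF \<Phi>c[OF z]] left_diff_distrib)
      also have "\<dots> = quad_form n (\<Phi> z) y - (\<Sum>p<n. of_real l * y $ p * cnj (y $ p))"
        unfolding sum_subtractf quad_form_def by simp
      also have "Im \<dots> = Im (quad_form n (\<Phi> z) y)" by (simp add: mult.assoc)
      finally have e: "Im (quad_form n (?M z) v) = Im (quad_form n (\<Phi> z) y)" .
      show "0 \<le> Im (quad_form n (?M z) v)" unfolding e by (rule \<Phi>im[OF z y])
    next
      have "AE x in lborel. \<exists>c. c \<noteq> 0 \<and> ((\<lambda>\<epsilon>. det (sh (\<Phi> (Complex x \<epsilon>)))) \<longlongrightarrow> c) (at_right 0)"
        by (rule rational_boundary_nonzero[OF detrat holomorphic_on_imp_continuous_on[OF dethol] nz'])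
      with Pick_R_entries(4)[OF \<Phi>]
      show "AE x in lborel. \<exists>B. has_boundary_mat n ?M x B \<and> self_adjoint n B"
      proof eventually_elim
        case (elim x)
        obtain B where B: "has_boundary_mat n \<Phi> x B" "self_adjoint n B" using elim(1) by blast
        have Bc: "B \<in> carrier_mat n n" using B(2) by (simp add: self_adjoint_def)
        have shl: "((\<lambda>\<epsilon>. sh (\<Phi> (Complex x \<epsilon>)) $$ (p, q)) \<longlongrightarrow> sh B $$ (p, q)) (at_right 0)" if pq: "p < n" "q < n" for p q
        proof -
          have "((\<lambda>\<epsilon>. \<Phi> (Complex x \<epsilon>) $$ (p, q) - (if p = q then of_real l else 0)) \<longlongrightarrow> B $$ (p, q) - (if p = q then of_real l else 0)) (at_right 0)"
            using B(1) pq by (intro tendsto_intros) (auto simp: has_boundary_mat_def)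
          moreover have "eventually (\<lambda>\<epsilon>. \<Phi> (Complex x \<epsilon>) $$ (p, q) - (if p = q then of_real l else 0) = sh (\<Phi> (Complex x \<epsilon>)) $$ (p, q)) (at_right 0)"
            using eventually_at_right_less[of 0] by eventually_elim (simp add: shi[OF \<Phi>c pq])
          ultimately show ?thesis unfolding shi[OF Bc pq] by (rule Lim_transform_eventually)
        qed
        have detl: "((\<lambda>\<epsilon>. det (sh (\<Phi> (Complex x \<epsilon>)))) \<longlongrightarrow> det (sh B)) (at_right 0)"
          by (intro tendsto_det[where n = n] shl shc always_eventually allI)
        obtain c where c: "c \<noteq> 0" "((\<lambda>\<epsilon>. det (sh (\<Phi> (Complex x \<epsilon>)))) \<longlongrightarrow> c) (at_right 0)" using elim(2) by blast
        have "c = det (sh B)" by (rule tendsto_unique[OF trivial_limit_at_right_real c(2) detl])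
        then have dB: "det (sh B) \<noteq> 0" using c(1) by simp
        have saN: "self_adjoint n (minv (sh B))"
        proof (rule self_adjoint_inverse[OF _ minvc minv(2)[OF shc dB]])
          have "sh B $$ (p, q) = cnj (sh B $$ (q, p))" if pq: "p < n" "q < n" for p q
          proof -
            have "B $$ (p, q) = cnj (B $$ (q, p))" by (rule self_adjoint_index[OF B(2) pq])
            then show ?thesis unfolding shi[OF Bc pq] shi[OF Bc pq(2,1)] by simp
          qed
          then show "self_adjoint n (sh B)" unfolding self_adjoint_iff using shc by blast
        qed
        define M0 where "M0 = mat n n (\<lambda>(i, j). - minv (sh B) $$ (i, j))"
        have "((\<lambda>\<epsilon>. - N (Complex x \<epsilon>) $$ (p, q)) \<longlongrightarrow> - minv (sh B) $$ (p, q)) (at_right 0)" if pq: "p < n" "q < n" for p q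
        proof -
          have i: "minv (sh B) $$ (p, q) = 1 / det (sh B) * adj_mat (sh B) $$ (p, q)" using pq by (simp add: minv_def)
          show ?thesis unfolding Ni[OF pq] i using dB
            by (intro tendsto_intros detl tendsto_adj_mat[where n = n] shl shc pq always_eventually allI)
        qed
        then have "has_boundary_mat n ?M x M0" unfolding has_boundary_mat_def by (simp add: M0_def)
        moreover have herm: "M0 $$ (p, q) = cnj (M0 $$ (q, p))" if pq: "p < n" "q < n" for p q
        proof -
          have "minv (sh B) $$ (p, q) = cnj (minv (sh B) $$ (q, p))" by (rule self_adjoint_index[OF saN pq])
          then show ?thesis using pq unfolding M0_def by simp
        qed
        have "self_adjoint n M0" by (rule self_adjointI[OF _ herm]) (simp_all add: M0_def)
        ultimately show ?case by blast
      qed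
    qed
  qed
qed

lemma quad_form_combination:
  "quad_form n (mat n n (\<lambda>(i, j). (if i = j then c else 0) + d * X $$ (i, j) + (\<Sum>k\<in>S. a k * Y k $$ (i, j)))) v
    = c * (\<Sum>i<n. v $ i * cnj (v $ i)) + d * quad_form n X v + (\<Sum>k\<in>S. a k * quad_form n (Y k) v)"
proof -
  have "quad_form n (mat n n (\<lambda>(i, j). (if i = j then c else 0) + d * X $$ (i, j) + (\<Sum>k\<in>S. a k * Y k $$ (i, j)))) v
      = (\<Sum>i<n. \<Sum>j<n. (if i = j then c * (v $ i * cnj (v $ i)) else 0) + d * (X $$ (i, j) * v $ j * cnj (v $ i))
          + (\<Sum>k\<in>S. a k * (Y k $$ (i, j) * v $ j * cnj (v $ i))))"
    unfolding quad_form_def by (intro sum.cong refl) (simp add: distrib_right sum_distrib_right mult.assoc)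
  also have "\<dots> = c * (\<Sum>i<n. v $ i * cnj (v $ i)) + d * quad_form n X v
      + (\<Sum>i<n. \<Sum>j<n. \<Sum>k\<in>S. a k * (Y k $$ (i, j) * v $ j * cnj (v $ i)))"
    unfolding sum.distrib quad_form_def by (simp add: sum_distrib_left)
  also have "(\<Sum>i<n. \<Sum>j<n. \<Sum>k\<in>S. a k * (Y k $$ (i, j) * v $ j * cnj (v $ i)))
      = (\<Sum>i<n. \<Sum>k\<in>S. \<Sum>j<n. a k * (Y k $$ (i, j) * v $ j * cnj (v $ i)))"
    by (intro sum.cong refl sum.swap)
  also have "\<dots> = (\<Sum>k\<in>S. \<Sum>i<n. \<Sum>j<n. a k * (Y k $$ (i, j) * v $ j * cnj (v $ i)))" by (rule sum.swap)
  also have "\<dots> = (\<Sum>k\<in>S. a k * quad_form n (Y k) v)" unfolding quad_form_def sum_distrib_left ..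
  finally show ?thesis .
qed

lemma Pick_R_combination:
  fixes c d :: real and a :: "nat \<Rightarrow> real"
  assumes \<Phi>: "\<Phi> \<in> Pick_R n" and S: "finite S" and M: "\<And>k. k \<in> S \<Longrightarrow> M k \<in> Pick_R n"
    and d: "0 \<le> d" and a: "\<And>k. k \<in> S \<Longrightarrow> 0 \<le> a k"
  shows "(\<lambda>z. mat n n (\<lambda>(i, j). (if i = j then of_real c else 0) + of_real d * \<Phi> z $$ (i, j)
    + (\<Sum>k\<in>S. of_real (a k) * M k z $$ (i, j)))) \<in> Pick_R n" (is "?H \<in> _")
  unfolding Pick_R_iff
proof (intro conjI ballI)
  show "holomorphic_mat n ?H" unfolding holomorphic_mat_def
    using Pick_R_entries(2)[OF \<Phi>] Pick_R_entries(2)[OF M] by (auto intro!: holomorphic_intros)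
  fix z and v :: "complex vec" assume z: "z \<in> upper_half_plane" and v: "v \<in> carrier_vec n"
  have "Im (quad_form n (?H z) v) = d * Im (quad_form n (\<Phi> z) v) + (\<Sum>k\<in>S. a k * Im (quad_form n (M k z) v))"
    unfolding quad_form_combination by simp
  also have "\<dots> \<ge> 0"
    using d a Pick_R_entries(3)[OF \<Phi> z v] Pick_R_entries(3)[OF M z v] by (intro add_nonneg_nonneg sum_nonneg mult_nonneg_nonneg) auto
  finally show "0 \<le> Im (quad_form n (?H z) v)" .
next
  have "AE x in lborel. \<forall>k\<in>S. \<exists>B. has_boundary_mat n (M k) x B \<and> self_adjoint n B"
    using S Pick_R_entries(4)[OF M] by (intro eventually_ball_finite) auto
  with Pick_R_entries(4)[OF \<Phi>] show "AE x in lborel. \<exists>B. has_boundary_mat n ?H x B \<and> self_adjoint n B"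
  proof eventually_elim
    case (elim x)
    obtain B where B: "has_boundary_mat n \<Phi> x B" "self_adjoint n B" using elim(1) by blast
    obtain B' where B': "\<And>k. k \<in> S \<Longrightarrow> has_boundary_mat n (M k) x (B' k) \<and> self_adjoint n (B' k)"
      using bchoice[OF elim(2)] by blast
    define H0 where "H0 = mat n n (\<lambda>(i, j). (if i = j then of_real c else 0) + of_real d * B $$ (i, j)
      + (\<Sum>k\<in>S. of_real (a k) * B' k $$ (i, j)))"
    have H0i: "H0 $$ (p, q) = (if p = q then of_real c else 0) + of_real d * B $$ (p, q) + (\<Sum>k\<in>S. of_real (a k) * B' k $$ (p, q))"
      if "p < n" "q < n" for p q using that by (simp add: H0_def)
    have "((\<lambda>\<epsilon>. ?H (Complex x \<epsilon>) $$ (p, q)) \<longlongrightarrow> H0 $$ (p, q)) (at_right 0)" if pq: "p < n" "q < n" for p q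
    proof -
      have "((\<lambda>\<epsilon>. (if p = q then of_real c else 0) + of_real d * \<Phi> (Complex x \<epsilon>) $$ (p, q)
          + (\<Sum>k\<in>S. of_real (a k) * M k (Complex x \<epsilon>) $$ (p, q))) \<longlongrightarrow> H0 $$ (p, q)) (at_right 0)"
        unfolding H0i[OF pq] using B(1) B' pq by (intro tendsto_intros) (auto simp: has_boundary_mat_def)
      then show ?thesis using pq by simp
    qed
    then have "has_boundary_mat n ?H x H0" unfolding has_boundary_mat_def H0_def by simp
    moreover have herm: "H0 $$ (p, q) = cnj (H0 $$ (q, p))" if pq: "p < n" "q < n" for p q
    proof -
      have "B $$ (p, q) = cnj (B $$ (q, p))" by (rule self_adjoint_index[OF B(2) pq])
      moreover have "B' k $$ (p, q) = cnj (B' k $$ (q, p))" if "k \<in> S" for k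
        using self_adjoint_index[OF _ pq] B'[OF that] by blast
      ultimately show ?thesis unfolding H0i[OF pq] H0i[OF pq(2,1)] by simp
    qed
    have "self_adjoint n H0" by (rule self_adjointI[OF _ herm]) (simp_all add: H0_def)
    ultimately show ?case by blast
  qed
qed

lemma Pick_R_cong:
  assumes F: "F \<in> Pick_R n" and GF: "\<And>z. z \<in> upper_half_plane \<Longrightarrow> G z = F z"
  shows "G \<in> Pick_R n"
  unfolding Pick_R_iff
proof (intro conjI ballI)
  show "holomorphic_mat n G" unfolding holomorphic_mat_def
  proof (intro conjI ballI allI impI)
    show "G z \<in> carrier_mat n n" if "z \<in> upper_half_plane" for z using Pick_R_entries(1)[OF F that] GF[OF that] by simp
    show "(\<lambda>z. G z $$ (i, j)) holomorphic_on upper_half_plane" if "i < n" "j < n" for i j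
      by (rule holomorphic_transform[OF Pick_R_entries(2)[OF F that]]) (simp add: GF)
  qed
  show "0 \<le> Im (quad_form n (G z) v)" if "z \<in> upper_half_plane" "v \<in> carrier_vec n" for z v
    using Pick_R_entries(3)[OF F that] GF[OF that(1)] by simp
  have ev: "eventually (\<lambda>\<epsilon>. F (Complex x \<epsilon>) $$ (i, j) = G (Complex x \<epsilon>) $$ (i, j)) (at_right 0)" for x and i j :: nat
    using eventually_at_right_less[of 0] by eventually_elim (simp add: GF)
  have bd: "has_boundary_mat n G x B" if "has_boundary_mat n F x B" for x B
    unfolding has_boundary_mat_def
  proof (intro conjI allI impI)
    fix i j assume "i < n" "j < n"
    then have "((\<lambda>\<epsilon>. F (Complex x \<epsilon>) $$ (i, j)) \<longlongrightarrow> B $$ (i, j)) (at_right 0)"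
      using that by (simp add: has_boundary_mat_def)
    then show "((\<lambda>\<epsilon>. G (Complex x \<epsilon>) $$ (i, j)) \<longlongrightarrow> B $$ (i, j)) (at_right 0)"
      by (rule Lim_transform_eventually) (rule ev)
  qed (use that in \<open>simp add: has_boundary_mat_def\<close>)
  show "AE x in lborel. \<exists>B. has_boundary_mat n G x B \<and> self_adjoint n B"
    using Pick_R_entries(4)[OF F] by eventually_elim (use bd in blast)
qed

text \<open>The partial fractions of \<open>f\<close> turn \<open>f\<close> of \<Phi> into a real
  multiple of the identity plus a nonnegative combination of \<Phi> and the functions
  \<open>- (\<Phi> - l k)\<^sup>-\<^sup>1\<close>, all of them rational Pick functions.\<close>

lemma Pick_R_hol_calc:
  assumes \<Phi>: "\<Phi> \<in> Pick_R n" and rat: "\<And>i j. i < n \<Longrightarrow> j < n \<Longrightarrow> rational_on_uhp (\<lambda>z. \<Phi> z $$ (i, j))"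
    and spec: "\<And>z \<mu>. z \<in> upper_half_plane \<Longrightarrow> det (\<Phi> z - \<mu> \<cdot>\<^sub>m 1\<^sub>m n) = 0 \<Longrightarrow> \<mu> \<in> upper_half_plane"
    and ratf: "rational_Pick 1 (scalar_op f)"
  shows "(\<lambda>z. hol_calc n f (\<Phi> z)) \<in> Pick_R n"
    and "\<And>i j. i < n \<Longrightarrow> j < n \<Longrightarrow> rational_on_uhp (\<lambda>z. hol_calc n f (\<Phi> z) $$ (i, j))"
proof -
  let ?U = upper_half_plane
  note \<Phi>c = Pick_R_entries(1)[OF \<Phi>]
  obtain c d :: real and m and l a :: "nat \<Rightarrow> real" where d: "0 \<le> d" and a: "\<And>k. k \<in> {1..m} \<Longrightarrow> 0 \<le> a k" and
    f: "\<And>z. z \<in> ?U \<Longrightarrow> f z = of_real c + of_real d * z + (\<Sum>k=1..m. of_real (a k) / (of_real (l k) - z))"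
    by (rule rational_Pick_scalar_op[OF ratf]) (rule that)
  have nz: "det (\<Phi> z - of_real (l k) \<cdot>\<^sub>m 1\<^sub>m n) \<noteq> 0" if "z \<in> ?U" for z k
    using spec[OF that, of "of_real (l k)"] by auto
  have "\<forall>k. \<exists>N. (\<forall>z\<in>?U. N z \<in> carrier_mat n n \<and> N z * (\<Phi> z - of_real (l k) \<cdot>\<^sub>m 1\<^sub>m n) = 1\<^sub>m n) \<and>
      (\<forall>i<n. \<forall>j<n. rational_on_uhp (\<lambda>z. N z $$ (i, j))) \<and> (\<lambda>z. mat n n (\<lambda>(i, j). - N z $$ (i, j))) \<in> Pick_R n"
  proof
    fix k
    show "\<exists>N. (\<forall>z\<in>?U. N z \<in> carrier_mat n n \<and> N z * (\<Phi> z - of_real (l k) \<cdot>\<^sub>m 1\<^sub>m n) = 1\<^sub>m n) \<and>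
      (\<forall>i<n. \<forall>j<n. rational_on_uhp (\<lambda>z. N z $$ (i, j))) \<and> (\<lambda>z. mat n n (\<lambda>(i, j). - N z $$ (i, j))) \<in> Pick_R n"
      by (rule Pick_R_resolvent[OF \<Phi> rat nz[of _ k]]) blast+
  qed
  then obtain N where N: "\<And>k z. z \<in> ?U \<Longrightarrow> N k z \<in> carrier_mat n n \<and> N k z * (\<Phi> z - of_real (l k) \<cdot>\<^sub>m 1\<^sub>m n) = 1\<^sub>m n"
    and Nrat: "\<And>k i j. i < n \<Longrightarrow> j < n \<Longrightarrow> rational_on_uhp (\<lambda>z. N k z $$ (i, j))"
    and NP: "\<And>k. (\<lambda>z. mat n n (\<lambda>(i, j). - N k z $$ (i, j))) \<in> Pick_R n"
    by metis
  have calc: "hol_calc n f (\<Phi> z) $$ (i, j) = (if i = j then of_real c else 0) + of_real d * \<Phi> z $$ (i, j)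
      - (\<Sum>k=1..m. of_real (a k) * N k z $$ (i, j))" if z: "z \<in> ?U" and ij: "i < n" "j < n" for z i j
  proof (rule hol_calc_rational[OF \<Phi>c[OF z] _ _ _ f ij])
    show "spectrum (\<Phi> z) \<subseteq> ?U" using spec[OF z] spectrum_iff_det[OF \<Phi>c[OF z]] by blast
  qed (use N[OF z] in auto)
  have dim: "dim_row (hol_calc n f A) = n" "dim_col (hol_calc n f A) = n" for A by (simp_all add: hol_calc_def Let_def)
  let ?M = "\<lambda>k z. mat n n (\<lambda>(i, j). - N k z $$ (i, j))"
  show "(\<lambda>z. hol_calc n f (\<Phi> z)) \<in> Pick_R n"
  proof (rule Pick_R_cong)
    show "(\<lambda>z. mat n n (\<lambda>(i, j). (if i = j then of_real c else 0) + of_real d * \<Phi> z $$ (i, j)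
        + (\<Sum>k\<in>{1..m}. of_real (a k) * ?M k z $$ (i, j)))) \<in> Pick_R n"
      by (rule Pick_R_combination[OF \<Phi> _ NP d a]) auto
    show "hol_calc n f (\<Phi> z) = mat n n (\<lambda>(i, j). (if i = j then of_real c else 0) + of_real d * \<Phi> z $$ (i, j)
        + (\<Sum>k\<in>{1..m}. of_real (a k) * ?M k z $$ (i, j)))" if "z \<in> ?U" for z
      by (intro eq_matI) (simp_all add: calc[OF that] dim sum_negf)
  qed
  fix i j assume ij: "i < n" "j < n"
  have "rational_on_uhp (\<lambda>z. (if i = j then of_real c else 0) + of_real d * \<Phi> z $$ (i, j)
      - (\<Sum>k=1..m. of_real (a k) * N k z $$ (i, j)))"
    by (intro rational_on_uhp_diff rational_on_uhp_add rational_on_uhp_mult rational_on_uhp_sum rational_on_uhp_const rat Nrat ij)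
  then show "rational_on_uhp (\<lambda>z. hol_calc n f (\<Phi> z) $$ (i, j))"
    by (subst rational_on_uhp_cong[OF calc[OF _ ij]])
qed

section \<open>Positivity of the degree and inequalities for eigenvalue products\<close>

lemma hol_calc_carrier: "hol_calc n f A \<in> carrier_mat n n"
  by (simp add: hol_calc_def Let_def)

text \<open>Obtained from the eigenvector equation in a coordinate of largest modulus. The bound is
  continuous in \<open>A\<close>, so over a compact set of matrices all eigenvalues stay in one
  disk.\<close>

lemma eigenvalue_bounded:
  fixes A :: "complex mat"
  assumes A: "A \<in> carrier_mat n n" and det0: "det (A - \<mu> \<cdot>\<^sub>m 1\<^sub>m n) = 0"
  shows "cmod \<mu> \<le> (\<Sum>i<n. \<Sum>j<n. cmod (A $$ (i, j)))"
proof -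
  obtain v where v: "v \<in> carrier_vec n" "v \<noteq> 0\<^sub>v n" "A *\<^sub>v v = \<mu> \<cdot>\<^sub>v v"
    using det0 det_eq_0_eigenvector[OF A] by blast
  obtain k where k: "k < n" "v $ k \<noteq> 0"
    using v(1,2) by (metis carrier_vecD eq_vecI index_zero_vec)
  define M where "M = Max ((\<lambda>i. cmod (v $ i)) ` {..<n})"
  have "M \<in> (\<lambda>i. cmod (v $ i)) ` {..<n}" unfolding M_def using k(1) by (intro Max_in) auto
  then obtain i where i: "i < n" "M = cmod (v $ i)" by auto
  have le: "cmod (v $ j) \<le> M" if "j < n" for j unfolding M_def using that by (intro Max_ge) auto
  have M: "0 < M" using le[OF k(1)] k(2) by (smt (verit) zero_less_norm_iff)
  have "cmod \<mu> * M = cmod ((A *\<^sub>v v) $ i)" unfolding v(3) using v(1) i by (simp add: norm_mult)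
  also have "\<dots> \<le> (\<Sum>j<n. cmod (A $$ (i, j) * v $ j))"
    unfolding mult_mat_vec_index_sum[OF A v(1) i(1)] by (rule norm_sum)
  also have "\<dots> \<le> (\<Sum>j<n. cmod (A $$ (i, j)) * M)"
    unfolding norm_mult using le by (intro sum_mono mult_left_mono) auto
  also have "\<dots> = (\<Sum>j<n. cmod (A $$ (i, j))) * M" by (simp add: sum_distrib_right)
  finally have "cmod \<mu> \<le> (\<Sum>j<n. cmod (A $$ (i, j)))" using M by simp
  also have "\<dots> \<le> (\<Sum>i<n. \<Sum>j<n. cmod (A $$ (i, j)))"
    using i(1) by (intro member_le_sum[of i "{..<n}" "\<lambda>i. \<Sum>j<n. cmod (A $$ (i, j))"]) (auto intro: sum_nonneg)
  finally show ?thesis .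
qed

text \<open>Degree 0 would make \<open>F\<close> a constant self-adjoint matrix with real spectrum.
  A positive zero count in turn means that every point of the half plane occurs as an eigenvalue,
  the surjectivity used to transport properness.\<close>

lemma Pick_deg_pos:
  assumes n: "0 < n" and rat: "rational_Pick n F"
    and Fc: "\<And>z. z \<in> upper_half_plane \<Longrightarrow> F z \<in> carrier_mat n n"
    and spec: "\<And>z w. z \<in> upper_half_plane \<Longrightarrow> det (F z - w \<cdot>\<^sub>m 1\<^sub>m n) = 0 \<Longrightarrow> w \<in> upper_half_plane"
  obtains d where "Pick_deg n F = enat d" "0 < d"
    "\<And>w. w \<in> upper_half_plane \<Longrightarrow> \<exists>z\<in>upper_half_plane. det (F z - w \<cdot>\<^sub>m 1\<^sub>m n) = 0"
proof (rule rational_Pick_degree[OF rat Fc])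
  fix d assume d: "Pick_deg n F = enat d"
    "\<And>w. w \<in> upper_half_plane \<Longrightarrow> zero_count (\<lambda>z. det (F z - w \<cdot>\<^sub>m 1\<^sub>m n)) d"
    "d = 0 \<Longrightarrow> \<exists>C. self_adjoint n C \<and> (\<forall>z\<in>upper_half_plane. F z = C)"
  have iU: "\<i> \<in> upper_half_plane" by simp
  have "d \<noteq> 0"
  proof
    assume "d = 0"
    then obtain C where "self_adjoint n C" "F \<i> = C" using d(3) iU by blast
    then show False by (rule rational_Pick_degree_pos[OF n]) (rule spec[OF iU])
  qed
  moreover have "\<exists>z\<in>upper_half_plane. det (F z - w \<cdot>\<^sub>m 1\<^sub>m n) = 0" if "w \<in> upper_half_plane" "0 < d" for w
    using zero_count_pos_imp_zero[OF d(2)[OF that(1)] that(2)] by blast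
  ultimately show ?thesis using that d(1) by blast
qed

text \<open>In cross-multiplied form the inequalities for the single eigenvalues can be multiplied,
  giving a comparison of four determinants.\<close>

lemma Schwarz_Pick_prod_list:
  assumes hol: "f holomorphic_on upper_half_plane" and f: "f ` upper_half_plane \<subseteq> upper_half_plane"
    and \<alpha>: "\<alpha> \<in> upper_half_plane" and \<mu>s: "set \<mu>s \<subseteq> upper_half_plane"
  shows "cmod (\<Prod>\<mu>\<leftarrow>\<mu>s. f \<mu> - f \<alpha>) * cmod (\<Prod>\<mu>\<leftarrow>\<mu>s. \<mu> - cnj \<alpha>)
    \<le> cmod (\<Prod>\<mu>\<leftarrow>\<mu>s. \<mu> - \<alpha>) * cmod (\<Prod>\<mu>\<leftarrow>\<mu>s. f \<mu> - cnj (f \<alpha>))"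
  using \<mu>s
proof (induction \<mu>s)
  case Nil
  show ?case by simp
next
  case (Cons \<mu> \<mu>s)
  have \<mu>: "\<mu> \<in> upper_half_plane" using Cons.prems by simp
  have "f \<mu> \<in> upper_half_plane" "f \<alpha> \<in> upper_half_plane" using f \<mu> \<alpha> by blast+
  then have "f \<mu> - cnj (f \<alpha>) \<noteq> 0" "\<mu> - cnj \<alpha> \<noteq> 0" using \<mu> \<alpha> by (auto simp: complex_eq_iff)
  then have s: "cmod (f \<mu> - f \<alpha>) * cmod (\<mu> - cnj \<alpha>) \<le> cmod (\<mu> - \<alpha>) * cmod (f \<mu> - cnj (f \<alpha>))"
    using Schwarz_Pick_upper_half_plane[OF hol f \<mu> \<alpha>] by (simp add: divide_simps mult.commute)
  have sub: "set \<mu>s \<subseteq> upper_half_plane" using Cons.prems by simp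
  have "(cmod (f \<mu> - f \<alpha>) * cmod (\<mu> - cnj \<alpha>)) * (cmod (\<Prod>\<mu>\<leftarrow>\<mu>s. f \<mu> - f \<alpha>) * cmod (\<Prod>\<mu>\<leftarrow>\<mu>s. \<mu> - cnj \<alpha>))
      \<le> (cmod (\<mu> - \<alpha>) * cmod (f \<mu> - cnj (f \<alpha>))) * (cmod (\<Prod>\<mu>\<leftarrow>\<mu>s. \<mu> - \<alpha>) * cmod (\<Prod>\<mu>\<leftarrow>\<mu>s. f \<mu> - cnj (f \<alpha>)))"
    by (rule mult_mono[OF s Cons.IH[OF sub]]) auto
  then show ?case by (simp add: norm_mult mult_ac)
qed

text \<open>All ratios of \<open>p\<close> to \<open>q\<close> have modulus at most 1, so a lower
  bound for their product is a lower bound for each of them.\<close>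

lemma prod_list_single_factor:
  assumes \<mu>: "\<mu> \<in> set \<mu>s" and le: "\<And>\<mu>. \<mu> \<in> set \<mu>s \<Longrightarrow> cmod (p \<mu>) \<le> cmod (q \<mu>) \<and> q \<mu> \<noteq> 0"
    and \<delta>: "\<delta> * cmod (\<Prod>\<mu>\<leftarrow>\<mu>s. q \<mu>) \<le> cmod (\<Prod>\<mu>\<leftarrow>\<mu>s. p \<mu> :: complex)"
  shows "\<delta> * cmod (q \<mu>) \<le> cmod (p \<mu>)"
proof -
  obtain xs ys where s: "\<mu>s = xs @ \<mu> # ys" using split_list[OF \<mu>] by blast
  have *: "cmod (\<Prod>\<mu>\<leftarrow>zs. p \<mu>) \<le> cmod (\<Prod>\<mu>\<leftarrow>zs. q \<mu>) \<and> (\<Prod>\<mu>\<leftarrow>zs. q \<mu>) \<noteq> 0" if "set zs \<subseteq> set \<mu>s" for zs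
    using that
  proof (induction zs)
    case (Cons z zs)
    then show ?case using le[of z] by (auto simp: norm_mult intro!: mult_mono)
  qed simp
  let ?p = "cmod (\<Prod>\<mu>\<leftarrow>xs @ ys. p \<mu>)" and ?q = "cmod (\<Prod>\<mu>\<leftarrow>xs @ ys. q \<mu>)"
  have pq: "?p \<le> ?q" "0 < ?q" using *[of "xs @ ys"] by (auto simp: s)
  have "(\<delta> * cmod (q \<mu>)) * ?q \<le> cmod (p \<mu>) * ?p" using \<delta> by (simp add: s norm_mult mult_ac)
  also have "\<dots> \<le> cmod (p \<mu>) * ?q" using pq(1) by (intro mult_left_mono) auto
  finally show ?thesis using pq(2) by simp
qed

text \<open>\<open>zero_count_eigenvalues\<close> is used twice: with the one-element list
  \<open>[g z]\<close> it multiplies the counts of \<open>F\<close> and \<open>g\<close>, and with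
  the eigenvalues of \<open>F (g z)\<close> it brings in the count of \<open>f\<close>. The
  composition is itself rational, so its degree is also a zero count, and the counts agree.\<close>

lemma Pick_deg_comp_rational:
  assumes F: "F \<in> Pick_R n" and f: "scalar_op f \<in> Pick_R 1" and g: "scalar_op g \<in> Pick_R 1"
    and fU: "\<And>z. z \<in> upper_half_plane \<Longrightarrow> f z \<in> upper_half_plane"
    and gU: "\<And>z. z \<in> upper_half_plane \<Longrightarrow> g z \<in> upper_half_plane"
    and spec: "\<And>z \<mu>. z \<in> upper_half_plane \<Longrightarrow> det (F z - \<mu> \<cdot>\<^sub>m 1\<^sub>m n) = 0 \<Longrightarrow> \<mu> \<in> upper_half_plane"
    and rat: "rational_Pick n F" "rational_Pick 1 (scalar_op f)" "rational_Pick 1 (scalar_op g)"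
  shows "Pick_deg n (Pick_comp n f F g) = Pick_deg 1 (scalar_op f) * Pick_deg n F * Pick_deg 1 (scalar_op g)"
proof -
  let ?U = upper_half_plane
  define \<Phi> where "\<Phi> z = F (g z)" for z
  have \<Phi>: "\<Phi> \<in> Pick_R n" unfolding \<Phi>_def by (rule Pick_R_compose[OF F rat(1) g rat(3) gU])
  have gr: "rational_on_uhp g" by (rule rational_on_uhp_scalar_op[OF rat(3)])
  have \<Phi>r: "rational_on_uhp (\<lambda>z. \<Phi> z $$ (i, j))" if "i < n" "j < n" for i j
    unfolding \<Phi>_def by (rule rational_Pick_entries_compose[OF rat(1) gr gU that])
  have \<Phi>s: "\<mu> \<in> ?U" if "z \<in> ?U" "det (\<Phi> z - \<mu> \<cdot>\<^sub>m 1\<^sub>m n) = 0" for z \<mu>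
    using spec[OF gU[OF that(1)]] that(2) by (simp add: \<Phi>_def)
  define G where "G = Pick_comp n f F g"
  have G_eq: "G = (\<lambda>z. hol_calc n f (\<Phi> z))" by (simp add: G_def Pick_comp_def \<Phi>_def fun_eq_iff)
  have G: "G \<in> Pick_R n" unfolding G_eq by (rule Pick_R_hol_calc(1)[OF \<Phi> \<Phi>r \<Phi>s rat(2)])
  have ratG: "rational_Pick n G"
    by (rule rational_Pick_of_rational_entries[OF G]) (unfold G_eq, rule Pick_R_hol_calc(2)[OF \<Phi> \<Phi>r \<Phi>s rat(2)])
  obtain dG where dG: "Pick_deg n G = enat dG"
    and cG: "\<And>w. w \<in> ?U \<Longrightarrow> zero_count (\<lambda>z. det (G z - w \<cdot>\<^sub>m 1\<^sub>m n)) dG"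
    using rational_Pick_degree[OF ratG Pick_R_entries(1)[OF G]] by metis
  obtain dF where dF: "Pick_deg n F = enat dF"
    and cF: "\<And>w. w \<in> ?U \<Longrightarrow> zero_count (\<lambda>z. det (F z - w \<cdot>\<^sub>m 1\<^sub>m n)) dF"
    using rational_Pick_degree[OF rat(1) Pick_R_entries(1)[OF F]] by metis
  obtain df where df: "Pick_deg 1 (scalar_op f) = enat df"
    and cf: "\<And>w. w \<in> ?U \<Longrightarrow> zero_count (\<lambda>z. f z - w) df"
    using rational_Pick_degree[OF rat(2) scalar_op_carrier] unfolding det_scalar_op by metis
  obtain dg where dg: "Pick_deg 1 (scalar_op g) = enat dg"
    and cg: "\<And>w. w \<in> ?U \<Longrightarrow> zero_count (\<lambda>z. g z - w) dg"
    using rational_Pick_degree[OF rat(3) scalar_op_carrier] unfolding det_scalar_op by metis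
  have ghol: "g holomorphic_on ?U" by (rule Pick_R_scalar_op(1)[OF g])
  have c\<Phi>: "zero_count (\<lambda>z. det (\<Phi> z - \<alpha> \<cdot>\<^sub>m 1\<^sub>m n)) (dF * dg)" if \<alpha>: "\<alpha> \<in> ?U" for \<alpha>
  proof -
    have "zero_count (\<lambda>z. \<Prod>\<mu>\<leftarrow>[g z]. det (F \<mu> - \<alpha> \<cdot>\<^sub>m 1\<^sub>m n)) (dF * dg)"
    proof (rule zero_count_eigenvalues[OF cF[OF \<alpha>], where n = 1])
      show "set [g z] \<subseteq> ?U \<and> length [g z] = 1" if "z \<in> ?U" for z using gU[OF that] by simp
      show "zero_count (\<lambda>z. \<Prod>\<mu>\<leftarrow>[g z]. \<mu> - \<beta>) dg" if "\<beta> \<in> ?U" for \<beta> using cg[OF that] by simp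
      show "rational_on_uhp (\<lambda>z. \<Prod>\<mu>\<leftarrow>[g z]. \<mu> - \<beta>)" for \<beta>
        using rational_on_uhp_diff[OF gr rational_on_uhp_const] by simp
      show "continuous_on ?U (\<lambda>z. \<Prod>\<mu>\<leftarrow>[g z]. \<mu> - \<beta>)" for \<beta>
        using holomorphic_on_imp_continuous_on[OF ghol] by (auto intro: continuous_intros)
    qed
    then show ?thesis by (simp add: \<Phi>_def)
  qed
  have fhol: "f holomorphic_on ?U" by (rule Pick_R_scalar_op(1)[OF f])
  have "\<forall>z\<in>?U. \<exists>\<mu>s. length \<mu>s = n \<and> set \<mu>s \<subseteq> ?U \<and> (\<forall>w. det (\<Phi> z - w \<cdot>\<^sub>m 1\<^sub>m n) = (\<Prod>\<mu>\<leftarrow>\<mu>s. \<mu> - w)) \<and>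
      (\<forall>w. det (G z - w \<cdot>\<^sub>m 1\<^sub>m n) = (\<Prod>\<mu>\<leftarrow>\<mu>s. f \<mu> - w))"
  proof
    fix z assume z: "z \<in> ?U"
    note \<Phi>z = Pick_R_entries(1)[OF \<Phi> z]
    have "spectrum (\<Phi> z) \<subseteq> ?U" using \<Phi>s[OF z] spectrum_iff_det[OF \<Phi>z] by blast
    then show "\<exists>\<mu>s. length \<mu>s = n \<and> set \<mu>s \<subseteq> ?U \<and> (\<forall>w. det (\<Phi> z - w \<cdot>\<^sub>m 1\<^sub>m n) = (\<Prod>\<mu>\<leftarrow>\<mu>s. \<mu> - w)) \<and>
      (\<forall>w. det (G z - w \<cdot>\<^sub>m 1\<^sub>m n) = (\<Prod>\<mu>\<leftarrow>\<mu>s. f \<mu> - w))"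
      unfolding G_eq by (rule hol_calc_eigenvalues[OF \<Phi>z]) (use fhol in blast)
  qed
  then obtain \<mu>s where \<mu>s: "\<And>z. z \<in> ?U \<Longrightarrow> set (\<mu>s z) \<subseteq> ?U \<and> length (\<mu>s z) = n"
    and \<mu>\<Phi>: "\<And>z w. z \<in> ?U \<Longrightarrow> det (\<Phi> z - w \<cdot>\<^sub>m 1\<^sub>m n) = (\<Prod>\<mu>\<leftarrow>\<mu>s z. \<mu> - w)"
    and \<mu>G: "\<And>z w. z \<in> ?U \<Longrightarrow> det (G z - w \<cdot>\<^sub>m 1\<^sub>m n) = (\<Prod>\<mu>\<leftarrow>\<mu>s z. f \<mu> - w)"
    by metis
  have sc: "\<Phi> z - \<alpha> \<cdot>\<^sub>m 1\<^sub>m n \<in> carrier_mat n n" for z \<alpha>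
    by (intro minus_carrier_mat smult_carrier_mat one_carrier_mat)
  have si: "(\<Phi> z - \<alpha> \<cdot>\<^sub>m 1\<^sub>m n) $$ (i, j) = \<Phi> z $$ (i, j) - (if i = j then \<alpha> else 0)" if "i < n" "j < n" for z \<alpha> i j
    using that by simp
  have "zero_count (\<lambda>z. \<Prod>\<mu>\<leftarrow>\<mu>s z. f \<mu> - \<i>) (df * (dF * dg))"
  proof (rule zero_count_eigenvalues[OF cf \<mu>s])
    show "\<i> \<in> ?U" by simp
    show "zero_count (\<lambda>z. \<Prod>\<mu>\<leftarrow>\<mu>s z. \<mu> - \<alpha>) (dF * dg)" if "\<alpha> \<in> ?U" for \<alpha>
      by (rule zero_count_cong[OF \<mu>\<Phi> c\<Phi>[OF that]])
    show "rational_on_uhp (\<lambda>z. \<Prod>\<mu>\<leftarrow>\<mu>s z. \<mu> - \<alpha>)" for \<alpha>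
    proof -
      have "rational_on_uhp (\<lambda>z. det (\<Phi> z - \<alpha> \<cdot>\<^sub>m 1\<^sub>m n))"
      proof (rule rational_on_uhp_det[OF sc])
        show "rational_on_uhp (\<lambda>z. (\<Phi> z - \<alpha> \<cdot>\<^sub>m 1\<^sub>m n) $$ (i, j))" if "i < n" "j < n" for i j
          unfolding si[OF that] by (intro rational_on_uhp_diff rational_on_uhp_const \<Phi>r that)
      qed
      then show ?thesis by (subst (asm) rational_on_uhp_cong[OF \<mu>\<Phi>])
    qed
    show "continuous_on ?U (\<lambda>z. \<Prod>\<mu>\<leftarrow>\<mu>s z. \<mu> - \<alpha>)" for \<alpha>
    proof -
      have "continuous_on ?U (\<lambda>z. det (\<Phi> z - \<alpha> \<cdot>\<^sub>m 1\<^sub>m n))"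
      proof (rule continuous_on_det[OF sc])
        show "continuous_on ?U (\<lambda>z. (\<Phi> z - \<alpha> \<cdot>\<^sub>m 1\<^sub>m n) $$ (i, j))" if "i < n" "j < n" for i j
          unfolding si[OF that]
          by (intro continuous_intros holomorphic_on_imp_continuous_on Pick_R_entries(2)[OF \<Phi>] that)
      qed
      then show ?thesis by (rule continuous_on_eq) (rule \<mu>\<Phi>)
    qed
  qed
  then have "zero_count (\<lambda>z. det (G z - \<i> \<cdot>\<^sub>m 1\<^sub>m n)) (df * (dF * dg))"
    by (rule zero_count_cong[rotated]) (simp add: \<mu>G)
  moreover have "zero_count (\<lambda>z. det (G z - \<i> \<cdot>\<^sub>m 1\<^sub>m n)) dG" by (rule cG) simp
  ultimately have "dG = df * (dF * dg)" by (rule zero_count_unique[rotated])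
  then show ?thesis unfolding G_def[symmetric] dG dF df dg by (simp add: mult.assoc)
qed

text \<open>The Schwarz--Pick inequality at the eigenvalues of \<open>F (g z)\<close> transports properness
  from \<open>f \<circ> F \<circ> g\<close> to \<open>g\<close>, then to \<open>F\<close>, then to \<open>f\<close>.\<close>

lemma rational_factors_of_rational_comp:
  assumes n: "0 < n" and F: "F \<in> Pick_R n" and f: "scalar_op f \<in> Pick_R 1" and g: "scalar_op g \<in> Pick_R 1"
    and fU: "\<And>z. z \<in> upper_half_plane \<Longrightarrow> f z \<in> upper_half_plane"
    and gU: "\<And>z. z \<in> upper_half_plane \<Longrightarrow> g z \<in> upper_half_plane"
    and spec: "\<And>z \<mu>. z \<in> upper_half_plane \<Longrightarrow> det (F z - \<mu> \<cdot>\<^sub>m 1\<^sub>m n) = 0 \<Longrightarrow> \<mu> \<in> upper_half_plane"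
    and rat: "rational_Pick n (Pick_comp n f F g)"
  shows "rational_Pick n F" "rational_Pick 1 (scalar_op f)" "rational_Pick 1 (scalar_op g)"
proof -
  let ?U = upper_half_plane
  have one: "0 < (1 :: nat)" by simp
  define G where "G = Pick_comp n f F g"
  note Fc = Pick_R_entries(1)[OF F]
  have fhol: "f holomorphic_on ?U" and ghol: "g holomorphic_on ?U"
    by (rule Pick_R_scalar_op(1)[OF f], rule Pick_R_scalar_op(1)[OF g])
  have ci: "cnj w \<notin> ?U" if "w \<in> ?U" for w using that by simp
  obtain dG where Gprop: "\<And>w. w \<in> ?U \<Longrightarrow> proper_at n G w"
    using rational_Pick_degree[OF rat] hol_calc_carrier unfolding G_def Pick_comp_def by metis
  have eig: "\<exists>\<mu>s. length \<mu>s = n \<and> set \<mu>s \<subseteq> ?U \<and> (\<forall>w. det (F (g z) - w \<cdot>\<^sub>m 1\<^sub>m n) = (\<Prod>\<mu>\<leftarrow>\<mu>s. \<mu> - w)) \<and>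
      (\<forall>w. det (G z - w \<cdot>\<^sub>m 1\<^sub>m n) = (\<Prod>\<mu>\<leftarrow>\<mu>s. f \<mu> - w))" if z: "z \<in> ?U" for z
  proof -
    note Fz = Fc[OF gU[OF z]]
    have "spectrum (F (g z)) \<subseteq> ?U" using spec[OF gU[OF z]] spectrum_iff_det[OF Fz] by blast
    then show ?thesis
      unfolding G_def Pick_comp_def by (rule hol_calc_eigenvalues[OF Fz]) (use fhol in blast)
  qed
  \<comment> \<open>Schwarz--Pick for determinants: a lower bound on the ratio for
    \<open>G z\<close> at \<open>f \<alpha>\<close> holds with the same \<delta> for
    \<open>F (g z)\<close> at \<alpha>.\<close>
  have star: "\<delta> * cmod (det (F (g z) - cnj \<alpha> \<cdot>\<^sub>m 1\<^sub>m n)) \<le> cmod (det (F (g z) - \<alpha> \<cdot>\<^sub>m 1\<^sub>m n))"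
    if z: "z \<in> ?U" and \<alpha>: "\<alpha> \<in> ?U"
      and le: "\<delta> * cmod (det (G z - cnj (f \<alpha>) \<cdot>\<^sub>m 1\<^sub>m n)) \<le> cmod (det (G z - f \<alpha> \<cdot>\<^sub>m 1\<^sub>m n))" for z \<alpha> \<delta>
  proof -
    obtain \<mu>s where \<mu>s: "set \<mu>s \<subseteq> ?U" "\<And>w. det (F (g z) - w \<cdot>\<^sub>m 1\<^sub>m n) = (\<Prod>\<mu>\<leftarrow>\<mu>s. \<mu> - w)"
      "\<And>w. det (G z - w \<cdot>\<^sub>m 1\<^sub>m n) = (\<Prod>\<mu>\<leftarrow>\<mu>s. f \<mu> - w)" using eig[OF z] by blast
    define X P' P where "X = cmod (\<Prod>\<mu>\<leftarrow>\<mu>s. f \<mu> - cnj (f \<alpha>))" and "P' = cmod (\<Prod>\<mu>\<leftarrow>\<mu>s. \<mu> - cnj \<alpha>)"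
      and "P = cmod (\<Prod>\<mu>\<leftarrow>\<mu>s. \<mu> - \<alpha>)"
    have "f \<mu> - cnj (f \<alpha>) \<noteq> 0" if "\<mu> \<in> set \<mu>s" for \<mu>
    proof -
      have "f \<mu> \<in> ?U" "cnj (f \<alpha>) \<notin> ?U" using fU \<mu>s(1) that ci[OF fU[OF \<alpha>]] by blast+
      then show ?thesis by auto
    qed
    then have X: "0 < X" by (auto simp: X_def)
    have "\<delta> * X * P' \<le> cmod (\<Prod>\<mu>\<leftarrow>\<mu>s. f \<mu> - f \<alpha>) * P'"
      using le unfolding \<mu>s(3) X_def P'_def by (intro mult_right_mono) auto
    also have "\<dots> \<le> P * X" unfolding P_def X_def P'_def
      by (rule Schwarz_Pick_prod_list[OF fhol _ \<alpha> \<mu>s(1)]) (use fU in blast)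
    finally have "X * (\<delta> * P') \<le> X * P" by (simp add: mult_ac)
    then show ?thesis using X unfolding \<mu>s(2) P_def P'_def by simp
  qed
  have proper_g: "proper_at 1 (scalar_op g) \<i>"
  proof -
    obtain \<mu>s where \<mu>s: "length \<mu>s = n" "\<And>w. det (F \<i> - w \<cdot>\<^sub>m 1\<^sub>m n) = (\<Prod>\<mu>\<leftarrow>\<mu>s. \<mu> - w)"
      using det_minus_scalar_eigenvalues[OF Fc[of \<i>]] by auto
    define \<alpha> where "\<alpha> = hd \<mu>s"
    have "\<alpha> \<in> set \<mu>s" using n \<mu>s(1) by (auto simp: \<alpha>_def)
    then have det0: "det (F \<i> - \<alpha> \<cdot>\<^sub>m 1\<^sub>m n) = 0" unfolding \<mu>s(2) by auto
    have \<alpha>: "\<alpha> \<in> ?U" by (rule spec[OF _ det0]) simp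
    have det1: "det (F \<i> - cnj \<alpha> \<cdot>\<^sub>m 1\<^sub>m n) \<noteq> 0" using spec[of \<i> "cnj \<alpha>"] ci[OF \<alpha>] by auto
    obtain K \<delta> where K: "compact K" "K \<subseteq> ?U" "0 < \<delta>" and K\<delta>:
      "\<And>z. z \<in> ?U - K \<Longrightarrow> \<delta> * cmod (det (G z - cnj (f \<alpha>) \<cdot>\<^sub>m 1\<^sub>m n)) \<le> cmod (det (G z - f \<alpha> \<cdot>\<^sub>m 1\<^sub>m n))"
      using Gprop[OF fU[OF \<alpha>]] unfolding proper_at_def by blast
    \<comment> \<open>With \<alpha> an eigenvalue of \<open>F \<i>\<close>, \<phi> is negative at
      \<i> and so on a disk about \<i>, whereas \<open>star\<close> makes it nonnegative at
      \<open>g z\<close> for \<open>z\<close> off \<open>K\<close>. Hence \<open>g z\<close> keeps a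
      fixed distance \<open>r\<close> from \<i> there.\<close>
    define \<phi> where "\<phi> w = cmod (det (F w - \<alpha> \<cdot>\<^sub>m 1\<^sub>m n)) - \<delta> * cmod (det (F w - cnj \<alpha> \<cdot>\<^sub>m 1\<^sub>m n))" for w
    have cdet: "continuous_on ?U (\<lambda>w. det (F w - \<beta> \<cdot>\<^sub>m 1\<^sub>m n))" for \<beta>
    proof (rule continuous_on_det)
      show "F w - \<beta> \<cdot>\<^sub>m 1\<^sub>m n \<in> carrier_mat n n" for w by (intro minus_carrier_mat smult_carrier_mat one_carrier_mat)
      fix i j assume ij: "i < n" "j < n"
      have "continuous_on ?U (\<lambda>w. F w $$ (i, j) - (if i = j then \<beta> else 0))"
        by (intro continuous_intros holomorphic_on_imp_continuous_on Pick_R_entries(2)[OF F] ij)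
      then show "continuous_on ?U (\<lambda>w. (F w - \<beta> \<cdot>\<^sub>m 1\<^sub>m n) $$ (i, j))" using ij by (cases "i = j") simp_all
    qed
    have "continuous_on ?U \<phi>" unfolding \<phi>_def by (intro continuous_intros cdet)
    then have "isCont \<phi> \<i>" using open_upper_half_plane by (simp add: continuous_on_eq_continuous_at)
    moreover have "\<phi> \<i> < 0" using det0 det1 K(3) by (simp add: \<phi>_def)
    ultimately have "eventually (\<lambda>w. \<phi> w < 0) (nhds \<i>)"
      by (intro order_tendstoD(2)[of \<phi> "\<phi> \<i>"]) (simp_all add: isCont_def tendsto_at_iff_tendsto_nhds)
    then obtain r where r: "0 < r" "\<And>w. dist w \<i> < r \<Longrightarrow> \<phi> w < 0" unfolding eventually_nhds_metric by blast
    have ge: "r \<le> cmod (g z - \<i>)" if z: "z \<in> ?U - K" for z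
    proof (rule ccontr)
      assume "\<not> r \<le> cmod (g z - \<i>)"
      then have "\<phi> (g z) < 0" by (intro r(2)) (simp add: dist_norm)
      moreover have "0 \<le> \<phi> (g z)" using star[OF _ \<alpha> K\<delta>[OF z]] z by (simp add: \<phi>_def)
      ultimately show False by simp
    qed
    \<comment> \<open>The distance between \<i> and its conjugate is 2, which is at most
      \<open>2 / r\<close> times \<open>cmod (g z - \<i>)\<close>.\<close>
    have "1 / (1 + 2 / r) * cmod (g z - cnj \<i>) \<le> cmod (g z - \<i>)" if z: "z \<in> ?U - K" for z
    proof -
      have "cmod (g z - cnj \<i>) \<le> cmod (g z - \<i>) + cmod (2 * \<i>)"
        using norm_triangle_ineq[of "g z - \<i>" "2 * \<i>"] by (simp add: algebra_simps)
      also have "cmod (2 * \<i>) \<le> 2 / r * cmod (g z - \<i>)" using ge[OF z] r(1) by (simp add: norm_mult field_simps)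
      finally have "cmod (g z - cnj \<i>) \<le> (1 + 2 / r) * cmod (g z - \<i>)" by (simp add: algebra_simps)
      moreover have "0 < 1 + 2 / r" using r(1) by (simp add: add_pos_pos)
      ultimately show ?thesis by (simp add: pos_divide_le_eq mult.commute)
    qed
    moreover have "0 < 1 / (1 + 2 / r)" using r(1) by (simp add: add_pos_pos)
    ultimately show ?thesis unfolding proper_at_def det_scalar_op using K(1,2) by blast
  qed
  have iU: "\<i> \<in> ?U" by simp
  have ent: "rational_Pick m H" if "H \<in> Pick_R m" "proper_at m H \<i>" for m H
    by (rule rational_Pick_of_rational_entries[OF that(1)]) (rule proper_Pick_rational_entries[OF that(1) iU that(2)])
  show ratg: "rational_Pick 1 (scalar_op g)" by (rule ent[OF g proper_g])
  \<comment> \<open>Surjectivity of the rational \<open>g\<close> lets the bound for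
    \<open>F \<circ> g\<close> off \<open>K\<close> become one for \<open>F\<close> off the image of
    \<open>K\<close>: every other point is \<open>g z\<close> with \<open>z\<close> outside
    \<open>K\<close>.\<close>
  have surj: "\<exists>z\<in>?U. g z = \<zeta>" if "\<zeta> \<in> ?U" for \<zeta>
  proof -
    have specg: "w \<in> ?U" if "z \<in> ?U" "det (scalar_op g z - w \<cdot>\<^sub>m 1\<^sub>m 1) = 0" for z w
      using that(2) gU[OF that(1)] unfolding det_scalar_op by simp
    have "\<exists>z\<in>?U. det (scalar_op g z - \<zeta> \<cdot>\<^sub>m 1\<^sub>m 1) = 0"
      by (rule Pick_deg_pos[OF one ratg scalar_op_carrier specg]) (use that in blast)+
    then show ?thesis unfolding det_scalar_op by auto
  qed
  have proper_F: "proper_at n F \<i>"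
  proof -
    obtain K \<delta> where K: "compact K" "K \<subseteq> ?U" "0 < \<delta>" and K\<delta>:
      "\<And>z. z \<in> ?U - K \<Longrightarrow> \<delta> * cmod (det (G z - cnj (f \<i>) \<cdot>\<^sub>m 1\<^sub>m n)) \<le> cmod (det (G z - f \<i> \<cdot>\<^sub>m 1\<^sub>m n))"
      using Gprop[OF fU[OF iU]] unfolding proper_at_def by blast
    have "compact (g ` K)"
      using K(1,2) ghol by (intro compact_continuous_image) (auto intro: holomorphic_on_imp_continuous_on continuous_on_subset)
    moreover have "g ` K \<subseteq> ?U" using K(2) gU by blast
    moreover have "\<delta> * cmod (det (F \<zeta> - cnj \<i> \<cdot>\<^sub>m 1\<^sub>m n)) \<le> cmod (det (F \<zeta> - \<i> \<cdot>\<^sub>m 1\<^sub>m n))" if \<zeta>: "\<zeta> \<in> ?U - g ` K" for \<zeta>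
    proof -
      obtain z where z: "z \<in> ?U" "g z = \<zeta>" using surj[of \<zeta>] \<zeta> by blast
      have "z \<in> ?U - K" using z \<zeta> by blast
      from star[OF z(1) iU K\<delta>[OF this]] show ?thesis unfolding z(2) .
    qed
    ultimately show ?thesis unfolding proper_at_def using K(3) by blast
  qed
  show ratF: "rational_Pick n F" by (rule ent[OF F proper_F])
  have "proper_at 1 (scalar_op f) \<i>"
  proof -
    obtain K \<delta> where K: "compact K" "K \<subseteq> ?U" "0 < \<delta>" and K\<delta>:
      "\<And>z. z \<in> ?U - K \<Longrightarrow> \<delta> * cmod (det (G z - cnj \<i> \<cdot>\<^sub>m 1\<^sub>m n)) \<le> cmod (det (G z - \<i> \<cdot>\<^sub>m 1\<^sub>m n))"
      using Gprop[OF iU] unfolding proper_at_def by blast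
    have gK: "continuous_on K g" by (rule continuous_on_subset[OF holomorphic_on_imp_continuous_on[OF ghol] K(2)])
    have FgK: "continuous_on K (\<lambda>z. F (g z) $$ (i, j))" if ij: "i < n" "j < n" for i j
      by (rule continuous_on_compose2[OF holomorphic_on_imp_continuous_on[OF Pick_R_entries(2)[OF F ij]] gK])
         (use K(2) gU in blast)
    have "continuous_on K (\<lambda>z. \<Sum>i<n. \<Sum>j<n. cmod (F (g z) $$ (i, j)))"
      by (intro continuous_intros FgK) auto
    from compact_imp_bounded[OF compact_continuous_image[OF this K(1)]]
    obtain M where M: "\<And>z. z \<in> K \<Longrightarrow> \<bar>\<Sum>i<n. \<Sum>j<n. cmod (F (g z) $$ (i, j))\<bar> \<le> M"
      unfolding bounded_iff by auto
    \<comment> \<open>Pairs of a point of \<open>K\<close> and an eigenvalue of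
      \<open>F (g z)\<close> there. Its second projection is compact, and a \<mu> outside it is an
      eigenvalue of \<open>F (g z)\<close> for some \<open>z\<close>, which then has to lie off
      \<open>K\<close>.\<close>
    define E where "E = {p \<in> K \<times> cball 0 M. det (F (g (fst p)) - snd p \<cdot>\<^sub>m 1\<^sub>m n) = 0}"
    have "compact E"
    proof -
      let ?S = "K \<times> cball (0::complex) M"
      have S: "compact ?S" using K(1) by (intro compact_Times compact_cball)
      have "continuous_on ?S (\<lambda>p. det (F (g (fst p)) - snd p \<cdot>\<^sub>m 1\<^sub>m n))"
      proof (rule continuous_on_det)
        show "F (g (fst p)) - snd p \<cdot>\<^sub>m 1\<^sub>m n \<in> carrier_mat n n" for p :: "complex \<times> complex"
          by (intro minus_carrier_mat smult_carrier_mat one_carrier_mat)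
        fix i j assume ij: "i < n" "j < n"
        have 1: "continuous_on ?S (\<lambda>p. F (g (fst p)) $$ (i, j))"
          by (rule continuous_on_compose2[OF FgK[OF ij] continuous_on_fst[OF continuous_on_id]]) auto
        have "continuous_on ?S (\<lambda>p. F (g (fst p)) $$ (i, j) - (if i = j then snd p else 0))"
          by (cases "i = j") (use 1 in \<open>auto intro!: continuous_intros\<close>)
        then show "continuous_on ?S (\<lambda>p. (F (g (fst p)) - snd p \<cdot>\<^sub>m 1\<^sub>m n) $$ (i, j))"
          using ij by (cases "i = j") simp_all
      qed
      then have "closed E" unfolding E_def
        by (rule continuous_closed_preimage_constant[OF _ compact_imp_closed[OF S]])
      moreover have "E = ?S \<inter> E" by (auto simp: E_def)
      ultimately show ?thesis using compact_Int_closed[OF S] by metis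
    qed
    then have "compact (snd ` E)" by (intro compact_continuous_image continuous_intros)
    moreover have "snd ` E \<subseteq> ?U"
    proof
      fix \<mu> assume "\<mu> \<in> snd ` E"
      then obtain z where z: "z \<in> K" "det (F (g z) - \<mu> \<cdot>\<^sub>m 1\<^sub>m n) = 0" by (auto simp: E_def)
      show "\<mu> \<in> ?U" by (rule spec[OF gU z(2)]) (use K(2) z(1) in blast)
    qed
    moreover have "\<delta> * cmod (f \<mu> - cnj \<i>) \<le> cmod (f \<mu> - \<i>)" if \<mu>: "\<mu> \<in> ?U - snd ` E" for \<mu>
    proof -
      have "\<exists>\<zeta>\<in>?U. det (F \<zeta> - \<mu> \<cdot>\<^sub>m 1\<^sub>m n) = 0"
        by (rule Pick_deg_pos[OF n ratF Fc spec]) (use \<mu> in auto)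
      then obtain z where z: "z \<in> ?U" "det (F (g z) - \<mu> \<cdot>\<^sub>m 1\<^sub>m n) = 0" using surj by metis
      have "z \<notin> K"
      proof
        assume zK: "z \<in> K"
        have "cmod \<mu> \<le> M" using eigenvalue_bounded[OF Fc[OF gU[OF z(1)]] z(2)] M[OF zK] by linarith
        then have "(z, \<mu>) \<in> E" using zK z(2) by (simp add: E_def)
        then show False using \<mu> by force
      qed
      then have zK: "z \<in> ?U - K" using z(1) by blast
      obtain \<mu>s where \<mu>s: "set \<mu>s \<subseteq> ?U" "\<And>w. det (F (g z) - w \<cdot>\<^sub>m 1\<^sub>m n) = (\<Prod>\<mu>\<leftarrow>\<mu>s. \<mu> - w)"
        "\<And>w. det (G z - w \<cdot>\<^sub>m 1\<^sub>m n) = (\<Prod>\<mu>\<leftarrow>\<mu>s. f \<mu> - w)" using eig[OF z(1)] by blast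
      have mem: "\<mu> \<in> set \<mu>s" using z(2) unfolding \<mu>s(2) by auto
      show ?thesis
      \<comment> \<open>Properness of \<open>G\<close> bounds the product over all eigenvalues; as
        \<open>f\<close> maps them into the half plane, the factor of \<mu> inherits the
        bound.\<close>
      proof (rule prod_list_single_factor[OF mem])
        show "\<delta> * cmod (\<Prod>\<mu>\<leftarrow>\<mu>s. f \<mu> - cnj \<i>) \<le> cmod (\<Prod>\<mu>\<leftarrow>\<mu>s. f \<mu> - \<i>)"
          using K\<delta>[OF zK] unfolding \<mu>s(3) .
        fix \<nu> assume "\<nu> \<in> set \<mu>s"
        then have "0 < Im (f \<nu>)" using fU \<mu>s(1) by (auto simp: subset_iff)
        then show "cmod (f \<nu> - \<i>) \<le> cmod (f \<nu> - cnj \<i>) \<and> f \<nu> - cnj \<i> \<noteq> 0"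
          by (auto simp: cmod_def complex_eq_iff intro!: power_mono_even)
      qed
    qed
    ultimately show ?thesis unfolding proper_at_def det_scalar_op using K(3) by blast
  qed
  then show "rational_Pick 1 (scalar_op f)" by (rule ent[OF f])
qed

text \<open>The determinant of the empty matrix is 1, so there are no zeros to count.\<close>

lemma Pick_deg_dimension_0:
  assumes Xc: "\<And>z. z \<in> upper_half_plane \<Longrightarrow> X z \<in> carrier_mat 0 0"
  shows "Pick_deg 0 X = 0"
proof -
  have "has_boundary_mat 0 X x (1\<^sub>m 0) \<and> self_adjoint 0 (1\<^sub>m 0)" for x
    by (simp add: has_boundary_mat_def self_adjoint_iff)
  then have "AE x in lborel. \<exists>B. has_boundary_mat 0 X x B \<and> self_adjoint 0 B" by (intro AE_I2) blast
  then have X: "X \<in> Pick_R 0" using Xc by (auto simp: Pick_R_iff holomorphic_mat_def quad_form_def)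
  have rat: "rational_Pick 0 X" by (rule rational_Pick_of_rational_entries[OF X]) auto
  obtain d where d: "Pick_deg 0 X = enat d"
    "\<And>w. w \<in> upper_half_plane \<Longrightarrow> zero_count (\<lambda>z. det (X z - w \<cdot>\<^sub>m 1\<^sub>m 0)) d"
    using rational_Pick_degree[OF rat Xc] by metis
  have "det (X z - w \<cdot>\<^sub>m 1\<^sub>m 0) = 1" for z w
    by (intro det_dim_zero minus_carrier_mat smult_carrier_mat one_carrier_mat)
  then have "zero_count (\<lambda>z. 1) d" using d(2)[of \<i>] by simp
  then have "d = 0" by (rule zero_count_unique) (simp add: zero_count_const)
  then show ?thesis using d(1) by (simp add: zero_enat_def)
qed

theorem theorem3p48:
  fixes n :: nat and f g :: "complex \<Rightarrow> complex" and F :: "complex \<Rightarrow> complex mat"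
  assumes "scalar_op f \<in> Pick_R 1" and "regular_Pick 1 (scalar_op f)"
    and "scalar_op g \<in> Pick_R 1" and "regular_Pick 1 (scalar_op g)"
    and "F \<in> Pick_R n" and "regular_Pick n F"
  shows "Pick_deg n (Pick_comp n f F g)
    = Pick_deg 1 (scalar_op f) * Pick_deg n F * Pick_deg 1 (scalar_op g)"
  proof -
  let ?U = upper_half_plane
  note f = assms(1) and g = assms(3) and F = assms(5)
  have fU: "f z \<in> ?U" if "z \<in> ?U" for z
    by (rule regular_Pick_spectrum[OF f assms(2) that]) (simp only: det_scalar_op, simp)
  have gU: "g z \<in> ?U" if "z \<in> ?U" for z
    by (rule regular_Pick_spectrum[OF g assms(4) that]) (simp only: det_scalar_op, simp)
  note spec = regular_Pick_spectrum[OF F assms(6)]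
  show ?thesis
  proof (cases "n = 0")
    \<comment> \<open>In dimension 0 both sides are 0, also when the degree of \<open>f\<close> or
      \<open>g\<close> is infinite, by the convention \<open>0 * \<infinity> = 0\<close>.\<close>
    case True
    have "Pick_deg 0 F = 0" by (rule Pick_deg_dimension_0) (use Pick_R_entries(1)[OF F] True in simp)
    moreover have "Pick_deg 0 (Pick_comp 0 f F g) = 0"
      by (rule Pick_deg_dimension_0) (unfold Pick_comp_def, rule hol_calc_carrier)
    ultimately show ?thesis using True by simp
  next
    case False
    then have n: "0 < n" by simp
    show ?thesis
    proof (cases "rational_Pick n F \<and> rational_Pick 1 (scalar_op f) \<and> rational_Pick 1 (scalar_op g)")
      case True
      show ?thesis
        by (rule Pick_deg_comp_rational[OF F f g])
           (use True in \<open>auto simp del: mem_upper_half_plane intro: fU gU spec\<close>)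
    next
      case False
      \<comment> \<open>With no factor equal to 0, a single infinite degree already makes the
        product infinite.\<close>
      have nz: "Pick_deg m H \<noteq> 0"
        if "0 < m" "\<And>z. z \<in> ?U \<Longrightarrow> H z \<in> carrier_mat m m"
          "\<And>z w. z \<in> ?U \<Longrightarrow> det (H z - w \<cdot>\<^sub>m 1\<^sub>m m) = 0 \<Longrightarrow> w \<in> ?U" for m H
      proof (cases "rational_Pick m H")
        case True
        show ?thesis
          by (rule Pick_deg_pos[OF that(1) True that(2,3)]) (auto simp: zero_enat_def)
      qed (simp add: Pick_deg_def)
      have one: "0 < (1 :: nat)" by simp
      have "Pick_deg n F \<noteq> 0" by (rule nz[OF n Pick_R_entries(1)[OF F] spec])
      moreover have "Pick_deg 1 (scalar_op f) \<noteq> 0"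
        by (rule nz[OF one scalar_op_carrier], rule regular_Pick_spectrum[OF f assms(2)])
      moreover have "Pick_deg 1 (scalar_op g) \<noteq> 0"
        by (rule nz[OF one scalar_op_carrier], rule regular_Pick_spectrum[OF g assms(4)])
      moreover have "Pick_deg n F = \<infinity> \<or> Pick_deg 1 (scalar_op f) = \<infinity> \<or> Pick_deg 1 (scalar_op g) = \<infinity>"
        using False by (auto simp: Pick_deg_def)
      moreover have "\<not> rational_Pick n (Pick_comp n f F g)"
      proof
        assume "rational_Pick n (Pick_comp n f F g)"
        note factors = rational_factors_of_rational_comp[OF n F f g _ _ _ this]
        have "rational_Pick n F"
          by (rule factors(1)) (rule fU, assumption, rule gU, assumption, rule spec, assumption, assumption)
        moreover have "rational_Pick 1 (scalar_op f)"
          by (rule factors(2)) (rule fU, assumption, rule gU, assumption, rule spec, assumption, assumption)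
        moreover have "rational_Pick 1 (scalar_op g)"
          by (rule factors(3)) (rule fU, assumption, rule gU, assumption, rule spec, assumption, assumption)
        ultimately show False using False by blast
      qed
      then have "Pick_deg n (Pick_comp n f F g) = \<infinity>" by (simp add: Pick_deg_def)
      ultimately have "Pick_deg 1 (scalar_op f) * Pick_deg n F * Pick_deg 1 (scalar_op g) = \<infinity>"
        by (auto simp: imult_is_infinity)
      with \<open>Pick_deg n (Pick_comp n f F g) = \<infinity>\<close> show ?thesis by simp
    qed
  qed
qed

end
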